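(* Let $u$ be the pathwise solution of the stochastic Burgers equation $\partial_tu=\nu\partial_{xx}u-u\partial_xu+\partial_tL$ with initial value $u(0)=u_0\in H^{1}$. There exist $C_1,C_2>0$ and $\sigma_0=\sigma_0(C_1,C_2)>0$ such that for all $\sigma\geq\sigma_0$ and all $T\geq1$, \[ C_1\nu^{-1}\leq\frac{1}{\sigma}\int_{T}^{T+\sigma}\mathbb{E}\big[\|u(t)\|_1^{2}\big]\,dt\leq C_2\nu^{-1}, \] uniformly in $\nu\in(0,1]$.
   Context: $\mathbb{S}^1=\mathbb{R}/\mathbb{Z}$. $H=\{\phi\in L^2(\mathbb{S}^1):\int\phi=0\}$, $H^1=\{u\in H:\partial_xu\in L^2\}$ with norm $\|u\|_1=\|\partial_xu\|_{L^2}$. Let $e_k(x)=\sqrt2\cos(2\pi kx)$ for $k\geq1$, $e_k(x)=\sqrt2\sin(2\pi kx)$ for $k\leq-1$, $\mathbb{Z}^\ast=\mathbb{Z}\setminus\{0\}$, $\lambda_k=4\pi^2k^2$. Noise: on a filtered probability space $(\Omega,\mathcal{F},(\mathcal{F}_t),\mathbb{P})$, $L(t,x)=\sum_{k\in\mathbb{Z}^\ast}\beta_kL_k(t)e_k(x)$ with $(L_k)$ independent identically distributed real Lévy processes with Lévy triplet $(0,0,\mu)$ and uniformly bounded jumps, and $C_1'\lambda_k^{-\gamma_0}\leq\beta_k\leq C_2'\lambda_k^{-\gamma_0}$ with $C_1',C_2'>0$, $\gamma_0>1$. The solution is pathwise: for a.e. $\omega$, $u(t)=u_0+\int_0^t(\nu\partial_{xx}u-u\partial_xu)ds+L(t)$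 for all $t\geq0$.
   Formalization: The Lévy measure μ is assumed to be nonzero; for μ=0 there is no noise and the lower bound fails (for example u=0 when u_0=0). *)

theory Defs
  imports "HOL-Probability.Probability"
begin

section \<open>Functions on the circle S^1 = R/Z, represented as 1-periodic functions on R\<close>

definition periodic1 :: "(real \<Rightarrow> real) \<Rightarrow> bool" where
  "periodic1 f \<longleftrightarrow> (\<forall>x. f (x + 1) = f x)"

definition in_L2 :: "(real \<Rightarrow> real) \<Rightarrow> bool" where
  "in_L2 f \<longleftrightarrow> f \<in> borel_measurable borel \<and> set_integrable lborel {0..1} (\<lambda>x. (f x)\<^sup>2)"

definition ipL2 :: "(real \<Rightarrow> real) \<Rightarrow> (real \<Rightarrow> real) \<Rightarrow> real" where
  "ipL2 f g = (LINT x:{0..1}|lborel. f x * g x)"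

definition distL2 :: "(real \<Rightarrow> real) \<Rightarrow> (real \<Rightarrow> real) \<Rightarrow> real" where
  "distL2 f g = sqrt (LINT x:{0..1}|lborel. (f x - g x)\<^sup>2)"

definition in_H :: "(real \<Rightarrow> real) \<Rightarrow> bool" where
  "in_H f \<longleftrightarrow> periodic1 f \<and> in_L2 f \<and> (LINT x:{0..1}|lborel. f x) = 0"

definition weak_deriv :: "(real \<Rightarrow> real) \<Rightarrow> (real \<Rightarrow> real) \<Rightarrow> bool" where
  "weak_deriv f g \<longleftrightarrow> periodic1 g \<and> in_L2 g \<and>
     (\<forall>\<phi> \<phi>'. (\<forall>x. (\<phi> has_real_derivative \<phi>' x) (at x)) \<and> continuous_on UNIV \<phi>' \<and> periodic1 \<phi>
        \<longrightarrow> (LINT x:{0..1}|lborel. f x * \<phi>' x) = - (LINT x:{0..1}|lborel. g x * \<phi> x))"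

definition in_H1 :: "(real \<Rightarrow> real) \<Rightarrow> bool" where
  "in_H1 f \<longleftrightarrow> in_H f \<and> (\<exists>g. weak_deriv f g)"

definition H1_sq :: "(real \<Rightarrow> real) \<Rightarrow> ennreal" where
  "H1_sq f = (if in_H1 f then ennreal (LINT x:{0..1}|lborel. ((SOME g. weak_deriv f g) x)\<^sup>2) else \<infinity>)"

definition ebasis :: "int \<Rightarrow> real \<Rightarrow> real" where
  "ebasis k x = (if k \<ge> 1 then sqrt 2 * cos (2 * pi * real_of_int k * x)
                 else sqrt 2 * sin (2 * pi * real_of_int k * x))"

definition lam :: "int \<Rightarrow> real" where
  "lam k = 4 * pi\<^sup>2 * (real_of_int k)\<^sup>2"

definition levy_measure :: "real measure \<Rightarrow> bool" where
  "levy_measure \<mu> \<longleftrightarrow> sets \<mu> = sets borel \<and> emeasure \<mu> {0} = 0 \<and>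
     (\<integral>\<^sup>+ y. ennreal (min 1 (y\<^sup>2)) \<partial>\<mu>) < \<infinity>"

text \<open>Levy-Khintchine exponent of the triplet (0,0,mu) (truncation function 1_{|y|<1}).\<close>
definition levy_exponent :: "real measure \<Rightarrow> real \<Rightarrow> complex" where
  "levy_exponent \<mu> \<xi> =
     (CLINT y|\<mu>. iexp (\<xi> * y) - 1 - \<i> * complex_of_real (\<xi> * y * indicator {-1<..<1} y))"

definition cadlag_path :: "(real \<Rightarrow> real) \<Rightarrow> bool" where
  "cadlag_path f \<longleftrightarrow> (\<forall>t\<ge>0. (f \<longlongrightarrow> f t) (at_right t) \<and> (t > 0 \<longrightarrow> (\<exists>l. (f \<longlongrightarrow> l) (at_left t))))"

definition levy_process_triplet0 :: "'a measure \<Rightarrow> real measure \<Rightarrow> (real \<Rightarrow> 'a \<Rightarrow> real) \<Rightarrow> bool" where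
  "levy_process_triplet0 M \<mu> X \<longleftrightarrow>
     (\<forall>t\<ge>0. X t \<in> borel_measurable M) \<and>
     (AE \<omega> in M. X 0 \<omega> = 0) \<and>
     (\<forall>n (ts :: nat \<Rightarrow> real). 0 \<le> ts 0 \<and> (\<forall>i<n. ts i \<le> ts (Suc i)) \<longrightarrow>
        prob_space.indep_vars M (\<lambda>_. borel) (\<lambda>i \<omega>. X (ts (Suc i)) \<omega> - X (ts i) \<omega>) {..<n}) \<and>
     (\<forall>s t. 0 \<le> s \<and> s \<le> t \<longrightarrow> distr M borel (\<lambda>\<omega>. X t \<omega> - X s \<omega>) = distr M borel (X (t - s))) \<and>
     (\<forall>t\<ge>0. \<forall>\<epsilon>>0. ((\<lambda>s. measure M {\<omega> \<in> space M. \<bar>X s \<omega> - X t \<omega>\<bar> > \<epsilon>}) \<longlongrightarrow> 0)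
                        (at t within {0..})) \<and>
     (AE \<omega> in M. cadlag_path (\<lambda>t. X t \<omega>)) \<and>
     (\<forall>t\<ge>0. \<forall>\<xi>. char (distr M borel (X t)) \<xi> = exp (complex_of_real t * levy_exponent \<mu> \<xi>))"

text \<open>Weak (Fourier-coefficientwise) form of
  u(t) = u0 + int_0^t (nu u_xx - u u_x) ds + L(t),  L(t,x) = sum_k beta_k L_k(t) e_k(x):
  testing with e_k gives <u_xx, e_k> = <u, e_k''> and <-u u_x, e_k> = <u^2/2, e_k'>.\<close>
definition burgers_rhs :: "real \<Rightarrow> (real \<Rightarrow> real) \<Rightarrow> int \<Rightarrow> real" where
  "burgers_rhs \<nu> v k = \<nu> * ipL2 v (deriv (deriv (ebasis k))) + ipL2 (\<lambda>x. (v x)\<^sup>2 / 2) (deriv (ebasis k))"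

definition burgers_solution ::
  "'a measure \<Rightarrow> (int \<Rightarrow> real) \<Rightarrow> (int \<Rightarrow> real \<Rightarrow> 'a \<Rightarrow> real) \<Rightarrow> real \<Rightarrow> (real \<Rightarrow> real)
     \<Rightarrow> (real \<Rightarrow> 'a \<Rightarrow> real \<Rightarrow> real) \<Rightarrow> bool" where
  "burgers_solution M \<beta> L \<nu> u0 u \<longleftrightarrow>
     (\<lambda>(t, \<omega>). H1_sq (u t \<omega>)) \<in> borel_measurable (lborel \<Otimes>\<^sub>M M) \<and>
     (AE \<omega> in M.
        (\<forall>t\<ge>0. in_H (u t \<omega>)) \<and>
        (\<forall>t\<ge>0. ((\<lambda>s. distL2 (u s \<omega>) (u t \<omega>)) \<longlongrightarrow> 0) (at_right t) \<and>
                (t > 0 \<longrightarrow> (\<exists>v. in_H v \<and> ((\<lambda>s. distL2 (u s \<omega>) v) \<longlongrightarrow> 0) (at_left t)))) \<and>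
        (\<forall>T\<ge>0. (\<integral>\<^sup>+ t\<in>{0..T}. H1_sq (u t \<omega>) \<partial>lborel) < \<infinity>) \<and>
        (\<forall>t\<ge>0. \<forall>k. k \<noteq> 0 \<longrightarrow>
           set_integrable lborel {0..t} (\<lambda>s. burgers_rhs \<nu> (u s \<omega>) k) \<and>
           ipL2 (u t \<omega>) (ebasis k) =
             ipL2 u0 (ebasis k) + (LINT s:{0..t}|lborel. burgers_rhs \<nu> (u s \<omega>) k) + \<beta> k * L k t \<omega>))"

end

(*
The argument is pathwise. Subtracting the noise increment over a time window and truncating in Fourier space gives the energy
balance of Burgers' equation up to a cubic term carried by the noise, hence controlled by X times the time integral of
||u||^2, where X bounds sum_k 2 sqrt 2 pi |k| beta_k |L_k(t) - L_k(a)| on the window. A Cole-Hopf argument bounds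
that time integral by 2 ||u(a)|| + O(X^2 + X), and iterating it shows that after one unit of time ||u||^2 is at most a
constant times 1 + X^4, whatever the initial value. So nu times the dissipation over a unit window is O(1 + X^4), uniformly
in nu; since the jumps are bounded, the Levy processes have uniformly bounded fourth moments of maximal increments,
which gives the upper bound.

For the lower bound, with a probability bounded below, L_1 makes a large displacement within a very short time, between
two quiet periods, while the other modes stay moderate (an independent event). The solution must follow that displacement,
so its energy becomes large, and by the universal decay this energy is dissipated within one unit of time: nu times the
dissipation is at least 1/3 on such an event. Adding up disjoint windows gives the claim.
*)

theory Submission
  imports Defs
begin

section \<open>Square-integrable functions on the circle and the trigonometric basis\<close>

text \<open>Viscosity alone damps at a rate of order \<nu>, and a Gronwall argument for the cubic
  noise term would cost a factor exponential in the noise. What closes the estimate is that the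
  Cole-Hopf bound on the time integral of ||u||^2 is linear in ||u(a)|| and uniform in \<nu>: energy
  that is quadratic in the norm cannot persist when its time integral is only linear in it. The same
  linearity drives the lower bound: during a sufficiently short displacement of size A the
  noise-free part reaches an energy of order A at most, so its norm is of order sqrt A and cannot
  compensate a displacement proportional to A. Both arguments run on Fourier truncations, where the
  projection of u^2 differs from the square of the projection; this defect vanishes in the limit
  because u(t) lies in H^1 for almost every t. The law of the noise is accessible through
  increments, so the probabilistic estimates are made on dyadic grids with constants independent of
  the mesh, and bounded jumps control the oscillation inside the cells. The fourth moment is what
  the power X^4 in the decay bound asks for.\<close>

definition UI :: "real measure" where "UI = restrict_space lborel {0..1}"

lemma space_UI [simp]: "space UI = {0..1}"
  by (simp add: UI_def space_restrict_space)

lemma prob_space_UI: "prob_space UI"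
  by (rule prob_spaceI) (simp add: UI_def emeasure_restrict_space space_restrict_space)

interpretation UI: prob_space UI by (rule prob_space_UI)

lemma set_lint_UI: "(LINT x:{0..1}|lborel. f x) = (\<integral>x. f x \<partial>UI)" for f :: "real \<Rightarrow> real"
  unfolding UI_def set_lebesgue_integral_def by (subst integral_restrict_space) auto

lemma set_integrable_UI: "set_integrable lborel {0..1} f \<longleftrightarrow> integrable UI f" for f :: "real \<Rightarrow> real"
  unfolding UI_def set_integrable_def by (subst integrable_restrict_space) auto

lemma measurable_UI [measurable (raw)]: "f \<in> borel_measurable borel \<Longrightarrow> f \<in> borel_measurable UI"
  unfolding UI_def by (auto intro: measurable_restrict_space1)

lemma integrable_UI_continuous:
  fixes f :: "real \<Rightarrow> real"
  assumes "continuous_on UNIV f" shows "integrable UI f"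
proof -
  have "set_integrable lborel {0..1} f"
    by (rule borel_integrable_atLeastAtMost') (use assms continuous_on_subset in blast)
  thus ?thesis by (simp add: set_integrable_UI)
qed

lemma integral_UI_FTC:
  fixes f F :: "real \<Rightarrow> real"
  assumes "\<And>x. (F has_real_derivative f x) (at x)" "continuous_on UNIV f"
  shows "(\<integral>x. f x \<partial>UI) = F 1 - F 0"
proof -
  have "(LBINT x. f x * indicator {0..1} x) = F 1 - F 0"
    by (rule integral_FTC_Icc_real)
       (use assms in \<open>auto simp: continuous_on_eq_continuous_at\<close>)
  thus ?thesis unfolding set_lint_UI[symmetric] set_lebesgue_integral_def by (simp add: mult.commute)
qed

definition sqint :: "(real \<Rightarrow> real) \<Rightarrow> bool" where
  "sqint f \<longleftrightarrow> f \<in> borel_measurable UI \<and> integrable UI (\<lambda>x. (f x)\<^sup>2)"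

definition l2 :: "(real \<Rightarrow> real) \<Rightarrow> real" where
  "l2 f = sqrt (\<integral>x. (f x)\<^sup>2 \<partial>UI)"

lemma sqint_measurable: "sqint f \<Longrightarrow> f \<in> borel_measurable UI"
  by (simp add: sqint_def)

lemma l2_nonneg [simp]: "0 \<le> l2 f" by (simp add: l2_def)

lemma l2_sq: "(l2 f)\<^sup>2 = (\<integral>x. (f x)\<^sup>2 \<partial>UI)"
  by (simp add: l2_def)

lemma sqint_mult:
  assumes "sqint f" "sqint g" shows "integrable UI (\<lambda>x. f x * g x)"
proof (rule Bochner_Integration.integrable_bound)
  show "integrable UI (\<lambda>x. (f x)\<^sup>2 + (g x)\<^sup>2)" using assms by (auto simp: sqint_def)
  show "(\<lambda>x. f x * g x) \<in> borel_measurable UI"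
    using assms by (auto simp: sqint_def)
  have "\<bar>a * b\<bar> \<le> a\<^sup>2 + b\<^sup>2" for a b :: real
  proof -
    have "2 * (\<bar>a\<bar> * \<bar>b\<bar>) \<le> a\<^sup>2 + b\<^sup>2" using sum_squares_bound[of "\<bar>a\<bar>" "\<bar>b\<bar>"] by (simp add: mult.assoc)
    moreover have "0 \<le> \<bar>a\<bar> * \<bar>b\<bar>" by simp
    ultimately show ?thesis by (simp only: abs_mult)
  qed
  thus "AE x in UI. norm (f x * g x) \<le> norm ((f x)\<^sup>2 + (g x)\<^sup>2)" by auto
qed

lemma sqint_cmult: "sqint f \<Longrightarrow> sqint (\<lambda>x. c * f x)"
  by (auto simp: sqint_def power_mult_distrib)

lemma sqint_add:
  assumes "sqint f" "sqint g" shows "sqint (\<lambda>x. f x + g x)"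
proof -
  have "integrable UI (\<lambda>x. ((f x)\<^sup>2 + (g x)\<^sup>2) + 2 * (f x * g x))"
    using assms sqint_mult[OF assms] by (auto simp: sqint_def)
  hence "integrable UI (\<lambda>x. (f x + g x)\<^sup>2)" by (simp add: power2_sum mult.assoc)
  thus ?thesis using assms by (auto simp: sqint_def)
qed

lemma sqint_diff:
  assumes "sqint f" "sqint g" shows "sqint (\<lambda>x. f x - g x)"
  using sqint_add[OF assms(1) sqint_cmult[OF assms(2), of "-1"]] by simp

lemma sqint_const [simp]: "sqint (\<lambda>x. c)"
  by (auto simp: sqint_def)

lemma sqint_sum: "(\<And>i. i \<in> A \<Longrightarrow> sqint (f i)) \<Longrightarrow> sqint (\<lambda>x. \<Sum>i\<in>A. f i x)"
  by (induction A rule: infinite_finite_induct) (auto intro: sqint_add)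

lemma sqint_continuous: "continuous_on UNIV f \<Longrightarrow> sqint f"
  unfolding sqint_def
  by (auto intro!: integrable_UI_continuous continuous_intros borel_measurable_continuous_onI measurable_UI)

lemma l2_sq_le_AE:
  assumes "sqint g" "f \<in> borel_measurable UI" "AE x in UI. \<bar>f x\<bar> \<le> C * \<bar>g x\<bar>" "0 \<le> C"
  shows "sqint f" "l2 f \<le> C * l2 g"
proof -
  have *: "AE x in UI. (f x)\<^sup>2 \<le> C\<^sup>2 * (g x)\<^sup>2"
    using assms(3)
  proof eventually_elim
    case (elim x)
    have "(f x)\<^sup>2 = \<bar>f x\<bar>\<^sup>2" by simp
    also have "\<dots> \<le> (C * \<bar>g x\<bar>)\<^sup>2" by (rule power_mono[OF elim]) simp
    finally show ?case by (simp add: power_mult_distrib)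
  qed
  have g: "integrable UI (\<lambda>x. C\<^sup>2 * (g x)\<^sup>2)" using assms(1) by (auto simp: sqint_def)
  have i: "integrable UI (\<lambda>x. (f x)\<^sup>2)"
    by (rule Bochner_Integration.integrable_bound[OF g]) (use assms(2) * in auto)
  thus "sqint f" using assms(2) by (simp add: sqint_def)
  have "(\<integral>x. (f x)\<^sup>2 \<partial>UI) \<le> (\<integral>x. C\<^sup>2 * (g x)\<^sup>2 \<partial>UI)"
    by (rule integral_mono_AE[OF i g *])
  hence "(l2 f)\<^sup>2 \<le> (C * l2 g)\<^sup>2" by (simp add: l2_sq power_mult_distrib)
  thus "l2 f \<le> C * l2 g" by (rule power2_le_imp_le) (use assms(4) in auto)
qed

lemma l2_cmult: "l2 (\<lambda>x. c * f x) = \<bar>c\<bar> * l2 f"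
  by (simp add: l2_def power_mult_distrib real_sqrt_mult)

lemma Cauchy_Schwarz_l2:
  assumes f: "sqint f" and g: "sqint g"
  shows "\<bar>\<integral>x. f x * g x \<partial>UI\<bar> \<le> l2 f * l2 g"
proof -
  define a b c where "a = (\<integral>x. (f x)\<^sup>2 \<partial>UI)" and "b = (\<integral>x. f x * g x \<partial>UI)" and "c = (\<integral>x. (g x)\<^sup>2 \<partial>UI)"
  have int: "integrable UI (\<lambda>x. (f x)\<^sup>2)" "integrable UI (\<lambda>x. (g x)\<^sup>2)" "integrable UI (\<lambda>x. f x * g x)"
    using f g sqint_mult by (auto simp: sqint_def)
  have q: "0 \<le> a + 2 * t * b + t\<^sup>2 * c" for t
  proof -
    have "0 \<le> (\<integral>x. (f x + t * g x)\<^sup>2 \<partial>UI)" by simp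
    also have "\<dots> = (\<integral>x. ((f x)\<^sup>2 + (2 * t) * (f x * g x)) + t\<^sup>2 * (g x)\<^sup>2 \<partial>UI)"
      by (intro Bochner_Integration.integral_cong) (auto simp: power2_eq_square algebra_simps)
    also have "\<dots> = a + 2 * t * b + t\<^sup>2 * c"
      unfolding a_def b_def c_def using int
      by (subst Bochner_Integration.integral_add | simp)+
    finally show ?thesis .
  qed
  have ac: "a \<ge> 0" "c \<ge> 0" by (auto simp: a_def c_def)
  have "b\<^sup>2 \<le> a * c"
  proof (cases "c = 0")
    case True
    have "b = 0"
    proof (rule ccontr)
      assume "b \<noteq> 0"
      \<comment> \<open>With \<open>c = 0\<close> the quadratic is affine in \<open>t\<close>, and
        this choice of \<open>t\<close> gives it the value -1.\<close>
      from q[of "- (a + 1) / (2 * b)"] True \<open>b \<noteq> 0\<close> show False by (simp add: field_simps)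
    qed
    thus ?thesis using ac True by simp
  next
    case False
    hence c: "c > 0" using ac by simp
    from q[of "- b / c"] have "0 \<le> a - b\<^sup>2 / c"
      using c by (simp add: field_simps power2_eq_square)
    thus ?thesis using c by (simp add: field_simps)
  qed
  hence "\<bar>b\<bar> \<le> sqrt (a * c)" by (simp add: real_le_rsqrt)
  thus ?thesis by (simp add: l2_def a_def b_def c_def real_sqrt_mult)
qed

lemma l2_triangle:
  assumes f: "sqint f" and g: "sqint g"
  shows "l2 (\<lambda>x. f x + g x) \<le> l2 f + l2 g"
proof (rule power2_le_imp_le)
  have int: "integrable UI (\<lambda>x. (f x)\<^sup>2)" "integrable UI (\<lambda>x. (g x)\<^sup>2)" "integrable UI (\<lambda>x. f x * g x)"
    using f g sqint_mult by (auto simp: sqint_def)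
  have "(l2 (\<lambda>x. f x + g x))\<^sup>2 = (\<integral>x. ((f x)\<^sup>2 + 2 * (f x * g x)) + (g x)\<^sup>2 \<partial>UI)"
    unfolding l2_sq by (intro Bochner_Integration.integral_cong) (auto simp: power2_eq_square algebra_simps)
  also have "\<dots> = (l2 f)\<^sup>2 + 2 * (\<integral>x. f x * g x \<partial>UI) + (l2 g)\<^sup>2"
    unfolding l2_sq using int by (subst Bochner_Integration.integral_add | simp)+
  also have "\<dots> \<le> (l2 f + l2 g)\<^sup>2"
    using Cauchy_Schwarz_l2[OF f g] by (simp add: power2_sum)
  finally show "(l2 (\<lambda>x. f x + g x))\<^sup>2 \<le> (l2 f + l2 g)\<^sup>2" .
qed simp

lemma l2_triangle_diff:
  assumes "sqint f" "sqint g" shows "l2 (\<lambda>x. f x - g x) \<le> l2 f + l2 g"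
  using l2_triangle[OF assms(1) sqint_cmult[OF assms(2), of "-1"]] l2_cmult[of "-1" g] by simp

lemma l2_commute: "l2 (\<lambda>x. f x - g x) = l2 (\<lambda>x. g x - f x)"
  by (simp add: l2_def power2_commute)

lemma l2_triangle3:
  assumes "sqint f" "sqint g" "sqint h"
  shows "l2 (\<lambda>x. f x - h x) \<le> l2 (\<lambda>x. f x - g x) + l2 (\<lambda>x. g x - h x)"
  using l2_triangle[OF sqint_diff[OF assms(1,2)] sqint_diff[OF assms(2,3)]] by simp

lemma L1_le_l2:
  assumes "sqint f" shows "(\<integral>x. \<bar>f x\<bar> \<partial>UI) \<le> l2 f"
proof -
  have "sqint (\<lambda>x. \<bar>f x\<bar>)" using assms by (auto simp: sqint_def)
  from Cauchy_Schwarz_l2[OF this sqint_const[of 1]] show ?thesis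
    using UI.prob_space by (simp add: l2_def)
qed


section \<open>The real trigonometric system, including the constant mode\<close>

definition bas :: "int \<Rightarrow> real \<Rightarrow> real" where
  "bas k x = (if k = 0 then 1 else ebasis k x)"

definition trig :: "(real \<Rightarrow> real) \<Rightarrow> bool" where
  "trig f \<longleftrightarrow> (\<exists>N c. f = (\<lambda>x. \<Sum>k\<in>{- int N..int N}. c k * bas k x))"

lemma continuous_bas [continuous_intros]: "continuous_on A (bas k)"
proof (cases "k = 0")
  case True
  hence "bas k = (\<lambda>x. 1)" by (auto simp: bas_def)
  thus ?thesis by simp
next
  case False
  hence "bas k = (\<lambda>x. if k \<ge> 1 then sqrt 2 * cos (2 * pi * real_of_int k * x)
                 else sqrt 2 * sin (2 * pi * real_of_int k * x))"
    by (auto simp: bas_def ebasis_def)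
  thus ?thesis by (cases "k \<ge> 1") (auto intro!: continuous_intros)
qed

lemma bas_measurable [measurable]: "bas k \<in> borel_measurable borel"
  by (rule borel_measurable_continuous_onI) (rule continuous_bas)

lemma sqint_bas [simp]: "sqint (bas k)"
  by (rule sqint_continuous) (rule continuous_bas)

text \<open>Cosines sit at positive and sines at negative indices, and the sines keep their negative
  frequency; so the two differentiation rules, signs included, merge into one factor
  \<open>2 * pi * k\<close> and the reflection of the index. Later Fourier computations rest on this
  single rule.\<close>

lemma bas_deriv: "(bas k has_real_derivative (2 * pi * real_of_int k * bas (- k) x)) (at x)"
proof -
  consider "k = 0" | "k \<ge> 1" | "k \<le> -1" by linarith
  thus ?thesis
  proof cases
    case 1
    hence "bas k = (\<lambda>x. 1)" by (auto simp: bas_def)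
    thus ?thesis using 1 by simp
  next
    case 2
    hence "bas k = (\<lambda>x. sqrt 2 * cos (2 * pi * real_of_int k * x))"
      "bas (-k) x = - sqrt 2 * sin (2 * pi * real_of_int k * x)"
      by (auto simp: bas_def ebasis_def)
    thus ?thesis by (auto intro!: derivative_eq_intros)
  next
    case 3
    hence "bas k = (\<lambda>x. sqrt 2 * sin (2 * pi * real_of_int k * x))"
      "bas (-k) x = sqrt 2 * cos (2 * pi * real_of_int k * x)"
      by (auto simp: bas_def ebasis_def)
    thus ?thesis by (auto intro!: derivative_eq_intros)
  qed
qed

lemma cos_2pi_int: "cos (2 * pi * real_of_int m) = 1" and sin_2pi_int: "sin (2 * pi * real_of_int m) = 0"
  using cos_int_2pin[of m] sin_int_2pin[of m] by (simp_all add: mult_ac)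

lemma integral_cos_UI: "(\<integral>x. cos (2 * pi * real_of_int m * x) \<partial>UI) = (if m = 0 then 1 else 0)"
proof (cases "m = 0")
  case True thus ?thesis using UI.prob_space by simp
next
  case False
  have "(\<integral>x. cos (2 * pi * real_of_int m * x) \<partial>UI) =
    (sin (2 * pi * real_of_int m * 1) / (2 * pi * m)) - (sin (2 * pi * real_of_int m * 0) / (2 * pi * m))"
    by (rule integral_UI_FTC) (use False in \<open>auto intro!: derivative_eq_intros continuous_intros\<close>)
  thus ?thesis using False by (simp add: sin_2pi_int)
qed

lemma integral_sin_UI: "(\<integral>x. sin (2 * pi * real_of_int m * x) \<partial>UI) = 0"
proof (cases "m = 0")
  case True thus ?thesis by simp
next
  case False
  have "(\<integral>x. sin (2 * pi * real_of_int m * x) \<partial>UI) =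
    (- cos (2 * pi * real_of_int m * 1) / (2 * pi * m)) - (- cos (2 * pi * real_of_int m * 0) / (2 * pi * m))"
    by (rule integral_UI_FTC) (use False in \<open>auto intro!: derivative_eq_intros continuous_intros\<close>)
  thus ?thesis using False by (simp add: cos_2pi_int)
qed

lemma integrable_cos_UI: "integrable UI (\<lambda>x. cos (c * x))" "integrable UI (\<lambda>x. sin (c * x))"
  by (auto intro!: integrable_UI_continuous continuous_intros)

text \<open>Product-to-sum formulas reduce all cases to the integrals of cosines and sines of
  integer frequency.\<close>

lemma bas_orthonormal: "(\<integral>x. bas j x * bas k x \<partial>UI) = (if j = k then 1 else 0)"
proof -
  have cc: "(\<integral>x. (sqrt 2 * cos (2 * pi * real_of_int m * x)) * (sqrt 2 * cos (2 * pi * real_of_int n * x)) \<partial>UI)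
     = (if m - n = 0 then 1 else 0) + (if m + n = 0 then 1 else 0)" for m n
  proof -
    have "(\<integral>x. (sqrt 2 * cos (2 * pi * real_of_int m * x)) * (sqrt 2 * cos (2 * pi * real_of_int n * x)) \<partial>UI)
      = (\<integral>x. cos (2 * pi * real_of_int (m - n) * x) + cos (2 * pi * real_of_int (m + n) * x) \<partial>UI)"
      by (intro Bochner_Integration.integral_cong refl)
         (simp add: algebra_simps cos_add cos_diff)
    also have "\<dots> = (\<integral>x. cos (2 * pi * real_of_int (m - n) * x) \<partial>UI) + (\<integral>x. cos (2 * pi * real_of_int (m + n) * x) \<partial>UI)"
      by (rule Bochner_Integration.integral_add) (rule integrable_cos_UI)+
    finally show ?thesis unfolding integral_cos_UI .
  qed
  have ss: "(\<integral>x. (sqrt 2 * sin (2 * pi * real_of_int m * x)) * (sqrt 2 * sin (2 * pi * real_of_int n * x)) \<partial>UI)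
     = (if m - n = 0 then 1 else 0) - (if m + n = 0 then 1 else 0)" for m n
  proof -
    have "(\<integral>x. (sqrt 2 * sin (2 * pi * real_of_int m * x)) * (sqrt 2 * sin (2 * pi * real_of_int n * x)) \<partial>UI)
      = (\<integral>x. cos (2 * pi * real_of_int (m - n) * x) - cos (2 * pi * real_of_int (m + n) * x) \<partial>UI)"
      by (intro Bochner_Integration.integral_cong refl)
         (simp add: algebra_simps cos_add cos_diff)
    also have "\<dots> = (\<integral>x. cos (2 * pi * real_of_int (m - n) * x) \<partial>UI) - (\<integral>x. cos (2 * pi * real_of_int (m + n) * x) \<partial>UI)"
      by (rule Bochner_Integration.integral_diff) (rule integrable_cos_UI)+
    finally show ?thesis unfolding integral_cos_UI .
  qed
  have sc: "(\<integral>x. (sqrt 2 * sin (2 * pi * real_of_int m * x)) * (sqrt 2 * cos (2 * pi * real_of_int n * x)) \<partial>UI) = 0" for m n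
  proof -
    have "(\<integral>x. (sqrt 2 * sin (2 * pi * real_of_int m * x)) * (sqrt 2 * cos (2 * pi * real_of_int n * x)) \<partial>UI)
      = (\<integral>x. sin (2 * pi * real_of_int (m - n) * x) + sin (2 * pi * real_of_int (m + n) * x) \<partial>UI)"
      by (intro Bochner_Integration.integral_cong refl)
         (simp add: algebra_simps sin_add sin_diff)
    also have "\<dots> = (\<integral>x. sin (2 * pi * real_of_int (m - n) * x) \<partial>UI) + (\<integral>x. sin (2 * pi * real_of_int (m + n) * x) \<partial>UI)"
      by (rule Bochner_Integration.integral_add) (rule integrable_cos_UI)+
    finally show ?thesis unfolding integral_sin_UI by simp
  qed
  have c1: "(\<integral>x. sqrt 2 * cos (2 * pi * real_of_int m * x) \<partial>UI) = 0" if "m \<noteq> 0" for m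
    using integral_cos_UI[of m] that by simp
  have s1: "(\<integral>x. sqrt 2 * sin (2 * pi * real_of_int m * x) \<partial>UI) = 0" for m
    using integral_sin_UI[of m] by simp
  have b: "bas k = (if k = 0 then (\<lambda>x. 1) else if k \<ge> 1 then (\<lambda>x. sqrt 2 * cos (2 * pi * real_of_int k * x)) else (\<lambda>x. sqrt 2 * sin (2 * pi * real_of_int k * x)))" for k
    by (auto simp: bas_def ebasis_def)
  have cs: "(\<integral>x. (sqrt 2 * cos (2 * pi * real_of_int m * x)) * (sqrt 2 * sin (2 * pi * real_of_int n * x)) \<partial>UI) = 0" for m n
    using sc[of n m] by (simp add: mult_ac)
  have p1: "(\<integral>x. (1::real) \<partial>UI) = 1" using UI.prob_space by simp
  consider "j = 0" | "j \<ge> 1" | "j \<le> -1" by linarith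
  thus ?thesis
  proof cases
    case 1
    consider "k = 0" | "k \<ge> 1" | "k \<le> -1" by linarith
    thus ?thesis by cases (use 1 p1 c1 s1 in \<open>simp_all add: b\<close>)
  next
    case 2
    consider "k = 0" | "k \<ge> 1" | "k \<le> -1" by linarith
    thus ?thesis
    proof cases
      case 1 thus ?thesis using 2 c1[of j] by (simp add: b)
    next
      case k: 2 
      have "bas j = (\<lambda>x. sqrt 2 * cos (2 * pi * real_of_int j * x))" "bas k = (\<lambda>x. sqrt 2 * cos (2 * pi * real_of_int k * x))" using 2 k by (auto simp: b)
      thus ?thesis using 2 k cc[of j k] by (simp only:) simp
    next
      case k: 3
      have "bas j = (\<lambda>x. sqrt 2 * cos (2 * pi * real_of_int j * x))" "bas k = (\<lambda>x. sqrt 2 * sin (2 * pi * real_of_int k * x))" using 2 k by (auto simp: b)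
      thus ?thesis using 2 k cs[of j k] by (simp only:) simp
    qed
  next
    case 3
    consider "k = 0" | "k \<ge> 1" | "k \<le> -1" by linarith
    thus ?thesis
    proof cases
      case 1 thus ?thesis using 3 s1[of j] by (simp add: b)
    next
      case k: 2 
      have "bas j = (\<lambda>x. sqrt 2 * sin (2 * pi * real_of_int j * x))" "bas k = (\<lambda>x. sqrt 2 * cos (2 * pi * real_of_int k * x))" using 3 k by (auto simp: b)
      thus ?thesis using 3 k sc[of j k] by (simp only:) simp
    next
      case k: 3
      have "bas j = (\<lambda>x. sqrt 2 * sin (2 * pi * real_of_int j * x))" "bas k = (\<lambda>x. sqrt 2 * sin (2 * pi * real_of_int k * x))" using 3 k by (auto simp: b)
      thus ?thesis using 3 k ss[of j k] by (simp only:) simp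
    qed
  qed
qed

lemma bas_bound: "\<bar>bas k x\<bar> \<le> sqrt 2"
proof -
  have "\<bar>sqrt 2 * cos y\<bar> \<le> sqrt 2" "\<bar>sqrt 2 * sin y\<bar> \<le> sqrt 2" for y :: real
    by (simp_all add: abs_mult abs_cos_le_one abs_sin_le_one)
  thus ?thesis by (auto simp: bas_def ebasis_def)
qed

section \<open>Density of trigonometric polynomials\<close>

lemma trig_add:
  assumes "trig f" "trig g" shows "trig (\<lambda>x. f x + g x)"
proof -
  obtain N c where f: "f = (\<lambda>x. \<Sum>k\<in>{- int N..int N}. c k * bas k x)" using assms(1) by (auto simp: trig_def)
  obtain M d where g: "g = (\<lambda>x. \<Sum>k\<in>{- int M..int M}. d k * bas k x)" using assms(2) by (auto simp: trig_def)
  define K where "K = max N M"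
  have pad: "(\<Sum>k\<in>{- int n..int n}. c k * bas k x) = (\<Sum>k\<in>{- int K..int K}. (if k \<in> {- int n..int n} then c k else 0) * bas k x)"
    if "n \<le> K" for n c x
    by (rule sum.mono_neutral_cong_left) (use that in auto)
  have "(\<lambda>x. f x + g x) = (\<lambda>x. \<Sum>k\<in>{- int K..int K}. ((if k \<in> {- int N..int N} then c k else 0) + (if k \<in> {- int M..int M} then d k else 0)) * bas k x)"
    unfolding f g using pad[of N c] pad[of M d] by (simp add: K_def sum.distrib[symmetric] algebra_simps)
  thus ?thesis by (auto simp: trig_def intro!: exI[of _ K])
qed

lemma trig_cmult:
  assumes "trig f" shows "trig (\<lambda>x. a * f x)"
proof -
  obtain N c where f: "f = (\<lambda>x. \<Sum>k\<in>{- int N..int N}. c k * bas k x)" using assms(1) by (auto simp: trig_def)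
  show ?thesis unfolding trig_def f
    by (intro exI[of _ N] exI[of _ "\<lambda>k. a * c k"]) (simp add: sum_distrib_left mult.assoc)
qed

lemma trig_bas: "trig (bas k)"
  unfolding trig_def
proof (intro exI[of _ "nat \<bar>k\<bar>"] exI[of _ "\<lambda>j. if j = k then 1 else 0"] ext)
  fix x
  have "(\<Sum>j\<in>{- int (nat \<bar>k\<bar>)..int (nat \<bar>k\<bar>)}. (if j = k then 1 else 0) * bas j x)
     = (\<Sum>j\<in>{- int (nat \<bar>k\<bar>)..int (nat \<bar>k\<bar>)}. if j = k then bas j x else 0)"
    by (intro sum.cong) auto
  thus "bas k x = (\<Sum>j\<in>{- int (nat \<bar>k\<bar>)..int (nat \<bar>k\<bar>)}. (if j = k then 1 else 0) * bas j x)"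
    by (auto simp: sum.delta)
qed

lemma trig_const: "trig (\<lambda>x. c)"
  using trig_cmult[OF trig_bas[of 0], of c] by (simp add: bas_def)

lemma trig_sum: "(\<And>i. i \<in> A \<Longrightarrow> trig (f i)) \<Longrightarrow> trig (\<lambda>x. \<Sum>i\<in>A. f i x)"
  by (induction A rule: infinite_finite_induct) (auto intro: trig_add trig_const)

lemma trig_cos: "trig (\<lambda>x. cos (2 * pi * real_of_int m * x))" and
  trig_sin: "trig (\<lambda>x. sin (2 * pi * real_of_int m * x))"
proof -
  have pos: "trig (\<lambda>x. cos (2 * pi * real_of_int n * x))" "trig (\<lambda>x. sin (2 * pi * real_of_int n * x))" if "n \<ge> 1" for n
  proof -
    have "(\<lambda>x. cos (2 * pi * real_of_int n * x)) = (\<lambda>x. (1 / sqrt 2) * bas n x)" 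
      using that by (auto simp: bas_def ebasis_def)
    thus "trig (\<lambda>x. cos (2 * pi * real_of_int n * x))" by (simp only:) (rule trig_cmult[OF trig_bas])
    have "(\<lambda>x. sin (2 * pi * real_of_int n * x)) = (\<lambda>x. (- 1 / sqrt 2) * bas (-n) x)" 
      using that by (auto simp: bas_def ebasis_def)
    thus "trig (\<lambda>x. sin (2 * pi * real_of_int n * x))" by (simp only:) (rule trig_cmult[OF trig_bas])
  qed
  consider "m = 0" | "m \<ge> 1" | "- m \<ge> 1" by linarith
  hence "trig (\<lambda>x. cos (2 * pi * real_of_int m * x)) \<and> trig (\<lambda>x. sin (2 * pi * real_of_int m * x))"
  proof cases
    case 1 thus ?thesis by (auto intro: trig_const)
  next
    case 2 thus ?thesis using pos by auto
  next
    case 3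
    from pos[OF 3] trig_cmult[of "\<lambda>x. sin (2 * pi * real_of_int (-m) * x)" "-1"] show ?thesis by simp
  qed
  thus "trig (\<lambda>x. cos (2 * pi * real_of_int m * x))" "trig (\<lambda>x. sin (2 * pi * real_of_int m * x))" by auto
qed

text \<open>Closure under multiplication by a shifted cosine yields, by induction on the degree, all
  polynomials in that cosine. The shift \<open>a\<close> later places the centre of an arc.\<close>

lemma trig_mult_cos:
  assumes "trig f" shows "trig (\<lambda>x. cos (2 * pi * (x - a)) * f x)"
proof -
  have c1: "trig (\<lambda>x. cos (2 * pi * (x - a)) * cos (2 * pi * real_of_int n * x))" for n
  proof -
    have "cos (2 * pi * (x - a)) * cos (2 * pi * real_of_int n * x) =
      (cos (2 * pi * a) / 2) * cos (2 * pi * real_of_int (n + 1) * x) + (cos (2 * pi * a) / 2) * cos (2 * pi * real_of_int (n - 1) * x) 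
      + ((sin (2 * pi * a) / 2) * sin (2 * pi * real_of_int (n + 1) * x) + (- sin (2 * pi * a) / 2) * sin (2 * pi * real_of_int (n - 1) * x))" for x
      by (simp add: algebra_simps cos_diff cos_add sin_diff sin_add)
    thus ?thesis by (simp only:) (intro trig_add trig_cmult trig_cos trig_sin)
  qed
  have c2: "trig (\<lambda>x. cos (2 * pi * (x - a)) * sin (2 * pi * real_of_int n * x))" for n
  proof -
    have "cos (2 * pi * (x - a)) * sin (2 * pi * real_of_int n * x) =
      (cos (2 * pi * a) / 2) * sin (2 * pi * real_of_int (n + 1) * x) + (cos (2 * pi * a) / 2) * sin (2 * pi * real_of_int (n - 1) * x) 
      + ((sin (2 * pi * a) / 2) * cos (2 * pi * real_of_int (n - 1) * x) + (- sin (2 * pi * a) / 2) * cos (2 * pi * real_of_int (n + 1) * x))" for x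
      by (simp add: algebra_simps cos_diff cos_add sin_diff sin_add)
    thus ?thesis by (simp only:) (intro trig_add trig_cmult trig_cos trig_sin)
  qed
  have cb: "trig (\<lambda>x. cos (2 * pi * (x - a)) * bas k x)" for k
  proof -
    consider "k = 0" | "k \<ge> 1" | "k \<le> -1" by linarith
    thus ?thesis
    proof cases
      case 1 thus ?thesis using c1[of 0] by (simp add: bas_def)
    next
      case 2
      hence "(\<lambda>x. cos (2 * pi * (x - a)) * bas k x) = (\<lambda>x. sqrt 2 * (cos (2 * pi * (x - a)) * cos (2 * pi * real_of_int k * x)))"
        by (auto simp: bas_def ebasis_def)
      thus ?thesis by (simp only:) (rule trig_cmult[OF c1])
    next
      case 3
      hence "(\<lambda>x. cos (2 * pi * (x - a)) * bas k x) = (\<lambda>x. sqrt 2 * (cos (2 * pi * (x - a)) * sin (2 * pi * real_of_int k * x)))"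
        by (auto simp: bas_def ebasis_def)
      thus ?thesis by (simp only:) (rule trig_cmult[OF c2])
    qed
  qed
  obtain N c where f: "f = (\<lambda>x. \<Sum>k\<in>{- int N..int N}. c k * bas k x)" using assms(1) by (auto simp: trig_def)
  have "(\<lambda>x. cos (2 * pi * (x - a)) * f x) = (\<lambda>x. \<Sum>k\<in>{- int N..int N}. c k * (cos (2 * pi * (x - a)) * bas k x))"
    unfolding f by (rule ext) (simp only: sum_distrib_left mult.left_commute)
  thus ?thesis by (simp only:) (intro trig_sum trig_cmult cb)
qed

lemma trig_poly_cos:
  assumes "real_polynomial_function p" shows "trig (\<lambda>x. p (cos (2 * pi * (x - a))))"
proof -
  have pw: "trig (\<lambda>x. cos (2 * pi * (x - a)) ^ n)" for n
    by (induction n) (auto intro: trig_const trig_mult_cos)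
  obtain c n where p: "p = (\<lambda>x. \<Sum>i\<le>n. c i * x ^ i)"
    using assms real_polynomial_function_iff_sum by blast
  show ?thesis unfolding p by (intro trig_sum trig_cmult pw)
qed

lemma trig_continuous: "trig f \<Longrightarrow> continuous_on A f"
  unfolding trig_def by (auto intro!: continuous_intros)

lemma trig_sqint: "trig f \<Longrightarrow> sqint f"
  by (rule sqint_continuous) (rule trig_continuous)

section \<open>Mean-square approximation by trigonometric polynomials, extended to all
  square-integrable functions\<close>

definition tappr :: "(real \<Rightarrow> real) \<Rightarrow> bool" where
  "tappr f \<longleftrightarrow> sqint f \<and> (\<forall>e>0. \<exists>T. trig T \<and> l2 (\<lambda>x. f x - T x) < e)"

lemma tappr_trig: "trig f \<Longrightarrow> tappr f"
  unfolding tappr_def using trig_sqint by (auto intro!: exI[of _ f] simp: l2_def)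

lemma tappr_add:
  assumes f: "tappr f" and g: "tappr g" shows "tappr (\<lambda>x. f x + g x)"
  unfolding tappr_def
proof (intro conjI allI impI)
  show "sqint (\<lambda>x. f x + g x)" using assms by (auto simp: tappr_def intro: sqint_add)
  fix e :: real assume "e > 0"
  then obtain S T where S: "trig S" "l2 (\<lambda>x. f x - S x) < e/2" and T: "trig T" "l2 (\<lambda>x. g x - T x) < e/2"
    using assms unfolding tappr_def by (meson half_gt_zero)
  have "l2 (\<lambda>x. (f x + g x) - (S x + T x)) = l2 (\<lambda>x. (f x - S x) + (g x - T x))"
    by (simp add: algebra_simps)
  also have "\<dots> \<le> l2 (\<lambda>x. f x - S x) + l2 (\<lambda>x. g x - T x)"
    using assms S T by (intro l2_triangle sqint_diff) (auto simp: tappr_def trig_sqint)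
  also have "\<dots> < e" using S T by simp
  finally show "\<exists>T. trig T \<and> l2 (\<lambda>x. f x + g x - T x) < e"
    using trig_add[OF S(1) T(1)] by blast
qed

lemma tappr_cmult:
  assumes f: "tappr f" shows "tappr (\<lambda>x. c * f x)"
  unfolding tappr_def
proof (intro conjI allI impI)
  show "sqint (\<lambda>x. c * f x)" using assms by (auto simp: tappr_def intro: sqint_cmult)
  fix e :: real assume e: "e > 0"
  have "e / (\<bar>c\<bar> + 1) > 0" using e by (simp add: divide_pos_pos add_nonneg_pos)
  then obtain S where S: "trig S" "l2 (\<lambda>x. f x - S x) < e / (\<bar>c\<bar> + 1)"
    using assms unfolding tappr_def by blast
  have "l2 (\<lambda>x. c * f x - c * S x) = l2 (\<lambda>x. c * (f x - S x))"
    by (simp add: algebra_simps)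
  also have "\<dots> = \<bar>c\<bar> * l2 (\<lambda>x. f x - S x)" by (rule l2_cmult)
  also have "\<dots> \<le> (\<bar>c\<bar> + 1) * l2 (\<lambda>x. f x - S x)" by (simp add: mult_right_mono)
  also have "\<dots> < e" using S(2) by (simp add: field_simps add_nonneg_pos)
  finally show "\<exists>T. trig T \<and> l2 (\<lambda>x. c * f x - T x) < e"
    using trig_cmult[OF S(1), of c] by blast
qed

lemma tappr_close:
  assumes "sqint f" "\<And>e. e > 0 \<Longrightarrow> \<exists>g. tappr g \<and> l2 (\<lambda>x. f x - g x) < e"
  shows "tappr f"
  unfolding tappr_def
proof (intro conjI allI impI assms(1))
  fix e :: real assume "e > 0"
  then obtain g where g: "tappr g" "l2 (\<lambda>x. f x - g x) < e/2" using assms(2)[of "e/2"] by auto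
  then obtain T where T: "trig T" "l2 (\<lambda>x. g x - T x) < e/2" using \<open>e > 0\<close> unfolding tappr_def by (meson half_gt_zero)
  have "l2 (\<lambda>x. f x - T x) \<le> l2 (\<lambda>x. f x - g x) + l2 (\<lambda>x. g x - T x)"
    using assms(1) g T by (intro l2_triangle3) (auto simp: tappr_def trig_sqint)
  thus "\<exists>T. trig T \<and> l2 (\<lambda>x. f x - T x) < e" using T g by fastforce
qed

lemma l2_tendsto_0I:
  assumes "(\<lambda>n. \<integral>x. (f n x)\<^sup>2 \<partial>UI) \<longlonglongrightarrow> 0" shows "(\<lambda>n. l2 (f n)) \<longlonglongrightarrow> 0"
  unfolding l2_def using tendsto_real_sqrt[OF assms] by simp

text \<open>Dominated convergence: both the limit and the approximants are bounded by |h|, hence the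
  squared differences by 4 h^2.\<close>

lemma tappr_limit:
  assumes g: "\<And>n. tappr (g n)" and f: "f \<in> borel_measurable UI" and lim: "AE x in UI. (\<lambda>n. g n x) \<longlonglongrightarrow> f x"
    and h: "integrable UI (\<lambda>x. (h x)\<^sup>2)" "AE x in UI. \<forall>n. \<bar>g n x\<bar> \<le> \<bar>h x\<bar>"
  shows "tappr f"
proof -
  have gm[measurable]: "g n \<in> borel_measurable UI" for n using g by (auto simp: tappr_def sqint_def)
  note f[measurable]
  have fh: "AE x in UI. \<bar>f x\<bar> \<le> \<bar>h x\<bar>"
    using lim h(2)
  proof eventually_elim
    case (elim x)
    have "(\<lambda>n. \<bar>g n x\<bar>) \<longlonglongrightarrow> \<bar>f x\<bar>" using elim(1) by (rule tendsto_rabs)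
    thus ?case by (rule LIMSEQ_le_const2) (use elim in auto)
  qed
  have fi: "integrable UI (\<lambda>x. (f x)\<^sup>2)"
    by (rule Bochner_Integration.integrable_bound[OF h(1)]) (use fh f in \<open>auto simp: abs_le_square_iff\<close>)
  hence sf: "sqint f" using f by (simp add: sqint_def)
  have "(\<lambda>n. \<integral>x. (f x - g n x)\<^sup>2 \<partial>UI) \<longlonglongrightarrow> (\<integral>x. 0 \<partial>UI)"
  proof (rule integral_dominated_convergence[where w="\<lambda>x. 4 * (h x)\<^sup>2"])
    show "AE x in UI. (\<lambda>n. (f x - g n x)\<^sup>2) \<longlonglongrightarrow> 0"
      using lim
    proof eventually_elim
      case (elim x)
      have "(\<lambda>n. (f x - g n x)\<^sup>2) \<longlonglongrightarrow> (f x - f x)\<^sup>2" by (intro tendsto_intros elim)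
      thus ?case by simp
    qed
    fix n show "AE x in UI. norm ((f x - g n x)\<^sup>2) \<le> 4 * (h x)\<^sup>2"
      using fh h(2)
    proof eventually_elim
      case (elim x)
      have "\<bar>f x - g n x\<bar> \<le> 2 * \<bar>h x\<bar>" using elim(1) elim(2)[rule_format, of n] by linarith
      hence "\<bar>f x - g n x\<bar>\<^sup>2 \<le> (2 * \<bar>h x\<bar>)\<^sup>2" by (intro power_mono) auto
      thus ?case by (simp add: power_mult_distrib)
    qed
  qed (use h in auto)
  hence "(\<lambda>n. l2 (\<lambda>x. f x - g n x)) \<longlonglongrightarrow> 0" by (intro l2_tendsto_0I) simp
  hence "\<exists>n. l2 (\<lambda>x. f x - g n x) < e" if "e > 0" for e
    using order_tendstoD(2)[of _ 0 sequentially e] that by (auto simp: eventually_sequentially)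
  thus ?thesis using g sf by (intro tappr_close) auto
qed

text \<open>Weierstrass approximation is applied to \<open>G\<close> on [-1, 1], and a polynomial in
  a cosine is a trigonometric polynomial.\<close>

lemma tappr_continuous_cos:
  fixes G :: "real \<Rightarrow> real"
  assumes "continuous_on {-1..1} G" shows "tappr (\<lambda>x. G (cos (2 * pi * (x - a))))"
proof -
  have cc: "continuous_on UNIV (\<lambda>x. G (cos (2 * pi * (x - a))))"
    by (rule continuous_on_compose2[OF assms]) (auto intro!: continuous_intros)
  show ?thesis
  proof (rule tappr_close)
    show "sqint (\<lambda>x. G (cos (2 * pi * (x - a))))" by (rule sqint_continuous[OF cc])
    fix e :: real assume e: "e > 0"
    obtain p where p: "real_polynomial_function p" "\<And>y. y \<in> {-1..1} \<Longrightarrow> \<bar>G y - p y\<bar> < e / 2"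
      using Stone_Weierstrass_real_polynomial_function[OF compact_Icc assms] e by (metis half_gt_zero)
    have T: "trig (\<lambda>x. p (cos (2 * pi * (x - a))))" by (rule trig_poly_cos[OF p(1)])
    have "l2 (\<lambda>x. G (cos (2 * pi * (x - a))) - p (cos (2 * pi * (x - a)))) \<le> (e/2) * l2 (\<lambda>x. 1)"
    proof (rule l2_sq_le_AE)
      have "\<bar>G (cos (2 * pi * (x - a))) - p (cos (2 * pi * (x - a)))\<bar> \<le> e / 2 * \<bar>1\<bar>" for x
        using p(2)[of "cos (2 * pi * (x - a))"] by (simp add: less_imp_le)
      thus "AE x in UI. \<bar>G (cos (2 * pi * (x - a))) - p (cos (2 * pi * (x - a)))\<bar> \<le> e / 2 * \<bar>1\<bar>" by simp
      show "(\<lambda>x. G (cos (2 * pi * (x - a))) - p (cos (2 * pi * (x - a)))) \<in> borel_measurable UI"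
        using sqint_continuous[OF cc] trig_sqint[OF T] by (auto simp: sqint_def)
    qed (use e in auto)
    also have "\<dots> < e" using e UI.prob_space by (simp add: l2_def)
    finally show "\<exists>g. tappr g \<and> l2 (\<lambda>x. G (cos (2 * pi * (x - a))) - g x) < e"
      using tappr_trig[OF T] by blast
  qed
qed

text \<open>The arc from 0 to \<open>a\<close> has centre \<open>a/2\<close> and half-width
  \<open>a/2\<close>, so up to endpoints it is the set where \<open>cos (2 * pi * (x - a/2))\<close>
  exceeds \<open>cos (pi * a)\<close>. Its indicator is a limit of continuous ramps in that
  cosine.\<close>

lemma tappr_arc:
  assumes a: "0 < a" "a < 1" shows "tappr (indicator {0..a})"
proof -
  define c where "c = cos (pi * a)"
  define G where "G n y = min 1 (max 0 (real n * (y - c)))" for n :: nat and y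
  have t: "tappr (\<lambda>x. G n (cos (2 * pi * (x - a/2))))" for n
    by (rule tappr_continuous_cos) (auto simp: G_def intro!: continuous_intros)
  have l1: "(\<lambda>n. G n y) \<longlonglongrightarrow> (if y > c then 1 else 0)" for y
  proof (cases "y > c")
    case True
    have "eventually (\<lambda>n. G n y = 1) sequentially"
    proof -
      obtain n0 where "real n0 * (y - c) \<ge> 1" using True reals_Archimedean3[of "y - c"] by (metis diff_gt_0_iff_gt less_imp_le)
      hence "G n y = 1" if "n \<ge> n0" for n
      proof -
        have "real n0 * (y - c) \<le> real n * (y - c)" using that True by (intro mult_right_mono) auto
        thus ?thesis using \<open>real n0 * (y - c) \<ge> 1\<close> by (simp add: G_def)
      qed
      thus ?thesis by (auto simp: eventually_sequentially)
    qed
    thus ?thesis using True by (simp add: tendsto_eventually)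
  next
    case False
    hence "G n y = 0" for n by (simp add: G_def mult_nonneg_nonpos)
    thus ?thesis using False by simp
  qed
  have ind: "(if cos (2 * pi * (x - a/2)) > c then 1 else 0) = (indicator {0..a} x :: real)" if "x \<in> {0<..<1}" "x \<noteq> a" for x :: real
  proof -
    have e: "cos (2 * pi * (x - a/2)) = cos (pi * \<bar>2 * x - a\<bar>)"
    proof -
      have "2 * pi * (x - a/2) = pi * (2 * x - a)" by (simp add: algebra_simps)
      moreover have "cos (pi * (2 * x - a)) = cos \<bar>pi * (2 * x - a)\<bar>" by simp
      ultimately show ?thesis by (simp only: abs_mult) simp
    qed
    show ?thesis
    proof (cases "x < a")
      case True
      have "\<bar>2 * x - a\<bar> < a" using that True by auto
      hence "cos (pi * \<bar>2 * x - a\<bar>) > c" unfolding c_def using a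
        by (intro cos_monotone_0_pi) auto
      thus ?thesis using that True by (simp add: e)
    next
      case False
      hence xa: "x > a" using that by auto
      show ?thesis
      proof (cases "2 * x - a \<le> 1")
        case True
        have "cos (pi * \<bar>2 * x - a\<bar>) < c" unfolding c_def using a xa True
          by (intro cos_monotone_0_pi) auto
        thus ?thesis using that xa by (simp add: e)
      next
        case False
        \<comment> \<open>Beyond the antipode of \<open>a/2\<close> the cosine increases again;
          reflection brings the angle back into [0, pi], where monotonicity applies.\<close>
        have "cos (pi * \<bar>2 * x - a\<bar>) = cos (pi * (2 - (2 * x - a)))"
        proof -
          have "cos (pi * (2 - (2 * x - a))) = cos (2 * pi - pi * (2 * x - a))" by (simp add: algebra_simps)
          also have "\<dots> = cos (pi * (2 * x - a))" by (simp add: cos_diff)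
          finally show ?thesis using False by simp
        qed
        also have "\<dots> < c" unfolding c_def using a xa False that
          by (intro cos_monotone_0_pi) auto
        finally show ?thesis using that xa by (simp add: e)
      qed
    qed
  qed
  have null: "AE x in UI. x \<in> {0<..<1} \<and> x \<noteq> a"
  proof -
    have "AE x in lborel. x \<noteq> 0 \<and> x \<noteq> 1 \<and> x \<noteq> a"
      using AE_lborel_singleton[of 0] AE_lborel_singleton[of 1] AE_lborel_singleton[of a] by auto
    hence "AE x in lborel. x \<in> {0..1} \<longrightarrow> (x \<in> {0<..<1} \<and> x \<noteq> a)" by eventually_elim auto
    thus ?thesis unfolding UI_def by (subst AE_restrict_space_iff) auto
  qed
  show ?thesis
  proof (rule tappr_limit[OF t, where h="\<lambda>x. 1"])
    show "AE x in UI. (\<lambda>n. G n (cos (2 * pi * (x - a / 2)))) \<longlonglongrightarrow> indicator {0..a} x"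
      using null
    proof eventually_elim
      case (elim x)
      show ?case using l1[of "cos (2 * pi * (x - a / 2))"] ind[of x] elim by simp
    qed
  qed (auto simp: G_def intro!: measurable_UI)
qed

lemma tappr_cong_AE:
  assumes "tappr f" "g \<in> borel_measurable UI" "AE x in UI. f x = g x" shows "tappr g"
  using assms by (intro tappr_limit[of "\<lambda>n. f" g f]) (auto simp: tappr_def sqint_def)

text \<open>A Dynkin argument: half-lines generate the Borel sets and are stable under intersection,
  and the class is closed under complements and, by \<open>tappr_limit\<close>, under countable
  disjoint unions.\<close>

lemma tappr_indicator:
  assumes "A \<in> sets borel" shows "tappr (indicator A)"
proof -
  have "sigma_sets UNIV (range (\<lambda>a::real. {..a})) = sets borel"
    by (subst borel_eq_atMost) auto
  hence "A \<in> sigma_sets UNIV (range (\<lambda>a::real. {..a}))" using assms by simp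
  have stable: "Int_stable (range (\<lambda>a::real. {..a}))"
  proof (rule Int_stableI)
    fix a b :: "real set" assume "a \<in> range (\<lambda>a. {..a})" "b \<in> range (\<lambda>a. {..a})"
    then obtain x y where "a = {..x}" "b = {..y}" by auto
    hence "a \<inter> b = {..min x y}" by auto
    thus "a \<inter> b \<in> range (\<lambda>a. {..a})" by auto
  qed
  have Pow: "range (\<lambda>a::real. {..a}) \<subseteq> Pow UNIV" by simp
  from \<open>A \<in> sigma_sets UNIV (range (\<lambda>a::real. {..a}))\<close> show ?thesis
  proof (induction rule: sigma_sets_induct_disjoint[OF stable Pow, consumes 1, case_names basic empty compl union])
    case (basic A)
    then obtain a where A: "A = {..a}" by auto
    \<comment> \<open>Inside the unit interval a half-line is, up to the null set {0}, everything,
      empty, or an arc starting at 0.\<close>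
    have eq: "indicator {..a} x = (f x :: real)" if "a \<ge> 1 \<Longrightarrow> f = (\<lambda>x. 1)" "0 < a \<Longrightarrow> a < 1 \<Longrightarrow> f = indicator {0..a}" "a \<le> 0 \<Longrightarrow> f = (\<lambda>x. 0)" "x \<in> {0<..1}" for f x
      using that by (cases "a \<ge> 1"; cases "a \<le> 0") (auto simp: indicator_def)
    define f :: "real \<Rightarrow> real" where "f = (if a \<ge> 1 then (\<lambda>x. 1) else if a \<le> 0 then (\<lambda>x. 0) else indicator {0..a})"
    have "tappr f" unfolding f_def using tappr_arc[of a] tappr_trig[OF trig_const] by auto
    moreover have "AE x in UI. f x = indicator {..a} x"
    proof -
      have "AE x in lborel. x \<noteq> (0::real)" by (rule AE_lborel_singleton)
      hence "AE x in lborel. x \<in> {0..1} \<longrightarrow> f x = indicator {..a} x"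
      proof eventually_elim
        case (elim x) show ?case using eq[of f x] elim by (auto simp: f_def)
      qed
      thus ?thesis unfolding UI_def by (subst AE_restrict_space_iff) auto
    qed
    ultimately show ?case unfolding A by (intro tappr_cong_AE[of f "indicator {..a}"]) (auto intro!: measurable_UI)
  next
    case empty show ?case using tappr_trig[OF trig_const[of 0]] by (simp add: indicator_def)
  next
    case (compl A)
    have "tappr (\<lambda>x. 1 + (-1) * indicator A x)" by (intro tappr_add tappr_cmult compl tappr_trig trig_const)
    moreover have "(\<lambda>x. 1 + (-1) * indicator A x :: real) = indicator (UNIV - A)" by (auto simp: indicator_def)
    ultimately show ?case by simp
  next
    case (union A)
    have m: "A i \<in> sets borel" for i using union(2) \<open>sigma_sets UNIV (range (\<lambda>a::real. {..a})) = sets borel\<close> by auto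
    have "tappr (\<lambda>x. \<Sum>i<n. indicator (A i) x)" for n
    proof (induction n)
      case 0 show ?case using tappr_trig[OF trig_const[of 0]] by simp
    next
      case (Suc n) show ?case using tappr_add[OF Suc union(3)[of n]] by simp
    qed
    moreover have e: "(\<Sum>i<n. indicator (A i) x) = (indicator (\<Union>i<n. A i) x :: real)" for n x
      using union(1) by (intro indicator_UN_disjoint[symmetric]) (auto simp: disjoint_family_on_def)
    ultimately have t: "tappr (indicator (\<Union>i<n. A i))" for n by simp
    show ?case
    proof (rule tappr_limit[OF t, where h="\<lambda>x. 1"])
      show "AE x in UI. (\<lambda>n. indicator (\<Union>i<n. A i) x :: real) \<longlonglongrightarrow> indicator (\<Union>i. A i) x"
        by (intro AE_I2 LIMSEQ_indicator_UN)
    qed (use m in \<open>auto simp: indicator_def intro!: measurable_UI borel_measurable_indicator[unfolded indicator_def[abs_def]]\<close>)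
  qed
qed

section \<open>Fourier coefficients and weak derivatives\<close>

text \<open>Simple functions bounded by 2 |f| converge pointwise to \<open>f\<close>, so
  \<open>tappr_limit\<close> completes the density proof.\<close>

lemma tappr_sqint:
  assumes f: "sqint f" shows "tappr f"
proof -
  have "f \<in> borel_measurable UI" using f by (simp add: sqint_def)
  then obtain F where F: "\<And>i. simple_function UI (F i)" "\<And>x. x \<in> space UI \<Longrightarrow> (\<lambda>i. F i x) \<longlonglongrightarrow> f x"
    "\<And>i x. x \<in> space UI \<Longrightarrow> dist (F i x) 0 \<le> 2 * dist (f x) 0"
    using borel_measurable_implies_sequence_metric[of f UI 0] by blast
  have simp: "tappr (F i)" for i
  proof -
    have fin: "finite (F i ` space UI)" using F(1) by (rule simple_functionD)
    have "tappr (\<lambda>x. \<Sum>y\<in>F i ` space UI. y * indicator (F i -` {y} \<inter> space UI) x)"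
      using fin
    proof (induction rule: finite_induct)
      case empty show ?case using tappr_trig[OF trig_const[of 0]] by simp
    next
      case (insert y A)
      have "F i -` {y} \<inter> space UI \<in> sets UI" using F(1) by (rule simple_functionD)
      hence "F i -` {y} \<inter> space UI \<in> sets borel" by (auto simp: UI_def sets_restrict_space)
      thus ?case unfolding sum.insert[OF insert.hyps(1,2)] by (intro tappr_add tappr_cmult tappr_indicator insert.IH)
    qed
    moreover have "(\<Sum>y\<in>F i ` space UI. y * indicator (F i -` {y} \<inter> space UI) x) = F i x" if "x \<in> space UI" for x
    proof -
      have "(\<Sum>y\<in>F i ` space UI. y * indicator (F i -` {y} \<inter> space UI) x)
         = (\<Sum>y\<in>F i ` space UI. if y = F i x then y else 0)"
        using that by (intro sum.cong) (auto simp: indicator_def)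
      thus ?thesis using fin that by (auto simp: sum.delta)
    qed
    ultimately show ?thesis
      by (intro tappr_cong_AE[of "\<lambda>x. \<Sum>y\<in>F i ` space UI. y * indicator (F i -` {y} \<inter> space UI) x" "F i"]
            borel_measurable_simple_function[OF F(1)] AE_I2)
  qed
  show ?thesis
  proof (rule tappr_limit[OF simp, where h="\<lambda>x. 2 * f x"])
    show "integrable UI (\<lambda>x. (2 * f x)\<^sup>2)" using sqint_cmult[OF f, of 2] by (simp add: sqint_def)
    show "AE x in UI. \<forall>n. \<bar>F n x\<bar> \<le> \<bar>2 * f x\<bar>"
      using F(3) by (intro AE_I2) (auto simp: abs_mult)
  qed (use F f in \<open>auto simp: sqint_def intro!: AE_I2\<close>)
qed

section \<open>Fourier projections, Bessel and Parseval\<close>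

abbreviation FN :: "nat \<Rightarrow> int set" where "FN N \<equiv> {- int N..int N}"

definition cf :: "(real \<Rightarrow> real) \<Rightarrow> int \<Rightarrow> real" where
  "cf f k = (\<integral>x. f x * bas k x \<partial>UI)"

definition PN :: "nat \<Rightarrow> (real \<Rightarrow> real) \<Rightarrow> real \<Rightarrow> real" where
  "PN N f x = (\<Sum>k\<in>FN N. cf f k * bas k x)"

lemma sqint_PN [simp]: "sqint (PN N f)"
  unfolding PN_def[abs_def] by (intro sqint_sum sqint_cmult sqint_bas)

lemma continuous_PN [continuous_intros]: "continuous_on A (PN N f)"
  unfolding PN_def[abs_def] by (intro continuous_intros)

lemma integral_mult_trig:
  assumes "sqint f"
  shows "(\<integral>x. f x * (\<Sum>k\<in>A. c k * bas k x) \<partial>UI) = (\<Sum>k\<in>A. c k * cf f k)"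
proof -
  have "(\<integral>x. f x * (\<Sum>k\<in>A. c k * bas k x) \<partial>UI) = (\<integral>x. (\<Sum>k\<in>A. c k * (f x * bas k x)) \<partial>UI)"
    by (simp add: sum_distrib_left mult.left_commute)
  also have "\<dots> = (\<Sum>k\<in>A. \<integral>x. c k * (f x * bas k x) \<partial>UI)"
    by (intro Bochner_Integration.integral_sum integrable_mult_right sqint_mult assms sqint_bas)
  finally show ?thesis by (simp add: cf_def)
qed

lemma cf_trig:
  assumes "finite A" shows "cf (\<lambda>x. \<Sum>k\<in>A. c k * bas k x) j = (if j \<in> A then c j else 0)"
proof -
  have "cf (\<lambda>x. \<Sum>k\<in>A. c k * bas k x) j = (\<integral>x. bas j x * (\<Sum>k\<in>A. c k * bas k x) \<partial>UI)"
    by (simp add: cf_def mult.commute)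
  also have "\<dots> = (\<Sum>k\<in>A. c k * cf (bas j) k)" by (rule integral_mult_trig) simp
  also have "\<dots> = (\<Sum>k\<in>A. if k = j then c k else 0)" by (intro sum.cong) (auto simp: cf_def bas_orthonormal)
  finally show ?thesis using assms by (auto simp: sum.delta)
qed

lemma integral_trig_sq:
  assumes "finite A" shows "(\<integral>x. (\<Sum>k\<in>A. c k * bas k x)\<^sup>2 \<partial>UI) = (\<Sum>k\<in>A. (c k)\<^sup>2)"
proof -
  have "(\<integral>x. (\<Sum>k\<in>A. c k * bas k x)\<^sup>2 \<partial>UI) = (\<Sum>k\<in>A. c k * cf (\<lambda>x. \<Sum>k\<in>A. c k * bas k x) k)"
    unfolding power2_eq_square by (rule integral_mult_trig) (intro sqint_sum sqint_cmult sqint_bas)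
  also have "\<dots> = (\<Sum>k\<in>A. c k * c k)" by (intro sum.cong refl) (simp add: cf_trig[OF assms])
  finally show ?thesis by (simp add: power2_eq_square)
qed

lemma l2_PN: "(l2 (PN N f))\<^sup>2 = (\<Sum>k\<in>FN N. (cf f k)\<^sup>2)"
  unfolding l2_sq PN_def by (rule integral_trig_sq) simp

text \<open>Completing the square in each coefficient. The choice \<open>c = cf f\<close> gives
  Bessel's inequality; the nonnegative last sum shows that this choice is the best
  approximation.\<close>

lemma l2_diff_trig:
  assumes f: "sqint f" and A: "finite A"
  shows "(l2 (\<lambda>x. f x - (\<Sum>k\<in>A. c k * bas k x)))\<^sup>2 = (l2 f)\<^sup>2 - (\<Sum>k\<in>A. (cf f k)\<^sup>2) + (\<Sum>k\<in>A. (c k - cf f k)\<^sup>2)"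
proof -
  let ?T = "\<lambda>x. \<Sum>k\<in>A. c k * bas k x"
  have T: "sqint ?T" by (intro sqint_sum sqint_cmult sqint_bas)
  have i: "integrable UI (\<lambda>x. (f x)\<^sup>2)" "integrable UI (\<lambda>x. f x * ?T x)" "integrable UI (\<lambda>x. (?T x)\<^sup>2)"
    using f T sqint_mult[OF f T] by (auto simp: sqint_def)
  have "(l2 (\<lambda>x. f x - ?T x))\<^sup>2 = (\<integral>x. ((f x)\<^sup>2 - 2 * (f x * ?T x)) + (?T x)\<^sup>2 \<partial>UI)"
    unfolding l2_sq by (intro Bochner_Integration.integral_cong refl) (simp add: power2_diff)
  also have "\<dots> = (\<integral>x. (f x)\<^sup>2 - 2 * (f x * ?T x) \<partial>UI) + (\<integral>x. (?T x)\<^sup>2 \<partial>UI)"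
    using i by (intro Bochner_Integration.integral_add) auto
  also have "(\<integral>x. (f x)\<^sup>2 - 2 * (f x * ?T x) \<partial>UI) = (\<integral>x. (f x)\<^sup>2 \<partial>UI) - 2 * (\<integral>x. f x * ?T x \<partial>UI)"
    using i by (subst Bochner_Integration.integral_diff) auto
  finally have "(l2 (\<lambda>x. f x - ?T x))\<^sup>2 = (l2 f)\<^sup>2 - 2 * (\<Sum>k\<in>A. c k * cf f k) + (\<Sum>k\<in>A. (c k)\<^sup>2)"
    by (simp add: l2_sq integral_mult_trig[OF f] integral_trig_sq[OF A])
  also have "\<dots> = (l2 f)\<^sup>2 - (\<Sum>k\<in>A. (cf f k)\<^sup>2) + (\<Sum>k\<in>A. (c k - cf f k)\<^sup>2)"
    by (simp add: power2_diff sum.distrib sum_subtractf sum_distrib_left algebra_simps)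
  finally show ?thesis .
qed

lemma l2_diff_PN:
  assumes "sqint f" shows "(l2 (\<lambda>x. f x - PN N f x))\<^sup>2 = (l2 f)\<^sup>2 - (\<Sum>k\<in>FN N. (cf f k)\<^sup>2)"
  unfolding PN_def using l2_diff_trig[OF assms, of "FN N" "cf f"] by simp

lemma Bessel:
  assumes "sqint f" shows "(\<Sum>k\<in>FN N. (cf f k)\<^sup>2) \<le> (l2 f)\<^sup>2"
  using l2_diff_PN[OF assms, of N] zero_le_power2[of "l2 (\<lambda>x. f x - PN N f x)"] by linarith

lemma l2_PN_le: "sqint f \<Longrightarrow> l2 (PN N f) \<le> l2 f"
  by (rule power2_le_imp_le) (auto simp: l2_PN Bessel)

text \<open>Density suffices, because the projection of degree \<open>N\<close> is at least as close
  to \<open>f\<close> as any trigonometric polynomial of degree at most \<open>N\<close>.\<close>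

lemma PN_tendsto:
  assumes f: "sqint f" shows "(\<lambda>N. l2 (\<lambda>x. f x - PN N f x)) \<longlonglongrightarrow> 0"
proof (rule LIMSEQ_I)
  fix e :: real assume "e > 0"
  then obtain T where T: "trig T" "l2 (\<lambda>x. f x - T x) < e"
    using tappr_sqint[OF f] unfolding tappr_def by blast
  obtain M c where Tc: "T = (\<lambda>x. \<Sum>k\<in>FN M. c k * bas k x)" using T(1) unfolding trig_def by auto
  have "l2 (\<lambda>x. f x - PN N f x) < e" if "N \<ge> M" for N
  proof -
    have "(\<Sum>k\<in>FN M. (cf f k)\<^sup>2) \<le> (\<Sum>k\<in>FN N. (cf f k)\<^sup>2)"
      using that by (intro sum_mono2) auto
    hence "(l2 (\<lambda>x. f x - PN N f x))\<^sup>2 \<le> (l2 f)\<^sup>2 - (\<Sum>k\<in>FN M. (cf f k)\<^sup>2)"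
      by (simp add: l2_diff_PN[OF f])
    also have "\<dots> \<le> (l2 f)\<^sup>2 - (\<Sum>k\<in>FN M. (cf f k)\<^sup>2) + (\<Sum>k\<in>FN M. (c k - cf f k)\<^sup>2)"
      by (simp add: sum_nonneg)
    also have "\<dots> = (l2 (\<lambda>x. f x - T x))\<^sup>2" unfolding Tc by (rule l2_diff_trig[OF f, symmetric]) simp
    finally have "l2 (\<lambda>x. f x - PN N f x) \<le> l2 (\<lambda>x. f x - T x)" by (rule power2_le_imp_le) simp
    thus ?thesis using T(2) by simp
  qed
  thus "\<exists>no. \<forall>n\<ge>no. norm (l2 (\<lambda>x. f x - PN n f x) - 0) < e" by (intro exI[of _ M]) auto
qed

lemma Parseval:
  assumes f: "sqint f" shows "(\<lambda>N. \<Sum>k\<in>FN N. (cf f k)\<^sup>2) \<longlonglongrightarrow> (l2 f)\<^sup>2"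
proof -
  have "(\<lambda>N. (l2 f)\<^sup>2 - (l2 (\<lambda>x. f x - PN N f x))\<^sup>2) \<longlonglongrightarrow> (l2 f)\<^sup>2 - 0\<^sup>2"
    by (intro tendsto_intros PN_tendsto f)
  thus ?thesis by (simp add: l2_diff_PN[OF f])
qed

text \<open>The excess of |f| over \<open>C\<close> is dominated by |f - g n| for every n, so its
  norm is zero.\<close>

lemma AE_bound_of_l2_limit:
  assumes f: "sqint f" and g: "\<And>n. sqint (g n)" and lim: "(\<lambda>n. l2 (\<lambda>x. f x - g n x)) \<longlonglongrightarrow> 0"
    and b: "\<And>n x. \<bar>g n x\<bar> \<le> C"
  shows "AE x in UI. \<bar>f x\<bar> \<le> C"
proof -
  define h where "h x = max 0 (\<bar>f x\<bar> - C)" for x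
  have hm: "h \<in> borel_measurable UI" using f unfolding h_def sqint_def by auto
  have hb: "\<bar>h x\<bar> \<le> 1 * \<bar>f x - g n x\<bar>" for n x
  proof -
    have "\<bar>f x\<bar> - C \<le> \<bar>f x - g n x\<bar>" using b[of n x] by linarith
    thus ?thesis unfolding h_def by simp
  qed
  have le: "l2 h \<le> 1 * l2 (\<lambda>x. f x - g n x)" and hs: "sqint h" for n
    using l2_sq_le_AE[OF sqint_diff[OF f g[of n]] hm, of 1] hb[of _ n] by auto
  have "l2 h \<le> 0"
    by (rule LIMSEQ_le_const[OF lim]) (use le in auto)
  hence "l2 h = 0" using l2_nonneg[of h] by linarith
  hence "(\<integral>x. (h x)\<^sup>2 \<partial>UI) = 0" using l2_sq[of h] by simp
  hence "AE x in UI. (h x)\<^sup>2 = 0"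
    using hs by (subst (asm) integral_nonneg_eq_0_iff_AE) (auto simp: sqint_def)
  thus ?thesis by eventually_elim (simp add: h_def max_def split: if_splits)
qed

lemma sum_inverse_squares_int: "(\<Sum>k\<in>FN N - {0}. 1 / (real_of_int k)\<^sup>2) \<le> 4"
proof -
  \<comment> \<open>Telescoping with 1/(n+1)^2 \<le> 1/n - 1/(n+1); the subtracted term makes the
    induction work.\<close>
  have pos: "(\<Sum>k\<in>{1..n}. 1 / (real k)\<^sup>2) \<le> 2 - 1 / real n" if "n \<ge> 1" for n :: nat
    using that
  proof (induction n rule: nat_induct_at_least)
    case (Suc n)
    have n: "real n \<ge> 1" using Suc by simp
    have "real n * (real n + 1) \<le> (real n + 1)\<^sup>2" by (simp add: power2_eq_square algebra_simps)
    hence "1 / (real n + 1)\<^sup>2 \<le> 1 / (real n * (real n + 1))"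
      using n by (intro divide_left_mono) auto
    also have "\<dots> = 1 / real n - 1 / (real n + 1)" using n by (simp add: field_simps)
    finally have "1 / (real (Suc n))\<^sup>2 \<le> 1 / real n - 1 / real (Suc n)" by (simp add: add.commute)
    moreover have "(\<Sum>k\<in>{1..Suc n}. 1 / (real k)\<^sup>2) = (\<Sum>k\<in>{1..n}. 1 / (real k)\<^sup>2) + 1 / (real (Suc n))\<^sup>2" by simp
    ultimately show ?case using Suc by linarith
  qed simp
  have pos2: "(\<Sum>k\<in>{1..N}. 1 / (real k)\<^sup>2) \<le> 2"
  proof (cases "N \<ge> 1")
    case True
    have "0 \<le> 1 / real N" by simp
    thus ?thesis using pos[OF True] by linarith
  qed simp
  have "FN N - {0} = int ` {1..N} \<union> (\<lambda>k. - int k) ` {1..N}" (is "_ = ?A \<union> ?B")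
  proof (intro equalityI subsetI)
    fix k assume k: "k \<in> FN N - {0}"
    show "k \<in> ?A \<union> ?B"
    proof (cases "k > 0")
      case True
      hence "k = int (nat k)" "nat k \<in> {1..N}" using k by auto
      thus ?thesis by blast
    next
      case False
      hence "k = - int (nat (- k))" "nat (- k) \<in> {1..N}" using k by auto
      thus ?thesis by blast
    qed
  qed auto
  hence "(\<Sum>k\<in>FN N - {0}. 1 / (real_of_int k)\<^sup>2) = (\<Sum>k\<in>?A. 1 / (real_of_int k)\<^sup>2) + (\<Sum>k\<in>?B. 1 / (real_of_int k)\<^sup>2)"
    by (simp only:) (rule sum.union_disjoint, auto)
  also have "(\<Sum>k\<in>?A. 1 / (real_of_int k)\<^sup>2) = (\<Sum>k\<in>{1..N}. 1 / (real k)\<^sup>2)"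
    by (subst sum.reindex) (auto simp: inj_on_def)
  also have "(\<Sum>k\<in>?B. 1 / (real_of_int k)\<^sup>2) = (\<Sum>k\<in>{1..N}. 1 / (real k)\<^sup>2)"
    by (subst sum.reindex) (auto simp: inj_on_def)
  finally show ?thesis using pos2 by linarith
qed

lemma abs_sq_le: "\<bar>a\<bar> \<le> c \<Longrightarrow> \<bar>a\<^sup>2\<bar> \<le> c * \<bar>a\<bar>" for a c :: real
  using mult_right_mono[of "\<bar>a\<bar>" c "\<bar>a\<bar>"] by (simp add: power2_eq_square)

section \<open>Weak derivatives in Fourier coefficients and the one-dimensional Sobolev
  bound\<close>

lemma PN_deriv: "(PN N w has_real_derivative (\<Sum>k\<in>FN N. 2 * pi * real_of_int k * cf w k * bas (- k) x)) (at x)"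
  unfolding PN_def[abs_def]
  by (rule DERIV_cong, rule DERIV_sum, rule DERIV_cmult, rule bas_deriv) (simp add: mult_ac)

lemma bas_periodic: "bas k (x + 1) = bas k x"
proof -
  have e: "2 * pi * real_of_int k * (x + 1) = 2 * pi * real_of_int k * x + 2 * pi * real_of_int k" by (simp add: algebra_simps)
  show ?thesis unfolding bas_def ebasis_def e cos_add sin_add cos_2pi_int sin_2pi_int by simp
qed

text \<open>The definition of the weak derivative is tested with \<open>bas (- k)\<close>, which is
  smooth and 1-periodic.\<close>

lemma weak_deriv_cf:
  assumes "weak_deriv w g" shows "cf g (- k) = 2 * pi * real_of_int k * cf w k"
proof -
  have *: "(LINT x:{0..1}|lborel. w x * \<phi>' x) = - (LINT x:{0..1}|lborel. g x * \<phi> x)"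
    if "\<forall>x. (\<phi> has_real_derivative \<phi>' x) (at x)" "continuous_on UNIV \<phi>'" "periodic1 \<phi>" for \<phi> \<phi>'
    using assms that unfolding weak_deriv_def by auto
  have "(LINT x:{0..1}|lborel. w x * (2 * pi * real_of_int (- k) * bas k x)) = - (LINT x:{0..1}|lborel. g x * bas (- k) x)"
  proof -
    have "\<forall>x. (bas (- k) has_real_derivative (2 * pi * real_of_int (- k) * bas k x)) (at x)"
      using bas_deriv[of "- k"] by simp
    moreover have "continuous_on UNIV (\<lambda>x. 2 * pi * real_of_int (- k) * bas k x)" by (intro continuous_intros)
    moreover have "periodic1 (bas (- k))" by (simp add: periodic1_def bas_periodic)
    ultimately show ?thesis by (intro *) auto
  qed
  hence "(\<integral>x. (2 * pi * real_of_int (- k)) * (w x * bas k x) \<partial>UI) = - cf g (- k)"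
    unfolding set_lint_UI cf_def by (simp add: mult_ac)
  thus ?thesis by (simp add: cf_def)
qed

lemma in_L2_sqint: "in_L2 f \<Longrightarrow> sqint f"
  by (auto simp: in_L2_def sqint_def set_integrable_UI)

lemma weak_deriv_sqint: "weak_deriv w g \<Longrightarrow> sqint g"
  by (auto simp: weak_deriv_def intro: in_L2_sqint)

lemma in_H_sqint: "in_H w \<Longrightarrow> sqint w" and in_H_cf: "in_H w \<Longrightarrow> cf w 0 = 0"
  by (auto simp: in_H_def cf_def bas_def set_lint_UI intro: in_L2_sqint)

lemma PN_weak_deriv:
  assumes "weak_deriv w g" shows "(PN N w has_real_derivative PN N g x) (at x)"
proof -
  have "(\<Sum>k\<in>FN N. 2 * pi * real_of_int k * cf w k * bas (- k) x) = (\<Sum>k\<in>FN N. cf g (- k) * bas (- k) x)"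
    by (simp add: weak_deriv_cf[OF assms])
  also have "\<dots> = PN N g x" unfolding PN_def
    by (rule sum.reindex_bij_witness[of _ uminus uminus]) auto
  finally show ?thesis using PN_deriv[of N w x] by simp
qed

text \<open>Sobolev embedding in dimension one: mean zero removes mode 0, the other coefficients are
  those of \<open>g\<close> divided by \<open>2 * pi * k\<close>, and Cauchy-Schwarz pairs them with
  the sum of 1/k^2, which is at most 4. The resulting constant sqrt 2 / pi is below 1.\<close>

lemma PN_sup_bound:
  assumes w: "in_H w" and g: "weak_deriv w g" shows "\<bar>PN N w x\<bar> \<le> l2 g"
proof -
  have sg: "sqint g" using g by (rule weak_deriv_sqint)
  have "\<bar>PN N w x\<bar> \<le> (\<Sum>k\<in>FN N. \<bar>cf w k * bas k x\<bar>)" unfolding PN_def by (rule sum_abs)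
  also have "\<dots> = (\<Sum>k\<in>FN N - {0}. \<bar>cf w k * bas k x\<bar>)"
    by (rule sum.mono_neutral_right) (auto simp: in_H_cf[OF w])
  also have "\<dots> \<le> (\<Sum>k\<in>FN N - {0}. (sqrt 2 / (2 * pi)) * ((1 / \<bar>real_of_int k\<bar>) * \<bar>cf g (- k)\<bar>))"
  proof (rule sum_mono)
    fix k assume k: "k \<in> FN N - {0}"
    have "\<bar>cf w k * bas k x\<bar> \<le> \<bar>cf w k\<bar> * sqrt 2" using bas_bound[of k x] by (simp add: abs_mult mult_left_mono)
    also have "\<bar>cf w k\<bar> = \<bar>cf g (- k)\<bar> / (2 * pi * \<bar>real_of_int k\<bar>)"
      using k by (simp add: weak_deriv_cf[OF g] abs_mult)
    finally show "\<bar>cf w k * bas k x\<bar> \<le> (sqrt 2 / (2 * pi)) * ((1 / \<bar>real_of_int k\<bar>) * \<bar>cf g (- k)\<bar>)"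
      by (simp add: field_simps)
  qed
  also have "\<dots> = (sqrt 2 / (2 * pi)) * (\<Sum>k\<in>FN N - {0}. (1 / \<bar>real_of_int k\<bar>) * \<bar>cf g (- k)\<bar>)"
    by (simp add: sum_distrib_left)
  finally have 1: "\<bar>PN N w x\<bar> \<le> (sqrt 2 / (2 * pi)) * (\<Sum>k\<in>FN N - {0}. (1 / \<bar>real_of_int k\<bar>) * \<bar>cf g (- k)\<bar>)" .
  have 2: "(\<Sum>k\<in>FN N - {0}. (1 / \<bar>real_of_int k\<bar>) * \<bar>cf g (- k)\<bar>) \<le> 2 * l2 g"
  proof (rule power2_le_imp_le)
    have "(\<Sum>k\<in>FN N - {0}. (1 / \<bar>real_of_int k\<bar>) * \<bar>cf g (- k)\<bar>)\<^sup>2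
      \<le> (\<Sum>k\<in>FN N - {0}. (1 / \<bar>real_of_int k\<bar>)\<^sup>2) * (\<Sum>k\<in>FN N - {0}. \<bar>cf g (- k)\<bar>\<^sup>2)"
      by (rule Cauchy_Schwarz_ineq_sum)
    also have "\<dots> \<le> 4 * (l2 g)\<^sup>2"
    proof (rule mult_mono)
      show "(\<Sum>k\<in>FN N - {0}. (1 / \<bar>real_of_int k\<bar>)\<^sup>2) \<le> 4"
        using sum_inverse_squares_int[of N] by (simp add: power_divide)
      have "(\<Sum>k\<in>FN N - {0}. \<bar>cf g (- k)\<bar>\<^sup>2) \<le> (\<Sum>k\<in>FN N. \<bar>cf g (- k)\<bar>\<^sup>2)"
        by (rule sum_mono2) auto
      also have "\<dots> = (\<Sum>k\<in>FN N. (cf g k)\<^sup>2)"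
        by (rule sum.reindex_bij_witness[of _ uminus uminus]) auto
      also have "\<dots> \<le> (l2 g)\<^sup>2" by (rule Bessel[OF sg])
      finally show "(\<Sum>k\<in>FN N - {0}. \<bar>cf g (- k)\<bar>\<^sup>2) \<le> (l2 g)\<^sup>2" .
    qed (auto intro: sum_nonneg)
    finally show "(\<Sum>k\<in>FN N - {0}. (1 / \<bar>real_of_int k\<bar>) * \<bar>cf g (- k)\<bar>)\<^sup>2 \<le> (2 * l2 g)\<^sup>2"
      by (simp add: power_mult_distrib)
  qed simp
  have "(sqrt 2 / (2 * pi)) * (\<Sum>k\<in>FN N - {0}. (1 / \<bar>real_of_int k\<bar>) * \<bar>cf g (- k)\<bar>) \<le> (sqrt 2 / (2 * pi)) * (2 * l2 g)"
    using 2 by (intro mult_left_mono) auto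
  also have "(sqrt 2 / (2 * pi)) * (2 * l2 g) \<le> 1 * l2 g"
  proof -
    have "sqrt 2 \<le> 2" by (simp add: real_le_lsqrt)
    hence "sqrt 2 / pi \<le> 1" using pi_gt3 by simp
    hence "sqrt 2 / pi * l2 g \<le> 1 * l2 g" by (intro mult_right_mono) auto
    thus ?thesis by simp
  qed
  finally show ?thesis using 1 by simp
qed

lemma H1_AE_bound:
  assumes w: "in_H w" and g: "weak_deriv w g" shows "AE x in UI. \<bar>w x\<bar> \<le> l2 g"
  by (rule AE_bound_of_l2_limit[OF in_H_sqint[OF w] sqint_PN PN_tendsto[OF in_H_sqint[OF w]]])
     (rule PN_sup_bound[OF w g])

text \<open>The defect of truncation with respect to squaring. The truncated equation contains the
  projection of u^2, while the cancellations in the energy balance and in the Cole-Hopf computation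
  hold for the square of the projection.\<close>

definition err :: "nat \<Rightarrow> (real \<Rightarrow> real) \<Rightarrow> real \<Rightarrow> real" where
  "err N w x = PN N (\<lambda>x. (w x)\<^sup>2) x - (PN N w x)\<^sup>2"

lemma sqint_square:
  assumes w: "in_H w" and g: "weak_deriv w g"
  shows "sqint (\<lambda>x. (w x)\<^sup>2)" "l2 (\<lambda>x. (w x)\<^sup>2) \<le> l2 g * l2 w"
proof -
  have "AE x in UI. \<bar>(w x)\<^sup>2\<bar> \<le> l2 g * \<bar>w x\<bar>"
    using H1_AE_bound[OF w g] by eventually_elim (rule abs_sq_le)
  from l2_sq_le_AE[OF in_H_sqint[OF w] _ this] in_H_sqint[OF w]
  show "sqint (\<lambda>x. (w x)\<^sup>2)" "l2 (\<lambda>x. (w x)\<^sup>2) \<le> l2 g * l2 w" by (auto simp: sqint_def)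
qed

lemma sqint_PN_sq [simp]: "sqint (\<lambda>x. (PN N w x)\<^sup>2)"
  by (intro sqint_continuous continuous_intros)

lemma sqint_err: "sqint (err N w)"
  unfolding err_def[abs_def] by (intro sqint_diff sqint_PN sqint_PN_sq)

text \<open>The uniform bound by \<open>l2 g\<close> turns the difference of the squares into a
  multiple of \<open>w - PN N w\<close>; this is where H^1 regularity pays for the
  nonlinearity.\<close>

lemma err_tendsto:
  assumes w: "in_H w" and g: "weak_deriv w g" shows "(\<lambda>N. l2 (err N w)) \<longlonglongrightarrow> 0"
proof -
  have sw: "sqint w" by (rule in_H_sqint[OF w])
  have s2: "sqint (\<lambda>x. (w x)\<^sup>2)" by (rule sqint_square[OF w g])
  have d: "l2 (\<lambda>x. (w x)\<^sup>2 - (PN N w x)\<^sup>2) \<le> (2 * l2 g) * l2 (\<lambda>x. w x - PN N w x)" for N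
  proof (rule l2_sq_le_AE[OF sqint_diff[OF sw sqint_PN]])
    show "AE x in UI. \<bar>(w x)\<^sup>2 - (PN N w x)\<^sup>2\<bar> \<le> 2 * l2 g * \<bar>w x - PN N w x\<bar>"
      using H1_AE_bound[OF w g]
    proof eventually_elim
      case (elim x)
      have "(w x)\<^sup>2 - (PN N w x)\<^sup>2 = (w x + PN N w x) * (w x - PN N w x)" by (simp add: power2_eq_square algebra_simps)
      hence "\<bar>(w x)\<^sup>2 - (PN N w x)\<^sup>2\<bar> = \<bar>w x + PN N w x\<bar> * \<bar>w x - PN N w x\<bar>" by (simp add: abs_mult)
      also have "\<dots> \<le> (2 * l2 g) * \<bar>w x - PN N w x\<bar>"
        using elim PN_sup_bound[OF w g, of N x] by (intro mult_right_mono) linarith+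
      finally show ?case .
    qed
    show "(\<lambda>x. (w x)\<^sup>2 - (PN N w x)\<^sup>2) \<in> borel_measurable UI"
      using sqint_diff[OF s2 sqint_PN_sq] by (rule sqint_measurable)
  qed simp
  have le: "l2 (err N w) \<le> l2 (\<lambda>x. (w x)\<^sup>2 - PN N (\<lambda>x. (w x)\<^sup>2) x) + (2 * l2 g) * l2 (\<lambda>x. w x - PN N w x)" for N
    using l2_triangle3[OF sqint_PN s2 sqint_PN_sq, of N "\<lambda>x. (w x)\<^sup>2" N w] d[of N]
      l2_commute[of "\<lambda>x. (w x)\<^sup>2" "PN N (\<lambda>x. (w x)\<^sup>2)"]
    unfolding err_def[abs_def] by linarith
  have "(\<lambda>N. l2 (\<lambda>x. (w x)\<^sup>2 - PN N (\<lambda>x. (w x)\<^sup>2) x) + (2 * l2 g) * l2 (\<lambda>x. w x - PN N w x)) \<longlonglongrightarrow> 0 + (2 * l2 g) * 0"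
    by (intro tendsto_intros PN_tendsto s2 sw)
  hence "(\<lambda>N. l2 (\<lambda>x. (w x)\<^sup>2 - PN N (\<lambda>x. (w x)\<^sup>2) x) + (2 * l2 g) * l2 (\<lambda>x. w x - PN N w x)) \<longlonglongrightarrow> 0" by simp
  thus ?thesis by (rule Lim_null_comparison[rotated]) (use le in auto)
qed

text \<open>A majorant independent of \<open>N\<close>, meant for dominated convergence in
  time.\<close>

lemma err_bound:
  assumes w: "in_H w" and g: "weak_deriv w g" shows "l2 (err N w) \<le> 2 * l2 g * l2 w"
proof -
  have sw: "sqint w" by (rule in_H_sqint[OF w])
  note s2 = sqint_square[OF w g]
  have "l2 (err N w) \<le> l2 (PN N (\<lambda>x. (w x)\<^sup>2)) + l2 (\<lambda>x. (PN N w x)\<^sup>2)"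
    unfolding err_def[abs_def] by (intro l2_triangle_diff sqint_PN sqint_PN_sq)
  also have "l2 (PN N (\<lambda>x. (w x)\<^sup>2)) \<le> l2 g * l2 w" using l2_PN_le[OF s2(1), of N] s2(2) by linarith
  also have "l2 (\<lambda>x. (PN N w x)\<^sup>2) \<le> l2 g * l2 (PN N w)"
  proof (rule l2_sq_le_AE[OF sqint_PN])
    show "AE x in UI. \<bar>(PN N w x)\<^sup>2\<bar> \<le> l2 g * \<bar>PN N w x\<bar>"
      by (intro AE_I2 abs_sq_le PN_sup_bound[OF w g])
  qed (use sqint_measurable[OF sqint_PN_sq] in auto)
  also have "l2 g * l2 (PN N w) \<le> l2 g * l2 w" by (intro mult_left_mono l2_PN_le sw) simp
  finally show ?thesis by simp
qed

section \<open>Integrals over time intervals and the chain rule for primitives\<close>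

definition TI :: "real \<Rightarrow> real \<Rightarrow> real measure" where "TI a b = restrict_space lborel {a..b}"

lemma space_TI [simp]: "space (TI a b) = {a..b}"
  by (simp add: TI_def space_restrict_space)

lemma sets_TI: "sets (TI a b) = sets (restrict_space borel {a..b})"
  by (simp add: TI_def sets_restrict_space)

lemma integrable_TI: "integrable (TI a b) f \<longleftrightarrow> set_integrable lborel {a..b} f" for f :: "real \<Rightarrow> real"
  unfolding TI_def set_integrable_def by (subst integrable_restrict_space) auto

lemma integral_TI: "(\<integral>s. f s \<partial>TI a b) = (LINT s:{a..b}|lborel. f s)" for f :: "real \<Rightarrow> real"
  unfolding TI_def set_lebesgue_integral_def by (subst integral_restrict_space) auto

lemma nn_integral_TI: "(\<integral>\<^sup>+s. f s \<partial>TI a b) = (\<integral>\<^sup>+s\<in>{a..b}. f s \<partial>lborel)"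
  unfolding TI_def by (subst nn_integral_restrict_space) auto

lemma AE_TI: "(AE s in TI a b. P s) \<longleftrightarrow> (AE s in lborel. s \<in> {a..b} \<longrightarrow> P s)"
  unfolding TI_def by (subst AE_restrict_space_iff) auto

lemma emeasure_TI: "a \<le> b \<Longrightarrow> emeasure (TI a b) {a..b} = ennreal (b - a)"
  unfolding TI_def by (subst emeasure_restrict_space) auto

lemma finite_measure_TI: "finite_measure (TI a b)"
proof (rule finite_measureI)
  show "emeasure (TI a b) (space (TI a b)) \<noteq> \<infinity>"
    by (cases "a \<le> b") (auto simp: emeasure_TI TI_def emeasure_restrict_space)
qed

lemma integrable_TI_const [simp]: "integrable (TI a b) (\<lambda>s. c :: real)"
  using finite_measure.integrable_const[OF finite_measure_TI] .

lemma measurable_TI: "f \<in> borel_measurable borel \<Longrightarrow> f \<in> borel_measurable (TI a b)"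
  unfolding TI_def by (auto intro: measurable_restrict_space1)

lemma continuous_on_measurable_TI: "continuous_on {a..b} f \<Longrightarrow> f \<in> borel_measurable (TI a b)"
  using borel_measurable_continuous_on_restrict[of "{a..b}" f]
  by (subst measurable_cong_sets[OF sets_TI refl])

lemma integrable_TI_subset:
  fixes f :: "real \<Rightarrow> real"
  assumes "integrable (TI a b) f" "a \<le> c" "d \<le> b" shows "integrable (TI c d) f"
  using assms unfolding integrable_TI by (elim set_integrable_subset) auto

lemma integral_TI_HK:
  fixes f :: "real \<Rightarrow> real"
  assumes "integrable (TI a b) f" shows "f integrable_on {a..b}" "(\<integral>s. f s \<partial>TI a b) = integral {a..b} f"
  using set_borel_integral_eq_integral[of "{a..b}" f] assms by (auto simp: integrable_TI integral_TI)

lemma integral_TI_split: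
  fixes f :: "real \<Rightarrow> real"
  assumes "integrable (TI a b) f" "a \<le> c" "c \<le> b"
  shows "(\<integral>s. f s \<partial>TI a c) + (\<integral>s. f s \<partial>TI c b) = (\<integral>s. f s \<partial>TI a b)"
proof -
  have "integrable (TI a c) f" "integrable (TI c b) f" using assms by (auto intro: integrable_TI_subset)
  thus ?thesis using assms Henstock_Kurzweil_Integration.integral_combine[where a=a and c=c and b=b and f=f] by (simp add: integral_TI_HK)
qed

lemma integral_TI_refl: "(\<integral>s. f s \<partial>TI a a) = (0::real)" for f :: "real \<Rightarrow> real"
proof -
  have "AE s in TI a a. f s = 0"
    unfolding AE_TI using AE_lborel_singleton[of a] by eventually_elim auto
  thus ?thesis by (rule integral_eq_zero_AE)
qed

text \<open>Absolute continuity in integral form: \<open>f'\<close> is merely integrable, which is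
  all the regularity in time that the noise-free Fourier coefficients have.\<close>

definition prim :: "real \<Rightarrow> real \<Rightarrow> (real \<Rightarrow> real) \<Rightarrow> (real \<Rightarrow> real) \<Rightarrow> bool" where
  "prim a b f f' \<longleftrightarrow> integrable (TI a b) f' \<and> (\<forall>t\<in>{a..b}. f t = f a + (\<integral>s. f' s \<partial>TI a t))"

lemma primI:
  assumes "integrable (TI a b) f'" "\<And>t. a \<le> t \<Longrightarrow> t \<le> b \<Longrightarrow> f t = f a + (\<integral>s. f' s \<partial>TI a t)"
  shows "prim a b f f'"
  unfolding prim_def by (intro conjI ballI assms) (simp_all only: atLeastAtMost_iff)

lemma primD:
  assumes "prim a b f f'"
  shows "integrable (TI a b) f'" "a \<le> t \<Longrightarrow> t \<le> b \<Longrightarrow> f t = f a + (\<integral>s. f' s \<partial>TI a t)"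
    "a \<le> t \<Longrightarrow> t \<le> b \<Longrightarrow> integrable (TI a t) f'"
proof -
  show 1: "integrable (TI a b) f'" using assms unfolding prim_def by (rule conjunct1)
  show "f t = f a + (\<integral>s. f' s \<partial>TI a t)" if "a \<le> t" "t \<le> b"
    using assms that unfolding prim_def by (meson atLeastAtMost_iff)
  show "integrable (TI a t) f'" if "a \<le> t" "t \<le> b"
    by (rule integrable_TI_subset[OF 1]) (use that in auto)
qed

lemma prim_diff:
  assumes p: "prim a b f f'" and "a \<le> s" "s \<le> t" "t \<le> b"
  shows "f t - f s = (\<integral>r. f' r \<partial>TI s t)"
proof -
  have "integrable (TI a t) f'" using primD(3)[OF p, of t] assms by simp
  from integral_TI_split[OF this, of s] show ?thesis
    using primD(2)[OF p, of s] primD(2)[OF p, of t] assms by linarith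
qed

lemma prim_continuous: assumes p: "prim a b f f'" shows "continuous_on {a..b} f"
proof -
  have i: "integrable (TI a b) f'" using p by (simp add: prim_def)
  have "continuous_on {a..b} (\<lambda>t. f a + integral {a..t} f')"
    by (intro continuous_intros indefinite_integral_continuous_1 integral_TI_HK i)
  moreover have "f a + integral {a..t} f' = f t" if "t \<in> {a..b}" for t
    using primD(2)[OF p, of t] that integral_TI_HK(2)[OF integrable_TI_subset[OF i, of a t]] by simp
  ultimately show ?thesis by (subst (asm) continuous_on_cong[OF refl]) auto
qed

lemma prim_const: "prim a b (\<lambda>t. c) (\<lambda>s. 0)"
  by (simp add: prim_def)

lemma prim_add:
  assumes f: "prim a b f f'" and g: "prim a b g g'" shows "prim a b (\<lambda>t. f t + g t) (\<lambda>s. f' s + g' s)"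
proof (rule primI)
  fix t assume t: "a \<le> t" "t \<le> b"
  show "f t + g t = f a + g a + (\<integral>s. f' s + g' s \<partial>TI a t)"
    using primD(2)[OF f t] primD(2)[OF g t] primD(3)[OF f t] primD(3)[OF g t] by simp
qed (use primD(1)[OF f] primD(1)[OF g] in simp)

lemma prim_cmult:
  assumes f: "prim a b f f'" shows "prim a b (\<lambda>t. c * f t) (\<lambda>s. c * f' s)"
proof (rule primI)
  fix t assume t: "a \<le> t" "t \<le> b"
  show "c * f t = c * f a + (\<integral>s. c * f' s \<partial>TI a t)"
    by (subst primD(2)[OF f t]) (simp add: distrib_left)
qed (use primD(1)[OF f] in simp)

lemma prim_sum:
  assumes "\<And>i. i \<in> A \<Longrightarrow> prim a b (f i) (f' i)"
  shows "prim a b (\<lambda>t. \<Sum>i\<in>A. f i t) (\<lambda>s. \<Sum>i\<in>A. f' i s)"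
  using assms by (induction A rule: infinite_finite_induct) (auto intro: prim_const prim_add)

lemma integrable_mult_continuous:
  fixes f g :: "real \<Rightarrow> real"
  assumes "integrable (TI a b) f" "continuous_on {a..b} g" shows "integrable (TI a b) (\<lambda>s. g s * f s)"
proof -
  have "bounded (g ` {a..b})" using assms(2) by (intro compact_imp_bounded compact_continuous_image) auto
  then obtain B where "\<forall>x\<in>g ` {a..b}. norm x \<le> B" unfolding bounded_iff by blast
  hence B: "\<bar>g s\<bar> \<le> B" if "s \<in> {a..b}" for s using that by auto
  show ?thesis
  proof (rule Bochner_Integration.integrable_bound[where f="\<lambda>s. B * f s"])
    show "AE s in TI a b. norm (g s * f s) \<le> norm (B * f s)"
    proof (rule AE_I2)
      fix s assume "s \<in> space (TI a b)"
      hence "\<bar>g s\<bar> \<le> \<bar>B\<bar>" using B[of s] by simp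
      thus "norm (g s * f s) \<le> norm (B * f s)" by (simp add: abs_mult mult_right_mono)
    qed
    show "(\<lambda>s. g s * f s) \<in> borel_measurable (TI a b)"
      using continuous_on_measurable_TI[OF assms(2)] borel_measurable_integrable[OF assms(1)] by (rule borel_measurable_times)
  qed (use assms in auto)
qed

text \<open>Bisection takes the place of almost everywhere differentiability: the defect of the
  formula on an interval is at most \<open>e\<close> times the integral of |f'|. This bound adds up
  over adjacent intervals and holds on short ones by the mean value theorem; then \<open>e\<close>
  tends to 0.\<close>

lemma prim_chain:
  assumes p: "prim a b f f'" and dF: "\<And>x. (F has_real_derivative F' x) (at x)" and cF: "continuous_on UNIV F'"
  shows "prim a b (\<lambda>t. F (f t)) (\<lambda>s. F' (f s) * f' s)"
proof -
  note cf = prim_continuous[OF p]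
  have i: "integrable (TI a b) f'" using p by (simp add: prim_def)
  have cF': "continuous_on {a..b} (\<lambda>s. F' (f s))"
    by (rule continuous_on_compose2[OF cF cf]) auto
  have ig: "integrable (TI a b) (\<lambda>s. F' (f s) * f' s)" by (rule integrable_mult_continuous[OF i cF'])
  have main: "\<bar>F (f t) - F (f s) - (\<integral>r. F' (f r) * f' r \<partial>TI s t)\<bar> \<le> e * (\<integral>r. \<bar>f' r\<bar> \<partial>TI s t)"
    if st: "a \<le> s" "s \<le> t" "t \<le> b" and e: "e > 0" for e s t
  proof -
    define P where "P s t \<longleftrightarrow> (a \<le> s \<longrightarrow> s \<le> t \<longrightarrow> t \<le> b \<longrightarrow> 
      \<bar>F (f t) - F (f s) - (\<integral>r. F' (f r) * f' r \<partial>TI s t)\<bar> \<le> e * (\<integral>r. \<bar>f' r\<bar> \<partial>TI s t))" for s t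
    have "P s t" using \<open>s \<le> t\<close>
    proof (induction rule: Bolzano)
      case (trans x y z)
      show ?case unfolding P_def
      proof (intro impI)
        assume xz: "a \<le> x" "x \<le> z" "z \<le> b"
        have 1: "(\<integral>r. F' (f r) * f' r \<partial>TI x y) + (\<integral>r. F' (f r) * f' r \<partial>TI y z) = (\<integral>r. F' (f r) * f' r \<partial>TI x z)"
          using xz trans by (intro integral_TI_split integrable_TI_subset[OF ig]) auto
        have 2: "(\<integral>r. \<bar>f' r\<bar> \<partial>TI x y) + (\<integral>r. \<bar>f' r\<bar> \<partial>TI y z) = (\<integral>r. \<bar>f' r\<bar> \<partial>TI x z)"
          using xz trans by (intro integral_TI_split integrable_TI_subset[OF integrable_abs[OF i]]) auto
        have 3: "e * (\<integral>r. \<bar>f' r\<bar> \<partial>TI x y) + e * (\<integral>r. \<bar>f' r\<bar> \<partial>TI y z) = e * (\<integral>r. \<bar>f' r\<bar> \<partial>TI x z)"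
          unfolding 2[symmetric] by (simp add: distrib_left)
        from trans xz have "\<bar>F (f y) - F (f x) - (\<integral>r. F' (f r) * f' r \<partial>TI x y)\<bar> \<le> e * (\<integral>r. \<bar>f' r\<bar> \<partial>TI x y)"
          "\<bar>F (f z) - F (f y) - (\<integral>r. F' (f r) * f' r \<partial>TI y z)\<bar> \<le> e * (\<integral>r. \<bar>f' r\<bar> \<partial>TI y z)"
          by (auto simp: P_def)
        thus "\<bar>F (f z) - F (f x) - (\<integral>r. F' (f r) * f' r \<partial>TI x z)\<bar> \<le> e * (\<integral>r. \<bar>f' r\<bar> \<partial>TI x z)"
          using 1 3 by linarith
      qed
    next
      case (local x)
      have x: "x \<in> {a..b}" using local st by auto
      have "isCont F' (f x)" using cF by (simp add: continuous_on_eq_continuous_at)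
      then obtain d1 where d1: "d1 > 0" "\<And>z. \<bar>z - f x\<bar> < d1 \<Longrightarrow> \<bar>F' z - F' (f x)\<bar> < e/2"
        using e unfolding continuous_at_eps_delta by (metis dist_real_def half_gt_zero)
      obtain d2 where d2: "d2 > 0" "\<And>y. y \<in> {a..b} \<Longrightarrow> \<bar>y - x\<bar> < d2 \<Longrightarrow> \<bar>f y - f x\<bar> < d1"
        using cf x d1(1) unfolding continuous_on_iff by (metis dist_real_def)
      show ?case
      proof (intro exI[of _ d2] conjI allI impI d2(1))
        fix y z assume yz: "y \<le> x \<and> x \<le> z \<and> z - y < d2"
        show "P y z" unfolding P_def
        proof (intro impI)
          assume ab: "a \<le> y" "y \<le> z" "z \<le> b"
          have near: "\<bar>f r - f x\<bar> < d1" if "r \<in> {y..z}" for r using d2(2)[of r] that ab yz by auto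
          \<comment> \<open>The mean value point lies between \<open>f y\<close> and
            \<open>f z\<close>, hence within \<open>d1\<close> of \<open>f x\<close>, where
            \<open>F'\<close> varies by less than e/2.\<close>
          have "\<exists>w. \<bar>w - f x\<bar> < d1 \<and> F (f z) - F (f y) = F' w * (f z - f y)"
          proof -
            consider "f y < f z" | "f y = f z" | "f z < f y" by linarith
            thus ?thesis
            proof cases
              case 1
              obtain w where "f y < w" "w < f z" "F (f z) - F (f y) = (f z - f y) * F' w"
                using MVT2[OF 1, of F F'] dF by auto
              thus ?thesis using near[of y] near[of z] ab by (intro exI[of _ w]) auto
            next
              case 2 thus ?thesis using near[of y] ab by (intro exI[of _ "f y"]) auto
            next
              case 3
              obtain w where "f z < w" "w < f y" "F (f y) - F (f z) = (f y - f z) * F' w"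
                using MVT2[OF 3, of F F'] dF by auto
              thus ?thesis using near[of y] near[of z] ab by (intro exI[of _ w]) (auto simp: algebra_simps)
            qed
          qed
          then obtain w where w: "\<bar>w - f x\<bar> < d1" "F (f z) - F (f y) = F' w * (f z - f y)" by blast
          have i': "integrable (TI y z) f'" "integrable (TI y z) (\<lambda>s. F' (f s) * f' s)"
            using ab by (auto intro: integrable_TI_subset[OF i] integrable_TI_subset[OF ig])
          have "F (f z) - F (f y) - (\<integral>r. F' (f r) * f' r \<partial>TI y z) = (\<integral>r. F' w * f' r \<partial>TI y z) - (\<integral>r. F' (f r) * f' r \<partial>TI y z)"
            using w(2) prim_diff[OF p, of y z] ab by simp
          also have "\<dots> = (\<integral>r. F' w * f' r - F' (f r) * f' r \<partial>TI y z)"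
            using i' by (intro Bochner_Integration.integral_diff[symmetric]) auto
          finally have "\<bar>F (f z) - F (f y) - (\<integral>r. F' (f r) * f' r \<partial>TI y z)\<bar> = \<bar>\<integral>r. F' w * f' r - F' (f r) * f' r \<partial>TI y z\<bar>" by simp
          also have "\<dots> \<le> (\<integral>r. \<bar>F' w * f' r - F' (f r) * f' r\<bar> \<partial>TI y z)" by (rule integral_abs_bound)
          also have "\<dots> \<le> (\<integral>r. e * \<bar>f' r\<bar> \<partial>TI y z)"
          proof (rule integral_mono)
            fix r assume r: "r \<in> space (TI y z)"
            have "\<bar>F' (f r) - F' (f x)\<bar> < e/2" by (rule d1(2), rule near) (use r in simp)
            hence "\<bar>F' w - F' (f r)\<bar> \<le> e" using d1(2)[OF w(1)] by linarith
            hence "\<bar>F' w - F' (f r)\<bar> * \<bar>f' r\<bar> \<le> e * \<bar>f' r\<bar>" by (rule mult_right_mono) simp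
            thus "\<bar>F' w * f' r - F' (f r) * f' r\<bar> \<le> e * \<bar>f' r\<bar>" by (simp add: abs_mult[symmetric] left_diff_distrib)
          qed (use i' in auto)
          finally show "\<bar>F (f z) - F (f y) - (\<integral>r. F' (f r) * f' r \<partial>TI y z)\<bar> \<le> e * (\<integral>r. \<bar>f' r\<bar> \<partial>TI y z)" by simp
        qed
      qed
    qed
    thus ?thesis using st by (simp add: P_def)
  qed
  show ?thesis unfolding prim_def
  proof (intro conjI ig ballI)
    fix t assume t: "t \<in> {a..b}"
    define A where "A = \<bar>F (f t) - F (f a) - (\<integral>r. F' (f r) * f' r \<partial>TI a t)\<bar>"
    define B where "B = (\<integral>r. \<bar>f' r\<bar> \<partial>TI a t)"
    have B: "B \<ge> 0" unfolding B_def by simp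
    have "A \<le> 0 + e" if "e > 0" for e
    proof -
      have "e / (B + 1) > 0" using that B by simp
      hence "A \<le> (e / (B + 1)) * B" unfolding A_def B_def using t by (intro main) auto
      also have "\<dots> \<le> e" using B that by (simp add: field_simps)
      finally show ?thesis by simp
    qed
    hence "A \<le> 0" by (rule field_le_epsilon)
    thus "F (f t) = F (f a) + (\<integral>s. F' (f s) * f' s \<partial>TI a t)" unfolding A_def by simp
  qed
qed

text \<open>Compactness of the interval, used through bisection: local bounds combine over adjacent
  intervals.\<close>

lemma locally_bounded_imp_bounded:
  fixes f :: "real \<Rightarrow> real"
  assumes "a \<le> b" and loc: "\<And>x. a \<le> x \<Longrightarrow> x \<le> b \<Longrightarrow> \<exists>d>0. \<exists>B. \<forall>y. a \<le> y \<and> y \<le> b \<and> \<bar>y - x\<bar> < d \<longrightarrow> f y \<le> B"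
  shows "\<exists>B. \<forall>y\<in>{a..b}. f y \<le> B"
proof -
  define P where "P s t \<longleftrightarrow> (\<exists>B. \<forall>y. a \<le> y \<and> y \<le> b \<and> s \<le> y \<and> y \<le> t \<longrightarrow> f y \<le> B)" for s t
  have "P a b" using assms(1)
  proof (induction rule: Bolzano)
    case (trans x y z)
    then obtain B C where "\<forall>r. a \<le> r \<and> r \<le> b \<and> x \<le> r \<and> r \<le> y \<longrightarrow> f r \<le> B" "\<forall>r. a \<le> r \<and> r \<le> b \<and> y \<le> r \<and> r \<le> z \<longrightarrow> f r \<le> C"
      by (auto simp: P_def)
    thus ?case unfolding P_def by (intro exI[of _ "max B C"]) (metis linear max.coboundedI1 max.coboundedI2)
  next
    case (local x)
    then obtain d B where d: "d > 0" "\<forall>y. a \<le> y \<and> y \<le> b \<and> \<bar>y - x\<bar> < d \<longrightarrow> f y \<le> B" using loc by blast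
    show ?case by (intro exI[of _ d] conjI d(1)) (use d(2) in \<open>auto simp: P_def intro!: exI[of _ B]\<close>)
  qed
  thus ?thesis unfolding P_def by (meson atLeastAtMost_iff)
qed

text \<open>Sampling at the next point of the mesh 1/(n+1) strictly to the right gives step
  functions that converge by right-continuity. \<open>max 0\<close> makes the function total, since
  paths are constrained at nonnegative times.\<close>

lemma right_continuous_measurable:
  fixes f :: "real \<Rightarrow> real"
  assumes rc: "\<And>t. t \<ge> 0 \<Longrightarrow> (f \<longlongrightarrow> f t) (at_right t)"
  shows "(\<lambda>t. f (max 0 t)) \<in> borel_measurable borel"
proof (rule borel_measurable_LIMSEQ_real)
  define g where "g n t = f ((real_of_int \<lfloor>real (Suc n) * max 0 t\<rfloor> + 1) / real (Suc n))" for n :: nat and t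
  show "g n \<in> borel_measurable borel" for n
  proof -
    have "(\<lambda>t. \<lfloor>real (Suc n) * max 0 t\<rfloor>) \<in> measurable borel (count_space UNIV)" by measurable
    moreover have "(\<lambda>j::int. f ((real_of_int j + 1) / real (Suc n))) \<in> measurable (count_space UNIV) borel" by simp
    ultimately show ?thesis unfolding g_def by (rule measurable_compose)
  qed
  fix t :: real
  define s where "s = max 0 t"
  have s: "s \<ge> 0" by (simp add: s_def)
  have up: "s < (real_of_int \<lfloor>real (Suc n) * s\<rfloor> + 1) / real (Suc n)" for n
  proof -
    have "real (Suc n) * s < real_of_int \<lfloor>real (Suc n) * s\<rfloor> + 1" by linarith
    thus ?thesis by (subst less_divide_eq) (simp add: mult.commute)
  qed
  have dn: "(real_of_int \<lfloor>real (Suc n) * s\<rfloor> + 1) / real (Suc n) \<le> s + inverse (real (Suc n))" for n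
  proof -
    have "real_of_int \<lfloor>real (Suc n) * s\<rfloor> + 1 \<le> real (Suc n) * s + 1" by linarith
    also have "\<dots> = (s + inverse (real (Suc n))) * real (Suc n)" 
    proof -
      have "inverse (real (Suc n)) * real (Suc n) = 1" by (rule left_inverse) simp
      thus ?thesis by (simp only: distrib_right mult.commute[of s])
    qed
    finally show ?thesis by (subst pos_divide_le_eq) auto
  qed
  define r where "r n = (real_of_int \<lfloor>real (Suc n) * s\<rfloor> + 1) / real (Suc n)" for n
  have r: "s < r n" "r n \<le> s + inverse (real (Suc n))" for n using up[of n] dn[of n] unfolding r_def by blast+
  have "(\<lambda>n. s + inverse (real (Suc n))) \<longlonglongrightarrow> s + 0" by (intro tendsto_intros LIMSEQ_inverse_real_of_nat)
  hence up': "(\<lambda>n. s + inverse (real (Suc n))) \<longlonglongrightarrow> s" by simp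
  have "r \<longlonglongrightarrow> s"
    by (rule tendsto_sandwich[OF _ _ tendsto_const up']) (intro always_eventually allI less_imp_le r(1), intro always_eventually allI r(2))
  hence "filterlim r (at_right s) sequentially"
    by (intro tendsto_imp_filterlim_at_right always_eventually allI r(1))
  from filterlim_compose[OF rc[OF s] this]
  show "(\<lambda>n. g n t) \<longlonglongrightarrow> f (max 0 t)" unfolding g_def r_def s_def .
qed

section \<open>Paths of the Burgers equation in Fourier space\<close>

definition TS :: "nat \<Rightarrow> (int \<Rightarrow> real) \<Rightarrow> real \<Rightarrow> real" where
  "TS N c x = (\<Sum>k\<in>FN N. c k * bas k x)"

definition TS' :: "nat \<Rightarrow> (int \<Rightarrow> real) \<Rightarrow> real \<Rightarrow> real" where
  "TS' N c x = (\<Sum>k\<in>FN N. 2 * pi * real_of_int k * c k * bas (- k) x)"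

lemma PN_TS: "PN N f = TS N (cf f)"
  by (rule ext) (simp add: PN_def TS_def)

lemma TS_deriv: "(TS N c has_real_derivative TS' N c x) (at x)"
  unfolding TS_def[abs_def] TS'_def
  by (rule DERIV_cong, rule DERIV_sum, rule DERIV_cmult, rule bas_deriv) (simp add: mult_ac)

lemma TS'_eq: "TS' N c = TS N (\<lambda>k. - 2 * pi * real_of_int k * c (- k))"
  by (rule ext, unfold TS_def TS'_def) (rule sum.reindex_bij_witness[of _ uminus uminus], auto)

lemma continuous_TS [continuous_intros]: "continuous_on A (TS N c)"
  unfolding TS_def[abs_def] by (intro continuous_intros)

lemma continuous_TS' [continuous_intros]: "continuous_on A (TS' N c)"
  unfolding TS'_eq by (rule continuous_TS)

lemma sqint_TS [simp]: "sqint (TS N c)" and sqint_TS' [simp]: "sqint (TS' N c)"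
  by (auto intro: sqint_continuous continuous_TS continuous_TS')

lemma TS_diff: "TS N (\<lambda>k. c k - d k) x = TS N c x - TS N d x"
  by (simp add: TS_def left_diff_distrib sum_subtractf)

lemma TS'_diff: "TS' N (\<lambda>k. c k - d k) x = TS' N c x - TS' N d x"
  by (simp add: TS'_def left_diff_distrib right_diff_distrib sum_subtractf)

lemma TS_periodic: "TS N c 1 = TS N c 0"
  unfolding TS_def using bas_periodic[of _ 0] by simp

lemma l2_TS: "(l2 (TS N c))\<^sup>2 = (\<Sum>k\<in>FN N. (c k)\<^sup>2)"
  unfolding l2_sq TS_def by (rule integral_trig_sq) simp

lemma integral_mult_TS: "sqint f \<Longrightarrow> (\<integral>x. f x * TS N c x \<partial>UI) = (\<Sum>k\<in>FN N. c k * cf f k)"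
  unfolding TS_def by (rule integral_mult_trig)

lemma integral_mult_TS':
  assumes "sqint f" shows "(\<integral>x. f x * TS' N c x \<partial>UI) = (\<Sum>k\<in>FN N. 2 * pi * real_of_int k * c k * cf f (- k))"
  unfolding TS'_eq integral_mult_TS[OF assms]
  by (rule sum.reindex_bij_witness[of _ uminus uminus]) auto

lemma TS_abs_le: "\<bar>TS N c x\<bar> \<le> (\<Sum>k\<in>FN N. sqrt 2 * \<bar>c k\<bar>)"
proof -
  have "\<bar>TS N c x\<bar> \<le> (\<Sum>k\<in>FN N. \<bar>c k * bas k x\<bar>)" unfolding TS_def by (rule sum_abs)
  also have "\<dots> \<le> (\<Sum>k\<in>FN N. sqrt 2 * \<bar>c k\<bar>)"
  proof (rule sum_mono)
    fix k show "\<bar>c k * bas k x\<bar> \<le> sqrt 2 * \<bar>c k\<bar>"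
      using mult_left_mono[OF bas_bound[of k x], of "\<bar>c k\<bar>"] by (simp add: abs_mult mult.commute)
  qed
  finally show ?thesis .
qed

lemma TS'_abs_le: "\<bar>TS' N c x\<bar> \<le> (\<Sum>k\<in>FN N. 2 * sqrt 2 * pi * \<bar>real_of_int k\<bar> * \<bar>c k\<bar>)"
proof -
  have "\<bar>TS' N c x\<bar> \<le> (\<Sum>k\<in>FN N. \<bar>2 * pi * real_of_int k * c k * bas (- k) x\<bar>)" unfolding TS'_def by (rule sum_abs)
  also have "\<dots> \<le> (\<Sum>k\<in>FN N. 2 * sqrt 2 * pi * \<bar>real_of_int k\<bar> * \<bar>c k\<bar>)"
  proof (rule sum_mono)
    fix k show "\<bar>2 * pi * real_of_int k * c k * bas (- k) x\<bar> \<le> 2 * sqrt 2 * pi * \<bar>real_of_int k\<bar> * \<bar>c k\<bar>"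
      using mult_left_mono[OF bas_bound[of "- k" x], of "2 * pi * \<bar>real_of_int k\<bar> * \<bar>c k\<bar>"] by (simp add: abs_mult mult_ac)
  qed
  finally show ?thesis .
qed

lemma l2_le_bound: "sqint f \<Longrightarrow> (\<And>x. \<bar>f x\<bar> \<le> C) \<Longrightarrow> l2 f \<le> C"
proof -
  assume f: "sqint f" and b: "\<And>x. \<bar>f x\<bar> \<le> C"
  have C: "0 \<le> C" using b[of 0] by linarith
  have "l2 f \<le> C * l2 (\<lambda>x. 1)"
    by (rule l2_sq_le_AE) (use f b C in \<open>auto simp: sqint_def\<close>)
  thus ?thesis using UI.prob_space by (simp add: l2_def)
qed

text \<open>The same choice of weak derivative as inside \<open>H1_sq\<close>, so that the two norms
  agree without invoking uniqueness.\<close>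

definition gd :: "(real \<Rightarrow> real) \<Rightarrow> real \<Rightarrow> real" where "gd w = (SOME g. weak_deriv w g)"

lemma gd_weak_deriv: "in_H1 w \<Longrightarrow> weak_deriv w (gd w)"
  unfolding gd_def in_H1_def by (rule someI_ex[where P="weak_deriv w"]) simp

lemma H1_sq_gd: "in_H1 w \<Longrightarrow> H1_sq w = ennreal ((l2 (gd w))\<^sup>2)"
  by (simp add: H1_sq_def gd_def set_lint_UI l2_sq)

text \<open>Mode k of \<nu> u_xx - u u_x with all derivatives moved onto the basis function. It
  vanishes at k = 0, in accordance with the mean staying zero.\<close>

definition cR :: "real \<Rightarrow> (real \<Rightarrow> real) \<Rightarrow> int \<Rightarrow> real" where
  "cR \<nu> w k = - \<nu> * (2 * pi * real_of_int k)\<^sup>2 * cf w k + pi * real_of_int k * cf (\<lambda>x. (w x)\<^sup>2) (- k)"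

lemma ebasis_bas: "k \<noteq> 0 \<Longrightarrow> ebasis k = bas k"
  by (rule ext) (simp add: bas_def)

lemma deriv_ebasis: "k \<noteq> 0 \<Longrightarrow> deriv (ebasis k) = (\<lambda>x. 2 * pi * real_of_int k * bas (- k) x)"
  unfolding ebasis_bas by (rule ext, rule DERIV_imp_deriv, rule bas_deriv)

lemma deriv_deriv_ebasis: "k \<noteq> 0 \<Longrightarrow> deriv (deriv (ebasis k)) = (\<lambda>x. - (2 * pi * real_of_int k)\<^sup>2 * bas k x)"
proof -
  assume k: "k \<noteq> 0"
  show ?thesis unfolding deriv_ebasis[OF k]
  proof (rule ext, rule DERIV_imp_deriv)
    fix x
    have "((\<lambda>x. 2 * pi * real_of_int k * bas (- k) x) has_real_derivative 2 * pi * real_of_int k * (2 * pi * real_of_int (- k) * bas (- (- k)) x)) (at x)"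
      by (rule DERIV_cmult, rule bas_deriv)
    thus "((\<lambda>x. 2 * pi * real_of_int k * bas (- k) x) has_real_derivative - (2 * pi * real_of_int k)\<^sup>2 * bas k x) (at x)"
      by (simp add: power2_eq_square algebra_simps)
  qed
qed

lemma ipL2_UI: "ipL2 f g = (\<integral>x. f x * g x \<partial>UI)"
  by (simp add: ipL2_def set_lint_UI)

lemma burgers_rhs_cR:
  assumes k: "k \<noteq> 0" shows "burgers_rhs \<nu> w k = cR \<nu> w k"
proof -
  have "(\<integral>x. w x * (- (2 * pi * real_of_int k)\<^sup>2 * bas k x) \<partial>UI) = - (2 * pi * real_of_int k)\<^sup>2 * cf w k"
    unfolding cf_def by (subst Bochner_Integration.integral_mult_right_zero[symmetric]) (simp add: mult_ac)
  moreover have "(\<integral>x. (w x)\<^sup>2 / 2 * (2 * pi * real_of_int k * bas (- k) x) \<partial>UI) = pi * real_of_int k * cf (\<lambda>x. (w x)\<^sup>2) (- k)"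
    unfolding cf_def by (subst Bochner_Integration.integral_mult_right_zero[symmetric]) (simp add: mult_ac)
  ultimately show ?thesis
    unfolding burgers_rhs_def deriv_deriv_ebasis[OF k] unfolding deriv_ebasis[OF k] ipL2_UI cR_def by simp
qed

text \<open>What is deterministic about one sample path: \<open>p k\<close> is the noise in mode k
  and \<open>c0\<close> holds the initial coefficients; no probability enters. \<open>bdd\<close> is
  what remains of the cadlag property in L2.\<close>

locale burgers_path =
  fixes \<nu> :: real and u :: "real \<Rightarrow> real \<Rightarrow> real" and p :: "int \<Rightarrow> real \<Rightarrow> real" and c0 :: "int \<Rightarrow> real"
  assumes nu: "0 < \<nu>" "\<nu> \<le> 1"
    and inH: "\<And>t. 0 \<le> t \<Longrightarrow> in_H (u t)"
    and bdd: "\<And>T. 0 \<le> T \<Longrightarrow> \<exists>B. \<forall>t\<in>{0..T}. l2 (u t) \<le> B"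
    and H1m: "(\<lambda>t. H1_sq (u t)) \<in> borel_measurable borel"
    and H1f: "\<And>T. 0 \<le> T \<Longrightarrow> (\<integral>\<^sup>+ t\<in>{0..T}. H1_sq (u t) \<partial>lborel) < \<infinity>"
    and p0: "\<And>t. p 0 t = 0"
    and pm: "\<And>k. (\<lambda>t. p k (max 0 t)) \<in> borel_measurable borel"
    and eqi: "\<And>t k. 0 \<le> t \<Longrightarrow> k \<noteq> 0 \<Longrightarrow> set_integrable lborel {0..t} (\<lambda>s. burgers_rhs \<nu> (u s) k)"
    and eq: "\<And>t k. 0 \<le> t \<Longrightarrow> k \<noteq> 0 \<Longrightarrow> ipL2 (u t) (ebasis k) = c0 k + (LINT s:{0..t}|lborel. burgers_rhs \<nu> (u s) k) + p k t"
begin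

definition hh :: "real \<Rightarrow> real" where "hh s = sqrt (enn2real (H1_sq (u s)))"

lemma hh_nonneg [simp]: "0 \<le> hh s" by (simp add: hh_def)

lemma hh_measurable: "hh \<in> borel_measurable (TI a b)"
  unfolding hh_def[abs_def] using H1m by (intro measurable_TI) measurable

lemma sq_u: "0 \<le> s \<Longrightarrow> sqint (u s)" by (rule in_H_sqint[OF inH])

lemma nn_finite:
  assumes "0 \<le> a" shows "(\<integral>\<^sup>+ s. H1_sq (u s) \<partial>TI a b) < \<infinity>"
proof -
  have "(\<integral>\<^sup>+ s. H1_sq (u s) \<partial>TI a b) \<le> (\<integral>\<^sup>+ t\<in>{0..max 0 b}. H1_sq (u t) \<partial>lborel)"
    unfolding nn_integral_TI by (rule nn_integral_mono) (use assms in \<open>auto simp: indicator_def\<close>)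
  also have "\<dots> < \<infinity>" by (rule H1f) simp
  finally show ?thesis .
qed

text \<open>Finiteness of the time integral places almost every time in H^1; there \<open>hh\<close>
  is the genuine norm of the derivative, and elsewhere its value is irrelevant.\<close>

lemma good_times:
  assumes "0 \<le> a" shows "AE s in TI a b. 0 \<le> s \<and> in_H1 (u s) \<and> weak_deriv (u s) (gd (u s)) \<and> hh s = l2 (gd (u s)) \<and> H1_sq (u s) = ennreal ((hh s)\<^sup>2)"
proof -
  have "AE s in TI a b. H1_sq (u s) \<noteq> \<infinity>"
  proof (rule nn_integral_noteq_infinite)
    show "(\<lambda>s. H1_sq (u s)) \<in> borel_measurable (TI a b)"
      unfolding TI_def by (rule measurable_restrict_space1) (use H1m in simp)
    show "(\<integral>\<^sup>+ s. H1_sq (u s) \<partial>TI a b) \<noteq> \<infinity>" using nn_finite[OF assms, of b] by (metis less_irrefl)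
  qed
  moreover have "AE s in TI a b. 0 \<le> s" using assms by (intro AE_I2) auto
  ultimately show ?thesis
  proof eventually_elim
    case (elim s)
    hence i: "in_H1 (u s)" by (auto simp: H1_sq_def split: if_splits)
    show ?case using i gd_weak_deriv[OF i] H1_sq_gd[OF i] elim by (simp add: hh_def)
  qed
qed

lemma hh_sq_integrable:
  assumes "0 \<le> a" shows "integrable (TI a b) (\<lambda>s. (hh s)\<^sup>2)" "(\<integral>\<^sup>+ s. H1_sq (u s) \<partial>TI a b) = ennreal (\<integral>s. (hh s)\<^sup>2 \<partial>TI a b)"
proof -
  have e: "(\<integral>\<^sup>+ s. H1_sq (u s) \<partial>TI a b) = (\<integral>\<^sup>+ s. ennreal ((hh s)\<^sup>2) \<partial>TI a b)"
    by (rule nn_integral_cong_AE) (use good_times[OF assms] in eventually_elim, simp)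
  show i: "integrable (TI a b) (\<lambda>s. (hh s)\<^sup>2)"
    by (rule integrableI_nonneg) (use nn_finite[OF assms, of b] hh_measurable e in auto)
  show "(\<integral>\<^sup>+ s. H1_sq (u s) \<partial>TI a b) = ennreal (\<integral>s. (hh s)\<^sup>2 \<partial>TI a b)"
    unfolding e by (rule nn_integral_eq_integral[OF i]) simp
qed

lemma hh_integrable:
  assumes "0 \<le> a" shows "integrable (TI a b) hh"
proof (rule Bochner_Integration.integrable_bound[where f="\<lambda>s. 1 + (hh s)\<^sup>2"])
  show "integrable (TI a b) (\<lambda>s. 1 + (hh s)\<^sup>2)" using hh_sq_integrable(1)[OF assms] by simp
  have "h \<le> 1 + h\<^sup>2" for h :: real 
  proof -
    have "0 \<le> h\<^sup>2 - 2 * h + 1" using zero_le_power2[of "h - 1"] by (simp add: power2_diff)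
    thus ?thesis using zero_le_power2[of h] by linarith
  qed
  thus "AE s in TI a b. norm (hh s) \<le> norm (1 + (hh s)\<^sup>2)" by (intro AE_I2) auto
qed (rule hh_measurable)

definition R :: "real \<Rightarrow> int \<Rightarrow> real" where "R s k = cR \<nu> (u s) k"

lemma R_integrable: assumes "0 \<le> a" shows "integrable (TI a b) (\<lambda>s. R s k)"
proof (cases "k = 0")
  case True thus ?thesis by (simp add: R_def cR_def)
next
  case False
  have "integrable (TI 0 (max 0 b)) (\<lambda>s. R s k)"
    using eqi[of "max 0 b" k] False by (simp add: integrable_TI R_def burgers_rhs_cR)
  thus ?thesis by (rule integrable_TI_subset) (use assms in auto)
qed

lemma cf_eq:
  assumes "0 \<le> t" "k \<noteq> 0" shows "cf (u t) k = c0 k + (\<integral>s. R s k \<partial>TI 0 t) + p k t"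
  using eq[OF assms] assms(2) by (simp add: ipL2_UI cf_def ebasis_bas integral_TI R_def burgers_rhs_cR)

lemma cf0: "0 \<le> t \<Longrightarrow> cf (u t) 0 = 0" by (rule in_H_cf[OF inH])

lemma p_measurable: assumes "0 \<le> a" shows "p k \<in> borel_measurable (TI a b)"
proof -
  have "(\<lambda>t. p k (max 0 t)) \<in> borel_measurable (TI a b)" by (rule measurable_TI[OF pm])
  thus ?thesis by (subst (asm) measurable_cong[where g="p k"]) (use assms in \<open>auto simp: max_def\<close>)
qed

text \<open>Measurability in time is read off from the equation itself: a coefficient is a constant,
  plus a continuous primitive, plus a measurable noise path.\<close>

lemma cf_measurable: assumes "0 \<le> a" shows "(\<lambda>s. cf (u s) k) \<in> borel_measurable (TI a b)"
proof (cases "k = 0")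
  case True
  have "(\<lambda>s. 0) \<in> borel_measurable (TI a b)" by simp
  thus ?thesis by (subst (asm) measurable_cong[where g="\<lambda>s. cf (u s) k"]) (use assms True cf0 in auto)
next
  case False
  have pr: "prim 0 (max 0 b) (\<lambda>t. \<integral>s. R s k \<partial>TI 0 t) (\<lambda>s. R s k)"
    by (rule primI[OF R_integrable]) (auto simp: integral_TI_refl)
  have "continuous_on {a..b} (\<lambda>t. \<integral>s. R s k \<partial>TI 0 t)"
    by (rule continuous_on_subset[OF prim_continuous[OF pr]]) (use assms in auto)
  hence "(\<lambda>t. \<integral>s. R s k \<partial>TI 0 t) \<in> borel_measurable (TI a b)" by (rule continuous_on_measurable_TI)
  hence "(\<lambda>t. c0 k + (\<integral>s. R s k \<partial>TI 0 t) + p k t) \<in> borel_measurable (TI a b)"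
    using p_measurable[OF assms] by measurable
  thus ?thesis by (subst (asm) measurable_cong[where g="\<lambda>s. cf (u s) k"]) (use assms False cf_eq in auto)
qed

lemma l2u_measurable: assumes "0 \<le> a" shows "(\<lambda>s. (l2 (u s))\<^sup>2) \<in> borel_measurable (TI a b)"
proof (rule borel_measurable_LIMSEQ_real[where u="\<lambda>N s. \<Sum>k\<in>FN N. (cf (u s) k)\<^sup>2"])
  show "(\<lambda>s. \<Sum>k\<in>FN N. (cf (u s) k)\<^sup>2) \<in> borel_measurable (TI a b)" for N
    using cf_measurable[OF assms] by measurable
  show "(\<lambda>N. \<Sum>k\<in>FN N. (cf (u s) k)\<^sup>2) \<longlonglongrightarrow> (l2 (u s))\<^sup>2" if "s \<in> space (TI a b)" for s
    using that assms by (intro Parseval sq_u) auto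
qed

lemma l2u_integrable: assumes "0 \<le> a" shows "integrable (TI a b) (\<lambda>s. (l2 (u s))\<^sup>2)"
proof -
  obtain B where B: "\<And>t. t \<in> {0..max 0 b} \<Longrightarrow> l2 (u t) \<le> B" using bdd[of "max 0 b"] by (meson max.cobounded1)
  have "\<bar>(l2 (u s))\<^sup>2\<bar> \<le> B\<^sup>2" if "s \<in> {a..b}" for s using B[of s] that assms by (auto intro: power_mono)
  thus ?thesis
    by (intro Bochner_Integration.integrable_bound[OF integrable_TI_const[of a b "B\<^sup>2"] l2u_measurable[OF assms]] AE_I2) auto
qed

text \<open>The equation is solved for the quadratic coefficient in terms of \<open>R\<close> and
  the linear coefficient; mode 0 is the squared norm.\<close>

lemma cf_sq_measurable: assumes "0 \<le> a" shows "(\<lambda>s. cf (\<lambda>x. (u s x)\<^sup>2) k) \<in> borel_measurable (TI a b)"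
proof (cases "k = 0")
  case True
  have "cf (\<lambda>x. (u s x)\<^sup>2) k = (l2 (u s))\<^sup>2" for s using True by (simp add: cf_def bas_def l2_sq)
  thus ?thesis using l2u_measurable[OF assms] by simp
next
  case False
  have "cf (\<lambda>x. (u s x)\<^sup>2) k = (R s (- k) + \<nu> * (2 * pi * real_of_int k)\<^sup>2 * cf (u s) (- k)) / (- pi * real_of_int k)" for s
  proof -
    have "R s (- k) + \<nu> * (2 * pi * real_of_int k)\<^sup>2 * cf (u s) (- k) = cf (\<lambda>x. (u s x)\<^sup>2) k * (- pi * real_of_int k)"
      by (simp add: R_def cR_def)
    moreover have "- pi * real_of_int k \<noteq> 0" using False by simp
    ultimately show ?thesis by (simp only: nonzero_mult_div_cancel_right not_False_eq_True)
  qed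
  moreover have "(\<lambda>s. (R s (- k) + \<nu> * (2 * pi * real_of_int k)\<^sup>2 * cf (u s) (- k)) / (- pi * real_of_int k)) \<in> borel_measurable (TI a b)"
    using cf_measurable[OF assms] borel_measurable_integrable[OF R_integrable[OF assms]] by measurable
  ultimately show ?thesis by simp
qed

lemma err_measurable: assumes "0 \<le> a" shows "(\<lambda>s. l2 (err N (u s))) \<in> borel_measurable (TI a b)"
proof -
  have [measurable]: "(\<lambda>s. cf (u s) k) \<in> borel_measurable (TI a b)" "(\<lambda>s. cf (\<lambda>x. (u s x)\<^sup>2) k) \<in> borel_measurable (TI a b)" for k
    using cf_measurable[OF assms] cf_sq_measurable[OF assms] by auto
  have [measurable]: "bas k \<in> borel_measurable UI" for k by (rule measurable_UI) measurable
  have "(\<lambda>(s, x). (err N (u s) x)\<^sup>2) \<in> borel_measurable (TI a b \<Otimes>\<^sub>M UI)"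
    unfolding err_def PN_def by measurable
  hence "(\<lambda>s. \<integral>x. (err N (u s) x)\<^sup>2 \<partial>UI) \<in> borel_measurable (TI a b)"
    by (rule UI.borel_measurable_lebesgue_integral)
  thus ?thesis unfolding l2_def by measurable
qed

text \<open>Dominated convergence with majorant
  \<open>2 * \<bar>B\<bar> * hh s * (hh s + C)\<close>, integrable because the square of
  \<open>hh\<close> is. The weight \<open>hh s + C\<close> will bound the derivative of the
  noise-free field against which the defect is tested.\<close>

lemma err_integrals:
  assumes a: "0 \<le> a" and C: "0 \<le> C"
  shows "integrable (TI a b) (\<lambda>s. l2 (err N (u s)) * (hh s + C))"
    "(\<lambda>N. \<integral>s. l2 (err N (u s)) * (hh s + C) \<partial>TI a b) \<longlonglongrightarrow> 0"
    "integrable (TI a b) (\<lambda>s. l2 (err N (u s)))"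
    "(\<lambda>N. \<integral>s. l2 (err N (u s)) \<partial>TI a b) \<longlonglongrightarrow> 0"
proof -
  obtain B where B: "\<And>t. t \<in> {0..max 0 b} \<Longrightarrow> l2 (u t) \<le> B" using bdd[of "max 0 b"] by (meson max.cobounded1)
  have bnd: "AE s in TI a b. \<forall>N. l2 (err N (u s)) \<le> 2 * \<bar>B\<bar> * hh s"
    using good_times[OF a, of b] AE_space[of "TI a b"]
  proof eventually_elim
    case (elim s)
    show ?case
    proof
      fix N
      have "l2 (err N (u s)) \<le> 2 * l2 (gd (u s)) * l2 (u s)"
        by (rule err_bound) (use elim inH in auto)
      also have "\<dots> \<le> 2 * l2 (gd (u s)) * \<bar>B\<bar>" using B[of s] elim a by (intro mult_left_mono) auto
      finally show "l2 (err N (u s)) \<le> 2 * \<bar>B\<bar> * hh s" using elim by (simp add: mult_ac)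
    qed
  qed
  have lim: "AE s in TI a b. (\<lambda>N. l2 (err N (u s))) \<longlonglongrightarrow> 0"
    using good_times[OF a, of b] by eventually_elim (rule err_tendsto, use inH in auto)
  have w1: "integrable (TI a b) (\<lambda>s. 2 * \<bar>B\<bar> * hh s * (hh s + C))"
  proof -
    have "integrable (TI a b) (\<lambda>s. 2 * \<bar>B\<bar> * (hh s)\<^sup>2 + 2 * \<bar>B\<bar> * C * hh s)"
      using hh_sq_integrable(1)[OF a, of b] hh_integrable[OF a, of b] by auto
    thus ?thesis by (simp add: power2_eq_square algebra_simps)
  qed
  have w2: "integrable (TI a b) (\<lambda>s. 2 * \<bar>B\<bar> * hh s)" using hh_integrable[OF a, of b] by auto
  have b1: "AE s in TI a b. norm (l2 (err N (u s)) * (hh s + C)) \<le> 2 * \<bar>B\<bar> * hh s * (hh s + C)" for N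
    using bnd by eventually_elim (use C in \<open>auto intro!: mult_right_mono\<close>)
  have b2: "AE s in TI a b. norm (l2 (err N (u s))) \<le> 2 * \<bar>B\<bar> * hh s" for N
    using bnd by eventually_elim auto
  have m1: "(\<lambda>s. l2 (err N (u s)) * (hh s + C)) \<in> borel_measurable (TI a b)" for N
    using err_measurable[OF a] hh_measurable by measurable
  have l1: "AE s in TI a b. (\<lambda>N. l2 (err N (u s)) * (hh s + C)) \<longlonglongrightarrow> 0"
    using lim by eventually_elim (auto intro: tendsto_mult_left_zero)
  have i1: "integrable (TI a b) (\<lambda>s. l2 (err N (u s)) * (hh s + C))" for N
    by (rule Bochner_Integration.integrable_bound[OF w1 m1]) (use b1[of N] in \<open>eventually_elim, auto\<close>)
  have i2: "integrable (TI a b) (\<lambda>s. l2 (err N (u s)))" for N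
    by (rule Bochner_Integration.integrable_bound[OF w2 err_measurable[OF a]]) (use b2[of N] in \<open>eventually_elim, auto\<close>)
  show "integrable (TI a b) (\<lambda>s. l2 (err N (u s)) * (hh s + C))" "integrable (TI a b) (\<lambda>s. l2 (err N (u s)))" by (rule i1, rule i2)
  show "(\<lambda>N. \<integral>s. l2 (err N (u s)) * (hh s + C) \<partial>TI a b) \<longlonglongrightarrow> 0"
    using integral_dominated_convergence[of "\<lambda>_. 0", OF _ m1 w1 l1 b1] by simp
  show "(\<lambda>N. \<integral>s. l2 (err N (u s)) \<partial>TI a b) \<longlonglongrightarrow> 0"
    using integral_dominated_convergence[of "\<lambda>_. 0", OF _ err_measurable[OF a] w2 lim b2] by simp
qed

end

section \<open>Energy estimate with additive noise\<close>

lemma Fubini_TI_UI: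
  fixes f :: "real \<Rightarrow> real \<Rightarrow> real"
  assumes m: "(\<lambda>(s, x). f s x) \<in> borel_measurable (TI a b \<Otimes>\<^sub>M UI)"
    and i: "integrable (TI a b) w" and b: "\<And>s x. s \<in> {a..b} \<Longrightarrow> \<bar>f s x\<bar> \<le> w s"
  shows "(\<integral>x. \<integral>s. f s x \<partial>TI a b \<partial>UI) = (\<integral>s. \<integral>x. f s x \<partial>UI \<partial>TI a b)"
    "integrable (TI a b) (\<lambda>s. \<integral>x. f s x \<partial>UI)" "integrable UI (\<lambda>x. \<integral>s. f s x \<partial>TI a b)"
proof -
  interpret T: finite_measure "TI a b" by (rule finite_measure_TI)
  interpret P: pair_sigma_finite "TI a b" UI ..
  have "integrable (TI a b \<Otimes>\<^sub>M UI) (\<lambda>(s, x). w s)"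
  proof (rule P.Fubini_integrable)
    show "(\<lambda>(s, x). w s) \<in> borel_measurable (TI a b \<Otimes>\<^sub>M UI)"
      using borel_measurable_integrable[OF i] by measurable
  qed (use i UI.prob_space in auto)
  hence I: "integrable (TI a b \<Otimes>\<^sub>M UI) (\<lambda>(s, x). f s x)"
  proof (rule Bochner_Integration.integrable_bound[OF _ m])
    show "AE z in TI a b \<Otimes>\<^sub>M UI. norm (case z of (s, x) \<Rightarrow> f s x) \<le> norm (case z of (s, x) \<Rightarrow> w s)"
    proof (rule AE_I2)
      fix z assume "z \<in> space (TI a b \<Otimes>\<^sub>M UI)"
      then obtain s x where z: "z = (s, x)" "s \<in> {a..b}" by (auto simp: space_pair_measure)
      show "norm (case z of (s, x) \<Rightarrow> f s x) \<le> norm (case z of (s, x) \<Rightarrow> w s)"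
        using b[OF z(2), of x] by (simp add: z)
    qed
  qed
  show "(\<integral>x. \<integral>s. f s x \<partial>TI a b \<partial>UI) = (\<integral>s. \<integral>x. f s x \<partial>UI \<partial>TI a b)"
    by (rule P.Fubini_integral[OF I])
  show "integrable (TI a b) (\<lambda>s. \<integral>x. f s x \<partial>UI)" using P.integrable_fst[OF I] .
  show "integrable UI (\<lambda>x. \<integral>s. f s x \<partial>TI a b)" using P.integrable_snd[OF I] .
qed

lemma measure_TI: "a \<le> b \<Longrightarrow> measure (TI a b) {a..b} = b - a"
  by (simp add: measure_def emeasure_TI)

text \<open>The weight \<open>2 * sqrt 2 * pi * \<bar>k\<bar>\<close> makes \<open>X\<close> bound
  both the noise increment and its space derivative, pointwise and for every truncation.\<close>

locale burgers_window = burgers_path +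
  fixes a b X :: real
  assumes ab: "0 \<le> a" "a \<le> b"
    and noise: "\<And>t N. a \<le> t \<Longrightarrow> t \<le> b \<Longrightarrow> (\<Sum>k\<in>FN N. 2 * sqrt 2 * pi * \<bar>real_of_int k\<bar> * \<bar>p k t - p k a\<bar>) \<le> X"
begin

definition q :: "real \<Rightarrow> int \<Rightarrow> real" where "q t k = p k t - p k a"
definition v :: "real \<Rightarrow> int \<Rightarrow> real" where "v t k = cf (u t) k - q t k"

lemma X0: "0 \<le> X" using noise[of a 0] ab by simp

lemma q_a [simp]: "q a k = 0" by (simp add: q_def)

lemma v_a: "v a = cf (u a)" by (rule ext) (simp add: v_def)

lemma q_sum: assumes "a \<le> t" "t \<le> b" shows "(\<Sum>k\<in>FN N. 2 * sqrt 2 * pi * \<bar>real_of_int k\<bar> * \<bar>q t k\<bar>) \<le> X"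
  using noise[OF assms] by (simp add: q_def)

lemma l_bound: assumes "a \<le> t" "t \<le> b" shows "\<bar>TS N (q t) x\<bar> \<le> X"
proof -
  have "\<bar>TS N (q t) x\<bar> \<le> (\<Sum>k\<in>FN N. sqrt 2 * \<bar>q t k\<bar>)" by (rule TS_abs_le)
  also have "\<dots> \<le> (\<Sum>k\<in>FN N. 2 * sqrt 2 * pi * \<bar>real_of_int k\<bar> * \<bar>q t k\<bar>)"
  proof (rule sum_mono)
    fix k
    show "sqrt 2 * \<bar>q t k\<bar> \<le> 2 * sqrt 2 * pi * \<bar>real_of_int k\<bar> * \<bar>q t k\<bar>"
    proof (cases "k = 0")
      case True thus ?thesis by (simp add: q_def p0)
    next
      case False
      hence "1 \<le> \<bar>real_of_int k\<bar>" by linarith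
      moreover have "1 \<le> 2 * pi" using pi_gt3 by simp
      ultimately have "1 * 1 \<le> (2 * pi) * \<bar>real_of_int k\<bar>" by (intro mult_mono) auto
      hence "1 * (sqrt 2 * \<bar>q t k\<bar>) \<le> ((2 * pi) * \<bar>real_of_int k\<bar>) * (sqrt 2 * \<bar>q t k\<bar>)" by (intro mult_right_mono) auto
      thus ?thesis by (simp add: mult_ac)
    qed
  qed
  finally show ?thesis using q_sum[OF assms, of N] by linarith
qed

lemma l'_bound: assumes "a \<le> t" "t \<le> b" shows "\<bar>TS' N (q t) x\<bar> \<le> X"
  using TS'_abs_le[of N "q t" x] q_sum[OF assms, of N] by linarith

lemma q_l2: assumes "a \<le> t" "t \<le> b" shows "l2 (TS N (q t)) \<le> X"
  by (rule l2_le_bound) (use l_bound[OF assms] in auto)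

text \<open>Subtracting the noise increment leaves an absolutely continuous function of time, so the
  chain rule applies although the solution jumps.\<close>

lemma prim_v: "prim a b (\<lambda>t. v t k) (\<lambda>s. R s k)"
proof (cases "k = 0")
  case True
  show ?thesis
  proof (rule primI)
    fix t assume t: "a \<le> t" "t \<le> b"
    have "v t k = 0" "v a k = 0" "\<And>s. R s k = 0" using True t ab by (auto simp: v_def q_def p0 cf0 R_def cR_def)
    thus "v t k = v a k + (\<integral>s. R s k \<partial>TI a t)" by simp
  qed (rule R_integrable[OF ab(1)])
next
  case False
  show ?thesis
  proof (rule primI)
    fix t assume t: "a \<le> t" "t \<le> b"
    have "(\<integral>s. R s k \<partial>TI 0 a) + (\<integral>s. R s k \<partial>TI a t) = (\<integral>s. R s k \<partial>TI 0 t)"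
      by (rule integral_TI_split[OF R_integrable]) (use ab t in auto)
    thus "v t k = v a k + (\<integral>s. R s k \<partial>TI a t)"
      using cf_eq[of t k] cf_eq[of a k] t ab False by (simp add: v_def q_def)
  qed (rule R_integrable[OF ab(1)])
qed

lemma uN_eq: "PN N (u t) x = TS N (v t) x + TS N (q t) x"
  by (simp add: PN_TS v_def[abs_def] TS_diff)

definition HN :: "nat \<Rightarrow> real \<Rightarrow> real" where "HN N s = (\<Sum>k\<in>FN N. (2 * pi * real_of_int k * cf (u s) k)\<^sup>2)"

lemma good:
  assumes s: "a \<le> s" "s \<le> b" and w: "weak_deriv (u s) g"
  shows "TS' N (cf (u s)) x = PN N g x" "(l2 (PN N g))\<^sup>2 = HN N s" "HN N s \<le> (l2 g)\<^sup>2"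
    "(\<lambda>N. HN N s) \<longlonglongrightarrow> (l2 g)\<^sup>2"
proof -
  have c: "cf g (- k) = 2 * pi * real_of_int k * cf (u s) k" for k by (rule weak_deriv_cf[OF w])
  have e: "(\<Sum>k\<in>FN N. (cf g k)\<^sup>2) = HN N s" for N
    unfolding HN_def c[symmetric] by (rule sum.reindex_bij_witness[of _ uminus uminus]) auto
  show "TS' N (cf (u s)) x = PN N g x"
    unfolding TS'_def c[symmetric] PN_def by (rule sum.reindex_bij_witness[of _ uminus uminus]) auto
  show "(l2 (PN N g))\<^sup>2 = HN N s" unfolding l2_PN e ..
  show "HN N s \<le> (l2 g)\<^sup>2" unfolding e[symmetric] by (rule Bessel[OF weak_deriv_sqint[OF w]])
  show "(\<lambda>N. HN N s) \<longlonglongrightarrow> (l2 g)\<^sup>2" unfolding e[symmetric] by (rule Parseval[OF weak_deriv_sqint[OF w]])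
qed

text \<open>The cubic term only survives through the noise, because the truncated field integrates its own square
  against its derivative to zero.\<close>
lemma energy_density:
  assumes s: "a \<le> s" "s \<le> b" and w: "weak_deriv (u s) g"
  shows "(\<Sum>k\<in>FN N. 2 * v s k * R s k) = - 2 * \<nu> * HN N s + 2 * \<nu> * (\<integral>x. PN N g x * TS' N (q s) x \<partial>UI)
     - (\<integral>x. (PN N (u s) x)\<^sup>2 * TS' N (q s) x \<partial>UI) + (\<integral>x. err N (u s) x * TS' N (v s) x \<partial>UI)"
proof -
  have s0: "0 \<le> s" using ab s by simp
  define D where "D = PN N g"
  define U where "U = PN N (u s)"
  define l where "l = TS' N (q s)"
  define E where "E = err N (u s)"
  have s2: "sqint (\<lambda>x. (u s x)\<^sup>2)" by (rule sqint_square[OF inH[OF s0] w])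
  have cE: "continuous_on UNIV E" unfolding E_def err_def[abs_def] by (intro continuous_intros)
  have cc: "continuous_on UNIV D" "continuous_on UNIV U" "continuous_on UNIV l" "continuous_on UNIV E" 
    unfolding D_def U_def l_def by (intro continuous_intros cE)+
  have vD: "TS' N (v s) x = D x - l x" for x
    unfolding v_def[abs_def] TS'_diff good(1)[OF s w] D_def l_def by simp
  \<comment> \<open>Pairing this flux with the space derivative of the noise-free field reproduces
    the sum of \<open>2 * v s k * R s k\<close>: integration by parts in Fourier space.\<close>
  define f where "f x = PN N (\<lambda>x. (u s x)\<^sup>2) x - 2 * \<nu> * D x" for x
  have sf: "sqint f" unfolding f_def[abs_def] D_def by (intro sqint_diff sqint_cmult sqint_PN)
  have f_eq: "f x = (U x)\<^sup>2 + E x - 2 * \<nu> * D x" for x by (simp add: f_def U_def E_def err_def)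
  have cff: "cf f j = cf (\<lambda>x. (u s x)\<^sup>2) j - 2 * \<nu> * cf g j" if "j \<in> FN N" for j
  proof -
    have "f = TS N (\<lambda>k. cf (\<lambda>x. (u s x)\<^sup>2) k - 2 * \<nu> * cf g k)"
      by (rule ext) (simp add: f_def D_def PN_TS TS_diff, simp add: TS_def sum_distrib_left mult.assoc)
    thus ?thesis unfolding TS_def[abs_def] using cf_trig[of "FN N" _ j] that by simp
  qed
  have "(\<integral>x. f x * TS' N (v s) x \<partial>UI) = (\<Sum>k\<in>FN N. 2 * pi * real_of_int k * v s k * cf f (- k))"
    by (rule integral_mult_TS'[OF sf])
  also have "\<dots> = (\<Sum>k\<in>FN N. 2 * v s k * R s k)"
  proof (rule sum.cong[OF refl])
    fix k assume k: "k \<in> FN N"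
    hence h: "cf f (- k) = cf (\<lambda>x. (u s x)\<^sup>2) (- k) - 2 * \<nu> * (2 * pi * real_of_int k * cf (u s) k)"
      using cff[of "- k"] weak_deriv_cf[OF w, of k] by simp
    show "2 * pi * real_of_int k * v s k * cf f (- k) = 2 * v s k * R s k"
      unfolding h R_def cR_def by (simp add: power2_eq_square algebra_simps)
  qed
  finally have 1: "(\<Sum>k\<in>FN N. 2 * v s k * R s k) = (\<integral>x. f x * TS' N (v s) x \<partial>UI)" ..
  have zero: "(\<integral>x. (U x)\<^sup>2 * D x \<partial>UI) = 0"
  proof -
    have dU: "(U has_real_derivative D x) (at x)" for x
      unfolding U_def D_def by (rule PN_weak_deriv[OF w])
    have "(\<integral>x. (U x)\<^sup>2 * D x \<partial>UI) = (U 1) ^ 3 / 3 - (U 0) ^ 3 / 3"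
    proof (rule integral_UI_FTC)
      fix x
      have "((\<lambda>x. (U x) ^ 3 / 3) has_real_derivative (3 * (U x)\<^sup>2 * D x) / 3) (at x)"
        by (rule DERIV_cong[OF DERIV_cdivide[OF DERIV_power[OF dU, of 3]]]) (simp add: power2_eq_square)
      thus "((\<lambda>x. (U x) ^ 3 / 3) has_real_derivative (U x)\<^sup>2 * D x) (at x)" by simp
    qed (intro continuous_intros cc)
    moreover have "U 1 = U 0" unfolding U_def PN_TS by (rule TS_periodic)
    ultimately show ?thesis by simp
  qed
  have "(\<integral>x. f x * TS' N (v s) x \<partial>UI) = (\<integral>x. (U x)\<^sup>2 * D x - (U x)\<^sup>2 * l x + E x * (D x - l x) - 2 * \<nu> * (D x)\<^sup>2 + 2 * \<nu> * (D x * l x) \<partial>UI)"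
    by (intro Bochner_Integration.integral_cong refl) (simp add: f_eq vD power2_eq_square algebra_simps)
  also have "\<dots> = (\<integral>x. (U x)\<^sup>2 * D x \<partial>UI) - (\<integral>x. (U x)\<^sup>2 * l x \<partial>UI) + (\<integral>x. E x * (D x - l x) \<partial>UI)
     - 2 * \<nu> * (\<integral>x. (D x)\<^sup>2 \<partial>UI) + 2 * \<nu> * (\<integral>x. D x * l x \<partial>UI)"
  proof -
    have i: "integrable UI (\<lambda>x. (U x)\<^sup>2 * D x)" "integrable UI (\<lambda>x. (U x)\<^sup>2 * l x)" "integrable UI (\<lambda>x. E x * (D x - l x))"
      "integrable UI (\<lambda>x. 2 * \<nu> * (D x)\<^sup>2)" "integrable UI (\<lambda>x. 2 * \<nu> * (D x * l x))"
      by (intro integrable_UI_continuous continuous_intros cc)+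
    show ?thesis
      by (subst Bochner_Integration.integral_add Bochner_Integration.integral_diff, (intro Bochner_Integration.integrable_add Bochner_Integration.integrable_diff i)+)+ simp
  qed
  finally have 2: "(\<integral>x. f x * TS' N (v s) x \<partial>UI) = - (\<integral>x. (U x)\<^sup>2 * l x \<partial>UI) + (\<integral>x. E x * TS' N (v s) x \<partial>UI)
     - 2 * \<nu> * HN N s + 2 * \<nu> * (\<integral>x. D x * l x \<partial>UI)"
    using zero good(2)[OF s w, of N] by (simp add: vD l2_sq D_def)
  show ?thesis unfolding 1 2 by (simp add: D_def U_def l_def E_def)
qed

text \<open>Young's inequality splits the cross term of viscosity and noise into \<open>HN\<close>
  and X^2, and \<nu> \<le> 1 frees the latter from \<nu>. This turns the factor 2 of the dissipation
  into 1 in the upper bound and into 3 in the lower one.\<close>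

lemma energy_density_bounds:
  assumes s: "a \<le> s" "s \<le> b" and w: "weak_deriv (u s) g" and h: "hh s = l2 g"
  shows "(\<Sum>k\<in>FN N. 2 * v s k * R s k) \<le> - \<nu> * HN N s + X\<^sup>2 + X * (l2 (u s))\<^sup>2 + l2 (err N (u s)) * (hh s + X)"
    "(\<Sum>k\<in>FN N. 2 * v s k * R s k) \<ge> - 3 * \<nu> * HN N s - X\<^sup>2 - X * (l2 (u s))\<^sup>2 - l2 (err N (u s)) * (hh s + X)"
proof -
  have s0: "0 \<le> s" using ab s by simp
  define I1 where "I1 = (\<integral>x. PN N g x * TS' N (q s) x \<partial>UI)"
  define I2 where "I2 = (\<integral>x. (PN N (u s) x)\<^sup>2 * TS' N (q s) x \<partial>UI)"
  define I3 where "I3 = (\<integral>x. err N (u s) x * TS' N (v s) x \<partial>UI)"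
  have ql: "l2 (TS' N (q s)) \<le> X" by (rule l2_le_bound) (use l'_bound[OF s] in auto)
  have "\<bar>I1\<bar> \<le> l2 (PN N g) * l2 (TS' N (q s))" unfolding I1_def by (rule Cauchy_Schwarz_l2) auto
  also have "\<dots> \<le> l2 (PN N g) * X" by (intro mult_left_mono ql) simp
  finally have i1: "2 * \<bar>I1\<bar> \<le> HN N s + X\<^sup>2"
    using sum_squares_bound[of "l2 (PN N g)" X] good(2)[OF s w, of N] by simp
  have 1: "2 * \<nu> * \<bar>I1\<bar> \<le> \<nu> * HN N s + X\<^sup>2"
  proof -
    have "\<nu> * (2 * \<bar>I1\<bar>) \<le> \<nu> * (HN N s + X\<^sup>2)" using i1 nu by (intro mult_left_mono) auto
    moreover have "\<nu> * X\<^sup>2 \<le> 1 * X\<^sup>2" using nu by (intro mult_right_mono) auto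
    ultimately show ?thesis by (simp add: distrib_left)
  qed
  have 2: "\<bar>I2\<bar> \<le> X * (l2 (u s))\<^sup>2"
  proof -
    have i: "integrable UI (\<lambda>x. (PN N (u s) x)\<^sup>2 * TS' N (q s) x)" "integrable UI (\<lambda>x. X * (PN N (u s) x)\<^sup>2)"
      by (intro integrable_UI_continuous continuous_intros)+
    have "\<bar>I2\<bar> \<le> (\<integral>x. \<bar>(PN N (u s) x)\<^sup>2 * TS' N (q s) x\<bar> \<partial>UI)" unfolding I2_def by (rule integral_abs_bound)
    also have "\<dots> \<le> (\<integral>x. X * (PN N (u s) x)\<^sup>2 \<partial>UI)"
    proof (rule integral_mono)
      fix x
      show "\<bar>(PN N (u s) x)\<^sup>2 * TS' N (q s) x\<bar> \<le> X * (PN N (u s) x)\<^sup>2"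
        using mult_left_mono[OF l'_bound[OF s, of N x], of "(PN N (u s) x)\<^sup>2"] by (simp add: abs_mult mult.commute)
    qed (use i in auto)
    also have "\<dots> = X * (l2 (PN N (u s)))\<^sup>2" by (simp add: l2_sq)
    also have "\<dots> \<le> X * (l2 (u s))\<^sup>2" by (intro mult_left_mono power_mono l2_PN_le sq_u s0 X0) auto
    finally show ?thesis .
  qed
  have 3: "\<bar>I3\<bar> \<le> l2 (err N (u s)) * (hh s + X)"
  proof -
    have "\<bar>I3\<bar> \<le> l2 (err N (u s)) * l2 (TS' N (v s))" unfolding I3_def by (rule Cauchy_Schwarz_l2) (auto intro: sqint_err)
    also have "l2 (TS' N (v s)) = l2 (\<lambda>x. PN N g x - TS' N (q s) x)"
    proof -
      have "TS' N (v s) = (\<lambda>x. PN N g x - TS' N (q s) x)"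
        by (rule ext) (simp add: v_def[abs_def] TS'_diff good(1)[OF s w])
      thus ?thesis by simp
    qed
    also have "\<dots> \<le> l2 (PN N g) + l2 (TS' N (q s))" by (rule l2_triangle_diff) auto
    also have "\<dots> \<le> hh s + X" using l2_PN_le[OF weak_deriv_sqint[OF w], of N] ql h by simp
    finally show ?thesis by (simp add: mult_left_mono)
  qed
  have e: "(\<Sum>k\<in>FN N. 2 * v s k * R s k) = - 2 * \<nu> * HN N s + 2 * \<nu> * I1 - I2 + I3"
    unfolding I1_def I2_def I3_def by (rule energy_density[OF s w])
  have f: "\<bar>2 * \<nu> * I1\<bar> \<le> \<nu> * HN N s + X\<^sup>2" using 1 nu by (simp add: abs_mult)
  show "(\<Sum>k\<in>FN N. 2 * v s k * R s k) \<le> - \<nu> * HN N s + X\<^sup>2 + X * (l2 (u s))\<^sup>2 + l2 (err N (u s)) * (hh s + X)"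
    using e f 2 3 by linarith
  show "(\<Sum>k\<in>FN N. 2 * v s k * R s k) \<ge> - 3 * \<nu> * HN N s - X\<^sup>2 - X * (l2 (u s))\<^sup>2 - l2 (err N (u s)) * (hh s + X)"
    using e f 2 3 by linarith
qed

lemma HN_measurable: "HN N \<in> borel_measurable (TI a b)"
  unfolding HN_def[abs_def] using cf_measurable[OF ab(1), of _ b] by measurable

lemma HN_integrable: "integrable (TI a b) (HN N)" and HN_tendsto: "(\<lambda>N. \<integral>s. HN N s \<partial>TI a b) \<longlonglongrightarrow> (\<integral>s. (hh s)\<^sup>2 \<partial>TI a b)"
proof -
  have HN0: "0 \<le> HN N s" for N s unfolding HN_def by (intro sum_nonneg) auto
  have b1: "AE s in TI a b. norm (HN N s) \<le> (hh s)\<^sup>2" for N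
    using good_times[OF ab(1), of b] AE_space[of "TI a b"]
  proof eventually_elim
    case (elim s)
    hence "HN N s \<le> (l2 (gd (u s)))\<^sup>2" by (intro good) auto
    thus ?case using elim HN0 by simp
  qed
  have l: "AE s in TI a b. (\<lambda>N. HN N s) \<longlonglongrightarrow> (hh s)\<^sup>2"
    using good_times[OF ab(1), of b] AE_space[of "TI a b"]
  proof eventually_elim
    case (elim s)
    hence "(\<lambda>N. HN N s) \<longlonglongrightarrow> (l2 (gd (u s)))\<^sup>2" by (intro good) auto
    thus ?case using elim by simp
  qed
  have hm: "(\<lambda>s. (hh s)\<^sup>2) \<in> borel_measurable (TI a b)" using hh_measurable by measurable
  show "integrable (TI a b) (HN N)"
    by (rule Bochner_Integration.integrable_bound[OF hh_sq_integrable(1)[OF ab(1)] HN_measurable]) (use b1[of N] in \<open>eventually_elim, auto\<close>)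
  show "(\<lambda>N. \<integral>s. HN N s \<partial>TI a b) \<longlonglongrightarrow> (\<integral>s. (hh s)\<^sup>2 \<partial>TI a b)"
    by (rule integral_dominated_convergence[OF hm HN_measurable hh_sq_integrable(1)[OF ab(1)] l b1])
qed

lemma energy_identity_N:
  "(\<Sum>k\<in>FN N. (v b k)\<^sup>2) = (\<Sum>k\<in>FN N. (cf (u a) k)\<^sup>2) + (\<integral>s. (\<Sum>k\<in>FN N. 2 * v s k * R s k) \<partial>TI a b)"
  "integrable (TI a b) (\<lambda>s. \<Sum>k\<in>FN N. 2 * v s k * R s k)"
proof -
  have "prim a b (\<lambda>t. (v t k)\<^sup>2) (\<lambda>s. (2 * v s k) * R s k)" for k
    by (rule prim_chain[OF prim_v, of "\<lambda>x. x\<^sup>2" "\<lambda>x. 2 * x"]) (auto intro!: derivative_eq_intros continuous_intros)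
  hence p: "prim a b (\<lambda>t. \<Sum>k\<in>FN N. (v t k)\<^sup>2) (\<lambda>s. \<Sum>k\<in>FN N. 2 * v s k * R s k)" by (intro prim_sum)
  show "integrable (TI a b) (\<lambda>s. \<Sum>k\<in>FN N. 2 * v s k * R s k)" by (rule primD(1)[OF p])
  show "(\<Sum>k\<in>FN N. (v b k)\<^sup>2) = (\<Sum>k\<in>FN N. (cf (u a) k)\<^sup>2) + (\<integral>s. (\<Sum>k\<in>FN N. 2 * v s k * R s k) \<partial>TI a b)"
    using primD(2)[OF p, of b] ab by (simp add: v_a)
qed

lemma energy_bounds_N:
  "(\<Sum>k\<in>FN N. (v b k)\<^sup>2) \<le> (\<Sum>k\<in>FN N. (cf (u a) k)\<^sup>2) - \<nu> * (\<integral>s. HN N s \<partial>TI a b) + X\<^sup>2 * (b - a)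
     + X * (\<integral>s. (l2 (u s))\<^sup>2 \<partial>TI a b) + (\<integral>s. l2 (err N (u s)) * (hh s + X) \<partial>TI a b)"
  "(\<Sum>k\<in>FN N. (v b k)\<^sup>2) \<ge> (\<Sum>k\<in>FN N. (cf (u a) k)\<^sup>2) - 3 * \<nu> * (\<integral>s. HN N s \<partial>TI a b) - X\<^sup>2 * (b - a)
     - X * (\<integral>s. (l2 (u s))\<^sup>2 \<partial>TI a b) - (\<integral>s. l2 (err N (u s)) * (hh s + X) \<partial>TI a b)"
proof -
  have i: "integrable (TI a b) (HN N)" "integrable (TI a b) (\<lambda>s. (l2 (u s))\<^sup>2)" "integrable (TI a b) (\<lambda>s. l2 (err N (u s)) * (hh s + X))"
    by (rule HN_integrable, rule l2u_integrable[OF ab(1)], rule err_integrals(1)[OF ab(1) X0])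
  have "(\<integral>s. (\<Sum>k\<in>FN N. 2 * v s k * R s k) \<partial>TI a b) \<le> (\<integral>s. - \<nu> * HN N s + X\<^sup>2 + X * (l2 (u s))\<^sup>2 + l2 (err N (u s)) * (hh s + X) \<partial>TI a b)"
  proof (rule integral_mono_AE[OF energy_identity_N(2)])
    show "AE s in TI a b. (\<Sum>k\<in>FN N. 2 * v s k * R s k) \<le> - \<nu> * HN N s + X\<^sup>2 + X * (l2 (u s))\<^sup>2 + l2 (err N (u s)) * (hh s + X)"
      using good_times[OF ab(1), of b] AE_space[of "TI a b"]
    proof eventually_elim
      case (elim s) thus ?case by (intro energy_density_bounds(1)) auto
    qed
  qed (use i in auto)
  also have "\<dots> = - \<nu> * (\<integral>s. HN N s \<partial>TI a b) + X\<^sup>2 * (b - a)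
     + X * (\<integral>s. (l2 (u s))\<^sup>2 \<partial>TI a b) + (\<integral>s. l2 (err N (u s)) * (hh s + X) \<partial>TI a b)"
    using i measure_TI[OF ab(2)] by simp
  finally show "(\<Sum>k\<in>FN N. (v b k)\<^sup>2) \<le> (\<Sum>k\<in>FN N. (cf (u a) k)\<^sup>2) - \<nu> * (\<integral>s. HN N s \<partial>TI a b) + X\<^sup>2 * (b - a)
     + X * (\<integral>s. (l2 (u s))\<^sup>2 \<partial>TI a b) + (\<integral>s. l2 (err N (u s)) * (hh s + X) \<partial>TI a b)"
    unfolding energy_identity_N(1) by linarith
  have "(\<integral>s. - 3 * \<nu> * HN N s - X\<^sup>2 - X * (l2 (u s))\<^sup>2 - l2 (err N (u s)) * (hh s + X) \<partial>TI a b) \<le> (\<integral>s. (\<Sum>k\<in>FN N. 2 * v s k * R s k) \<partial>TI a b)"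
  proof (rule integral_mono_AE[OF _ energy_identity_N(2)])
    show "AE s in TI a b. - 3 * \<nu> * HN N s - X\<^sup>2 - X * (l2 (u s))\<^sup>2 - l2 (err N (u s)) * (hh s + X) \<le> (\<Sum>k\<in>FN N. 2 * v s k * R s k)"
      using good_times[OF ab(1), of b] AE_space[of "TI a b"]
    proof eventually_elim
      case (elim s) thus ?case by (intro energy_density_bounds(2)) auto
    qed
  qed (use i in auto)
  moreover have "(\<integral>s. - 3 * \<nu> * HN N s - X\<^sup>2 - X * (l2 (u s))\<^sup>2 - l2 (err N (u s)) * (hh s + X) \<partial>TI a b)
    = - 3 * \<nu> * (\<integral>s. HN N s \<partial>TI a b) - X\<^sup>2 * (b - a)
     - X * (\<integral>s. (l2 (u s))\<^sup>2 \<partial>TI a b) - (\<integral>s. l2 (err N (u s)) * (hh s + X) \<partial>TI a b)"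
    using i measure_TI[OF ab(2)] by simp
  ultimately show "(\<Sum>k\<in>FN N. (v b k)\<^sup>2) \<ge> (\<Sum>k\<in>FN N. (cf (u a) k)\<^sup>2) - 3 * \<nu> * (\<integral>s. HN N s \<partial>TI a b) - X\<^sup>2 * (b - a)
     - X * (\<integral>s. (l2 (u s))\<^sup>2 \<partial>TI a b) - (\<integral>s. l2 (err N (u s)) * (hh s + X) \<partial>TI a b)"
    unfolding energy_identity_N(1) by linarith
qed

text \<open>\<open>V\<close> is the squared \<open>L\<^sup>2\<close> norm of the solution minus the noise increment since time \<open>a\<close>.\<close>
lemma energy_estimate:
  obtains V where "0 \<le> V"
    "V + \<nu> * (\<integral>s. (hh s)\<^sup>2 \<partial>TI a b) \<le> (l2 (u a))\<^sup>2 + X\<^sup>2 * (b - a) + X * (\<integral>s. (l2 (u s))\<^sup>2 \<partial>TI a b)"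
    "(l2 (u a))\<^sup>2 \<le> V + 3 * \<nu> * (\<integral>s. (hh s)\<^sup>2 \<partial>TI a b) + X\<^sup>2 * (b - a) + X * (\<integral>s. (l2 (u s))\<^sup>2 \<partial>TI a b)"
    "l2 (u b) \<le> sqrt V + X" "sqrt V \<le> l2 (u b) + X"
    "\<forall>k. \<bar>p k b - p k a\<bar> \<le> l2 (u b) + sqrt V"
proof -
  define W where "W N = (\<Sum>k\<in>FN N. (v b k)\<^sup>2)" for N
  have b0: "0 \<le> b" using ab by simp
  have Wl2: "sqrt (W N) = l2 (TS N (v b))" for N unfolding W_def l2_TS[symmetric] by simp
  have vTS: "TS N (v b) x = PN N (u b) x - TS N (q b) x" for N x by (simp add: uN_eq)
  have up: "sqrt (W N) \<le> l2 (u b) + X" for N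
  proof -
    have "sqrt (W N) = l2 (\<lambda>x. PN N (u b) x - TS N (q b) x)" unfolding Wl2 by (simp add: vTS[abs_def])
    also have "\<dots> \<le> l2 (PN N (u b)) + l2 (TS N (q b))" by (rule l2_triangle_diff) auto
    also have "\<dots> \<le> l2 (u b) + X" using l2_PN_le[OF sq_u[OF b0], of N] q_l2[of b N] ab by simp
    finally show ?thesis .
  qed
  have dn: "l2 (PN N (u b)) \<le> sqrt (W N) + X" for N
  proof -
    have "l2 (PN N (u b)) = l2 (\<lambda>x. TS N (v b) x + TS N (q b) x)" by (simp add: uN_eq[abs_def])
    also have "\<dots> \<le> l2 (TS N (v b)) + l2 (TS N (q b))" by (rule l2_triangle) auto
    finally show ?thesis using q_l2[of b N] ab unfolding Wl2 by simp
  qed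
  have inc: "incseq W" unfolding W_def by (intro monoI sum_mono2) auto
  have W0: "0 \<le> W N" for N unfolding W_def by (intro sum_nonneg) auto
  have Wb: "W N \<le> (l2 (u b) + X)\<^sup>2" for N
    using power_mono[OF up[of N], of 2] W0[of N] by simp
  \<comment> \<open>Partial sums that increase and are bounded: the squared norm of the noise-free
    part is obtained as a limit of numbers, without constructing a limit function.\<close>
  obtain V where V: "W \<longlonglongrightarrow> V" "\<And>N. W N \<le> V"
    using incseq_convergent[OF inc, of "(l2 (u b) + X)\<^sup>2"] Wb by (auto)
  have V0: "0 \<le> V" using W0[of 0] V(2)[of 0] by linarith
  have sV: "(\<lambda>N. sqrt (W N)) \<longlonglongrightarrow> sqrt V" by (rule tendsto_real_sqrt[OF V(1)])
  have l2l: "(\<lambda>N. l2 (PN N (u b))) \<longlonglongrightarrow> l2 (u b)"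
    using tendsto_real_sqrt[OF Parseval[OF sq_u[OF b0]]] unfolding l2_PN[symmetric] by simp
  have e: "(\<lambda>N. \<integral>s. l2 (err N (u s)) * (hh s + X) \<partial>TI a b) \<longlonglongrightarrow> 0" by (rule err_integrals(2)[OF ab(1) X0])
  have pa: "(\<lambda>N. \<Sum>k\<in>FN N. (cf (u a) k)\<^sup>2) \<longlonglongrightarrow> (l2 (u a))\<^sup>2" by (rule Parseval[OF sq_u[OF ab(1)]])
  have A: "V \<le> (l2 (u a))\<^sup>2 - \<nu> * (\<integral>s. (hh s)\<^sup>2 \<partial>TI a b) + X\<^sup>2 * (b - a)
     + X * (\<integral>s. (l2 (u s))\<^sup>2 \<partial>TI a b) + 0"
  proof (rule LIMSEQ_le[OF V(1)])
    show "(\<lambda>N. (\<Sum>k\<in>FN N. (cf (u a) k)\<^sup>2) - \<nu> * (\<integral>s. HN N s \<partial>TI a b) + X\<^sup>2 * (b - a)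
     + X * (\<integral>s. (l2 (u s))\<^sup>2 \<partial>TI a b) + (\<integral>s. l2 (err N (u s)) * (hh s + X) \<partial>TI a b)) \<longlonglongrightarrow> (l2 (u a))\<^sup>2 - \<nu> * (\<integral>s. (hh s)\<^sup>2 \<partial>TI a b) + X\<^sup>2 * (b - a)
     + X * (\<integral>s. (l2 (u s))\<^sup>2 \<partial>TI a b) + 0"
      by (intro tendsto_intros pa HN_tendsto e)
  qed (use energy_bounds_N(1) in \<open>auto simp: W_def\<close>)
  have B: "(l2 (u a))\<^sup>2 - 3 * \<nu> * (\<integral>s. (hh s)\<^sup>2 \<partial>TI a b) - X\<^sup>2 * (b - a)
     - X * (\<integral>s. (l2 (u s))\<^sup>2 \<partial>TI a b) - 0 \<le> V"
  proof (rule LIMSEQ_le[OF _ V(1)])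
    show "(\<lambda>N. (\<Sum>k\<in>FN N. (cf (u a) k)\<^sup>2) - 3 * \<nu> * (\<integral>s. HN N s \<partial>TI a b) - X\<^sup>2 * (b - a)
     - X * (\<integral>s. (l2 (u s))\<^sup>2 \<partial>TI a b) - (\<integral>s. l2 (err N (u s)) * (hh s + X) \<partial>TI a b)) \<longlonglongrightarrow> (l2 (u a))\<^sup>2 - 3 * \<nu> * (\<integral>s. (hh s)\<^sup>2 \<partial>TI a b) - X\<^sup>2 * (b - a)
     - X * (\<integral>s. (l2 (u s))\<^sup>2 \<partial>TI a b) - 0"
      by (intro tendsto_intros pa HN_tendsto e)
  qed (use energy_bounds_N(2) in \<open>auto simp: W_def\<close>)
  show ?thesis
  proof (rule that[OF V0])
    show "l2 (u b) \<le> sqrt V + X"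
      by (rule LIMSEQ_le[OF l2l tendsto_add[OF sV tendsto_const]]) (use dn in auto)
    show "sqrt V \<le> l2 (u b) + X"
      by (rule LIMSEQ_le_const2[OF sV]) (use up in auto)
    show "\<forall>k. \<bar>p k b - p k a\<bar> \<le> l2 (u b) + sqrt V"
    proof
    fix k
    \<comment> \<open>The noise increment in mode k is the difference of the coefficients of u(b)
      and of the noise-free part, each bounded by the corresponding norm. This is what forces the
      solution to follow a displacement.\<close>
    have "k \<in> FN (nat \<bar>k\<bar>)" by auto
    hence k1: "(v b k)\<^sup>2 \<le> W (nat \<bar>k\<bar>)" and k2: "(cf (u b) k)\<^sup>2 \<le> (\<Sum>j\<in>FN (nat \<bar>k\<bar>). (cf (u b) j)\<^sup>2)"
      unfolding W_def by (auto intro: member_le_sum[where f="\<lambda>j. (v b j)\<^sup>2"] member_le_sum[where f="\<lambda>j. (cf (u b) j)\<^sup>2"])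
    have "(v b k)\<^sup>2 \<le> V" using k1 V(2) by (rule order_trans)
    hence "\<bar>v b k\<bar> \<le> sqrt V" by (simp add: real_le_rsqrt)
    moreover have "(cf (u b) k)\<^sup>2 \<le> (l2 (u b))\<^sup>2" using k2 Bessel[OF sq_u[OF b0]] by (rule order_trans)
    hence "\<bar>cf (u b) k\<bar> \<le> l2 (u b)" by (simp add: abs_le_square_iff[symmetric])
    ultimately show "\<bar>p k b - p k a\<bar> \<le> l2 (u b) + sqrt V" unfolding v_def q_def by linarith
    qed
  qed (use A B in linarith)+
qed

end

section \<open>Cole--Hopf estimate of the time integral of the energy\<close>

text \<open>The periodic primitive of mean zero of \<open>bas k\<close>, that is the potential of
  one mode. At k = 0 division by zero yields 0, which suits fields without constant mode.\<close>

definition Ek :: "int \<Rightarrow> real \<Rightarrow> real" where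
  "Ek k x = - bas (- k) x / (2 * pi * real_of_int k)"

lemma Ek_0 [simp]: "Ek 0 x = 0" by (simp add: Ek_def)

lemma Ek_deriv: "k \<noteq> 0 \<Longrightarrow> (Ek k has_real_derivative bas k x) (at x)"
proof -
  assume k: "k \<noteq> 0"
  have "((\<lambda>x. - bas (- k) x / (2 * pi * real_of_int k)) has_real_derivative - (2 * pi * real_of_int (- k) * bas (- (- k)) x) / (2 * pi * real_of_int k)) (at x)"
    by (intro DERIV_cdivide DERIV_minus bas_deriv)
  thus ?thesis using k unfolding Ek_def[abs_def] by simp
qed

lemma continuous_Ek [continuous_intros]: "continuous_on A (Ek k)"
  unfolding Ek_def[abs_def] by (cases "k = 0") (auto intro!: continuous_intros)

lemma Ek_measurable: "Ek k \<in> borel_measurable UI"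
  by (intro measurable_UI borel_measurable_continuous_onI continuous_Ek)

lemma Ek_abs: "\<bar>Ek k x\<bar> \<le> (sqrt 2 / (2 * pi)) * (1 / \<bar>real_of_int k\<bar>)"
  using bas_bound[of "- k" x] by (cases "k = 0") (auto simp: Ek_def abs_mult divide_right_mono)

lemma Ek_abs_le_1: "\<bar>Ek k x\<bar> \<le> 1"
proof (cases "k = 0")
  case False
  hence "1 \<le> \<bar>real_of_int k\<bar>" by linarith
  hence "1 / \<bar>real_of_int k\<bar> \<le> 1" by simp
  moreover have "sqrt 2 / (2 * pi) \<le> 1"
  proof -
    have "sqrt 2 \<le> 2" by (simp add: real_le_lsqrt)
    thus ?thesis using pi_gt3 by simp
  qed
  ultimately have "(sqrt 2 / (2 * pi)) * (1 / \<bar>real_of_int k\<bar>) \<le> 1 * 1" by (intro mult_mono) auto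
  thus ?thesis using Ek_abs[of k x] by linarith
qed simp

text \<open>The squares are at most 1/4 of 1/k^2, whose sum is at most 4. With Cauchy-Schwarz the
  potential of a field is bounded by its L2 norm, as stated in \<open>Ek_sum_bound\<close>.\<close>

lemma sum_Ek_sq: "(\<Sum>k\<in>FN N. (Ek k x)\<^sup>2) \<le> 1"
proof -
  have "(\<Sum>k\<in>FN N. (Ek k x)\<^sup>2) = (\<Sum>k\<in>FN N - {0}. (Ek k x)\<^sup>2)"
    by (rule sum.mono_neutral_right) auto
  also have "\<dots> \<le> (\<Sum>k\<in>FN N - {0}. (1 / 4) * (1 / (real_of_int k)\<^sup>2))"
  proof (rule sum_mono)
    fix k
    have "(Ek k x)\<^sup>2 = \<bar>Ek k x\<bar>\<^sup>2" by simp
    also have "\<dots> \<le> ((sqrt 2 / (2 * pi)) * (1 / \<bar>real_of_int k\<bar>))\<^sup>2" by (intro power_mono Ek_abs) simp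
    also have "\<dots> = (1 / (2 * pi\<^sup>2)) * (1 / (real_of_int k)\<^sup>2)" by (simp add: power_mult_distrib power_divide)
    also have "\<dots> \<le> (1/4) * (1 / (real_of_int k)\<^sup>2)"
    proof (rule mult_right_mono)
      have "3\<^sup>2 \<le> pi\<^sup>2" using pi_gt3 by (intro power_mono) auto
      thus "1 / (2 * pi\<^sup>2) \<le> 1 / 4" by (intro divide_left_mono) auto
    qed simp
    finally show "(Ek k x)\<^sup>2 \<le> (1 / 4) * (1 / (real_of_int k)\<^sup>2)" .
  qed
  also have "\<dots> = (1/4) * (\<Sum>k\<in>FN N - {0}. 1 / (real_of_int k)\<^sup>2)" by (simp only: sum_distrib_left)
  also have "\<dots> \<le> 1" using sum_inverse_squares_int[of N] by simp
  finally show ?thesis .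
qed

lemma Ek_sum_bound: "\<bar>\<Sum>k\<in>FN N. c k * Ek k x\<bar> \<le> l2 (TS N c)"
proof (rule power2_le_imp_le)
  have "(\<Sum>k\<in>FN N. c k * Ek k x)\<^sup>2 \<le> (\<Sum>k\<in>FN N. (c k)\<^sup>2) * (\<Sum>k\<in>FN N. (Ek k x)\<^sup>2)"
    by (rule Cauchy_Schwarz_ineq_sum)
  also have "\<dots> \<le> (\<Sum>k\<in>FN N. (c k)\<^sup>2) * 1" by (intro mult_left_mono sum_Ek_sq sum_nonneg) auto
  finally show "\<bar>\<Sum>k\<in>FN N. c k * Ek k x\<bar>\<^sup>2 \<le> (l2 (TS N c))\<^sup>2" by (simp add: l2_TS)
qed simp

lemma integral_Ek: "(\<integral>x. Ek k x \<partial>UI) = 0"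
proof (cases "k = 0")
  case False
  have "(\<integral>x. bas (- k) x * bas 0 x \<partial>UI) = 0" using False by (simp add: bas_orthonormal)
  hence "(\<integral>x. bas (- k) x \<partial>UI) = 0" by (simp add: bas_def)
  thus ?thesis by (simp add: Ek_def)
qed simp

section \<open>The Hamilton-Jacobi equation of the truncated potential\<close>

context burgers_window
begin

lemma v_l2: assumes "a \<le> t" "t \<le> b" shows "l2 (TS N (v t)) \<le> l2 (u t) + X"
proof -
  have t0: "0 \<le> t" using ab assms by simp
  have "TS N (v t) = (\<lambda>x. PN N (u t) x - TS N (q t) x)" by (rule ext) (simp add: uN_eq)
  hence "l2 (TS N (v t)) \<le> l2 (PN N (u t)) + l2 (TS N (q t))" using l2_triangle_diff[of "PN N (u t)" "TS N (q t)"] by simp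
  thus ?thesis using l2_PN_le[OF sq_u[OF t0], of N] q_l2[OF assms, of N] by linarith
qed

lemma v_0: "a \<le> t \<Longrightarrow> v t 0 = 0" using ab by (simp add: v_def q_def p0 cf0)

text \<open>Dominates the remainder l^2/2 + \<nu> l_x that the noise increment l leaves in the
  Hamilton-Jacobi equation, so that this remainder gets a sign.\<close>

definition \<kappa> :: real where "\<kappa> = X\<^sup>2 / 2 + \<nu> * X"
text \<open>The Cole-Hopf exponent: the product \<alpha> \<nu> = 1/2 lets the quadratic term cancel
  against the viscous one.\<close>

definition \<alpha> :: real where "\<alpha> = 1 / (2 * \<nu>)"
text \<open>The space mean of the potential. Half of the squared norm is the constant mode of u^2/2,
  which the functions \<open>Ek k\<close> cannot carry.\<close>

definition mm :: "real \<Rightarrow> real" where "mm t = (\<integral>s. \<kappa> - (l2 (u s))\<^sup>2 / 2 \<partial>TI a t)"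
text \<open>A potential of the noise-free truncated field. Removing the noise first makes it
  absolutely continuous in time at each x.\<close>

definition Z :: "nat \<Rightarrow> real \<Rightarrow> real \<Rightarrow> real" where "Z N t x = mm t + (\<Sum>k\<in>FN N. v t k * Ek k x)"
definition W :: "nat \<Rightarrow> real \<Rightarrow> real \<Rightarrow> real" where "W N t x = exp (- \<alpha> * Z N t x)"
definition zd :: "nat \<Rightarrow> real \<Rightarrow> real \<Rightarrow> real" where
  "zd N s x = \<kappa> - (l2 (u s))\<^sup>2 / 2 + (\<Sum>k\<in>FN N. R s k * Ek k x)"

lemma \<alpha>_pos: "0 < \<alpha>" using nu by (simp add: \<alpha>_def)

lemma prim_mm: "prim a b mm (\<lambda>s. \<kappa> - (l2 (u s))\<^sup>2 / 2)"
  by (rule primI) (use l2u_integrable[OF ab(1)] in \<open>auto simp: mm_def integral_TI_refl\<close>)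

lemma prim_Z: "prim a b (\<lambda>t. Z N t x) (\<lambda>s. zd N s x)"
proof -
  have "prim a b (\<lambda>t. Ek k x * v t k) (\<lambda>s. Ek k x * R s k)" for k by (rule prim_cmult[OF prim_v])
  hence "prim a b (\<lambda>t. v t k * Ek k x) (\<lambda>s. R s k * Ek k x)" for k by (simp add: mult.commute)
  thus ?thesis unfolding Z_def zd_def by (intro prim_add prim_mm prim_sum)
qed

lemma prim_W: "prim a b (\<lambda>t. W N t x) (\<lambda>s. - \<alpha> * W N s x * zd N s x)"
proof -
  have "((\<lambda>y. exp (- \<alpha> * y)) has_real_derivative (- \<alpha> * exp (- \<alpha> * y))) (at y)" for y
    by (auto intro!: derivative_eq_intros)
  from prim_chain[OF prim_Z this, of N x] show ?thesis
    unfolding W_def by (simp add: continuous_intros)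
qed

lemma W_deriv_x:
  assumes "a \<le> t" shows "(W N t has_real_derivative - \<alpha> * W N t x * TS N (v t) x) (at x)"
proof -
  have "((\<lambda>x. v t k * Ek k x) has_real_derivative v t k * bas k x) (at x)" for k
    by (cases "k = 0") (use v_0[OF assms] Ek_deriv[of k x] in \<open>auto intro!: derivative_eq_intros\<close>)
  hence "((\<lambda>x. \<Sum>k\<in>FN N. v t k * Ek k x) has_real_derivative TS N (v t) x) (at x)"
    unfolding TS_def by (rule DERIV_sum)
  hence "(Z N t has_real_derivative TS N (v t) x) (at x)"
    unfolding Z_def[abs_def] by (rule DERIV_cong[OF DERIV_add[OF DERIV_const]]) simp
  thus ?thesis unfolding W_def[abs_def] by (auto intro!: derivative_eq_intros)
qed

lemma continuous_W: "continuous_on A (W N t)"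
  unfolding W_def[abs_def] Z_def by (intro continuous_intros)

lemma W_periodic: "W N t 1 = W N t 0"
  unfolding W_def Z_def Ek_def using bas_periodic[of _ 0] by simp

text \<open>The bound may depend on the path and on \<nu>: it only multiplies the truncation defect,
  which tends to zero.\<close>

lemma W_bounded: "\<exists>K\<ge>0. \<forall>N. \<forall>t\<in>{a..b}. \<forall>x. W N t x \<le> K"
proof -
  obtain B where B: "\<And>t. t \<in> {0..b} \<Longrightarrow> l2 (u t) \<le> B" using bdd[of b] ab by (meson order_trans)
  have "bounded (mm ` {a..b})" by (intro compact_imp_bounded compact_continuous_image prim_continuous[OF prim_mm]) auto
  then obtain C where C: "\<forall>y\<in>mm ` {a..b}. norm y \<le> C" unfolding bounded_iff by blast
  have "W N t x \<le> exp (\<alpha> * (C + (B + X)))" if t: "t \<in> {a..b}" for N t x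
  proof -
    have "\<bar>mm t\<bar> \<le> C" using C t by auto
    moreover have "\<bar>\<Sum>k\<in>FN N. v t k * Ek k x\<bar> \<le> B + X"
      using Ek_sum_bound[where N=N and c="v t" and x=x] v_l2[of t N] B[of t] t ab by force
    ultimately have "- Z N t x \<le> C + (B + X)" unfolding Z_def by linarith
    hence "\<alpha> * (- Z N t x) \<le> \<alpha> * (C + (B + X))" using \<alpha>_pos by (intro mult_left_mono) auto
    thus ?thesis unfolding W_def by simp
  qed
  thus ?thesis by (intro exI[of _ "exp (\<alpha> * (C + (B + X)))"]) auto
qed

text \<open>The Hamilton-Jacobi equation of the truncated potential, with the truncation defect as
  its error term.\<close>

lemma zd_good:
  assumes s: "a \<le> s" "s \<le> b" and w: "weak_deriv (u s) g"
  shows "zd N s x = \<kappa> - ((PN N (u s) x)\<^sup>2 + err N (u s) x) / 2 + \<nu> * PN N g x"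
proof -
  define c where "c k = cf (\<lambda>x. (u s x)\<^sup>2) k" for k
  have c0: "c 0 = (l2 (u s))\<^sup>2" by (simp add: c_def cf_def bas_def l2_sq)
  have g0: "cf g 0 = 0" using weak_deriv_cf[OF w, of 0] by simp
  \<comment> \<open>At k = 0 both sides vanish; the conditional term cancels later against the half
    squared norm in \<open>zd\<close>.\<close>
  have tm: "R s k * Ek k x = - ((c (- k) / 2 - \<nu> * cf g (- k)) * bas (- k) x) + (if k = 0 then (l2 (u s))\<^sup>2 / 2 else 0)" for k
  proof (cases "k = 0")
    case True thus ?thesis using c0 g0 by (simp add: bas_def)
  next
    case False
    have "R s k = (2 * pi * real_of_int k) * (c (- k) / 2 - \<nu> * cf g (- k))"
      unfolding R_def cR_def weak_deriv_cf[OF w] c_def by (simp add: power2_eq_square algebra_simps)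
    thus ?thesis using False by (simp add: Ek_def)
  qed
  have "(\<Sum>k\<in>FN N. R s k * Ek k x) = (\<Sum>k\<in>FN N. - ((c (- k) / 2 - \<nu> * cf g (- k)) * bas (- k) x)) + (l2 (u s))\<^sup>2 / 2"
    unfolding tm sum.distrib by simp
  also have "(\<Sum>k\<in>FN N. - ((c (- k) / 2 - \<nu> * cf g (- k)) * bas (- k) x)) = (\<Sum>k\<in>FN N. - ((c k / 2 - \<nu> * cf g k) * bas k x))"
    by (rule sum.reindex_bij_witness[of _ uminus uminus]) auto
  also have "\<dots> = - PN N (\<lambda>x. (u s x)\<^sup>2) x / 2 + \<nu> * PN N g x"
    unfolding PN_def c_def[symmetric] by (simp add: sum_subtractf sum_distrib_left sum_divide_distrib left_diff_distrib mult.assoc sum_negf)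
  finally show ?thesis unfolding zd_def err_def by simp
qed

text \<open>Apart from the noise remainder, which has a sign, and the defect, the integrand is an
  exact space derivative and integrates to zero over the period.\<close>

lemma space_integral_bound:
  assumes s: "a \<le> s" "s \<le> b" and w: "weak_deriv (u s) g" and K: "\<And>x. W N s x \<le> K" "0 \<le> K"
  shows "(\<integral>x. - \<alpha> * W N s x * zd N s x \<partial>UI) \<le> \<alpha> * K * l2 (err N (u s))"
proof -
  define V where "V = TS N (v s)"
  define V' where "V' = TS' N (v s)"
  define l where "l = TS N (q s)"
  define l' where "l' = TS' N (q s)"
  \<comment> \<open>The derivative of W (- \<nu> V - 2 \<nu> l). Differentiating W brings down -
    \<alpha> V, and \<alpha> \<nu> = 1/2 produces V^2/2; the part 2 \<nu> l is chosen to produce the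
    mixed term V l, at the price of a term in l', which \<open>X\<close> controls.\<close>
  define G' where "G' x = W N s x * ((V x)\<^sup>2 / 2 + V x * l x - \<nu> * V' x - 2 * \<nu> * l' x)" for x
  have cE: "continuous_on UNIV (err N (u s))" unfolding err_def[abs_def] by (intro continuous_intros)
  have cc: "continuous_on UNIV V" "continuous_on UNIV V'" "continuous_on UNIV l" "continuous_on UNIV l'" "continuous_on UNIV (W N s)"
    unfolding V_def V'_def l_def l'_def by (intro continuous_intros continuous_W)+
  have cG: "continuous_on UNIV G'" unfolding G'_def[abs_def] by (intro continuous_intros cc) simp
  have "(\<integral>x. G' x \<partial>UI) = W N s 1 * (- \<nu> * V 1 - 2 * \<nu> * l 1) - W N s 0 * (- \<nu> * V 0 - 2 * \<nu> * l 0)"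
  proof (rule integral_UI_FTC[OF _ cG])
    fix x
    have d: "(V has_real_derivative V' x) (at x)" "(l has_real_derivative l' x) (at x)"
      unfolding V_def V'_def l_def l'_def by (rule TS_deriv)+
    have "((\<lambda>x. W N s x * (- \<nu> * V x - 2 * \<nu> * l x)) has_real_derivative
       (- \<alpha> * W N s x * V x) * (- \<nu> * V x - 2 * \<nu> * l x) + (- \<nu> * V' x - 2 * \<nu> * l' x) * W N s x) (at x)"
      unfolding V_def[symmetric]
      by (intro DERIV_mult DERIV_diff DERIV_cmult d) (use W_deriv_x[OF s(1), of N x] in \<open>simp add: V_def\<close>)
    moreover have "(- \<alpha> * W N s x * V x) * (- \<nu> * V x - 2 * \<nu> * l x) + (- \<nu> * V' x - 2 * \<nu> * l' x) * W N s x = G' x"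
    proof -
      have "\<alpha> * \<nu> = 1 / 2" using nu by (simp add: \<alpha>_def)
      have "(- \<alpha> * W N s x * V x) * (- \<nu> * V x - 2 * \<nu> * l x) = (\<alpha> * \<nu>) * (W N s x * (V x * V x + 2 * V x * l x))"
        by (simp add: algebra_simps)
      also have "\<dots> = W N s x * ((V x)\<^sup>2 / 2 + V x * l x)" unfolding \<open>\<alpha> * \<nu> = 1 / 2\<close> by (simp add: power2_eq_square algebra_simps)
      finally show ?thesis unfolding G'_def by (simp add: algebra_simps)
    qed
    ultimately show "((\<lambda>x. W N s x * (- \<nu> * V x - 2 * \<nu> * l x)) has_real_derivative G' x) (at x)" by simp
  qed
  also have "\<dots> = 0" using W_periodic[of N s] unfolding V_def l_def by (simp add: TS_periodic)
  finally have G0: "(\<integral>x. G' x \<partial>UI) = 0" .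
  have pt: "- \<alpha> * W N s x * zd N s x \<le> \<alpha> * G' x + \<alpha> * K * \<bar>err N (u s) x\<bar>" for x
  proof -
    have PNg: "PN N g x = V' x + l' x" using good(1)[OF s w, of N x] by (simp add: V'_def l'_def v_def[abs_def] TS'_diff)
    have PNu: "PN N (u s) x = V x + l x" by (simp add: uN_eq V_def l_def)
    have W0: "0 \<le> W N s x" by (simp add: W_def)
    have "- \<alpha> * W N s x * zd N s x = \<alpha> * G' x + \<alpha> * (W N s x * ((l x)\<^sup>2 / 2 + \<nu> * l' x - \<kappa>)) + \<alpha> * (W N s x * (err N (u s) x / 2))"
      unfolding zd_good[OF s w] PNg PNu G'_def by (simp add: power2_eq_square algebra_simps add_divide_distrib)
    moreover have "\<alpha> * (W N s x * ((l x)\<^sup>2 / 2 + \<nu> * l' x - \<kappa>)) \<le> 0"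
    proof -
      have "(l x)\<^sup>2 \<le> X\<^sup>2" using l_bound[OF s, of N x] unfolding l_def by (simp add: abs_le_square_iff[symmetric] X0)
      moreover have "l' x \<le> X" using l'_bound[OF s, of N x] unfolding l'_def by linarith
      hence "\<nu> * l' x \<le> \<nu> * X" using nu by (intro mult_left_mono) auto
      ultimately have "(l x)\<^sup>2 / 2 + \<nu> * l' x - \<kappa> \<le> 0" unfolding \<kappa>_def by linarith
      thus ?thesis using W0 \<alpha>_pos by (intro mult_nonneg_nonpos) auto
    qed
    moreover have "\<alpha> * (W N s x * (err N (u s) x / 2)) \<le> \<alpha> * K * \<bar>err N (u s) x\<bar>"
    proof -
      have "W N s x * (err N (u s) x / 2) \<le> K * \<bar>err N (u s) x\<bar>"
      proof -
        have "W N s x * (err N (u s) x / 2) \<le> W N s x * \<bar>err N (u s) x\<bar>" using W0 by (intro mult_left_mono) auto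
        also have "\<dots> \<le> K * \<bar>err N (u s) x\<bar>" by (intro mult_right_mono K) auto
        finally show ?thesis .
      qed
      thus ?thesis using \<alpha>_pos by (simp add: mult.assoc)
    qed
    ultimately show ?thesis by linarith
  qed
  have cz: "continuous_on UNIV (zd N s)" unfolding zd_def[abs_def] by (intro continuous_intros)
  have "(\<integral>x. - \<alpha> * W N s x * zd N s x \<partial>UI) \<le> (\<integral>x. \<alpha> * G' x + \<alpha> * K * \<bar>err N (u s) x\<bar> \<partial>UI)"
    by (intro integral_mono pt integrable_UI_continuous continuous_intros cG cE cz cc)
  also have "\<dots> = \<alpha> * (\<integral>x. G' x \<partial>UI) + \<alpha> * K * (\<integral>x. \<bar>err N (u s) x\<bar> \<partial>UI)"
    using integrable_UI_continuous[OF cG] integrable_UI_continuous[OF cE] by simp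
  also have "\<dots> \<le> \<alpha> * K * l2 (err N (u s))"
    using L1_le_l2[OF sqint_err] \<alpha>_pos K(2) unfolding G0 by (auto intro!: mult_left_mono)
  finally show ?thesis .
qed

text \<open>Cole--Hopf: for the noise-free part, \<open>\<integral> exp (- Z / (2 \<nu>))\<close> is conserved along the Hamilton--Jacobi equation, so the mean
  of the potential cannot fall below its initial minimum, while it decreases at rate half the energy.\<close>
lemma L2_time_integral:
  "(\<integral>s. (l2 (u s))\<^sup>2 \<partial>TI a b) \<le> 2 * l2 (u a) + (X\<^sup>2 + 2 * X) * (b - a)"
proof -
  obtain K where K: "0 \<le> K" "\<And>N t x. t \<in> {a..b} \<Longrightarrow> W N t x \<le> K" using W_bounded by auto
  have step: "exp (- \<alpha> * mm b) \<le> exp (\<alpha> * l2 (u a)) + \<alpha> * K * (\<integral>s. l2 (err N (u s)) \<partial>TI a b)" for N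
  proof -
    define f where "f s x = - \<alpha> * W N s x * zd N s x" for s x
    \<comment> \<open>An integrable majorant independent of x, so that the integrals over space and
      time may be exchanged.\<close>
    define w where "w s = \<alpha> * K * (\<bar>\<kappa>\<bar> + (l2 (u s))\<^sup>2 / 2 + (\<Sum>k\<in>FN N. \<bar>R s k\<bar>))" for s
    have fm: "(\<lambda>(s, x). f s x) \<in> borel_measurable (TI a b \<Otimes>\<^sub>M UI)"
    proof -
      have [measurable]: "mm \<in> borel_measurable (TI a b)" "(\<lambda>t. v t k) \<in> borel_measurable (TI a b)"
        "(\<lambda>s. R s k) \<in> borel_measurable (TI a b)" "(\<lambda>s. (l2 (u s))\<^sup>2) \<in> borel_measurable (TI a b)" "Ek k \<in> borel_measurable UI" for k
        by (auto intro: continuous_on_measurable_TI prim_continuous[OF prim_mm] prim_continuous[OF prim_v]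
              borel_measurable_integrable[OF R_integrable[OF ab(1)]] l2u_measurable[OF ab(1)] Ek_measurable)
      show ?thesis unfolding f_def W_def Z_def zd_def by measurable
    qed
    have wi: "integrable (TI a b) w" unfolding w_def
      using l2u_integrable[OF ab(1), of b] R_integrable[OF ab(1), of b] by (auto intro!: integrable_mult_right Bochner_Integration.integrable_add Bochner_Integration.integrable_sum)
    have fb: "\<bar>f s x\<bar> \<le> w s" if s: "s \<in> {a..b}" for s x
    proof -
      have "\<bar>zd N s x\<bar> \<le> \<bar>\<kappa>\<bar> + (l2 (u s))\<^sup>2 / 2 + (\<Sum>k\<in>FN N. \<bar>R s k\<bar>)"
      proof -
        have "\<bar>\<Sum>k\<in>FN N. R s k * Ek k x\<bar> \<le> (\<Sum>k\<in>FN N. \<bar>R s k * Ek k x\<bar>)" by (rule sum_abs)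
        also have "\<dots> \<le> (\<Sum>k\<in>FN N. \<bar>R s k\<bar>)"
        proof (rule sum_mono)
          fix k show "\<bar>R s k * Ek k x\<bar> \<le> \<bar>R s k\<bar>" using mult_left_mono[OF Ek_abs_le_1[of k x], of "\<bar>R s k\<bar>"] by (simp add: abs_mult)
        qed
        moreover have "0 \<le> (l2 (u s))\<^sup>2 / 2" by simp
        ultimately show ?thesis unfolding zd_def by linarith
      qed
      moreover have "0 \<le> W N s x" by (simp add: W_def)
      ultimately have "W N s x * \<bar>zd N s x\<bar> \<le> K * (\<bar>\<kappa>\<bar> + (l2 (u s))\<^sup>2 / 2 + (\<Sum>k\<in>FN N. \<bar>R s k\<bar>))"
        using K(2)[OF s, of N x] K(1) by (intro mult_mono) auto
      hence "\<alpha> * (W N s x * \<bar>zd N s x\<bar>) \<le> \<alpha> * (K * (\<bar>\<kappa>\<bar> + (l2 (u s))\<^sup>2 / 2 + (\<Sum>k\<in>FN N. \<bar>R s k\<bar>)))"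
        using \<alpha>_pos by (intro mult_left_mono) auto
      moreover have "\<bar>f s x\<bar> = \<alpha> * (W N s x * \<bar>zd N s x\<bar>)"
        using \<alpha>_pos \<open>0 \<le> W N s x\<close> by (simp add: f_def abs_mult)
      ultimately show ?thesis unfolding w_def by (simp add: mult.assoc)
    qed
    note F = Fubini_TI_UI[OF fm wi fb]
    have Wb: "W N b x = W N a x + (\<integral>s. f s x \<partial>TI a b)" for x
      using primD(2)[OF prim_W, of b N x] ab by (simp add: f_def)
    have iW: "integrable UI (W N t)" for t by (intro integrable_UI_continuous continuous_W)
    have "(\<integral>x. W N b x \<partial>UI) = (\<integral>x. W N a x \<partial>UI) + (\<integral>x. \<integral>s. f s x \<partial>TI a b \<partial>UI)"
      unfolding Wb using iW[of a] F(3) by (intro Bochner_Integration.integral_add) auto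
    also have "(\<integral>x. \<integral>s. f s x \<partial>TI a b \<partial>UI) = (\<integral>s. \<integral>x. f s x \<partial>UI \<partial>TI a b)" by (rule F(1))
    also have "\<dots> \<le> (\<integral>s. \<alpha> * K * l2 (err N (u s)) \<partial>TI a b)"
    proof (rule integral_mono_AE[OF F(2)])
      show "integrable (TI a b) (\<lambda>s. \<alpha> * K * l2 (err N (u s)))" using err_integrals(3)[OF ab(1) X0] by auto
      show "AE s in TI a b. (\<integral>x. f s x \<partial>UI) \<le> \<alpha> * K * l2 (err N (u s))"
        using good_times[OF ab(1), of b] AE_space[of "TI a b"]
      proof eventually_elim
        case (elim s) thus ?case unfolding f_def by (intro space_integral_bound K) auto
      qed
    qed
    also have "(\<integral>x. W N a x \<partial>UI) \<le> (\<integral>x. exp (\<alpha> * l2 (u a)) \<partial>UI)"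
    proof (rule integral_mono[OF iW])
      fix x
      have "- Z N a x \<le> l2 (u a)"
        using Ek_sum_bound[where N=N and c="v a" and x=x] l2_PN_le[OF sq_u[OF ab(1)], of N]
        unfolding Z_def mm_def integral_TI_refl v_a PN_TS by linarith
      hence "\<alpha> * (- Z N a x) \<le> \<alpha> * l2 (u a)" using \<alpha>_pos by (intro mult_left_mono) auto
      thus "W N a x \<le> exp (\<alpha> * l2 (u a))" unfolding W_def by simp
    qed auto
    finally have up: "(\<integral>x. W N b x \<partial>UI) \<le> exp (\<alpha> * l2 (u a)) + \<alpha> * K * (\<integral>s. l2 (err N (u s)) \<partial>TI a b)"
      using UI.prob_space by simp
    have iE: "integrable UI (\<lambda>x. \<Sum>k\<in>FN N. v b k * Ek k x)" by (intro integrable_UI_continuous continuous_intros)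
    \<comment> \<open>Jensen's inequality in the form exp y \<ge> 1 + y, as the oscillating part of
      the potential has mean zero.\<close>
    have "(\<integral>x. exp (- \<alpha> * mm b) * (1 - \<alpha> * (\<Sum>k\<in>FN N. v b k * Ek k x)) \<partial>UI) \<le> (\<integral>x. W N b x \<partial>UI)"
    proof (rule integral_mono)
      fix x
      have "1 - \<alpha> * (\<Sum>k\<in>FN N. v b k * Ek k x) \<le> exp (- \<alpha> * (\<Sum>k\<in>FN N. v b k * Ek k x))"
        using exp_ge_add_one_self[of "- \<alpha> * (\<Sum>k\<in>FN N. v b k * Ek k x)"] by simp
      hence "exp (- \<alpha> * mm b) * (1 - \<alpha> * (\<Sum>k\<in>FN N. v b k * Ek k x)) \<le> exp (- \<alpha> * mm b) * exp (- \<alpha> * (\<Sum>k\<in>FN N. v b k * Ek k x))"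
        by (intro mult_left_mono) auto
      also have "\<dots> = W N b x" unfolding W_def Z_def exp_add[symmetric] by (simp add: algebra_simps)
      finally show "exp (- \<alpha> * mm b) * (1 - \<alpha> * (\<Sum>k\<in>FN N. v b k * Ek k x)) \<le> W N b x" .
    qed (use iE iW in auto)
    moreover have "(\<integral>x. exp (- \<alpha> * mm b) * (1 - \<alpha> * (\<Sum>k\<in>FN N. v b k * Ek k x)) \<partial>UI) = exp (- \<alpha> * mm b)"
    proof -
      have "(\<integral>x. (\<Sum>k\<in>FN N. v b k * Ek k x) \<partial>UI) = 0"
        using integrable_UI_continuous[OF continuous_Ek] by (simp add: integral_Ek)
      thus ?thesis using iE UI.prob_space by simp
    qed
    ultimately show ?thesis using up by linarith
  qed
  have "(\<lambda>N. exp (\<alpha> * l2 (u a)) + \<alpha> * K * (\<integral>s. l2 (err N (u s)) \<partial>TI a b)) \<longlonglongrightarrow> exp (\<alpha> * l2 (u a)) + \<alpha> * K * 0"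
    by (intro tendsto_intros err_integrals(4)[OF ab(1) X0])
  hence "exp (- \<alpha> * mm b) \<le> exp (\<alpha> * l2 (u a)) + \<alpha> * K * 0"
    by (rule LIMSEQ_le_const) (use step in auto)
  hence "\<alpha> * (- mm b) \<le> \<alpha> * l2 (u a)" by simp
  hence "- mm b \<le> l2 (u a)" using \<alpha>_pos by (simp only: mult_le_cancel_left_pos)
  moreover have "mm b = \<kappa> * (b - a) - (\<integral>s. (l2 (u s))\<^sup>2 \<partial>TI a b) / 2"
    unfolding mm_def using l2u_integrable[OF ab(1), of b] measure_TI[OF ab(2)] by simp
  moreover have "2 * (\<kappa> * (b - a)) \<le> (X\<^sup>2 + 2 * X) * (b - a)"
  proof -
    have "\<nu> * X \<le> 1 * X" using nu X0 by (intro mult_right_mono) auto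
    hence "2 * \<kappa> \<le> X\<^sup>2 + 2 * X" unfolding \<kappa>_def by simp
    hence "(2 * \<kappa>) * (b - a) \<le> (X\<^sup>2 + 2 * X) * (b - a)" using ab by (intro mult_right_mono) auto
    thus ?thesis by (simp add: mult.assoc)
  qed
  ultimately show ?thesis by linarith
qed

end

section \<open>Pathwise bounds for the dissipation\<close>

lemma power_le_1_plus_4: "0 \<le> x \<Longrightarrow> i \<le> 4 \<Longrightarrow> x ^ i \<le> 1 + x ^ 4" for x :: real
proof -
  assume x: "0 \<le> x" "i \<le> 4"
  show ?thesis
  proof (cases "x \<le> 1")
    case True
    hence "x ^ i \<le> 1" using x by (simp add: power_le_one)
    thus ?thesis using x by (simp add: add_increasing2)
  next
    case False
    hence "x ^ i \<le> x ^ 4" using x by (intro power_increasing) auto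
    thus ?thesis by simp
  qed
qed

context burgers_path
begin

definition noise_le :: "real \<Rightarrow> real \<Rightarrow> real \<Rightarrow> bool" where
  "noise_le a b X \<longleftrightarrow> (\<forall>t N. a \<le> t \<longrightarrow> t \<le> b \<longrightarrow> (\<Sum>k\<in>FN N. 2 * sqrt 2 * pi * \<bar>real_of_int k\<bar> * \<bar>p k t - p k a\<bar>) \<le> X)"

definition Q :: "real \<Rightarrow> real \<Rightarrow> real" where "Q a b = (\<integral>s. (l2 (u s))\<^sup>2 \<partial>TI a b)"
definition Dh :: "real \<Rightarrow> real \<Rightarrow> real" where "Dh a b = (\<integral>s. (hh s)\<^sup>2 \<partial>TI a b)"

lemma noise_le_nonneg: "noise_le a b X \<Longrightarrow> a \<le> b \<Longrightarrow> 0 \<le> X"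
  unfolding noise_le_def by (drule spec[of _ a], drule spec[of _ 0]) simp

text \<open>The reference time moves from \<open>a\<close> to \<open>c\<close>; the triangle
  inequality through \<open>a\<close> doubles the bound.\<close>

lemma noise_le_sub:
  assumes n: "noise_le a b X" and c: "a \<le> c" "c \<le> d" "d \<le> b" shows "noise_le c d (2 * X)"
  unfolding noise_le_def
proof (intro allI impI)
  fix t N assume t: "c \<le> t" "t \<le> d"
  have "(\<Sum>k\<in>FN N. 2 * sqrt 2 * pi * \<bar>real_of_int k\<bar> * \<bar>p k t - p k c\<bar>)
     \<le> (\<Sum>k\<in>FN N. 2 * sqrt 2 * pi * \<bar>real_of_int k\<bar> * \<bar>p k t - p k a\<bar> + 2 * sqrt 2 * pi * \<bar>real_of_int k\<bar> * \<bar>p k c - p k a\<bar>)"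
    unfolding distrib_left[symmetric] by (intro sum_mono mult_left_mono) auto
  also have "\<dots> \<le> X + X" unfolding sum.distrib using n c t unfolding noise_le_def by (intro add_mono) auto
  finally show "(\<Sum>k\<in>FN N. 2 * sqrt 2 * pi * \<bar>real_of_int k\<bar> * \<bar>p k t - p k c\<bar>) \<le> 2 * X" by simp
qed

lemma noise_le_start: "noise_le a b X \<Longrightarrow> d \<le> b \<Longrightarrow> noise_le a d X"
  unfolding noise_le_def by force

lemma windowI: "noise_le a b X \<Longrightarrow> 0 \<le> a \<Longrightarrow> a \<le> b \<Longrightarrow> burgers_window \<nu> u p c0 a b X"
  by unfold_locales (auto simp: noise_le_def)

lemma Q_bound: "noise_le a b X \<Longrightarrow> 0 \<le> a \<Longrightarrow> a \<le> b \<Longrightarrow> Q a b \<le> 2 * l2 (u a) + (X\<^sup>2 + 2 * X) * (b - a)"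
  unfolding Q_def by (rule burgers_window.L2_time_integral[OF windowI])

lemma Q_split: "0 \<le> a \<Longrightarrow> a \<le> c \<Longrightarrow> c \<le> b \<Longrightarrow> Q a c + Q c b = Q a b"
  unfolding Q_def by (rule integral_TI_split[OF l2u_integrable])

lemma Dh_split: "0 \<le> a \<Longrightarrow> a \<le> c \<Longrightarrow> c \<le> b \<Longrightarrow> Dh a c + Dh c b = Dh a b"
  unfolding Dh_def by (rule integral_TI_split[OF hh_sq_integrable(1)])

lemma Q_nonneg: "0 \<le> Q a b" and Dh_nonneg: "0 \<le> Dh a b" unfolding Q_def Dh_def by simp_all

lemma Q_lower:
  assumes "0 \<le> a" "a \<le> b" "\<And>s. a \<le> s \<Longrightarrow> s \<le> b \<Longrightarrow> c \<le> (l2 (u s))\<^sup>2" shows "c * (b - a) \<le> Q a b"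
proof -
  have "c * (b - a) = (\<integral>s. c \<partial>TI a b)" using measure_TI[OF assms(2)] by simp
  also have "\<dots> \<le> Q a b" unfolding Q_def
    by (rule integral_mono[OF _ l2u_integrable[OF assms(1)]]) (use assms(3) in auto)
  finally show ?thesis .
qed

text \<open>Some time does not exceed the average by much; the slack 1 makes the contradiction
  strict.\<close>

lemma exists_low_energy:
  assumes "0 \<le> a" "a < b" obtains t where "a \<le> t" "t \<le> b" "(l2 (u t))\<^sup>2 \<le> Q a b / (b - a) + 1"
proof -
  have "\<exists>t. a \<le> t \<and> t \<le> b \<and> (l2 (u t))\<^sup>2 \<le> Q a b / (b - a) + 1"
  proof (rule ccontr)
    assume neg: "\<not> ?thesis"
    have "(Q a b / (b - a) + 1) * (b - a) \<le> Q a b"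
    proof (rule Q_lower)
      fix s assume "a \<le> s" "s \<le> b"
      thus "Q a b / (b - a) + 1 \<le> (l2 (u s))\<^sup>2" using neg by (meson not_le less_imp_le)
    qed (use assms in auto)
    thus False using assms by (simp add: distrib_right)
  qed
  thus ?thesis using that by blast
qed

text \<open>With \<open>\<psi> s\<close> the remaining time integral of the energy, \<open>L2_time_integral\<close> turns into the differential inequality
  \<open>\<psi>\<^sup>2 \<le> - 4 \<psi>'\<close>, which bounds \<open>\<psi>\<close> irrespective of the initial value.\<close>
lemma Q_universal:
  assumes n: "noise_le a (a + 1) X" and a: "0 \<le> a" shows "Q (a + 1/2) (a + 1) \<le> 4 * X\<^sup>2 + 4 * X + 64"
proof (rule ccontr)
  assume neg: "\<not> ?thesis"
  have X: "0 \<le> X" using noise_le_nonneg[OF n] by simp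
  \<comment> \<open>The noise contribution (2X)^2 + 2 (2X) of \<open>Q_bound\<close> for a later
    starting time, where the change of reference has doubled X.\<close>
  define c where "c = 4 * X\<^sup>2 + 4 * X"
  have c0: "0 \<le> c" using X by (simp add: c_def)
  define \<psi> where "\<psi> s = Q s (a + 1) - c" for s
  have b1: "\<psi> s \<le> 2 * l2 (u s)" if "a \<le> s" "s \<le> a + 1" for s
  proof -
    have "Q s (a + 1) \<le> 2 * l2 (u s) + ((2 * X)\<^sup>2 + 2 * (2 * X)) * (a + 1 - s)"
      by (rule Q_bound[OF noise_le_sub[OF n]]) (use that a in auto)
    also have "((2 * X)\<^sup>2 + 2 * (2 * X)) * (a + 1 - s) \<le> ((2 * X)\<^sup>2 + 2 * (2 * X)) * 1"
      using that X by (intro mult_left_mono) auto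
    finally show ?thesis by (simp add: \<psi>_def c_def power_mult_distrib)
  qed
  have mono: "\<psi> s \<le> \<psi> r" if "a \<le> r" "r \<le> s" "s \<le> a + 1" for r s
    using Q_split[of r s "a + 1"] Q_nonneg[of r s] that a by (simp add: \<psi>_def)
  have step: "\<psi> s + (s - r) * ((\<psi> s)\<^sup>2 / 4) \<le> \<psi> r" if "a \<le> r" "r \<le> s" "s \<le> a + 1" "0 \<le> \<psi> s" for r s
  proof -
    have "(\<psi> s)\<^sup>2 / 4 * (s - r) \<le> Q r s"
    proof (rule Q_lower)
      fix t assume t: "r \<le> t" "t \<le> s"
      have "\<psi> s \<le> 2 * l2 (u t)" using mono[of t s] b1[of t] t that by linarith
      hence "(\<psi> s)\<^sup>2 \<le> (2 * l2 (u t))\<^sup>2" using that by (intro power_mono) auto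
      thus "(\<psi> s)\<^sup>2 / 4 \<le> (l2 (u t))\<^sup>2" by (simp add: power_mult_distrib)
    qed (use that a in auto)
    thus ?thesis using Q_split[of r s "a + 1"] that a by (simp add: \<psi>_def mult.commute)
  qed
  \<comment> \<open>Times approaching \<open>a\<close> geometrically: a discrete form of the
    differential inequality, in which \<psi> need not be differentiated.\<close>
  define s where "s j = a + (1/2) ^ (j + 1)" for j :: nat
  have sj: "a \<le> s j" "s j \<le> a + 1" for j
    using power_le_one[of "1/2 :: real" "j + 1"] unfolding s_def by auto
  \<comment> \<open>From \<psi> \<ge> 64 * 2^j at \<open>s j\<close>, the gap of length 2^-(j+2)
    adds at least (64 * 2^j)^2 / 4 times that length, which is 256 * 2^j: more than a doubling.
    Unbounded growth contradicts the finite value at \<open>a\<close>.\<close>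
  have big: "64 * 2 ^ j \<le> \<psi> (s j)" for j
  proof (induction j)
    case 0 show ?case using neg by (simp add: s_def \<psi>_def c_def)
  next
    case (Suc j)
    have d: "s j - s (Suc j) = (1/4) * (1/2) ^ j" by (simp add: s_def)
    have p: "0 \<le> \<psi> (s j)" by (rule order_trans[OF _ Suc]) simp
    have "(64 * 2 ^ j)\<^sup>2 \<le> (\<psi> (s j))\<^sup>2" using Suc by (intro power_mono) auto
    hence "(s j - s (Suc j)) * ((64 * 2 ^ j)\<^sup>2 / 4) \<le> (s j - s (Suc j)) * ((\<psi> (s j))\<^sup>2 / 4)" 
      by (intro mult_left_mono) (auto simp: d)
    moreover have "(s j - s (Suc j)) * ((64 * 2 ^ j)\<^sup>2 / 4) = 256 * 2 ^ j"
      unfolding d by (simp add: power2_eq_square power_divide)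
    moreover have "\<psi> (s j) + (s j - s (Suc j)) * ((\<psi> (s j))\<^sup>2 / 4) \<le> \<psi> (s (Suc j))"
    proof (rule step[OF sj(1) _ sj(2) p])
      have "0 \<le> s j - s (Suc j)" unfolding d by simp
      thus "s (Suc j) \<le> s j" by simp
    qed
    moreover have "(0::real) \<le> 2 ^ j" by simp
    ultimately show ?case using p unfolding power_Suc by linarith
  qed
  obtain j where "\<psi> a < 2 ^ j" using real_arch_pow[of 2 "\<psi> a"] by auto
  moreover have "\<psi> (s j) \<le> \<psi> a" using mono[of a "s j"] sj[of j] by simp
  moreover have "(0::real) \<le> 2 ^ j" by simp
  ultimately show False using big[of j] by linarith
qed

text \<open>The bound on the time integral over the second half of the window provides a time
  \<open>t\<close> of moderate energy, and the energy estimate carries this bound to the end of the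
  window.\<close>

lemma universal_decay:
  assumes n: "noise_le a (a + 1) X" and a: "0 \<le> a" shows "(l2 (u (a + 1)))\<^sup>2 \<le> 600 * (1 + X ^ 4)"
proof -
  have X: "0 \<le> X" using noise_le_nonneg[OF n] by simp
  define c where "c = 4 * X\<^sup>2 + 4 * X + 64"
  have q: "Q (a + 1/2) (a + 1) \<le> c" unfolding c_def by (rule Q_universal[OF n a])
  obtain t where t: "a + 1/2 \<le> t" "t \<le> a + 1" "(l2 (u t))\<^sup>2 \<le> Q (a + 1/2) (a + 1) / (a + 1 - (a + 1/2)) + 1"
    using exists_low_energy[of "a + 1/2" "a + 1"] a by auto
  have e: "(l2 (u t))\<^sup>2 \<le> 2 * c + 1" using t(3) q by simp
  have qt: "Q t (a + 1) \<le> c" using Q_split[of "a + 1/2" t "a + 1"] Q_nonneg[of "a + 1/2" t] q t a by simp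
  interpret W: burgers_window \<nu> u p c0 t "a + 1" "2 * X"
    by (rule windowI[OF noise_le_sub[OF n]]) (use t a in auto)
  obtain V where V: "0 \<le> V" "V + \<nu> * Dh t (a + 1) \<le> (l2 (u t))\<^sup>2 + (2 * X)\<^sup>2 * (a + 1 - t) + (2 * X) * Q t (a + 1)"
    "l2 (u (a + 1)) \<le> sqrt V + 2 * X"
    unfolding Q_def Dh_def by (rule W.energy_estimate)
  have "(2 * X)\<^sup>2 * (a + 1 - t) \<le> (2 * X)\<^sup>2 * 1" using t by (intro mult_left_mono) auto
  moreover have "(2 * X) * Q t (a + 1) \<le> (2 * X) * c" using qt X by (intro mult_left_mono) auto
  moreover have "0 \<le> \<nu> * Dh t (a + 1)" using nu Dh_nonneg by simp
  ultimately have V2: "V \<le> 2 * c + 1 + 4 * X\<^sup>2 + 2 * X * c" using V(2) e by (simp add: power_mult_distrib)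
  have "(l2 (u (a + 1)))\<^sup>2 \<le> (sqrt V + 2 * X)\<^sup>2" using V by (intro power_mono) auto
  also have "\<dots> \<le> 2 * V + 8 * X\<^sup>2"
    using V(1) zero_le_power2[of "sqrt V - 2 * X"] by (simp add: power2_sum power2_diff power_mult_distrib)
  also have "\<dots> \<le> 2 * (2 * c + 1 + 4 * X\<^sup>2 + 2 * X * c) + 8 * X\<^sup>2" using V2 by simp
  also have "\<dots> = 258 + 272 * X + 48 * X\<^sup>2 + 16 * X ^ 3"
    by (simp add: c_def power2_eq_square power3_eq_cube algebra_simps)
  \<comment> \<open>Each power is at most 1 + X^4, and 258 + 272 + 48 + 16 \<le> 600.\<close>
  also have "\<dots> \<le> 600 * (1 + X ^ 4)"
  proof -
    define Y where "Y = X ^ 4"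
    have "0 \<le> Y" by (simp add: Y_def)
    moreover have "X \<le> 1 + Y" "X\<^sup>2 \<le> 1 + Y" "X ^ 3 \<le> 1 + Y"
      using power_le_1_plus_4[OF X, of 1] power_le_1_plus_4[OF X, of 2] power_le_1_plus_4[OF X, of 3] by (simp_all add: Y_def)
    ultimately show ?thesis unfolding Y_def[symmetric] by argo
  qed
  finally show ?thesis .
qed

text \<open>The first unit of time forgets the initial value; the energy estimate is applied on the
  second. The time integral of the energy brings in 2 X1 e, linear in the norm \<open>e\<close> at
  its start, and this is split into X1^2 + e^2.\<close>

lemma dissipation_upper:
  assumes n0: "noise_le a (a + 1) X0" and n1: "noise_le (a + 1) (a + 2) X1" and a: "0 \<le> a"
  shows "\<nu> * Dh (a + 1) (a + 2) \<le> 1300 * (1 + X0 ^ 4) + 1300 * (1 + X1 ^ 4)"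
proof -
  have X: "0 \<le> X0" "0 \<le> X1" using noise_le_nonneg[OF n0] noise_le_nonneg[OF n1] by auto
  interpret W: burgers_window \<nu> u p c0 "a + 1" "a + 2" X1
    by (rule windowI[OF n1]) (use a in auto)
  define e where "e = l2 (u (a + 1))"
  have ee: "e\<^sup>2 \<le> 600 * (1 + X0 ^ 4)" unfolding e_def by (rule universal_decay[OF n0 a])
  obtain V where V: "0 \<le> V" "V + \<nu> * Dh (a + 1) (a + 2) \<le> e\<^sup>2 + X1\<^sup>2 * (a + 2 - (a + 1)) + X1 * Q (a + 1) (a + 2)"
    unfolding Q_def Dh_def e_def by (rule W.energy_estimate)
  have "Q (a + 1) (a + 2) \<le> 2 * e + (X1\<^sup>2 + 2 * X1) * (a + 2 - (a + 1))" unfolding e_def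
    by (rule Q_bound[OF n1]) (use a in auto)
  hence "X1 * Q (a + 1) (a + 2) \<le> X1 * (2 * e + (X1\<^sup>2 + 2 * X1))" using X by (intro mult_left_mono) auto
  also have "\<dots> = 2 * X1 * e + X1 ^ 3 + 2 * X1\<^sup>2" by (simp add: power2_eq_square power3_eq_cube algebra_simps)
  also have "\<dots> \<le> X1\<^sup>2 + e\<^sup>2 + X1 ^ 3 + 2 * X1\<^sup>2" using sum_squares_bound[of X1 e] by simp
  finally have "\<nu> * Dh (a + 1) (a + 2) \<le> 2 * e\<^sup>2 + 4 * X1\<^sup>2 + X1 ^ 3" using V by simp
  moreover define Y Y' where "Y = X1 ^ 4" and "Y' = X0 ^ 4"
  moreover have "0 \<le> Y" "0 \<le> Y'" by (simp_all add: Y_def Y'_def)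
  moreover have "X1\<^sup>2 \<le> 1 + Y" "X1 ^ 3 \<le> 1 + Y"
    using power_le_1_plus_4[OF X(2), of 2] power_le_1_plus_4[OF X(2), of 3] by (simp_all add: Y_def)
  ultimately show ?thesis using ee[folded Y'_def] unfolding Y_def[symmetric] Y'_def[symmetric] by argo
qed

text \<open>A large displacement of one mode within a time short compared with its size, preceded and followed by a moderate noise:
  the energy gained cannot survive one unit of time, so it is dissipated, at a rate independent of \<open>\<nu>\<close>.\<close>
lemma dissipation_lower:
  assumes n0: "noise_le s (s + 1) X0" and ng: "noise_le (s + 1) b Xg" and n1: "noise_le b (b + 1) X0"
    and s: "0 \<le> s" "s + 1 \<le> b" and h: "Xg ^ 3 * (b - (s + 1)) \<le> 1" "1 \<le> Xg"
    and E0: "E0 = 600 * (1 + X0 ^ 4)"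
    and A: "B + sqrt (E0 + 4 + 2 * Xg * sqrt E0) \<le> \<bar>p j b - p j (s + 1)\<bar>"
    and B: "7 + 6 * X0 + 7 * X0\<^sup>2 + X0 ^ 3 \<le> B"
  shows "1/3 \<le> \<nu> * Dh s (b + 1)"
proof -
  define a where "a = s + 1"
  have a0: "0 \<le> a" and ab: "a \<le> b" and b0: "0 \<le> b" using s by (auto simp: a_def)
  have X: "0 \<le> X0" using noise_le_nonneg[OF n0] by simp
  have ea: "(l2 (u a))\<^sup>2 \<le> E0" unfolding a_def E0 by (rule universal_decay[OF n0 s(1)])
  hence ea': "l2 (u a) \<le> sqrt E0" by (simp add: real_le_rsqrt)
  have R0: "0 \<le> E0" by (rule order_trans[OF _ ea]) simp
  note ng' = ng[folded a_def]
  \<comment> \<open>The window is so short that Xg^2 h and Xg^3 h are at most 1; among the noise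
    terms only \<open>2 * Xg * sqrt E0\<close> stays unbounded, and it is linear in
    \<open>Xg\<close>.\<close>
  define h where "h = b - a"
  have h0: "0 \<le> h" using ab by (simp add: h_def)
  have h3: "Xg ^ 3 * h \<le> 1" using h(1) by (simp add: h_def a_def)
  have h2: "Xg ^ 2 * h \<le> 1"
  proof -
    have "Xg ^ 2 * h \<le> Xg ^ 3 * h" using h(2) h0 by (intro mult_right_mono power_increasing) auto
    thus ?thesis using h3 by simp
  qed
  interpret W: burgers_window \<nu> u p c0 a b Xg by (rule windowI[OF ng' a0 ab])
  obtain V where V: "0 \<le> V" "V + \<nu> * Dh a b \<le> (l2 (u a))\<^sup>2 + Xg\<^sup>2 * (b - a) + Xg * Q a b"
    "\<forall>k. \<bar>p k b - p k a\<bar> \<le> l2 (u b) + sqrt V"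
    unfolding Q_def Dh_def by (rule W.energy_estimate)
  have "Xg * Q a b \<le> Xg * (2 * l2 (u a) + (Xg\<^sup>2 + 2 * Xg) * (b - a))"
    using Q_bound[OF ng' a0 ab] h(2) by (intro mult_left_mono) auto
  also have "\<dots> = 2 * Xg * l2 (u a) + Xg ^ 3 * h + 2 * (Xg\<^sup>2 * h)"
    by (simp add: h_def power2_eq_square power3_eq_cube algebra_simps)
  also have "\<dots> \<le> 2 * Xg * sqrt E0 + 1 + 2 * 1"
    using h2 h3 h(2) ea' by (intro add_mono mult_left_mono) auto
  finally have "Xg * Q a b \<le> 2 * Xg * sqrt E0 + 3" by simp
  moreover have "0 \<le> \<nu> * Dh a b" using nu Dh_nonneg by simp
  moreover have "Xg\<^sup>2 * (b - a) \<le> 1" using h2 by (simp add: h_def)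
  ultimately have "V \<le> E0 + 4 + 2 * Xg * sqrt E0" using V(2) ea by linarith
  hence "sqrt V \<le> sqrt (E0 + 4 + 2 * Xg * sqrt E0)" by simp
  \<comment> \<open>The displacement is at most \<open>l2 (u b) + sqrt V\<close>, so what exceeds
    the bound for \<open>sqrt V\<close> must be carried by the solution.\<close>
  hence eb: "B \<le> l2 (u b)" using V(3)[rule_format, of j] A[folded a_def] by linarith
  define E where "E = l2 (u b)"
  define c where "c = X0\<^sup>2 + 2 * X0"
  have c0: "0 \<le> c" using X by (simp add: c_def)
  have q1: "Q b (b + 1) \<le> 2 * E + c"
    using Q_bound[OF n1 b0] by (simp add: E_def c_def)
  obtain t where t: "b \<le> t" "t \<le> b + 1" "(l2 (u t))\<^sup>2 \<le> Q b (b + 1) / (b + 1 - b) + 1"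
    using exists_low_energy[of b "b + 1"] b0 by auto
  have et: "(l2 (u t))\<^sup>2 \<le> 2 * E + c + 1" using t(3) q1 by simp
  have qt: "Q b t \<le> 2 * E + c" using Q_split[of b t "b + 1"] Q_nonneg[of t "b + 1"] q1 t b0 by simp
  interpret W2: burgers_window \<nu> u p c0 b t X0
    by (rule windowI[OF noise_le_start[OF n1]]) (use t b0 in auto)
  obtain V2 where V2: "0 \<le> V2" "E\<^sup>2 \<le> V2 + 3 * \<nu> * Dh b t + X0\<^sup>2 * (t - b) + X0 * Q b t" "sqrt V2 \<le> l2 (u t) + X0"
    unfolding Q_def Dh_def E_def by (rule W2.energy_estimate)
  have "V2 = (sqrt V2)\<^sup>2" using V2(1) by simp
  also have "\<dots> \<le> (l2 (u t) + X0)\<^sup>2" using V2 by (intro power_mono) auto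
  also have "\<dots> \<le> 2 * (l2 (u t))\<^sup>2 + 2 * X0\<^sup>2"
    using zero_le_power2[of "l2 (u t) - X0"] by (simp add: power2_sum power2_diff)
  finally have v: "V2 \<le> 2 * (2 * E + c + 1) + 2 * X0\<^sup>2" using et by argo
  have "X0\<^sup>2 * (t - b) \<le> X0\<^sup>2 * 1" using t by (intro mult_left_mono) auto
  moreover have "X0 * Q b t \<le> X0 * (2 * E + c)" using qt X by (intro mult_left_mono) auto
  ultimately have "E\<^sup>2 \<le> 2 * (2 * E + c + 1) + 2 * X0\<^sup>2 + 3 * (\<nu> * Dh b t) + X0\<^sup>2 + X0 * (2 * E + c)"
    using V2(2) v by simp
  \<comment> \<open>The energy at \<open>b\<close> is quadratic in E, whereas all that can survive
    until \<open>t\<close> or be fed in by the noise is linear in E; the difference must have been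
    dissipated.\<close>
  hence m: "E * (E - (4 + 2 * X0)) - (2 * c + 2 + 3 * X0\<^sup>2 + X0 * c) \<le> 3 * (\<nu> * Dh b t)"
    by (simp add: power2_eq_square algebra_simps)
  define k where "k = 2 * c + 2 + 3 * X0\<^sup>2 + X0 * c"
  have k0: "0 \<le> k" unfolding k_def using c0 X by simp
  \<comment> \<open>Expanded in powers of \<open>X0\<close>, the left side is the polynomial in the
    hypothesis on \<open>B\<close>.\<close>
  have kB: "(4 + 2 * X0) + k + 1 \<le> B"
    using B X unfolding k_def c_def by (simp add: power2_eq_square power3_eq_cube algebra_simps)
  have "1 * (k + 1) \<le> E * (E - (4 + 2 * X0))"
    using kB eb k0 X unfolding E_def by (intro mult_mono) auto
  hence "1 \<le> 3 * (\<nu> * Dh b t)" using m unfolding k_def[symmetric] by argo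
  moreover have "\<nu> * Dh b t \<le> \<nu> * Dh s (b + 1)"
    using Dh_split[of s b "b + 1"] Dh_split[of b t "b + 1"] Dh_nonneg[of s b] Dh_nonneg[of t "b + 1"] s t b0 nu
    by (intro mult_left_mono) auto
  ultimately show ?thesis by linarith
qed

end

section \<open>Cadlag paths and the law of grid increments\<close>

lemma cadlag_left: "cadlag_path f \<Longrightarrow> 0 < t \<Longrightarrow> \<exists>l. (f \<longlongrightarrow> l) (at_left t)"
  unfolding cadlag_path_def by simp

text \<open>On each side of \<open>t\<close> the values lie within 1/2 of the one-sided limit, and
  the two limits differ by at most \<open>R\<close>.\<close>

lemma cadlag_local:
  assumes c: "cadlag_path f" and j: "\<forall>t>0. \<forall>l. (f \<longlongrightarrow> l) (at_left t) \<longrightarrow> \<bar>f t - l\<bar> \<le> R" and R: "0 \<le> R" and t: "0 \<le> t"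
  shows "\<exists>d>0. \<forall>x y. 0 \<le> x \<longrightarrow> x \<le> y \<longrightarrow> \<bar>x - t\<bar> < d \<longrightarrow> \<bar>y - t\<bar> < d \<longrightarrow> \<bar>f y - f x\<bar> \<le> R + 1"
proof -
  have "(f \<longlongrightarrow> f t) (at_right t)" using c t by (simp add: cadlag_path_def)
  hence "eventually (\<lambda>x. dist (f x) (f t) < 1/2) (at_right t)" by (rule tendstoD) simp
  then obtain r where r: "r > t" "\<And>x. t < x \<Longrightarrow> x < r \<Longrightarrow> dist (f x) (f t) < 1/2"
    unfolding eventually_at_right_field by auto
  have r': "\<bar>f x - f t\<bar> < 1/2" if "t \<le> x" "x < r" for x
    using r(2)[of x] that by (cases "x = t") (auto simp: dist_real_def)
  show ?thesis
  proof (cases "t > 0")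
    case False
    hence "t = 0" using t by simp
    show ?thesis
    proof (intro exI[of _ "r - t"] conjI allI impI)
      fix x y assume xy: "0 \<le> x" "x \<le> y" "\<bar>x - t\<bar> < r - t" "\<bar>y - t\<bar> < r - t"
      have "\<bar>f x - f t\<bar> < 1/2" "\<bar>f y - f t\<bar> < 1/2" using xy \<open>t = 0\<close> r'[of x] r'[of y] by simp_all
      thus "\<bar>f y - f x\<bar> \<le> R + 1" using R by linarith
    qed (use r in simp)
  next
    case True
    then obtain l where l: "(f \<longlongrightarrow> l) (at_left t)" using cadlag_left[OF c] by blast
    have jl: "\<bar>f t - l\<bar> \<le> R" using j True l by blast
    have "eventually (\<lambda>x. dist (f x) l < 1/2) (at_left t)" using l by (rule tendstoD) simp
    then obtain q where q: "q < t" "\<And>x. q < x \<Longrightarrow> x < t \<Longrightarrow> dist (f x) l < 1/2"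
      unfolding eventually_at_left_field by auto
    show ?thesis
    proof (intro exI[of _ "min (r - t) (t - q)"] conjI allI impI)
      fix x y assume xy: "0 \<le> x" "x \<le> y" "\<bar>x - t\<bar> < min (r - t) (t - q)" "\<bar>y - t\<bar> < min (r - t) (t - q)"
      have L: "\<bar>f z - l\<bar> < 1/2" if "z < t" "\<bar>z - t\<bar> < min (r - t) (t - q)" for z
        using q(2)[of z] that by (auto simp: dist_real_def)
      have Rr: "\<bar>f z - f t\<bar> < 1/2" if "t \<le> z" "\<bar>z - t\<bar> < min (r - t) (t - q)" for z
        using that by (intro r') auto
      consider "x < t" "y < t" | "x < t" "t \<le> y" | "t \<le> x" "t \<le> y" using xy(2) by linarith
      thus "\<bar>f y - f x\<bar> \<le> R + 1"
      proof cases
        case 1 thus ?thesis using L[of x] L[of y] xy R by linarith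
      next
        case 2 thus ?thesis using L[of x] Rr[of y] xy R jl by linarith
      next
        case 3 thus ?thesis using Rr[of x] Rr[of y] xy R by linarith
      qed
    qed (use r q in auto)
  qed
qed

text \<open>The radius is a Lebesgue number of the cover by the neighbourhoods of
  \<open>cadlag_local\<close>.\<close>

lemma cadlag_osc:
  assumes c: "cadlag_path f" and j: "\<forall>t>0. \<forall>l. (f \<longlongrightarrow> l) (at_left t) \<longrightarrow> \<bar>f t - l\<bar> \<le> R" and R: "0 \<le> R" and a: "0 \<le> a"
  shows "\<exists>d>0. \<forall>x y. a \<le> x \<longrightarrow> x \<le> y \<longrightarrow> y \<le> b \<longrightarrow> y - x < d \<longrightarrow> \<bar>f y - f x\<bar> \<le> R + 1"
proof -
  define good where "good t d \<longleftrightarrow> d > 0 \<and> (\<forall>x y. 0 \<le> x \<longrightarrow> x \<le> y \<longrightarrow> \<bar>x - t\<bar> < d \<longrightarrow> \<bar>y - t\<bar> < d \<longrightarrow> \<bar>f y - f x\<bar> \<le> R + 1)" for t d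
  have ex: "\<exists>d. good t d" if "0 \<le> t" for t using cadlag_local[OF c j R that] unfolding good_def by blast
  define G where "G = {ball t d | t d. good t d}"
  have "{a..b} \<subseteq> \<Union>G"
  proof
    fix t assume t: "t \<in> {a..b}"
    then obtain d where d: "good t d" using ex[of t] a by auto
    hence "t \<in> ball t d" by (simp add: good_def)
    thus "t \<in> \<Union>G" using d unfolding G_def by blast
  qed
  then obtain e where e: "0 < e" "\<And>x. x \<in> {a..b} \<Longrightarrow> \<exists>B\<in>G. ball x e \<subseteq> B"
  proof (rule Heine_Borel_lemma[OF compact_Icc])
    show "open B" if "B \<in> G" for B using that unfolding G_def by auto
  qed (rule that; assumption)
  show ?thesis
  proof (intro exI[of _ e] conjI allI impI e(1))
    fix x y assume xy: "a \<le> x" "x \<le> y" "y \<le> b" "y - x < e"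
    then obtain t d where td: "good t d" "ball x e \<subseteq> ball t d" using e(2)[of x] unfolding G_def by auto
    have "x \<in> ball x e" "y \<in> ball x e" using xy e(1) by (auto simp: dist_real_def)
    hence "x \<in> ball t d" "y \<in> ball t d" using td(2) by blast+
    hence "\<bar>x - t\<bar> < d" "\<bar>y - t\<bar> < d" unfolding mem_ball dist_real_def by linarith+
    moreover have "0 \<le> x" using xy a by simp
    ultimately show "\<bar>f y - f x\<bar> \<le> R + 1" using td(1) xy(2) unfolding good_def by blast
  qed
qed

lemma cadlag_bounded:
  assumes c: "cadlag_path f" and a: "0 \<le> a" "a \<le> b"
  shows "\<exists>B. \<forall>t\<in>{a..b}. \<bar>f t - c0\<bar> \<le> B"
proof (rule locally_bounded_imp_bounded[OF a(2)])
  fix t assume t: "a \<le> t" "t \<le> b"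
  have t0: "0 \<le> t" using t a by simp
  have "(f \<longlongrightarrow> f t) (at_right t)" using c t0 by (simp add: cadlag_path_def)
  hence "eventually (\<lambda>x. dist (f x) (f t) < 1) (at_right t)" by (rule tendstoD) simp
  then obtain r where r: "r > t" "\<And>x. t < x \<Longrightarrow> x < r \<Longrightarrow> dist (f x) (f t) < 1"
    unfolding eventually_at_right_field by auto
  obtain q l where q: "q < t" "\<And>x. 0 \<le> x \<Longrightarrow> q < x \<Longrightarrow> x < t \<Longrightarrow> dist (f x) l < 1"
  proof (cases "t > 0")
    case True
    then obtain l where l: "(f \<longlongrightarrow> l) (at_left t)" using cadlag_left[OF c] by blast
    have "eventually (\<lambda>x. dist (f x) l < 1) (at_left t)" using l by (rule tendstoD) simp
    thus ?thesis using that unfolding eventually_at_left_field by blast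
  next
    case False thus ?thesis using that[of "t - 1" 0] by auto
  qed
  show "\<exists>d>0. \<exists>B. \<forall>y. a \<le> y \<and> y \<le> b \<and> \<bar>y - t\<bar> < d \<longrightarrow> \<bar>f y - c0\<bar> \<le> B"
  proof (rule exI[of _ "min (r - t) (t - q)"], rule conjI, goal_cases)
    case 2
    show ?case
    proof (rule exI[of _ "\<bar>f t\<bar> + \<bar>l\<bar> + 1 + \<bar>c0\<bar>"], intro allI impI)
    fix y assume y: "a \<le> y \<and> y \<le> b \<and> \<bar>y - t\<bar> < min (r - t) (t - q)"
    consider "y < t" | "y = t" | "y > t" by linarith
    thus "\<bar>f y - c0\<bar> \<le> \<bar>f t\<bar> + \<bar>l\<bar> + 1 + \<bar>c0\<bar>"
    proof cases
      case 1 
      hence "dist (f y) l < 1" using y a by (intro q(2)) auto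
      thus ?thesis unfolding dist_real_def by linarith
    next
      case 2 thus ?thesis by simp
    next
      case 3
      hence "dist (f y) (f t) < 1" using y by (intro r(2)) auto
      thus ?thesis unfolding dist_real_def by linarith
    qed
    qed
  qed (use r q in auto)
qed

text \<open>The next dyadic point to the right of \<open>t\<close> stays in the window when
  \<open>t\<close> is not its right end, and the right end is itself dyadic; right-continuity does
  the rest.\<close>

lemma dyadic_dense_bound:
  fixes f :: "real \<Rightarrow> real"
  assumes rc: "\<And>t. t \<ge> s \<Longrightarrow> (f \<longlongrightarrow> f t) (at_right t)"
    and b: "\<And>m j. j \<le> T * 2 ^ m \<Longrightarrow> \<bar>f (s + real j / 2 ^ m) - c\<bar> \<le> B" and t: "s \<le> t" "t \<le> s + real T"
  shows "\<bar>f t - c\<bar> \<le> B"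
proof (cases "t = s + real T")
  case True thus ?thesis using b[of T 0] by simp
next
  case False
  hence tT: "t < s + real T" using t by simp
  define j where "j m = nat (\<lfloor>(t - s) * 2 ^ m\<rfloor> + 1)" for m :: nat
  define r where "r m = s + real (j m) / 2 ^ m" for m
  have jr: "real (j m) = real_of_int \<lfloor>(t - s) * 2 ^ m\<rfloor> + 1" for m
  proof -
    have "0 \<le> \<lfloor>(t - s) * 2 ^ m\<rfloor>" using t by simp
    thus ?thesis by (simp add: j_def)
  qed
  have r1: "t < r m" for m
  proof -
    have "(t - s) * 2 ^ m < real (j m)" unfolding jr by linarith
    hence "t - s < real (j m) / 2 ^ m" by (simp add: pos_less_divide_eq)
    thus ?thesis by (simp add: r_def)
  qed
  have r2: "r m \<le> t + (1/2) ^ m" for m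
  proof -
    have "real (j m) \<le> (t - s) * 2 ^ m + 1" unfolding jr by linarith
    hence "real (j m) / 2 ^ m \<le> ((t - s) * 2 ^ m + 1) / 2 ^ m" by (intro divide_right_mono) auto
    also have "\<dots> = (t - s) + (1/2) ^ m" by (simp add: add_divide_distrib power_divide)
    finally show ?thesis by (simp add: r_def)
  qed
  have jm: "j m \<le> T * 2 ^ m" for m
  proof -
    have "(t - s) * 2 ^ m < real T * 2 ^ m" using tT by (intro mult_strict_right_mono) auto
    hence "\<lfloor>(t - s) * 2 ^ m\<rfloor> < int (T * 2 ^ m)" by (simp add: floor_less_iff)
    thus ?thesis by (simp add: j_def nat_le_iff)
  qed
  have "(\<lambda>m. t + (1/2) ^ m :: real) \<longlonglongrightarrow> t + 0" by (intro tendsto_intros LIMSEQ_realpow_zero) auto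
  hence up: "(\<lambda>m. t + (1/2) ^ m :: real) \<longlonglongrightarrow> t" by simp
  have "r \<longlonglongrightarrow> t"
    by (rule tendsto_sandwich[OF _ _ tendsto_const up]) (intro always_eventually allI less_imp_le r1, intro always_eventually allI r2)
  hence "filterlim r (at_right t) sequentially" by (intro tendsto_imp_filterlim_at_right always_eventually allI r1)
  hence "(\<lambda>m. f (r m)) \<longlonglongrightarrow> f t" by (rule filterlim_compose[OF rc[OF t(1)]])
  hence "(\<lambda>m. \<bar>f (r m) - c\<bar>) \<longlonglongrightarrow> \<bar>f t - c\<bar>" by (intro tendsto_intros)
  thus ?thesis by (rule LIMSEQ_le_const2) (use b[OF jm] in \<open>auto simp: r_def\<close>)
qed

section \<open>Increments over grids: common law and independence\<close>

context prob_space
begin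

lemma levy_measurable: "levy_process_triplet0 M \<mu> X \<Longrightarrow> 0 \<le> t \<Longrightarrow> X t \<in> borel_measurable M"
  by (simp add: levy_process_triplet0_def)

lemma levy_law_eq:
  assumes "levy_process_triplet0 M \<mu> X" "levy_process_triplet0 M \<mu> Z" "0 \<le> t"
  shows "distr M borel (X t) = distr M borel (Z t)"
proof (rule Levy_uniqueness)
  show "real_distribution (distr M borel (X t))" "real_distribution (distr M borel (Z t))"
    using assms by (auto intro!: real_distribution_distr levy_measurable)
  show "char (distr M borel (X t)) = char (distr M borel (Z t))"
    using assms unfolding levy_process_triplet0_def by (intro ext) simp
qed

definition linc :: "(real \<Rightarrow> 'a \<Rightarrow> real) \<Rightarrow> real \<Rightarrow> real \<Rightarrow> nat \<Rightarrow> 'a \<Rightarrow> real" where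
  "linc X s d i \<omega> = X (s + real (Suc i) * d) \<omega> - X (s + real i * d) \<omega>"

text \<open>Values relative to the start of the grid, so that the law does not depend on the
  starting time. Events on grids are written as predicates of this vector.\<close>

definition gridv :: "(real \<Rightarrow> 'a \<Rightarrow> real) \<Rightarrow> real \<Rightarrow> real \<Rightarrow> nat \<Rightarrow> 'a \<Rightarrow> nat \<Rightarrow> real" where
  "gridv X s d n \<omega> = (\<lambda>j\<in>{..n}. X (s + real j * d) \<omega> - X s \<omega>)"

lemma linc_indep:
  assumes "levy_process_triplet0 M \<mu> X" "0 \<le> s" "0 \<le> d"
  shows "indep_vars (\<lambda>_. borel) (linc X s d) {..<n}"
proof -
  have "0 \<le> s + real 0 * d \<and> (\<forall>i<n. s + real i * d \<le> s + real (Suc i) * d)" using assms by (auto intro: mult_right_mono)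
  hence "indep_vars (\<lambda>_. borel) (\<lambda>i \<omega>. X (s + real (Suc i) * d) \<omega> - X (s + real i * d) \<omega>) {..<n}"
  proof -
    have H: "\<forall>n (ts :: nat \<Rightarrow> real). 0 \<le> ts 0 \<and> (\<forall>i<n. ts i \<le> ts (Suc i)) \<longrightarrow>
        indep_vars (\<lambda>_. borel) (\<lambda>i \<omega>. X (ts (Suc i)) \<omega> - X (ts i) \<omega>) {..<n}"
      using assms(1) unfolding levy_process_triplet0_def by (elim conjE)
    assume "0 \<le> s + real 0 * d \<and> (\<forall>i<n. s + real i * d \<le> s + real (Suc i) * d)"
    thus ?thesis using H[THEN spec[of _ n], THEN spec[of _ "\<lambda>i. s + real i * d"]] by simp
  qed
  thus ?thesis by (simp add: linc_def[abs_def])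
qed

lemma linc_measurable:
  assumes "levy_process_triplet0 M \<mu> X" "0 \<le> s" "0 \<le> d" shows "linc X s d i \<in> borel_measurable M"
  unfolding linc_def[abs_def] using assms by (intro borel_measurable_diff levy_measurable) auto

lemma linc_law:
  assumes "levy_process_triplet0 M \<mu> X" "0 \<le> s" "0 \<le> d"
  shows "distr M borel (linc X s d i) = distr M borel (X d)"
proof -
  have "\<forall>s t. 0 \<le> s \<and> s \<le> t \<longrightarrow> distr M borel (\<lambda>\<omega>. X t \<omega> - X s \<omega>) = distr M borel (X (t - s))"
    using assms(1) unfolding levy_process_triplet0_def by (elim conjE)
  moreover have "0 \<le> s + real i * d \<and> s + real i * d \<le> s + real (Suc i) * d" using assms by (auto intro: mult_right_mono)
  ultimately have "distr M borel (\<lambda>\<omega>. X (s + real (Suc i) * d) \<omega> - X (s + real i * d) \<omega>) = distr M borel (X ((s + real (Suc i) * d) - (s + real i * d)))" by blast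
  moreover have "(s + real (Suc i) * d) - (s + real i * d) = d" by (simp add: algebra_simps)
  ultimately show ?thesis by (simp add: linc_def[abs_def])
qed

lemma linc_sum: "(\<Sum>i<j. linc X s d i \<omega>) = X (s + real j * d) \<omega> - X s \<omega>"
  unfolding linc_def by (subst sum_lessThan_telescope) simp

lemma linc_sum_shift: "(\<Sum>i\<in>{k..<k+j}. linc X s d i \<omega>) = X (s + real k * d + real j * d) \<omega> - X (s + real k * d) \<omega>"
proof -
  have "(\<Sum>i\<in>{k..<k+j}. linc X s d i \<omega>) = X (s + real (k + j) * d) \<omega> - X (s + real k * d) \<omega>"
    unfolding linc_def by (subst sum_Suc_diff') auto
  thus ?thesis by (simp add: algebra_simps)
qed

lemma gridv_measurable:
  assumes "levy_process_triplet0 M \<mu> X" "0 \<le> s" "0 \<le> d"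
  shows "gridv X s d n \<in> measurable M (PiM {..n} (\<lambda>_. borel))"
  unfolding gridv_def[abs_def] using assms
  by (intro measurable_restrict borel_measurable_diff levy_measurable) auto

text \<open>The cell increments are independent, each with the law of \<open>X d\<close>, and the
  grid values are their partial sums.\<close>

lemma gridv_law:
  assumes X: "levy_process_triplet0 M \<mu> X" and s: "0 \<le> s" "0 \<le> d" and n: "0 < n"
  shows "distr M (PiM {..n} (\<lambda>_. borel)) (gridv X s d n) =
    distr (PiM {..<n} (\<lambda>_. distr M borel (X d))) (PiM {..n} (\<lambda>_. borel)) (\<lambda>x. \<lambda>j\<in>{..n}. \<Sum>i<j. x i)"
proof -
  have law: "distr M (PiM {..<n} (\<lambda>_. borel)) (\<lambda>\<omega>. \<lambda>i\<in>{..<n}. linc X s d i \<omega>) = PiM {..<n} (\<lambda>_. distr M borel (X d))"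
  proof -
    have "{..<n} \<noteq> {}" using n by auto
    from indep_vars_iff_distr_eq_PiM'[OF this, where M'="\<lambda>_. borel" and X="linc X s d"] linc_indep[OF X s, of n] linc_measurable[OF X s]
    have "distr M (PiM {..<n} (\<lambda>_. borel)) (\<lambda>\<omega>. \<lambda>i\<in>{..<n}. linc X s d i \<omega>) = PiM {..<n} (\<lambda>i. distr M borel (linc X s d i))" by simp
    thus ?thesis by (simp add: linc_law[OF X s])
  qed
  have m1: "(\<lambda>\<omega>. \<lambda>i\<in>{..<n}. linc X s d i \<omega>) \<in> measurable M (PiM {..<n} (\<lambda>_. borel))"
    by (intro measurable_restrict linc_measurable[OF X s])
  have m2: "(\<lambda>x. \<lambda>j\<in>{..n}. \<Sum>i<j. x i) \<in> measurable (PiM {..<n} (\<lambda>_. borel :: real measure)) (PiM {..n} (\<lambda>_. borel))"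
    by (intro measurable_restrict borel_measurable_sum measurable_component_singleton) auto
  have "distr (PiM {..<n} (\<lambda>_. distr M borel (X d))) (PiM {..n} (\<lambda>_. borel)) (\<lambda>x. \<lambda>j\<in>{..n}. \<Sum>i<j. x i)
    = distr M (PiM {..n} (\<lambda>_. borel)) ((\<lambda>x. \<lambda>j\<in>{..n}. \<Sum>i<j. x i) \<circ> (\<lambda>\<omega>. \<lambda>i\<in>{..<n}. linc X s d i \<omega>))"
    unfolding law[symmetric] by (rule distr_distr[OF m2 m1])
  also have "(\<lambda>x. \<lambda>j\<in>{..n}. \<Sum>i<j. x i) \<circ> (\<lambda>\<omega>. \<lambda>i\<in>{..<n}. linc X s d i \<omega>) = gridv X s d n"
  proof (rule ext)
    fix \<omega>
    have "(\<Sum>i<j. (\<lambda>i\<in>{..<n}. linc X s d i \<omega>) i) = X (s + real j * d) \<omega> - X s \<omega>" if "j \<le> n" for j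
      unfolding linc_sum[symmetric] using that by (intro sum.cong) auto
    thus "((\<lambda>x. \<lambda>j\<in>{..n}. \<Sum>i<j. x i) \<circ> (\<lambda>\<omega>. \<lambda>i\<in>{..<n}. linc X s d i \<omega>)) \<omega> = gridv X s d n \<omega>"
      by (auto simp: gridv_def fun_eq_iff restrict_def)
  qed
  finally show ?thesis ..
qed

text \<open>Finite-dimensional events have the same probability for all Levy processes with the same triplet and all starting times.\<close>
lemma gridv_prob_eq:
  assumes X: "levy_process_triplet0 M \<mu> X" and Z: "levy_process_triplet0 M \<mu> Z" and s: "0 \<le> s" "0 \<le> r" "0 \<le> d"
    and P: "Measurable.pred (PiM {..n} (\<lambda>_. borel)) P"
  shows "prob {\<omega>\<in>space M. P (gridv X s d n \<omega>)} = prob {\<omega>\<in>space M. P (gridv Z r d n \<omega>)}"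
proof (cases "n = 0")
  case True
  have "gridv X s d n \<omega> = gridv Z r d n \<omega>" for \<omega> using True by (auto simp: gridv_def fun_eq_iff)
  thus ?thesis by simp
next
  case False
  hence n: "0 < n" by simp
  have S: "{y\<in>space (PiM {..n} (\<lambda>_. borel)). P y} \<in> sets (PiM {..n} (\<lambda>_. borel :: real measure))"
    using P by measurable
  have *: "prob {\<omega>\<in>space M. P (gridv X s d n \<omega>)} = measure (distr M (PiM {..n} (\<lambda>_. borel)) (gridv X s d n)) {y\<in>space (PiM {..n} (\<lambda>_. borel)). P y}"
    if X: "levy_process_triplet0 M \<mu> X" and s: "0 \<le> s" for X s
  proof -
    have m: "gridv X s d n \<in> measurable M (PiM {..n} (\<lambda>_. borel))" by (rule gridv_measurable[OF X s assms(5)])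
    show ?thesis unfolding measure_distr[OF m S]
      by (rule arg_cong[where f=prob]) (use measurable_space[OF m] in auto)
  qed
  show ?thesis unfolding *[OF X s(1)] *[OF Z s(2)] gridv_law[OF X s(1,3) n] gridv_law[OF Z s(2,3) n] levy_law_eq[OF X Z s(3)] ..
qed

text \<open>The Markov property at a fixed grid time: the two vectors are functions of disjoint
  blocks of cell increments.\<close>

lemma gridv_indep:
  assumes X: "levy_process_triplet0 M \<mu> X" and s: "0 \<le> s" "0 \<le> d"
    and P1: "Measurable.pred (PiM {..n} (\<lambda>_. borel)) P1" and P2: "Measurable.pred (PiM {..m} (\<lambda>_. borel)) P2"
  shows "prob {\<omega>\<in>space M. P1 (gridv X s d n \<omega>) \<and> P2 (gridv X (s + real n * d) d m \<omega>)}
    = prob {\<omega>\<in>space M. P1 (gridv X s d n \<omega>)} * prob {\<omega>\<in>space M. P2 (gridv X (s + real n * d) d m \<omega>)}"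
proof -
  define A where "A \<omega> = (\<lambda>i\<in>{..<n}. linc X s d i \<omega>)" for \<omega>
  define B where "B \<omega> = (\<lambda>i\<in>{n..<n+m}. linc X s d i \<omega>)" for \<omega>
  have ind: "indep_var (PiM {..<n} (\<lambda>_. borel)) A (PiM {n..<n+m} (\<lambda>_. borel)) B"
    unfolding A_def[abs_def] B_def[abs_def] by (rule indep_var_restrict[OF linc_indep[OF X s, of "n + m"]]) auto
  define f where "f x = (\<lambda>j\<in>{..n}. \<Sum>i<j. x i :: real)" for x
  define g where "g x = (\<lambda>j\<in>{..m}. \<Sum>i\<in>{n..<n+j}. x i :: real)" for x
  have fm: "f \<in> measurable (PiM {..<n} (\<lambda>_. borel)) (PiM {..n} (\<lambda>_. borel))" unfolding f_def[abs_def]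
    by (intro measurable_restrict borel_measurable_sum measurable_component_singleton) auto
  have gm: "g \<in> measurable (PiM {n..<n+m} (\<lambda>_. borel)) (PiM {..m} (\<lambda>_. borel))" unfolding g_def[abs_def]
    by (intro measurable_restrict borel_measurable_sum measurable_component_singleton) auto
  have fA: "f \<circ> A = gridv X s d n"
  proof (rule ext)
    fix \<omega>
    have "(\<Sum>i<j. A \<omega> i) = X (s + real j * d) \<omega> - X s \<omega>" if "j \<le> n" for j
      unfolding linc_sum[symmetric] A_def using that by (intro sum.cong) auto
    thus "(f \<circ> A) \<omega> = gridv X s d n \<omega>" by (auto simp: gridv_def f_def fun_eq_iff restrict_def)
  qed
  have gB: "g \<circ> B = gridv X (s + real n * d) d m"
  proof (rule ext)
    fix \<omega>
    have "(\<Sum>i\<in>{n..<n+j}. B \<omega> i) = X (s + real n * d + real j * d) \<omega> - X (s + real n * d) \<omega>" if "j \<le> m" for j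
      unfolding linc_sum_shift[symmetric] B_def using that by (intro sum.cong) auto
    thus "(g \<circ> B) \<omega> = gridv X (s + real n * d) d m \<omega>" by (auto simp: gridv_def g_def fun_eq_iff restrict_def)
  qed
  have ind2: "indep_var (PiM {..n} (\<lambda>_. borel)) (gridv X s d n) (PiM {..m} (\<lambda>_. borel)) (gridv X (s + real n * d) d m)"
    using indep_var_compose[OF ind fm gm] unfolding fA gB .
  define S1 where "S1 = {y\<in>space (PiM {..n} (\<lambda>_. borel)). P1 y}"
  define S2 where "S2 = {y\<in>space (PiM {..m} (\<lambda>_. borel)). P2 y}"
  have S: "S1 \<in> sets (PiM {..n} (\<lambda>_. borel))" "S2 \<in> sets (PiM {..m} (\<lambda>_. borel))"
    unfolding S1_def S2_def using P1 P2 by measurable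
  have m1: "gridv X s d n \<in> measurable M (PiM {..n} (\<lambda>_. borel))" by (rule gridv_measurable[OF X s])
  have m2: "gridv X (s + real n * d) d m \<in> measurable M (PiM {..m} (\<lambda>_. borel))" by (rule gridv_measurable[OF X _ s(2)]) (use s in auto)
  have e: "(\<lambda>\<omega>. (gridv X s d n \<omega>, gridv X (s + real n * d) d m \<omega>)) -` (S1 \<times> S2) \<inter> space M = {\<omega>\<in>space M. P1 (gridv X s d n \<omega>) \<and> P2 (gridv X (s + real n * d) d m \<omega>)}"
    "gridv X s d n -` S1 \<inter> space M = {\<omega>\<in>space M. P1 (gridv X s d n \<omega>)}"
    "gridv X (s + real n * d) d m -` S2 \<inter> space M = {\<omega>\<in>space M. P2 (gridv X (s + real n * d) d m \<omega>)}"
    using measurable_space[OF m1] measurable_space[OF m2] by (auto simp: S1_def S2_def)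
  show ?thesis using indep_varD[OF ind2 S] unfolding e .
qed

end

section \<open>Maximal increments of Levy processes with bounded jumps\<close>

lemma gridv_component: "j \<le> n \<Longrightarrow> (\<lambda>y. y j) \<in> borel_measurable (PiM {..n} (\<lambda>_. borel))"
  by (rule measurable_component_singleton) simp

text \<open>One reference process carries the bounded jumps. Its estimates pass to every process
  with the same triplet through the equality of grid laws.\<close>

locale levy_noise = prob_space M for M :: "'a measure" +
  fixes \<mu> :: "real measure" and R :: real and X0 :: "real \<Rightarrow> 'a \<Rightarrow> real"
  assumes R0: "0 \<le> R"
    and base: "levy_process_triplet0 M \<mu> X0"
    and base_jumps: "AE \<omega> in M. \<forall>t>0. \<forall>l. ((\<lambda>s. X0 s \<omega>) \<longlongrightarrow> l) (at_left t) \<longrightarrow> \<bar>X0 t \<omega> - l\<bar> \<le> R"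
begin

abbreviation levy :: "(real \<Rightarrow> 'a \<Rightarrow> real) \<Rightarrow> bool" where "levy X \<equiv> levy_process_triplet0 M \<mu> X"

lemma levy_cadlag: "levy X \<Longrightarrow> AE \<omega> in M. cadlag_path (\<lambda>t. X t \<omega>)"
  unfolding levy_process_triplet0_def by (elim conjE)

definition maxgt :: "(real \<Rightarrow> 'a \<Rightarrow> real) \<Rightarrow> real \<Rightarrow> nat \<Rightarrow> real \<Rightarrow> 'a set" where
  "maxgt X s m x = {\<omega>\<in>space M. \<exists>j\<in>{..2 ^ m}. x < \<bar>X (s + real j / 2 ^ m) \<omega> - X s \<omega>\<bar>}"

text \<open>The trace of \<open>cadlag_osc\<close> on grids: within some cell of width 2^-m the
  finer grid shows an increment beyond R + 1. Three units of time cover a quiet unit, the passage,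
  and a second quiet unit.\<close>

definition osc :: "(real \<Rightarrow> 'a \<Rightarrow> real) \<Rightarrow> real \<Rightarrow> nat \<Rightarrow> nat \<Rightarrow> 'a set" where
  "osc X s m m' = {\<omega>\<in>space M. \<exists>i\<in>{..<3 * 2 ^ m}. \<exists>j\<in>{..2 ^ m'}.
      R + 1 < \<bar>X (s + real i / 2 ^ m + real j / 2 ^ (m + m')) \<omega> - X (s + real i / 2 ^ m) \<omega>\<bar>}"

lemma maxgt_gridv: "maxgt X s m x = {\<omega>\<in>space M. (\<lambda>y. \<exists>j\<in>{..2 ^ m}. x < \<bar>y j\<bar>) (gridv X s (1 / 2 ^ m) (2 ^ m) \<omega>)}"
  unfolding maxgt_def gridv_def by auto

lemma maxgt_pred: "Measurable.pred (PiM {..2 ^ m} (\<lambda>_. borel)) (\<lambda>y. \<exists>j\<in>{..(2::nat) ^ m}. x < \<bar>y j :: real\<bar>)"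
proof (intro pred_intros_finite)
  fix j :: nat assume "j \<in> {..2 ^ m}"
  hence [measurable]: "(\<lambda>y. y j) \<in> borel_measurable (PiM {..2 ^ m} (\<lambda>_. borel :: real measure))" by (intro gridv_component) auto
  show "Measurable.pred (PiM {..2 ^ m} (\<lambda>_. borel)) (\<lambda>y. x < \<bar>y j :: real\<bar>)" by measurable
qed auto

lemma osc_gridv: "osc X s m m' = {\<omega>\<in>space M. (\<lambda>y. \<exists>i\<in>{..<3 * 2 ^ m}. \<exists>j\<in>{..2 ^ m'}. R + 1 < \<bar>y (i * 2 ^ m' + j) - y (i * 2 ^ m')\<bar>) (gridv X s (1 / 2 ^ (m + m')) (3 * 2 ^ (m + m')) \<omega>)}"
proof -
  have e: "R + 1 < \<bar>X (s + real i / 2 ^ m + real j / 2 ^ (m + m')) \<omega> - X (s + real i / 2 ^ m) \<omega>\<bar> \<longleftrightarrow>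
     R + 1 < \<bar>gridv X s (1 / 2 ^ (m + m')) (3 * 2 ^ (m + m')) \<omega> (i * 2 ^ m' + j) - gridv X s (1 / 2 ^ (m + m')) (3 * 2 ^ (m + m')) \<omega> (i * 2 ^ m')\<bar>"
    if "i \<in> {..<3 * 2 ^ m}" "j \<in> {..2 ^ m'}" for i j \<omega>
  proof -
    have "i * 2 ^ m' + j \<le> (i + 1) * 2 ^ m'" using that by simp
    also have "\<dots> \<le> (3 * 2 ^ m) * 2 ^ m'" using that by (intro mult_right_mono) auto
    finally have 1: "i * 2 ^ m' + j \<le> 3 * 2 ^ (m + m')" by (simp add: power_add mult.assoc)
    have 2: "i * 2 ^ m' \<le> 3 * 2 ^ (m + m')" using 1 by simp
    have 3: "real (i * 2 ^ m') * (1 / 2 ^ (m + m')) = real i / 2 ^ m" by (simp add: power_add)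
    have 4: "real (i * 2 ^ m' + j) * (1 / 2 ^ (m + m')) = real i / 2 ^ m + real j / 2 ^ (m + m')"
      by (simp add: power_add add_divide_distrib)
    show ?thesis using 1 2 unfolding gridv_def by (simp only: restrict_apply atMost_iff if_True 3 4) (simp add: add.assoc)
  qed
  show ?thesis unfolding osc_def using e by blast
qed

lemma osc_pred: "Measurable.pred (PiM {..3 * 2 ^ (m + m')} (\<lambda>_. borel)) (\<lambda>y. \<exists>i\<in>{..<3 * (2::nat) ^ m}. \<exists>j\<in>{..(2::nat) ^ m'}. c < \<bar>y (i * 2 ^ m' + j) - y (i * 2 ^ m') :: real\<bar>)"
proof (intro pred_intros_finite)
  fix i j :: nat assume "i \<in> {..<3 * 2 ^ m}" "j \<in> {..2 ^ m'}"
  hence "i * 2 ^ m' + j \<le> (i + 1) * 2 ^ m'" "i + 1 \<le> 3 * 2 ^ m" by auto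
  moreover from this(2) have "(i + 1) * 2 ^ m' \<le> (3 * 2 ^ m) * 2 ^ m'" by (rule mult_le_mono1)
  ultimately have "i * 2 ^ m' + j \<le> (3 * 2 ^ m) * 2 ^ m'" by linarith
  hence 1: "i * 2 ^ m' + j \<le> 3 * 2 ^ (m + m')" by (simp add: power_add mult.assoc)
  hence [measurable]: "(\<lambda>y. y (i * 2 ^ m' + j)) \<in> borel_measurable (PiM {..3 * 2 ^ (m + m')} (\<lambda>_. borel :: real measure))"
    "(\<lambda>y. y (i * 2 ^ m')) \<in> borel_measurable (PiM {..3 * 2 ^ (m + m')} (\<lambda>_. borel :: real measure))"
    by (intro gridv_component, simp)+
  show "Measurable.pred (PiM {..3 * 2 ^ (m + m')} (\<lambda>_. borel)) (\<lambda>y. c < \<bar>y (i * 2 ^ m' + j) - y (i * 2 ^ m') :: real\<bar>)" by measurable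
qed auto

lemma maxgt_prob_eq: "levy X \<Longrightarrow> 0 \<le> s \<Longrightarrow> prob (maxgt X s m x) = prob (maxgt X0 0 m x)"
  unfolding maxgt_gridv by (rule gridv_prob_eq[OF _ base _ _ _ maxgt_pred]) auto

lemma osc_prob_eq: "levy X \<Longrightarrow> 0 \<le> s \<Longrightarrow> prob (osc X s m m') = prob (osc X0 0 m m')"
  unfolding osc_gridv by (rule gridv_prob_eq[OF _ base _ _ _ osc_pred]) auto

lemma levy_rv: "levy X \<Longrightarrow> 0 \<le> t \<Longrightarrow> random_variable borel (X t)" by (rule levy_measurable)

lemma maxgt_sets: "levy X \<Longrightarrow> 0 \<le> s \<Longrightarrow> maxgt X s m x \<in> sets M"
proof -
  assume X: "levy X" "0 \<le> s"
  have [measurable]: "random_variable borel (X (s + real j / 2 ^ m))" "random_variable borel (X s)" for j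
    using X by (auto intro!: levy_rv)
  show ?thesis unfolding maxgt_def by measurable
qed

lemma osc_sets: "levy X \<Longrightarrow> 0 \<le> s \<Longrightarrow> osc X s m m' \<in> sets M"
proof -
  assume X: "levy X" "0 \<le> s"
  have [measurable]: "random_variable borel (X (s + real i / 2 ^ m + real j / 2 ^ (m + m')))" "random_variable borel (X (s + real i / 2 ^ m))" for i j
    using X by (auto intro!: levy_rv)
  show ?thesis unfolding osc_def by measurable
qed

lemma incseq_prob_limit:
  assumes "\<And>n. F n \<in> sets M" "incseq F" "AE \<omega> in M. \<exists>n. \<omega> \<in> F n" "0 < e"
  shows "\<exists>n. prob (space M - F n) \<le> e"
proof -
  have "(\<lambda>n. prob (F n)) \<longlonglongrightarrow> prob (\<Union>n. F n)" by (rule finite_Lim_measure_incseq) (use assms in auto)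
  moreover have "prob (\<Union>n. F n) = 1"
    by (subst prob_eq_1) (use assms in auto)
  ultimately have "eventually (\<lambda>n. 1 - e < prob (F n)) sequentially" using assms(4) by (intro order_tendstoD(1)) auto
  then obtain n where "1 - e < prob (F n)" by (auto simp: eventually_sequentially)
  thus ?thesis using prob_compl[OF assms(1)[of n]] by (intro exI[of _ n]) simp
qed

text \<open>A cadlag path is bounded on [0, 1], so with high probability one level serves all grids
  of the reference path at once; each single grid event then transfers to any process and starting
  time.\<close>

lemma tight:
  assumes "0 < e" shows "\<exists>A>0. \<forall>X s m. levy X \<longrightarrow> 0 \<le> s \<longrightarrow> prob (maxgt X s m A) \<le> e"
proof -
  define F where "F B = {\<omega>\<in>space M. \<forall>m. \<forall>j\<in>{..2 ^ m}. \<bar>X0 (0 + real j / 2 ^ m) \<omega> - X0 0 \<omega>\<bar> \<le> real (Suc B)}" for B :: nat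
  have Fs: "F B \<in> sets M" for B
  proof -
    have [measurable]: "random_variable borel (X0 (0 + real j / 2 ^ m))" "random_variable borel (X0 0)" for j m
      using base by (auto intro!: levy_rv)
    show ?thesis unfolding F_def by measurable
  qed
  have inc: "incseq F"
  proof (intro monoI subsetI)
    fix A B \<omega> assume "A \<le> B" "\<omega> \<in> F A"
    moreover from this(1) have "real (Suc A) \<le> real (Suc B)" by simp
    ultimately show "\<omega> \<in> F B" unfolding F_def by (blast intro: order_trans)
  qed
  have "AE \<omega> in M. \<exists>B. \<omega> \<in> F B"
    using levy_cadlag[OF base] AE_space
  proof eventually_elim
    case (elim \<omega>)
    obtain B where B: "\<forall>t\<in>{0..1}. \<bar>X0 t \<omega> - X0 0 \<omega>\<bar> \<le> B" using cadlag_bounded[OF elim(1), of 0 1 "X0 0 \<omega>"] by auto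
    obtain n where n: "B \<le> real n" using real_arch_simple by blast
    have "\<omega> \<in> F n" unfolding F_def
    proof (intro CollectI conjI allI ballI elim(2))
      fix m j :: nat assume "j \<in> {..2 ^ m}"
      hence "real j \<le> 2 ^ m" using of_nat_mono[of j "2 ^ m"] by simp
      hence "0 + real j / 2 ^ m \<in> {0..1}" by simp
      hence "\<bar>X0 (0 + real j / 2 ^ m) \<omega> - X0 0 \<omega>\<bar> \<le> B" using B by blast
      thus "\<bar>X0 (0 + real j / 2 ^ m) \<omega> - X0 0 \<omega>\<bar> \<le> real (Suc n)" using n by simp
    qed
    thus ?case by blast
  qed
  from incseq_prob_limit[OF Fs inc this assms] obtain B where B: "prob (space M - F B) \<le> e" by blast
  show ?thesis
  proof (intro exI[of _ "real (Suc B)"] conjI allI impI)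
    fix X and s :: real and m assume X: "levy X" "0 \<le> s"
    have "prob (maxgt X s m (real (Suc B))) = prob (maxgt X0 0 m (real (Suc B)))" by (rule maxgt_prob_eq[OF X])
    also have "\<dots> \<le> prob (space M - F B)"
    proof (rule finite_measure_mono)
      show "maxgt X0 0 m (real (Suc B)) \<subseteq> space M - F B"
      proof (intro subsetI DiffI notI)
        fix \<omega> assume "\<omega> \<in> maxgt X0 0 m (real (Suc B))"
        then obtain j where j: "j \<in> {..2 ^ m}" "real (Suc B) < \<bar>X0 (0 + real j / 2 ^ m) \<omega> - X0 0 \<omega>\<bar>" and "\<omega> \<in> space M"
          unfolding maxgt_def by blast
        thus "\<omega> \<in> space M" by simp
        assume "\<omega> \<in> F B"
        hence "\<bar>X0 (0 + real j / 2 ^ m) \<omega> - X0 0 \<omega>\<bar> \<le> real (Suc B)" unfolding F_def using j(1) by blast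
        thus False using j(2) by linarith
      qed
    qed (use Fs in auto)
    finally show "prob (maxgt X s m (real (Suc B))) \<le> e" using B by simp
  qed simp
qed

text \<open>Almost every reference path has all its increments over sufficiently short cells at most
  R + 1, by \<open>cadlag_osc\<close>; the transfer again happens grid by grid.\<close>

lemma osc_small:
  assumes "0 < e" shows "\<exists>m0. \<forall>X s m m'. levy X \<longrightarrow> 0 \<le> s \<longrightarrow> m0 \<le> m \<longrightarrow> prob (osc X s m m') \<le> e"
proof -
  define G where "G m0 = {\<omega>\<in>space M. \<forall>m. m0 \<le> m \<longrightarrow> (\<forall>i\<in>{..<3 * 2 ^ m}. \<forall>m'. \<forall>j\<in>{..2 ^ m'}.
      \<bar>X0 (0 + real i / 2 ^ m + real j / 2 ^ (m + m')) \<omega> - X0 (0 + real i / 2 ^ m) \<omega>\<bar> \<le> R + 1)}" for m0 :: nat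
  have Gs: "G m0 \<in> sets M" for m0
  proof -
    have [measurable]: "random_variable borel (X0 (0 + real i / 2 ^ m + real j / 2 ^ (m + m')))" "random_variable borel (X0 (0 + real i / 2 ^ m))" for i j m m'
      using base by (auto intro!: levy_rv)
    show ?thesis unfolding G_def by measurable
  qed
  have inc: "incseq G" unfolding G_def by (intro monoI) (auto intro: order_trans)
  have "AE \<omega> in M. \<exists>m0. \<omega> \<in> G m0"
    using levy_cadlag[OF base] base_jumps AE_space
  proof eventually_elim
    case (elim \<omega>)
    obtain d where d: "d > 0" "\<And>x y. 0 \<le> x \<Longrightarrow> x \<le> y \<Longrightarrow> y \<le> 3 \<Longrightarrow> y - x < d \<Longrightarrow> \<bar>X0 y \<omega> - X0 x \<omega>\<bar> \<le> R + 1"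
      using cadlag_osc[OF elim(1,2) R0, of 0 3] by auto
    obtain m0 where m0: "(1/2) ^ m0 < d" using real_arch_pow_inv[of d "1/2"] d(1) by auto
    have "\<omega> \<in> G m0" unfolding G_def
    proof (intro CollectI conjI allI ballI impI elim(3))
      fix m i m' j :: nat assume m: "m0 \<le> m" and i: "i \<in> {..<3 * 2 ^ m}" and j: "j \<in> {..2 ^ m'}"
      have "real j \<le> 2 ^ m'" using j of_nat_mono[of j "2 ^ m'"] by simp
      hence "real j / 2 ^ (m + m') \<le> 2 ^ m' / 2 ^ (m + m')" by (intro divide_right_mono) auto
      also have "\<dots> = (1/2) ^ m" by (simp add: power_add power_divide)
      finally have jm: "real j / 2 ^ (m + m') \<le> (1/2) ^ m" .
      have "(1/2::real) ^ m \<le> (1/2) ^ m0" using m by (intro power_decreasing) auto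
      hence jd: "real j / 2 ^ (m + m') < d" using jm m0 by linarith
      have "real (i + 1) \<le> real (3 * 2 ^ m)" using i by (intro of_nat_mono) auto
      hence "real (i + 1) / 2 ^ m \<le> 3 * 2 ^ m / 2 ^ m" by (intro divide_right_mono) auto
      hence "real i / 2 ^ m + (1/2) ^ m \<le> 3" by (simp add: add_divide_distrib power_divide)
      hence le3: "0 + real i / 2 ^ m + real j / 2 ^ (m + m') \<le> 3" using jm by linarith
      show "\<bar>X0 (0 + real i / 2 ^ m + real j / 2 ^ (m + m')) \<omega> - X0 (0 + real i / 2 ^ m) \<omega>\<bar> \<le> R + 1"
        by (rule d(2)) (use le3 jd in auto)
    qed
    thus ?case by blast
  qed
  from incseq_prob_limit[OF Gs inc this assms] obtain m0 where m0: "prob (space M - G m0) \<le> e" by blast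
  show ?thesis
  proof (intro exI[of _ m0] allI impI)
    fix X and s :: real and m m' :: nat assume X: "levy X" "0 \<le> s" "m0 \<le> m"
    have "prob (osc X s m m') = prob (osc X0 0 m m')" by (rule osc_prob_eq[OF X(1,2)])
    also have "\<dots> \<le> prob (space M - G m0)"
    proof (rule finite_measure_mono)
      show "osc X0 0 m m' \<subseteq> space M - G m0"
      proof (intro subsetI DiffI notI)
        fix \<omega> assume "\<omega> \<in> osc X0 0 m m'"
        then obtain i j where j: "i \<in> {..<3 * 2 ^ m}" "j \<in> {..2 ^ m'}" and gt: "R + 1 < \<bar>X0 (0 + real i / 2 ^ m + real j / 2 ^ (m + m')) \<omega> - X0 (0 + real i / 2 ^ m) \<omega>\<bar>" and "\<omega> \<in> space M"
          unfolding osc_def by blast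
        thus "\<omega> \<in> space M" by simp
        assume "\<omega> \<in> G m0"
        hence "\<bar>X0 (0 + real i / 2 ^ m + real j / 2 ^ (m + m')) \<omega> - X0 (0 + real i / 2 ^ m) \<omega>\<bar> \<le> R + 1" unfolding G_def using j X(3) by blast
        thus False using gt by linarith
      qed
    qed (use Gs in auto)
    finally show "prob (osc X s m m') \<le> e" using m0 by simp
  qed
qed

text \<open>The condition on all earlier steps bounds the overshoot at a first passage. Paths
  violating it belong to an \<open>osc\<close> event, which becomes negligible on fine
  grids.\<close>

definition reach :: "(real \<Rightarrow> 'a \<Rightarrow> real) \<Rightarrow> real \<Rightarrow> nat \<Rightarrow> real \<Rightarrow> 'a set" where
  "reach X s m x = {\<omega>\<in>space M. \<exists>j\<in>{..2 ^ m}. x < \<bar>X (s + real j / 2 ^ m) \<omega> - X s \<omega>\<bar> \<and>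
      (\<forall>i\<in>{..<j}. \<bar>X (s + real (Suc i) / 2 ^ m) \<omega> - X (s + real i / 2 ^ m) \<omega>\<bar> \<le> R + 1)}"

lemma reach_sets: "levy X \<Longrightarrow> 0 \<le> s \<Longrightarrow> reach X s m x \<in> sets M"
proof -
  assume X: "levy X" "0 \<le> s"
  have [measurable]: "random_variable borel (X (s + real j / 2 ^ m))" "random_variable borel (X s)" for j
    using X by (auto intro!: levy_rv)
  show ?thesis unfolding reach_def by measurable
qed

text \<open>First passage decomposition: from the first grid time above level \<open>x\<close>, where the overshoot is at most \<open>R + 1\<close>,
  reaching \<open>x + A + R + 1\<close> requires a further independent displacement exceeding \<open>A\<close>.\<close>
lemma reach_step:
  assumes X: "levy X" and s: "0 \<le> s" and x: "0 \<le> x" and A: "0 \<le> A"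
    and q: "\<And>r. 0 \<le> r \<Longrightarrow> prob (maxgt X r m A) \<le> q"
  shows "prob (reach X s m (x + (A + (R + 1)))) \<le> q * prob (reach X s m x)"
proof -
  define n :: nat where "n = 2 ^ m"
  define d :: real where "d = 1 / 2 ^ m"
  have d0: "0 \<le> d" by (simp add: d_def)
  have t: "s + real j * d = s + real j / 2 ^ m" for j by (simp add: d_def)
  \<comment> \<open>First passage above \<open>x\<close> at index \<open>j\<close> with no large
    step on the way: an event determined by the increments up to \<open>j\<close>, hence independent
    of those that follow.\<close>
  define P1 where "P1 j y \<longleftrightarrow> (\<forall>i\<in>{..<j}. \<bar>y i\<bar> \<le> x) \<and> x < \<bar>y j\<bar> \<and> (\<forall>i\<in>{..<j}. \<bar>y (Suc i) - y i :: real\<bar> \<le> R + 1)" for j :: nat and y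
  define P2 where "P2 y \<longleftrightarrow> (\<exists>j\<in>{..2 ^ m}. A < \<bar>y j\<bar>)" for y :: "nat \<Rightarrow> real"
  have P1m: "Measurable.pred (PiM {..j} (\<lambda>_. borel)) (P1 j)" for j
    unfolding P1_def
  proof (intro pred_intros_logic pred_intros_finite)
    fix i assume "i \<in> {..<j}"
    hence [measurable]: "(\<lambda>y. y i) \<in> borel_measurable (PiM {..j} (\<lambda>_. borel :: real measure))" "(\<lambda>y. y (Suc i)) \<in> borel_measurable (PiM {..j} (\<lambda>_. borel :: real measure))"
      by (auto intro!: gridv_component)
    show "Measurable.pred (PiM {..j} (\<lambda>_. borel)) (\<lambda>y. \<bar>y i\<bar> \<le> x)" by measurable
    show "Measurable.pred (PiM {..j} (\<lambda>_. borel)) (\<lambda>y. \<bar>y (Suc i) - y i\<bar> \<le> R + 1)" by measurable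
  next
    have [measurable]: "(\<lambda>y. y j) \<in> borel_measurable (PiM {..j} (\<lambda>_. borel :: real measure))" by (intro gridv_component) simp
    show "Measurable.pred (PiM {..j} (\<lambda>_. borel)) (\<lambda>y. x < \<bar>y j\<bar>)" by measurable
  qed auto
  have P2m: "Measurable.pred (PiM {..n} (\<lambda>_. borel)) P2" unfolding P2_def n_def by (rule maxgt_pred)
  define F where "F j = {\<omega>\<in>space M. P1 j (gridv X s d j \<omega>)}" for j
  define H where "H j = {\<omega>\<in>space M. P2 (gridv X (s + real j * d) d n \<omega>)}" for j
  have sj: "0 \<le> s + real j * d" for j using s d0 by simp
  have Fs: "F j \<in> sets M" for j unfolding F_def
    using measurable_compose[OF gridv_measurable[OF X s d0, of j] P1m[of j]] by (simp add: pred_def)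
  have Hs: "H j \<in> sets M" for j unfolding H_def
    using measurable_compose[OF gridv_measurable[OF X sj d0, of j n] P2m] by (simp add: pred_def)
  have Hq: "prob (H j) \<le> q" for j
    using q[OF sj[of j]] unfolding H_def P2_def maxgt_gridv d_def n_def .
  have FH: "prob (F j \<inter> H j) \<le> q * prob (F j)" for j
  proof -
    have "F j \<inter> H j = {\<omega>\<in>space M. P1 j (gridv X s d j \<omega>) \<and> P2 (gridv X (s + real j * d) d n \<omega>)}" by (auto simp: F_def H_def)
    hence "prob (F j \<inter> H j) = prob (F j) * prob (H j)" using gridv_indep[OF X s d0 P1m P2m, of j] by (simp add: F_def H_def)
    also have "\<dots> \<le> prob (F j) * q" by (intro mult_left_mono Hq) auto
    finally show ?thesis by (simp add: mult.commute)
  qed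
  have gv: "gridv X s d j \<omega> i = X (s + real i / 2 ^ m) \<omega> - X s \<omega>" if "i \<le> j" for i j \<omega>
    using that by (simp add: gridv_def d_def)
  have Fchar: "\<omega> \<in> F j \<longleftrightarrow> \<omega> \<in> space M \<and> (\<forall>i<j. \<bar>X (s + real i / 2 ^ m) \<omega> - X s \<omega>\<bar> \<le> x) \<and> x < \<bar>X (s + real j / 2 ^ m) \<omega> - X s \<omega>\<bar> \<and>
     (\<forall>i<j. \<bar>X (s + real (Suc i) / 2 ^ m) \<omega> - X (s + real i / 2 ^ m) \<omega>\<bar> \<le> R + 1)" for \<omega> j
    unfolding F_def P1_def by (auto simp: gv)
  have sub: "reach X s m (x + (A + (R + 1))) \<subseteq> (\<Union>j\<in>{..n}. F j \<inter> H j)"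
  proof
    fix \<omega> assume "\<omega> \<in> reach X s m (x + (A + (R + 1)))"
    then obtain j where w: "\<omega> \<in> space M" and j: "j \<le> 2 ^ m" "x + (A + (R + 1)) < \<bar>X (s + real j / 2 ^ m) \<omega> - X s \<omega>\<bar>"
      and inc: "\<And>i. i < j \<Longrightarrow> \<bar>X (s + real (Suc i) / 2 ^ m) \<omega> - X (s + real i / 2 ^ m) \<omega>\<bar> \<le> R + 1"
      by (auto simp: reach_def)
    define y where "y i = X (s + real i / 2 ^ m) \<omega> - X s \<omega>" for i :: nat
    show "\<omega> \<in> (\<Union>j\<in>{..n}. F j \<inter> H j)"
    proof (cases "\<exists>i\<le>j. x < \<bar>y i\<bar>")
      case True
      define k where "k = (LEAST i. x < \<bar>y i\<bar>)"
      have k: "x < \<bar>y k\<bar>" unfolding k_def using True by (meson LeastI)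
      have kj: "k \<le> j" using True unfolding k_def by (meson Least_le order_trans)
      have kl: "\<bar>y i\<bar> \<le> x" if "i < k" for i using not_less_Least[of i "\<lambda>i. x < \<bar>y i\<bar>"] that unfolding k_def by simp
      \<comment> \<open>The displacement at index 0 is 0, not above \<open>x\<close>; so the passage
        index has a predecessor, at which the level was not exceeded.\<close>
      have "k \<noteq> 0" using k x by (auto simp: y_def intro: ccontr)
      then obtain k' where k': "k = Suc k'" using not0_implies_Suc by blast
      have "\<bar>y k - y k'\<bar> \<le> R + 1" using inc[of k'] k' kj by (simp add: y_def)
      hence yk: "\<bar>y k\<bar> \<le> x + (R + 1)" using kl[of k'] k' by linarith
      have "\<omega> \<in> F k" unfolding Fchar using w k kl inc kj by (auto simp: y_def)
      moreover have "\<omega> \<in> H k"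
      proof -
        have "A < \<bar>y j - y k\<bar>" using j(2) yk unfolding y_def[symmetric] by linarith
        moreover have "gridv X (s + real k * d) d n \<omega> (j - k) = y j - y k"
        proof -
          have "s + real k * d + real (j - k) * d = s + real j / 2 ^ m" using kj by (simp add: d_def of_nat_diff algebra_simps diff_divide_distrib)
          moreover have "j - k \<in> {..n}" using j(1) by (simp add: n_def)
          ultimately show ?thesis unfolding gridv_def y_def by (simp only: restrict_apply if_True t)
        qed
        ultimately show ?thesis unfolding H_def P2_def using w j(1) by (auto intro!: bexI[of _ "j - k"])
      qed
      ultimately show ?thesis using kj j(1) by (auto simp: n_def)
    next
      case False
      hence "\<bar>y j\<bar> \<le> x" by auto
      hence "A + (R + 1) < 0" using j(2) unfolding y_def by linarith
      hence "A < 0" using R0 by linarith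
      thus ?thesis using A by simp
    qed
  qed
  have "prob (reach X s m (x + (A + (R + 1)))) \<le> prob (\<Union>j\<in>{..n}. F j \<inter> H j)"
    by (rule finite_measure_mono[OF sub]) (use Fs Hs in auto)
  also have "\<dots> \<le> (\<Sum>j\<in>{..n}. prob (F j \<inter> H j))"
    by (rule finite_measure_subadditive_finite) (use Fs Hs in auto)
  also have "\<dots> \<le> (\<Sum>j\<in>{..n}. q * prob (F j))" by (intro sum_mono FH)
  also have "\<dots> = q * prob (\<Union>j\<in>{..n}. F j)"
  proof -
    have "disjoint_family_on F {..n}"
      unfolding disjoint_family_on_def
    proof (intro ballI impI equals0I)
      fix i j \<omega> assume "i \<in> {..n}" "j \<in> {..n}" "i \<noteq> j" "\<omega> \<in> F i \<inter> F j"
      hence a: "\<forall>k<i. \<bar>X (s + real k / 2 ^ m) \<omega> - X s \<omega>\<bar> \<le> x" "x < \<bar>X (s + real i / 2 ^ m) \<omega> - X s \<omega>\<bar>"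
        "\<forall>k<j. \<bar>X (s + real k / 2 ^ m) \<omega> - X s \<omega>\<bar> \<le> x" "x < \<bar>X (s + real j / 2 ^ m) \<omega> - X s \<omega>\<bar>"
        unfolding Int_iff Fchar by blast+
      consider "i < j" | "j < i" using \<open>i \<noteq> j\<close> by linarith
      thus False using a by cases (fastforce simp: not_le[symmetric])+
    qed
    hence "prob (\<Union>j\<in>{..n}. F j) = (\<Sum>j\<in>{..n}. prob (F j))" using Fs by (intro finite_measure_finite_Union) auto
    thus ?thesis by (simp add: sum_distrib_left)
  qed
  also have "\<dots> \<le> q * prob (reach X s m x)"
  proof (rule mult_left_mono)
    show "prob (\<Union>j\<in>{..n}. F j) \<le> prob (reach X s m x)"
      by (rule finite_measure_mono[OF _ reach_sets[OF X s]]) (auto simp: Fchar reach_def n_def)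
    show "0 \<le> q" using Hq[of 0] measure_nonneg[of M "H 0"] by linarith
  qed
  finally show ?thesis .
qed

lemma maxgt_mono:
  assumes "m \<le> m'" shows "maxgt X s m x \<subseteq> maxgt X s m' x"
proof
  fix \<omega> assume "\<omega> \<in> maxgt X s m x"
  then obtain j where w: "\<omega> \<in> space M" and j: "j \<le> 2 ^ m" "x < \<bar>X (s + real j / 2 ^ m) \<omega> - X s \<omega>\<bar>" by (auto simp: maxgt_def)
  obtain k where k: "m' = m + k" using assms le_Suc_ex by blast
  have "j * 2 ^ k \<le> 2 ^ m'" using j(1) unfolding k by (simp add: power_add)
  moreover have "real (j * 2 ^ k) / 2 ^ m' = real j / 2 ^ m" unfolding k by (simp add: power_add)
  ultimately show "\<omega> \<in> maxgt X s m' x" unfolding maxgt_def using w j(2) by (auto intro!: bexI[of _ "j * 2 ^ k"])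
qed

text \<open>Iterating \<open>reach_step\<close> gives a geometric tail for \<open>reach\<close>.
  Refining the grid enlarges \<open>maxgt\<close> and makes \<open>osc\<close> negligible, so the
  tail holds for \<open>maxgt\<close> on every grid. The ratio 1/32 leaves room for fourth
  powers.\<close>

lemma tail: "\<exists>c>0. \<forall>X s m l. levy X \<longrightarrow> 0 \<le> s \<longrightarrow> prob (maxgt X s m (real l * c)) \<le> (1/32) ^ l"
proof -
  obtain A where A: "A > 0" "\<And>X s m. levy X \<Longrightarrow> 0 \<le> s \<Longrightarrow> prob (maxgt X s m A) \<le> 1/32"
    using tight[of "1/32"] by auto
  define c where "c = A + (R + 1)"
  have c: "c > 0" using A R0 by (simp add: c_def)
  have re: "prob (reach X s m (real l * c)) \<le> (1/32) ^ l" if X: "levy X" "0 \<le> s" for X s m l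
  proof (induction l)
    case (Suc l)
    have "prob (reach X s m (real l * c + (A + (R + 1)))) \<le> 1/32 * prob (reach X s m (real l * c))"
      by (rule reach_step[OF X _ _ A(2)[OF X(1)]]) (use c A(1) in auto)
    moreover have "real l * c + (A + (R + 1)) = real (Suc l) * c" by (simp add: c_def algebra_simps)
    ultimately show ?case using Suc by simp
  qed simp
  have fin: "prob (maxgt X s m (real l * c)) \<le> (1/32) ^ l + e" if X: "levy X" "0 \<le> s" and e: "e > 0" for X s m l e
  proof -
    obtain m0 where m0: "\<And>m m'. m0 \<le> m \<Longrightarrow> prob (osc X s m m') \<le> e" using osc_small[OF e] X by blast
    define n where "n = max m m0"
    have "maxgt X s n (real l * c) \<subseteq> reach X s n (real l * c) \<union> osc X s n 0"
    proof
      fix \<omega> assume w: "\<omega> \<in> maxgt X s n (real l * c)"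
      then obtain j where j: "j \<le> 2 ^ n" "real l * c < \<bar>X (s + real j / 2 ^ n) \<omega> - X s \<omega>\<bar>" and sp: "\<omega> \<in> space M" by (auto simp: maxgt_def)
      show "\<omega> \<in> reach X s n (real l * c) \<union> osc X s n 0"
      proof (cases "\<forall>i<j. \<bar>X (s + real (Suc i) / 2 ^ n) \<omega> - X (s + real i / 2 ^ n) \<omega>\<bar> \<le> R + 1")
        case True thus ?thesis using j sp by (auto simp: reach_def)
      next
        case False
        then obtain i where i: "i < j" "R + 1 < \<bar>X (s + real (Suc i) / 2 ^ n) \<omega> - X (s + real i / 2 ^ n) \<omega>\<bar>" by (auto simp: not_le)
        have "s + real (Suc i) / 2 ^ n = s + real i / 2 ^ n + real 1 / 2 ^ (n + 0)" by (simp add: add_divide_distrib)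
        from i(2)[unfolded this] have "R + 1 < \<bar>X (s + real i / 2 ^ n + real 1 / 2 ^ (n + 0)) \<omega> - X (s + real i / 2 ^ n) \<omega>\<bar>" .
        moreover have "i < 3 * 2 ^ n" using i(1) j(1) by simp
        ultimately have "\<omega> \<in> osc X s n 0" unfolding osc_def using sp by force
        thus ?thesis by simp
      qed
    qed
    hence "prob (maxgt X s n (real l * c)) \<le> prob (reach X s n (real l * c) \<union> osc X s n 0)"
      by (rule finite_measure_mono) (use X reach_sets osc_sets in auto)
    also have "\<dots> \<le> prob (reach X s n (real l * c)) + prob (osc X s n 0)"
      by (rule measure_Un_le) (use X reach_sets osc_sets in auto)
    also have "\<dots> \<le> (1/32) ^ l + e" using re[OF X, of n l] m0[of n 0] by (simp add: n_def)
    finally have "prob (maxgt X s n (real l * c)) \<le> (1/32) ^ l + e" .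
    moreover have "prob (maxgt X s m (real l * c)) \<le> prob (maxgt X s n (real l * c))"
      by (rule finite_measure_mono[OF maxgt_mono maxgt_sets[OF X]]) (simp add: n_def)
    ultimately show ?thesis by linarith
  qed
  show ?thesis
  proof (intro exI[of _ c] conjI allI impI c)
    fix X and s :: real and m l :: nat assume X: "levy X" "0 \<le> s"
    show "prob (maxgt X s m (real l * c)) \<le> (1/32) ^ l" by (rule field_le_epsilon) (rule fin[OF X])
  qed
qed

text \<open>The fourth power of the maximal displacement during a unit of time; a supremum over
  dyadic points is a measurable function of the path.\<close>

definition Zp :: "real \<Rightarrow> (real \<Rightarrow> real) \<Rightarrow> ennreal" where
  "Zp s x = (SUP m. SUP j\<in>{..(2::nat) ^ m}. ennreal (\<bar>x (s + real j / 2 ^ m) - x s\<bar> ^ 4))"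

lemma Zp_measurable: "levy X \<Longrightarrow> 0 \<le> s \<Longrightarrow> (\<lambda>\<omega>. Zp s (\<lambda>t. X t \<omega>)) \<in> borel_measurable M"
proof -
  assume X: "levy X" "0 \<le> s"
  have [measurable]: "random_variable borel (X (s + real j / 2 ^ m))" "random_variable borel (X s)" for j m
    using X by (auto intro!: levy_rv)
  show ?thesis unfolding Zp_def by measurable
qed

lemma Zp_dominates:
  assumes "cadlag_path x" "0 \<le> s" "s \<le> t" "t \<le> s + 1" shows "ennreal (\<bar>x t - x s\<bar> ^ 4) \<le> Zp s x"
proof (cases "Zp s x = \<infinity>")
  case False
  then obtain z where z: "Zp s x = ennreal z" "0 \<le> z" by (cases "Zp s x") auto
  have b: "\<bar>x (s + real j / 2 ^ m) - x s\<bar> \<le> root 4 z" if "j \<le> 1 * 2 ^ m" for j m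
  proof -
    have "ennreal (\<bar>x (s + real j / 2 ^ m) - x s\<bar> ^ 4) \<le> Zp s x" unfolding Zp_def
      by (rule SUP_upper2[of m], simp, rule SUP_upper2[of j]) (use that in auto)
    hence "\<bar>x (s + real j / 2 ^ m) - x s\<bar> ^ 4 \<le> z" using z by simp
    hence "root 4 (\<bar>x (s + real j / 2 ^ m) - x s\<bar> ^ 4) \<le> root 4 z" by (intro real_root_le_mono) auto
    moreover have "root 4 (\<bar>x (s + real j / 2 ^ m) - x s\<bar> ^ 4) = \<bar>x (s + real j / 2 ^ m) - x s\<bar>"
      by (rule real_root_power_cancel) auto
    ultimately show ?thesis by linarith
  qed
  have "\<bar>x t - x s\<bar> \<le> root 4 z"
    by (rule dyadic_dense_bound[of s x 1]) (use assms b in \<open>auto simp: cadlag_path_def\<close>)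
  hence "\<bar>x t - x s\<bar> ^ 4 \<le> root 4 z ^ 4" by (intro power_mono) auto
  thus ?thesis using z by simp
qed simp

text \<open>Slicing by multiples of \<open>c\<close>, the geometric tail and (l + 1)^4 \<le> 16^l
  give a series of ratio 16/32. The bound is the same for all grids, so monotone convergence
  applies.\<close>

lemma moment: "\<exists>C\<ge>0. \<forall>X s. levy X \<longrightarrow> 0 \<le> s \<longrightarrow> (\<integral>\<^sup>+ \<omega>. Zp s (\<lambda>t. X t \<omega>) \<partial>M) \<le> ennreal C"
proof -
  obtain c where c: "c > 0" "\<And>X s m l. levy X \<Longrightarrow> 0 \<le> s \<Longrightarrow> prob (maxgt X s m (real l * c)) \<le> (1/32) ^ l"
    using tail by blast
  have "(\<integral>\<^sup>+ \<omega>. Zp s (\<lambda>t. X t \<omega>) \<partial>M) \<le> ennreal (2 * c ^ 4)" if X: "levy X" "0 \<le> s" for X s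
  proof -
    define f where "f m \<omega> = (SUP j\<in>{..(2::nat) ^ m}. ennreal (\<bar>X (s + real j / 2 ^ m) \<omega> - X s \<omega>\<bar> ^ 4))" for m \<omega>
    have fm: "f m \<in> borel_measurable M" for m
    proof -
      have [measurable]: "random_variable borel (X (s + real j / 2 ^ m))" "random_variable borel (X s)" for j m
        using X by (auto intro!: levy_rv)
      show ?thesis unfolding f_def[abs_def] by measurable
    qed
    have incf: "incseq f"
    proof (rule incseq_SucI, rule le_funI)
      fix m \<omega>
      show "f m \<omega> \<le> f (Suc m) \<omega>" unfolding f_def
      proof (rule SUP_least)
        fix j :: nat assume j: "j \<in> {..2 ^ m}"
        have "s + real (2 * j) / 2 ^ Suc m = s + real j / 2 ^ m" by simp
        thus "ennreal (\<bar>X (s + real j / 2 ^ m) \<omega> - X s \<omega>\<bar> ^ 4) \<le> (SUP j\<in>{..2 ^ Suc m}. ennreal (\<bar>X (s + real j / 2 ^ Suc m) \<omega> - X s \<omega>\<bar> ^ 4))"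
          using j by (intro SUP_upper2[of "2 * j"]) auto
      qed
    qed
    have pt: "f m \<omega> \<le> (\<Sum>l. ennreal ((real (Suc l) * c) ^ 4) * indicator (maxgt X s m (real l * c)) \<omega>)" if w: "\<omega> \<in> space M" for m \<omega>
      unfolding f_def
    proof (rule SUP_least)
      fix j :: nat assume j: "j \<in> {..2 ^ m}"
      define a where "a = \<bar>X (s + real j / 2 ^ m) \<omega> - X s \<omega>\<bar>"
      show "ennreal (\<bar>X (s + real j / 2 ^ m) \<omega> - X s \<omega>\<bar> ^ 4) \<le> (\<Sum>l. ennreal ((real (Suc l) * c) ^ 4) * indicator (maxgt X s m (real l * c)) \<omega>)"
        unfolding a_def[symmetric]
      proof (cases "a = 0")
        case True thus "ennreal (a ^ 4) \<le> (\<Sum>l. ennreal ((real (Suc l) * c) ^ 4) * indicator (maxgt X s m (real l * c)) \<omega>)" by simp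
      next
        case False
        hence a: "a > 0" by (simp add: a_def)
        \<comment> \<open>The value \<open>a\<close> lies above \<open>l * c\<close> and at most at
          \<open>Suc l * c\<close>; the ceiling minus one keeps the first inequality strict, as
          \<open>maxgt\<close> demands.\<close>
        define l where "l = nat (\<lceil>a / c\<rceil> - 1)"
        have cl: "\<lceil>a / c\<rceil> \<ge> 1" using a c(1) by simp
        have rl: "real l = real_of_int \<lceil>a / c\<rceil> - 1" using cl by (simp add: l_def)
        have "real l < a / c" unfolding rl by linarith
        hence 1: "real l * c < a" using c(1) by (simp add: pos_less_divide_eq)
        have "a / c \<le> real (Suc l)" using rl by simp
        hence 2: "a \<le> real (Suc l) * c" using c(1) by (simp add: pos_divide_le_eq)
        have "ennreal (a ^ 4) \<le> ennreal ((real (Suc l) * c) ^ 4) * indicator (maxgt X s m (real l * c)) \<omega>"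
        proof -
          have "\<omega> \<in> maxgt X s m (real l * c)" using 1 j w unfolding maxgt_def a_def by auto
          moreover have "a ^ 4 \<le> (real (Suc l) * c) ^ 4" using 2 a by (intro power_mono) auto
          ultimately show ?thesis by (simp add: ennreal_leI)
        qed
        also have "\<dots> = sum (\<lambda>l. ennreal ((real (Suc l) * c) ^ 4) * indicator (maxgt X s m (real l * c)) \<omega>) {l}"
          by (rule sum.insert[of "{}", simplified sum.empty add_0_right, symmetric]) auto
        also have "\<dots> \<le> (\<Sum>l. ennreal ((real (Suc l) * c) ^ 4) * indicator (maxgt X s m (real l * c)) \<omega>)"
          by (rule sum_le_suminf) auto
        finally show "ennreal (a ^ 4) \<le> (\<Sum>l. ennreal ((real (Suc l) * c) ^ 4) * indicator (maxgt X s m (real l * c)) \<omega>)" .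
      qed
    qed
    have fb: "(\<integral>\<^sup>+ \<omega>. f m \<omega> \<partial>M) \<le> ennreal (2 * c ^ 4)" for m
    proof -
      have ms: "maxgt X s m x \<in> sets M" for x by (rule maxgt_sets[OF X])
      have "(\<integral>\<^sup>+ \<omega>. f m \<omega> \<partial>M) \<le> (\<integral>\<^sup>+ \<omega>. (\<Sum>l. ennreal ((real (Suc l) * c) ^ 4) * indicator (maxgt X s m (real l * c)) \<omega>) \<partial>M)"
        by (rule nn_integral_mono) (rule pt)
      also have "\<dots> = (\<Sum>l. \<integral>\<^sup>+ \<omega>. ennreal ((real (Suc l) * c) ^ 4) * indicator (maxgt X s m (real l * c)) \<omega> \<partial>M)"
        by (rule nn_integral_suminf) (use ms in measurable)
      also have "\<dots> = (\<Sum>l. ennreal ((real (Suc l) * c) ^ 4) * emeasure M (maxgt X s m (real l * c)))"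
        using ms by (simp add: nn_integral_cmult_indicator)
      also have "\<dots> \<le> (\<Sum>l. ennreal (c ^ 4 * (1/2) ^ l))"
      proof (rule suminf_le)
        fix l
        have "real (Suc l) \<le> 2 ^ l" by (induction l) auto
        hence "real (Suc l) ^ 4 \<le> (2 ^ l) ^ 4" by (intro power_mono) auto
        also have "(2 ^ l) ^ 4 = ((2::real) ^ 4) ^ l" by (metis power_mult mult.commute)
        also have "(2::real) ^ 4 = 16" by simp
        finally have p: "real (Suc l) ^ 4 \<le> 16 ^ l" .
        have "(real (Suc l) * c) ^ 4 * prob (maxgt X s m (real l * c)) \<le> (16 ^ l * c ^ 4) * (1/32) ^ l"
        proof (rule mult_mono[OF _ c(2)[OF X]])
          show "(real (Suc l) * c) ^ 4 \<le> 16 ^ l * c ^ 4"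
            unfolding power_mult_distrib using c(1) by (intro mult_right_mono[OF p]) simp
        qed (use c(1) in auto)
        also have "\<dots> = c ^ 4 * (16 ^ l * (1/32) ^ l)" by (simp only: mult_ac)
        also have "(16::real) ^ l * (1/32) ^ l = (1/2) ^ l" unfolding power_mult_distrib[symmetric] by simp
        finally have "(real (Suc l) * c) ^ 4 * prob (maxgt X s m (real l * c)) \<le> c ^ 4 * (1/2) ^ l" .
        thus "ennreal ((real (Suc l) * c) ^ 4) * emeasure M (maxgt X s m (real l * c)) \<le> ennreal (c ^ 4 * (1/2) ^ l)"
          using c(1) by (simp add: emeasure_eq_measure ennreal_mult'[symmetric] ennreal_leI)
      qed auto
      also have "\<dots> = ennreal (\<Sum>l. c ^ 4 * (1/2) ^ l)"
        by (rule suminf_ennreal2) (use c in \<open>auto intro!: summable_mult summable_geometric\<close>)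
      also have "(\<Sum>l. c ^ 4 * (1/2) ^ l) = 2 * c ^ 4"
        by (subst suminf_mult) (auto simp: suminf_geometric intro!: summable_geometric)
      finally show ?thesis .
    qed
    have "(\<integral>\<^sup>+ \<omega>. Zp s (\<lambda>t. X t \<omega>) \<partial>M) = (\<integral>\<^sup>+ \<omega>. (SUP m. f m \<omega>) \<partial>M)" by (simp add: Zp_def f_def)
    also have "\<dots> = (SUP m. \<integral>\<^sup>+ \<omega>. f m \<omega> \<partial>M)" by (rule nn_integral_monotone_convergence_SUP[OF incf fm])
    also have "\<dots> \<le> ennreal (2 * c ^ 4)" by (rule SUP_least) (rule fb)
    finally show ?thesis .
  qed
  thus ?thesis using c(1) by (intro exI[of _ "2 * c ^ 4"]) auto
qed

end

section \<open>Levy processes with nonzero Levy measure are unbounded\<close>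

lemma cos_ge_quad: "1 - x\<^sup>2 / 2 \<le> cos (x :: real)"
proof -
  have "cos x = 1 - 2 * (sin (x / 2))\<^sup>2" using cos_double_sin[of "x / 2"] by simp
  moreover have "\<bar>sin (x / 2)\<bar>\<^sup>2 \<le> \<bar>x / 2\<bar>\<^sup>2" by (intro power_mono abs_sin_x_le_abs_x) simp
  ultimately show ?thesis by (simp add: power_divide)
qed

text \<open>Taylor remainder of second order for |y| < 1 and the trivial bound 2 elsewhere, both
  controlled by min 1 y^2.\<close>

lemma levy_exponent_integrable:
  assumes "levy_measure \<mu>"
  shows "integrable \<mu> (\<lambda>y. iexp (\<xi> * y) - 1 - \<i> * complex_of_real (\<xi> * y * indicator {-1<..<1} y))"
proof (rule Bochner_Integration.integrable_bound)
  have s[measurable_cong]: "sets \<mu> = sets borel" using assms by (simp add: levy_measure_def)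
  have b: "(\<integral>\<^sup>+ y. ennreal (min 1 (y\<^sup>2)) \<partial>\<mu>) < \<infinity>" using assms by (simp add: levy_measure_def)
  have m: "(\<lambda>y. min 1 (y\<^sup>2)) \<in> borel_measurable \<mu>" by measurable
  have "integrable \<mu> (\<lambda>y. min 1 (y\<^sup>2))" by (rule integrableI_nonneg[OF m _ b]) auto
  thus "integrable \<mu> (\<lambda>y. (\<xi>\<^sup>2 + 2) * min 1 (y\<^sup>2))" by simp
  show "(\<lambda>y. iexp (\<xi> * y) - 1 - \<i> * complex_of_real (\<xi> * y * indicator {-1<..<1} y)) \<in> borel_measurable \<mu>" by measurable
  show "AE y in \<mu>. norm (iexp (\<xi> * y) - 1 - \<i> * complex_of_real (\<xi> * y * indicator {-1<..<1} y)) \<le> norm ((\<xi>\<^sup>2 + 2) * min 1 (y\<^sup>2))"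
  proof (rule AE_I2)
    fix y
    show "norm (iexp (\<xi> * y) - 1 - \<i> * complex_of_real (\<xi> * y * indicator {-1<..<1} y)) \<le> norm ((\<xi>\<^sup>2 + 2) * min 1 (y\<^sup>2))"
    proof (cases "y \<in> {-1<..<1}")
      case True
      hence "\<bar>y\<bar> \<le> 1" by auto
      hence y1: "y\<^sup>2 \<le> 1" by (simp add: abs_square_le_1)
      have "cmod (iexp (\<xi> * y) - (\<Sum>k\<le>1. (\<i> * complex_of_real (\<xi> * y)) ^ k / fact k)) \<le> \<bar>\<xi> * y\<bar> ^ Suc 1 / fact (Suc 1)"
        by (rule iexp_approx1)
      hence "cmod (iexp (\<xi> * y) - 1 - \<i> * complex_of_real (\<xi> * y)) \<le> (\<xi> * y)\<^sup>2 / 2"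
        by (simp add: numeral_2_eq_2 algebra_simps)
      also have "\<dots> \<le> (\<xi>\<^sup>2 + 2) * y\<^sup>2"
      proof -
        have "0 \<le> \<xi>\<^sup>2 * y\<^sup>2" "0 \<le> y\<^sup>2" by simp_all
        thus ?thesis by (simp add: power_mult_distrib algebra_simps)
      qed
      finally show ?thesis using True y1 by (simp add: min_def abs_mult)
    next
      case False
      hence "1 \<le> \<bar>y\<bar>" by auto
      hence y1: "1 \<le> y\<^sup>2" using power_mono[of 1 "\<bar>y\<bar>" 2] by simp
      have "norm (iexp (\<xi> * y) - 1) \<le> norm (iexp (\<xi> * y)) + norm (1::complex)" by (rule norm_triangle_ineq4)
      also have "\<dots> = 2" by simp
      also have "\<dots> \<le> \<xi>\<^sup>2 + 2" by simp
      finally show ?thesis using False y1 by (simp add: min_def)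
    qed
  qed
qed

lemma Re_levy_exponent:
  assumes "levy_measure \<mu>"
  shows "integrable \<mu> (\<lambda>y. cos (\<xi> * y) - 1)" "Re (levy_exponent \<mu> \<xi>) = (\<integral>y. cos (\<xi> * y) - 1 \<partial>\<mu>)"
proof -
  have r: "Re (iexp (\<xi> * y) - 1 - \<i> * complex_of_real (\<xi> * y * indicator {-1<..<1} y)) = cos (\<xi> * y) - 1" for y
    by (simp add: Re_exp)
  note i = levy_exponent_integrable[OF assms, of \<xi>]
  show "integrable \<mu> (\<lambda>y. cos (\<xi> * y) - 1)" using integrable_Re[OF i] unfolding r .
  show "Re (levy_exponent \<mu> \<xi>) = (\<integral>y. cos (\<xi> * y) - 1 \<partial>\<mu>)"
    unfolding levy_exponent_def using integral_Re[OF i] unfolding r ..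
qed

text \<open>Otherwise cos (\<xi> y) = 1 for \<mu>-almost every y, simultaneously for all \<xi> =
  1/(n+1). For n > |y| the argument is below 1 in modulus, hence 0, so \<mu> would be concentrated
  on {0}, which is a null set of \<mu>.\<close>

lemma levy_exponent_nondegenerate:
  assumes L: "levy_measure \<mu>" and pos: "emeasure \<mu> UNIV > 0"
  shows "\<exists>\<xi>. Re (levy_exponent \<mu> \<xi>) < 0"
proof (rule ccontr)
  assume neg: "\<not> ?thesis"
  have s: "sets \<mu> = sets borel" using L by (simp add: levy_measure_def)
  have sp: "space \<mu> = UNIV" using sets_eq_imp_space_eq[OF s] by simp
  have z: "AE y in \<mu>. cos (\<xi> * y) = 1" for \<xi>
  proof -
    have i: "integrable \<mu> (\<lambda>y. 1 - cos (\<xi> * y))" using integrable_minus[OF Re_levy_exponent(1)[OF L, of \<xi>]] by simp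
    have "(\<integral>y. 1 - cos (\<xi> * y) \<partial>\<mu>) = - Re (levy_exponent \<mu> \<xi>)"
      unfolding Re_levy_exponent(2)[OF L] by (subst Bochner_Integration.integral_minus[symmetric]) simp
    also have "\<dots> \<le> 0" using neg by (simp add: not_less)
    finally have "(\<integral>y. 1 - cos (\<xi> * y) \<partial>\<mu>) \<le> 0" .
    moreover have "0 \<le> (\<integral>y. 1 - cos (\<xi> * y) \<partial>\<mu>)" by simp
    ultimately have "(\<integral>y. 1 - cos (\<xi> * y) \<partial>\<mu>) = 0" by linarith
    hence "AE y in \<mu>. 1 - cos (\<xi> * y) = 0" using integral_nonneg_eq_0_iff_AE[OF i] by simp
    thus ?thesis by simp
  qed
  have "AE y in \<mu>. \<forall>n::nat. cos (1 / real (Suc n) * y) = 1" by (subst AE_all_countable) (intro allI z)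
  hence "AE y in \<mu>. y = 0"
  proof eventually_elim
    case (elim y)
    show "y = 0"
    proof (rule ccontr)
      assume y: "y \<noteq> 0"
      obtain n where n: "\<bar>y\<bar> < real n" using reals_Archimedean2 by blast
      define x where "x = 1 / real (Suc n) * y"
      have x: "cos x = 1" unfolding x_def using elim by blast
      have "\<bar>x\<bar> < 1" using n by (simp add: x_def abs_mult)
      moreover obtain k :: int where "x = k * 2 * pi" using x cos_one_2pi_int by auto
      ultimately have "\<bar>real_of_int k\<bar> * (2 * pi) < 1" by (simp add: abs_mult)
      moreover have "x \<noteq> 0" using y by (simp add: x_def)
      hence "k \<noteq> 0" using \<open>x = k * 2 * pi\<close> by auto
      hence "1 \<le> \<bar>real_of_int k\<bar>" by linarith
      hence "1 * (2 * 3) \<le> \<bar>real_of_int k\<bar> * (2 * pi)" using pi_gt3 by (intro mult_mono) auto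
      ultimately show False by simp
    qed
  qed
  hence "emeasure \<mu> (UNIV - {0}) = 0"
    by (subst (asm) AE_iff_measurable[where N="UNIV - {0}"]) (auto simp: s sp)
  moreover have "emeasure \<mu> {0} = 0" using L by (simp add: levy_measure_def)
  moreover have "emeasure \<mu> UNIV \<le> emeasure \<mu> {0} + emeasure \<mu> (UNIV - {0})"
    using emeasure_subadditive[of "{0}" \<mu> "UNIV - {0}"] by (simp add: s Un_commute)
  ultimately show False using pos by simp
qed

section \<open>Large values at every positive time have positive probability\<close>

context prob_space
begin

lemma levy_at_0: "levy_process_triplet0 M \<mu> X \<Longrightarrow> AE \<omega> in M. X 0 \<omega> = 0"
  unfolding levy_process_triplet0_def by (elim conjE)

text \<open>If \<open>X\<^sub>h\<close> were bounded by \<open>A\<close>, each of its \<open>n\<close> independent equal parts would be bounded by \<open>A / n\<close>;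
  then its characteristic function would have modulus one.\<close>
lemma levy_part_bounded:
  assumes X: "levy_process_triplet0 M \<mu> X" and h: "0 < h" and A: "prob {\<omega>\<in>space M. A \<le> \<bar>X h \<omega>\<bar>} = 0" and n: "0 < n"
  shows "AE \<omega> in M. \<bar>X (h / real n) \<omega>\<bar> \<le> A / real n"
proof -
  define d where "d = h / real n"
  have d: "0 \<le> d" using h by (simp add: d_def)
  \<comment> \<open>If one part were at least A / n with positive probability, then by independence
    and equality of laws all n parts would be so at once, and their sum would reach A. The factor
    \<open>c\<close> selects the sign.\<close>
  have half: "prob {\<omega>\<in>space M. A / real n \<le> c * X d \<omega>} = 0" if c: "\<bar>c\<bar> = 1" for c :: real
  proof -
    define S where "S = {y. A / real n \<le> c * y}"
    have S[measurable]: "S \<in> sets borel" unfolding S_def by measurable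
    have m: "linc X 0 d i \<in> borel_measurable M" for i by (rule linc_measurable[OF X _ d]) simp
    have pe: "prob (linc X 0 d i -` S \<inter> space M) = prob {\<omega>\<in>space M. A / real n \<le> c * X d \<omega>}" for i
    proof -
      have "prob (linc X 0 d i -` S \<inter> space M) = measure (distr M borel (linc X 0 d i)) S" using m by (simp add: measure_distr)
      also have "\<dots> = measure (distr M borel (X d)) S" by (simp add: linc_law[OF X _ d])
      also have "\<dots> = prob (X d -` S \<inter> space M)" using levy_measurable[OF X d] by (simp add: measure_distr)
      also have "X d -` S \<inter> space M = {\<omega>\<in>space M. A / real n \<le> c * X d \<omega>}" by (auto simp: S_def)
      finally show ?thesis .
    qed
    have "prob (\<Inter>i\<in>{..<n}. linc X 0 d i -` S \<inter> space M) = (\<Prod>i\<in>{..<n}. prob (linc X 0 d i -` S \<inter> space M))"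
      by (rule indep_varsD[OF linc_indep[OF X _ d, of 0 n]]) (use n S in auto)
    hence "prob (\<Inter>i\<in>{..<n}. linc X 0 d i -` S \<inter> space M) = prob {\<omega>\<in>space M. A / real n \<le> c * X d \<omega>} ^ n" by (simp add: pe)
    moreover have "prob (\<Inter>i\<in>{..<n}. linc X 0 d i -` S \<inter> space M) \<le> prob {\<omega>\<in>space M. A \<le> \<bar>X h \<omega>\<bar>}"
    proof (rule finite_measure_mono_AE)
      show "AE \<omega> in M. \<omega> \<in> (\<Inter>i\<in>{..<n}. linc X 0 d i -` S \<inter> space M) \<longrightarrow> \<omega> \<in> {\<omega>\<in>space M. A \<le> \<bar>X h \<omega>\<bar>}"
        using levy_at_0[OF X] AE_space
      proof eventually_elim
        case (elim \<omega>)
        show ?case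
        proof
          assume "\<omega> \<in> (\<Inter>i\<in>{..<n}. linc X 0 d i -` S \<inter> space M)"
          hence "\<omega> \<in> linc X 0 d i -` S" if "i < n" for i using that by blast
          hence "A / real n \<le> c * linc X 0 d i \<omega>" if "i < n" for i using that unfolding S_def by blast
          hence "(\<Sum>i<n. A / real n) \<le> (\<Sum>i<n. c * linc X 0 d i \<omega>)" by (intro sum_mono) simp
          also have "\<dots> = c * (X (0 + real n * d) \<omega> - X 0 \<omega>)" unfolding linc_sum[symmetric] by (simp add: sum_distrib_left)
          also have "\<dots> = c * X h \<omega>" using n elim by (simp add: d_def)
          finally have "A \<le> c * X h \<omega>" using n by simp
          also have "\<dots> \<le> \<bar>X h \<omega>\<bar>" using c by (metis abs_ge_self abs_mult mult_1)
          finally show "\<omega> \<in> {\<omega>\<in>space M. A \<le> \<bar>X h \<omega>\<bar>}" using elim by simp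
        qed
      qed
      have [measurable]: "X h \<in> borel_measurable M" using levy_measurable[OF X] h by simp
      show "{\<omega>\<in>space M. A \<le> \<bar>X h \<omega>\<bar>} \<in> sets M" by measurable
    qed
    ultimately have "prob {\<omega>\<in>space M. A / real n \<le> c * X d \<omega>} ^ n \<le> 0" using A by simp
    moreover have "0 \<le> prob {\<omega>\<in>space M. A / real n \<le> c * X d \<omega>} ^ n" by simp
    ultimately have "prob {\<omega>\<in>space M. A / real n \<le> c * X d \<omega>} ^ n = 0" by linarith
    thus ?thesis by simp
  qed
  have [measurable]: "X d \<in> borel_measurable M" using levy_measurable[OF X d] .
  have "AE \<omega> in M. \<not> A / real n \<le> c * X d \<omega>" if "\<bar>c\<bar> = 1" for c
    using half[OF that] by (subst AE_iff_measurable[OF _ refl]) (auto simp: emeasure_eq_measure)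
  from this[of 1] this[of "-1"] show ?thesis unfolding d_def[symmetric] by (auto elim!: eventually_elim2)
qed

text \<open>If the value at time h were bounded by A, a part of duration h / n would be bounded by A
  / n, and its characteristic function would have real part at least 1 - K / n^2. Its modulus to the
  power n is exp (h r) with r < 0, yet by Bernoulli at least 1 - K / n, which tends to 1.\<close>

lemma levy_unbounded:
  assumes X: "levy_process_triplet0 M \<mu> X" and L: "levy_measure \<mu>" "emeasure \<mu> UNIV > 0" and h: "0 < h"
  shows "0 < prob {\<omega>\<in>space M. A \<le> \<bar>X h \<omega>\<bar>}"
proof (rule ccontr)
  assume "\<not> ?thesis"
  hence 0: "prob {\<omega>\<in>space M. A \<le> \<bar>X h \<omega>\<bar>} = 0" by (simp add: not_less measure_le_0_iff)
  obtain \<xi> where \<xi>: "Re (levy_exponent \<mu> \<xi>) < 0" using levy_exponent_nondegenerate[OF L] by blast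
  define r where "r = Re (levy_exponent \<mu> \<xi>)"
  define K where "K = (\<xi> * A)\<^sup>2 / 2"
  have K0: "0 \<le> K" by (simp add: K_def)
  have main: "1 - K / real n \<le> exp (h * r)" if n: "0 < n" "K \<le> (real n)\<^sup>2" for n :: nat
  proof -
    define d where "d = h / real n"
    have d: "0 \<le> d" using h by (simp add: d_def)
    have [measurable]: "X d \<in> borel_measurable M" using levy_measurable[OF X d] .
    have "char (distr M borel (X d)) \<xi> = exp (complex_of_real d * levy_exponent \<mu> \<xi>)"
      using X d unfolding levy_process_triplet0_def by simp
    hence n1: "cmod (char (distr M borel (X d)) \<xi>) = exp (d * r)" by (simp add: r_def)
    have i: "integrable M (\<lambda>\<omega>. iexp (\<xi> * X d \<omega>))"
      by (rule integrable_const_bound[where B=1]) (auto intro: AE_I2)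
    have "char (distr M borel (X d)) \<xi> = (CLINT \<omega>|M. iexp (\<xi> * X d \<omega>))"
      unfolding char_def by (rule integral_distr) auto
    hence "Re (char (distr M borel (X d)) \<xi>) = (\<integral>\<omega>. cos (\<xi> * X d \<omega>) \<partial>M)"
      using integral_Re[OF i] by (simp add: Re_exp)
    moreover have "1 - K / (real n)\<^sup>2 \<le> (\<integral>\<omega>. cos (\<xi> * X d \<omega>) \<partial>M)"
    proof -
      have "1 - K / (real n)\<^sup>2 = (\<integral>\<omega>. 1 - K / (real n)\<^sup>2 \<partial>M)" using prob_space by simp
      also have "\<dots> \<le> (\<integral>\<omega>. cos (\<xi> * X d \<omega>) \<partial>M)"
      proof (rule integral_mono_AE)
        show "integrable M (\<lambda>\<omega>. cos (\<xi> * X d \<omega>))" by (rule integrable_const_bound[where B=1]) (auto intro: AE_I2)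
        show "AE \<omega> in M. 1 - K / (real n)\<^sup>2 \<le> cos (\<xi> * X d \<omega>)"
          using levy_part_bounded[OF X h 0 n(1)]
        proof eventually_elim
          case (elim \<omega>)
          have "(\<xi> * X d \<omega>)\<^sup>2 \<le> (\<xi> * (A / real n))\<^sup>2"
            unfolding power_mult_distrib using elim power_mono[of "\<bar>X d \<omega>\<bar>" "A / real n" 2] by (intro mult_left_mono) (auto simp: d_def)
          hence "(\<xi> * X d \<omega>)\<^sup>2 / 2 \<le> K / (real n)\<^sup>2" by (simp add: K_def power_mult_distrib power_divide)
          moreover have "1 - (\<xi> * X d \<omega>)\<^sup>2 / 2 \<le> cos (\<xi> * X d \<omega>)" by (rule cos_ge_quad)
          ultimately show ?case by linarith
        qed
      qed auto
      finally show ?thesis .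
    qed
    ultimately have "1 - K / (real n)\<^sup>2 \<le> exp (d * r)"
      using complex_Re_le_cmod[of "char (distr M borel (X d)) \<xi>"] n1 by linarith
    moreover have Kn: "K / (real n)\<^sup>2 \<le> 1" using n by (simp add: divide_le_eq)
    ultimately have "(1 - K / (real n)\<^sup>2) ^ n \<le> exp (d * r) ^ n" by (intro power_mono) auto
    also have "\<dots> = exp (h * r)" using n(1) by (simp add: exp_of_nat_mult[symmetric] d_def)
    finally have e: "(1 - K / (real n)\<^sup>2) ^ n \<le> exp (h * r)" .
    have "1 + real n * (- (K / (real n)\<^sup>2)) \<le> (1 + (- (K / (real n)\<^sup>2))) ^ n"
      by (rule Bernoulli_inequality) (use Kn in simp)
    moreover have "real n * (K / (real n)\<^sup>2) = K / real n" using n(1) by (simp add: power2_eq_square)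
    ultimately show ?thesis using e by simp
  qed
  have "(\<lambda>n. 1 - K * inverse (real (Suc n))) \<longlonglongrightarrow> 1 - K * 0"
    by (intro tendsto_intros LIMSEQ_inverse_real_of_nat)
  hence l: "(\<lambda>n. 1 - K * inverse (real (Suc n))) \<longlonglongrightarrow> 1" by simp
  obtain n0 where n0: "K \<le> real n0" using real_arch_simple by blast
  have "1 \<le> exp (h * r)"
  proof (rule LIMSEQ_le_const2[OF l], intro exI[of _ n0] allI impI)
    fix n assume n: "n0 \<le> n"
    have "K \<le> real (Suc n)" using n0 n by simp
    also have "\<dots> \<le> (real (Suc n))\<^sup>2" using power_increasing[of 1 2 "real (Suc n)"] by simp
    finally show "1 - K * inverse (real (Suc n)) \<le> exp (h * r)" using main[of "Suc n"] by (simp only: divide_inverse zero_less_Suc)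
  qed
  moreover have "h * r < 0" using h \<xi> unfolding r_def by (simp add: mult_pos_neg)
  ultimately show False by simp
qed

end

section \<open>Rapid passage of a level between two quiet periods\<close>

text \<open>The last clause transfers the bounds from the grid of width \<open>1 / 2 ^ m\<close> to all times: no increment within a cell exceeds
  \<open>R + 1\<close>, where \<open>R\<close> bounds the jumps.\<close>
definition growth :: "real \<Rightarrow> real \<Rightarrow> real \<Rightarrow> nat \<Rightarrow> nat \<Rightarrow> real \<Rightarrow> (real \<Rightarrow> real) \<Rightarrow> bool" where
  "growth R S0 A m p s x \<longleftrightarrow>
     (\<forall>j\<in>{..2 ^ m}. \<bar>x (s + real j / 2 ^ m) - x s\<bar> \<le> S0) \<and>
     (\<exists>j\<in>{1..2 ^ (m - p)}.
        (\<forall>i\<in>{..<j}. \<bar>x (s + 1 + real i / 2 ^ m) - x (s + 1)\<bar> < A) \<and>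
        A \<le> \<bar>x (s + 1 + real j / 2 ^ m) - x (s + 1)\<bar> \<and>
        (\<forall>i\<in>{..2 ^ m}. \<bar>x (s + 1 + real j / 2 ^ m + real i / 2 ^ m) - x (s + 1 + real j / 2 ^ m)\<bar> \<le> S0)) \<and>
     (\<forall>i\<in>{..<3 * 2 ^ m}. \<forall>m'. \<forall>j\<in>{..2 ^ m'}. \<bar>x (s + real i / 2 ^ m + real j / 2 ^ (m + m')) - x (s + real i / 2 ^ m)\<bar> \<le> R + 1)"

lemma growth_measurable: "Measurable.pred (PiM UNIV (\<lambda>_. borel)) (growth R S0 A m p s)"
proof -
  have [measurable]: "(\<lambda>x. x t) \<in> borel_measurable (PiM UNIV (\<lambda>_. borel :: real measure))" for t :: real
    by (rule measurable_component_singleton) simp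
  show ?thesis unfolding growth_def by measurable
qed

text \<open>The cell is rescaled to the unit interval, where its refined grid points become the
  dyadic ones.\<close>

lemma cell_bound:
  assumes c: "cadlag_path x" and s: "0 \<le> s" and o: "\<And>m' j. j \<le> 2 ^ m' \<Longrightarrow> \<bar>x (s + real j / 2 ^ (m + m')) - x s\<bar> \<le> B"
    and t: "s \<le> t" "t \<le> s + 1 / 2 ^ m"
  shows "\<bar>x t - x s\<bar> \<le> B"
proof -
  define f where "f r = x (s + r / 2 ^ m)" for r :: real
  have fl: "(f \<longlongrightarrow> f r) (at_right r)" if r: "0 \<le> r" for r
  proof -
    have "((\<lambda>q. s + q / 2 ^ m) \<longlongrightarrow> s + r / 2 ^ m) (at_right r)" by (intro tendsto_intros) auto
    hence "filterlim (\<lambda>q. s + q / 2 ^ m) (at_right (s + r / 2 ^ m)) (at_right r)"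
      by (rule tendsto_imp_filterlim_at_right) (use eventually_at_right_less[of r] in \<open>eventually_elim, simp add: divide_strict_right_mono\<close>)
    moreover have "(x \<longlongrightarrow> x (s + r / 2 ^ m)) (at_right (s + r / 2 ^ m))" using c s r by (simp add: cadlag_path_def)
    ultimately show ?thesis unfolding f_def by (rule filterlim_compose[rotated])
  qed
  have "\<bar>f ((t - s) * 2 ^ m) - x s\<bar> \<le> B"
  proof (rule dyadic_dense_bound[of 0 f 1])
    fix m' j :: nat assume "j \<le> 1 * 2 ^ m'"
    thus "\<bar>f (0 + real j / 2 ^ m') - x s\<bar> \<le> B" using o[of j m'] by (simp add: f_def power_add mult.commute)
  next
    have "(t - s) * 2 ^ m \<le> (1 / 2 ^ m) * 2 ^ m" using t by (intro mult_right_mono) auto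
    thus "(t - s) * 2 ^ m \<le> 0 + real 1" by simp
  qed (use fl t in auto)
  thus ?thesis by (simp add: f_def)
qed

text \<open>Every time is compared with the grid point at the left end of its cell, at the cost R +
  1. The witness \<open>b\<close> is the grid time at which the level \<open>A\<close> is first
  reached.\<close>

lemma growth_path:
  assumes c: "cadlag_path x" and s: "0 \<le> s" and g: "growth R S0 A m p s x" and pm: "p \<le> m" and R: "0 \<le> R" and S0: "0 \<le> S0"
  shows "\<exists>b>s + 1. b \<le> s + 1 + 1 / 2 ^ p \<and> A \<le> \<bar>x b - x (s + 1)\<bar> \<and>
     (\<forall>t. s \<le> t \<longrightarrow> t \<le> s + 1 \<longrightarrow> \<bar>x t - x s\<bar> \<le> S0 + (R + 1)) \<and>
     (\<forall>t. s + 1 \<le> t \<longrightarrow> t \<le> b \<longrightarrow> \<bar>x t - x (s + 1)\<bar> \<le> A + (R + 1)) \<and>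
     (\<forall>t. b \<le> t \<longrightarrow> t \<le> b + 1 \<longrightarrow> \<bar>x t - x b\<bar> \<le> S0 + (R + 1))"
proof -
  define y where "y i = x (s + real i / 2 ^ m)" for i :: nat
  obtain j where j: "j \<in> {1..2 ^ (m - p)}"
    and j1: "\<And>i. i < j \<Longrightarrow> \<bar>x (s + 1 + real i / 2 ^ m) - x (s + 1)\<bar> < A"
    and j2: "A \<le> \<bar>x (s + 1 + real j / 2 ^ m) - x (s + 1)\<bar>"
    and j3: "\<And>i. i \<le> 2 ^ m \<Longrightarrow> \<bar>x (s + 1 + real j / 2 ^ m + real i / 2 ^ m) - x (s + 1 + real j / 2 ^ m)\<bar> \<le> S0"
    and g1: "\<And>i. i \<le> 2 ^ m \<Longrightarrow> \<bar>x (s + real i / 2 ^ m) - x s\<bar> \<le> S0"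
    and g3: "\<And>i m' j. i < 3 * 2 ^ m \<Longrightarrow> j \<le> 2 ^ m' \<Longrightarrow> \<bar>x (s + real i / 2 ^ m + real j / 2 ^ (m + m')) - x (s + real i / 2 ^ m)\<bar> \<le> R + 1"
    using g unfolding growth_def by (elim conjE bexE) (rule that; auto)
  have jle: "j \<le> 2 ^ m"
  proof -
    have "(2::nat) ^ (m - p) \<le> 2 ^ m" by (rule power_increasing) auto
    thus ?thesis using j unfolding atLeastAtMost_iff by linarith
  qed
  \<comment> \<open>The index stays strictly below \<open>l\<close> unless \<open>t\<close> is the
    right end. This matters for the passage, where the grid bound holds at indices before
    \<open>j\<close> only.\<close>
  have near: "\<exists>i. k \<le> i \<and> (i < l \<or> t = s + real l / 2 ^ m) \<and> i \<le> l \<and> \<bar>x t - x (s + real i / 2 ^ m)\<bar> \<le> R + 1"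
    if kl: "k \<le> l" "l \<le> 3 * 2 ^ m" and t: "s + real k / 2 ^ m \<le> t" "t \<le> s + real l / 2 ^ m" for k l t
  proof (cases "t = s + real l / 2 ^ m")
    case True thus ?thesis using kl R by (intro exI[of _ l]) auto
  next
    case False
    define i where "i = nat \<lfloor>(t - s) * 2 ^ m\<rfloor>"
    have k: "real k \<le> (t - s) * 2 ^ m" using t(1) by (simp add: field_simps)
    hence fl0: "0 \<le> \<lfloor>(t - s) * 2 ^ m\<rfloor>" by (simp add: order_trans[OF of_nat_0_le_iff])
    have ri: "real i = real_of_int \<lfloor>(t - s) * 2 ^ m\<rfloor>" using fl0 by (simp add: i_def)
    have i1: "real i \<le> (t - s) * 2 ^ m" "(t - s) * 2 ^ m < real i + 1" unfolding ri by linarith+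
    have "t < s + real l / 2 ^ m" using t False by simp
    hence lt: "(t - s) * 2 ^ m < real l" by (simp add: field_simps)
    have ki: "k \<le> i"
    proof -
      have "real k < real i + 1" using k i1 by linarith
      thus ?thesis by linarith
    qed
    have il: "i < l"
    proof -
      have "real i < real l" using i1 lt by linarith
      thus ?thesis by simp
    qed
    have "\<bar>x t - x (s + real i / 2 ^ m)\<bar> \<le> R + 1"
    proof (rule cell_bound[OF c, where m=m])
      show "s + real i / 2 ^ m \<le> t" using i1(1) by (simp add: field_simps)
      show "t \<le> s + real i / 2 ^ m + 1 / 2 ^ m" using i1(2) by (simp add: field_simps)
    qed (use s il kl g3 in auto)
    thus ?thesis using ki il by auto
  qed
  define b where "b = s + 1 + real j / 2 ^ m"
  have sb: "s + 1 + real i / 2 ^ m = s + real (2 ^ m + i) / 2 ^ m" for i by (simp add: add_divide_distrib)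
  have sb2: "b + real i / 2 ^ m = s + real (2 ^ m + j + i) / 2 ^ m" for i by (simp add: b_def add_divide_distrib)
  have bb: "b = s + real (2 ^ m + j) / 2 ^ m" unfolding b_def by (rule sb)
  show ?thesis
  proof (intro exI[of _ b] conjI allI impI)
    show "s + 1 < b" using j by (simp add: b_def)
    have "real j \<le> 2 ^ (m - p)" using j of_nat_mono[of j "2 ^ (m - p)"] by auto
    hence "real j / 2 ^ m \<le> 2 ^ (m - p) / 2 ^ m" by (intro divide_right_mono) auto
    also have "\<dots> = 1 / (2::real) ^ p" using pm by (simp add: power_diff)
    finally show "b \<le> s + 1 + 1 / 2 ^ p" by (simp add: b_def)
    show "A \<le> \<bar>x b - x (s + 1)\<bar>" using j2 by (simp add: b_def)
  next
    fix t assume t: "s \<le> t" "t \<le> s + 1"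
    obtain i where i: "i \<le> 2 ^ m" "\<bar>x t - x (s + real i / 2 ^ m)\<bar> \<le> R + 1"
      using near[of 0 "2 ^ m" t] t by auto
    show "\<bar>x t - x s\<bar> \<le> S0 + (R + 1)" using g1[OF i(1)] i(2) by linarith
  next
    fix t assume t: "s + 1 \<le> t" "t \<le> b"
    have e1: "s + real (2 ^ m) / 2 ^ m = s + 1" by simp
    show "\<bar>x t - x (s + 1)\<bar> \<le> A + (R + 1)"
    proof (cases "t = b")
      case True
      \<comment> \<open>At the passage itself the level may be overshot; the preceding grid point is
        still below \<open>A\<close>, and one cell adds at most R + 1.\<close>
      define j' where "j' = j - 1"
      have jj: "j = Suc j'" using j by (simp add: j'_def)
      have "\<bar>x (s + 1 + real j' / 2 ^ m) - x (s + 1)\<bar> < A" by (rule j1) (simp add: jj)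
      moreover have e: "s + real (2 ^ m + j') / 2 ^ m + real 1 / 2 ^ (m + 0) = b" unfolding b_def jj by (simp add: add_divide_distrib)
      have "\<bar>x (s + real (2 ^ m + j') / 2 ^ m + real 1 / 2 ^ (m + 0)) - x (s + real (2 ^ m + j') / 2 ^ m)\<bar> \<le> R + 1"
        by (rule g3) (use jle jj in auto)
      hence "\<bar>x b - x (s + 1 + real j' / 2 ^ m)\<bar> \<le> R + 1" by (simp only: e sb)
      ultimately show ?thesis unfolding True by linarith
    next
      case False
      obtain i where i: "2 ^ m \<le> i" "i < 2 ^ m + j" "\<bar>x t - x (s + real i / 2 ^ m)\<bar> \<le> R + 1"
        using near[of "2 ^ m" "2 ^ m + j" t] t e1 jle False unfolding bb by auto
      obtain i' where i': "i = 2 ^ m + i'" using i(1) le_Suc_ex by blast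
      have "\<bar>x (s + 1 + real i' / 2 ^ m) - x (s + 1)\<bar> < A" by (rule j1) (use i(2) i' in simp)
      thus ?thesis using i(3) unfolding i' sb[symmetric] by linarith
    qed
  next
    fix t assume t: "b \<le> t" "t \<le> b + 1"
    have e1: "s + real (2 ^ m + j + 2 ^ m) / 2 ^ m = b + 1" unfolding sb2[symmetric] by simp
    have le: "2 ^ m + j + 2 ^ m \<le> 3 * 2 ^ m" using jle by simp
    obtain i where i: "2 ^ m + j \<le> i" "i \<le> 2 ^ m + j + 2 ^ m" "\<bar>x t - x (s + real i / 2 ^ m)\<bar> \<le> R + 1"
      using near[of "2 ^ m + j" "2 ^ m + j + 2 ^ m" t, OF _ le] t e1 unfolding bb[symmetric] by auto
    obtain i' where i': "i = 2 ^ m + j + i'" using i(1) le_Suc_ex by blast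
    have "\<bar>x (b + real i' / 2 ^ m) - x b\<bar> \<le> S0" unfolding b_def by (rule j3) (use i(2) i' in simp)
    thus "\<bar>x t - x b\<bar> \<le> S0 + (R + 1)" using i(3) unfolding i' sb2[symmetric] by linarith
  qed
qed

section \<open>Probability of a rapid passage, uniform in the process and the starting time\<close>

context levy_noise
begin

lemma gridv_sets:
  assumes X: "levy X" and s: "0 \<le> s" "0 \<le> d" and P: "Measurable.pred (PiM {..n} (\<lambda>_. borel)) P"
  shows "{\<omega>\<in>space M. P (gridv X s d n \<omega>)} \<in> sets M"
  using measurable_compose[OF gridv_measurable[OF X s] P] by (simp add: pred_def)

text \<open>A quiet unit, a first passage at index \<open>j\<close> and a quiet unit are three
  independent blocks, the quiet ones of probability at least 1/2. First passages at different
  \<open>j\<close> are disjoint and together cover the event that the displacement after time 1 /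
  2^p reaches \<open>A\<close>; summing over \<open>j\<close> gives the factor 1/4.\<close>

lemma growth_prob_grid:
  assumes X: "levy X" and s: "0 \<le> s" and S0: "\<And>r. 0 \<le> r \<Longrightarrow> prob (maxgt X r m S0) \<le> 1/2" and p: "p \<le> m" and A: "0 < A"
  defines "E \<equiv> {\<omega>\<in>space M. (\<forall>j\<in>{..2 ^ m}. \<bar>X (s + real j / 2 ^ m) \<omega> - X s \<omega>\<bar> \<le> S0) \<and>
     (\<exists>j\<in>{1..2 ^ (m - p)}.
        (\<forall>i\<in>{..<j}. \<bar>X (s + 1 + real i / 2 ^ m) \<omega> - X (s + 1) \<omega>\<bar> < A) \<and>
        A \<le> \<bar>X (s + 1 + real j / 2 ^ m) \<omega> - X (s + 1) \<omega>\<bar> \<and>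
        (\<forall>i\<in>{..2 ^ m}. \<bar>X (s + 1 + real j / 2 ^ m + real i / 2 ^ m) \<omega> - X (s + 1 + real j / 2 ^ m) \<omega>\<bar> \<le> S0))}"
  shows "prob {\<omega>\<in>space M. A \<le> \<bar>X (1 / 2 ^ p) \<omega>\<bar>} / 4 \<le> prob E"
proof -
  define n :: nat where "n = 2 ^ m"
  define N :: nat where "N = 2 ^ (m - p)"
  define d :: real where "d = 1 / 2 ^ m"
  have d0: "0 \<le> d" by (simp add: d_def)
  have nd: "s + real n * d = s + 1" by (simp add: n_def d_def)
  define B where "B j = s + 1 + real j / 2 ^ m" for j :: nat
  have njd: "s + real (n + j) * d = B j" for j by (simp add: n_def d_def B_def add_divide_distrib)
  define P0 where "P0 y \<longleftrightarrow> \<not> (\<exists>j\<in>{..2 ^ m}. S0 < \<bar>y j :: real\<bar>)" for y :: "nat \<Rightarrow> real"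
  define P1 where "P1 j y \<longleftrightarrow> (\<forall>i\<in>{..<j}. \<bar>y i\<bar> < A) \<and> A \<le> \<bar>y j :: real\<bar>" for j :: nat and y
  have P0m: "Measurable.pred (PiM {..n} (\<lambda>_. borel)) P0" unfolding P0_def n_def
    by (rule pred_intros_logic(2)) (rule maxgt_pred)
  have P1m: "Measurable.pred (PiM {..j} (\<lambda>_. borel)) (P1 j)" for j unfolding P1_def
  proof (intro pred_intros_logic pred_intros_finite)
    fix i assume "i \<in> {..<j}"
    hence [measurable]: "(\<lambda>y. y i) \<in> borel_measurable (PiM {..j} (\<lambda>_. borel :: real measure))" by (auto intro!: gridv_component)
    show "Measurable.pred (PiM {..j} (\<lambda>_. borel)) (\<lambda>y. \<bar>y i\<bar> < A)" by measurable
  next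
    have [measurable]: "(\<lambda>y. y j) \<in> borel_measurable (PiM {..j} (\<lambda>_. borel :: real measure))" by (intro gridv_component) simp
    show "Measurable.pred (PiM {..j} (\<lambda>_. borel)) (\<lambda>y. A \<le> \<bar>y j\<bar>)" by measurable
  qed auto
  \<comment> \<open>The first two blocks are fused into a predicate of one longer grid, because
    \<open>gridv_indep\<close> separates two consecutive grids; it is used twice.\<close>
  define P01 where "P01 j y \<longleftrightarrow> P0 (\<lambda>i\<in>{..n}. y i) \<and> P1 j (\<lambda>i\<in>{..j}. y (n + i) - y n)" for j and y :: "nat \<Rightarrow> real"
  have P01m: "Measurable.pred (PiM {..n + j} (\<lambda>_. borel)) (P01 j)" for j
  proof -
    have 1: "(\<lambda>y. \<lambda>i\<in>{..n}. y i) \<in> measurable (PiM {..n + j} (\<lambda>_. borel :: real measure)) (PiM {..n} (\<lambda>_. borel))"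
      by (rule measurable_restrict) (auto intro!: gridv_component)
    have 2: "(\<lambda>y. \<lambda>i\<in>{..j}. y (n + i) - y n) \<in> measurable (PiM {..n + j} (\<lambda>_. borel :: real measure)) (PiM {..j} (\<lambda>_. borel))"
      by (rule measurable_restrict) (auto intro!: gridv_component borel_measurable_diff)
    show ?thesis unfolding P01_def by (intro pred_intros_logic measurable_compose[OF 1 P0m] measurable_compose[OF 2 P1m])
  qed
  have split: "P01 j (gridv X s d (n + j) \<omega>) \<longleftrightarrow> P0 (gridv X s d n \<omega>) \<and> P1 j (gridv X (s + real n * d) d j \<omega>)" for j \<omega>
  proof -
    have "(\<lambda>i\<in>{..n}. gridv X s d (n + j) \<omega> i) = gridv X s d n \<omega>" by (auto simp: gridv_def fun_eq_iff)
    moreover have "(\<lambda>i\<in>{..j}. gridv X s d (n + j) \<omega> (n + i) - gridv X s d (n + j) \<omega> n) = gridv X (s + real n * d) d j \<omega>"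
      by (auto simp: gridv_def fun_eq_iff algebra_simps)
    ultimately show ?thesis unfolding P01_def by simp
  qed
  define G where "G j = {\<omega>\<in>space M. P1 j (gridv X (s + real n * d) d j \<omega>)}" for j
  define E' where "E' j = {\<omega>\<in>space M. P01 j (gridv X s d (n + j) \<omega>) \<and> P0 (gridv X (s + real (n + j) * d) d n \<omega>)}" for j
  have sn: "0 \<le> s + real k * d" for k using s d0 by simp
  have P0prob: "1/2 \<le> prob {\<omega>\<in>space M. P0 (gridv X r d n \<omega>)}" if r: "0 \<le> r" for r
  proof -
    have "{\<omega>\<in>space M. P0 (gridv X r d n \<omega>)} = space M - maxgt X r m S0"
      unfolding maxgt_gridv P0_def d_def n_def by auto
    thus ?thesis using S0[OF r] prob_compl[OF maxgt_sets[OF X r]] by simp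
  qed
  have Es: "E' j \<in> sets M" for j
  proof -
    have "E' j = {\<omega>\<in>space M. P01 j (gridv X s d (n + j) \<omega>)} \<inter> {\<omega>\<in>space M. P0 (gridv X (s + real (n + j) * d) d n \<omega>)}"
      unfolding E'_def by auto
    thus ?thesis using gridv_sets[OF X s d0 P01m[of j]] gridv_sets[OF X sn d0 P0m, of "n + j"] by simp
  qed
  have Gs: "G j \<in> sets M" for j unfolding G_def by (rule gridv_sets[OF X sn d0 P1m])
  have EG: "prob (G j) / 4 \<le> prob (E' j)" for j
  proof -
    have "prob (E' j) = prob {\<omega>\<in>space M. P01 j (gridv X s d (n + j) \<omega>)} * prob {\<omega>\<in>space M. P0 (gridv X (s + real (n + j) * d) d n \<omega>)}"
      unfolding E'_def by (rule gridv_indep[OF X s d0 P01m P0m])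
    also have "prob {\<omega>\<in>space M. P01 j (gridv X s d (n + j) \<omega>)} = prob {\<omega>\<in>space M. P0 (gridv X s d n \<omega>)} * prob (G j)"
      unfolding split G_def by (rule gridv_indep[OF X s d0 P0m P1m])
    finally have e: "prob (E' j) = prob {\<omega>\<in>space M. P0 (gridv X s d n \<omega>)} * prob (G j) * prob {\<omega>\<in>space M. P0 (gridv X (s + real (n + j) * d) d n \<omega>)}" .
    have "(1/2 * prob (G j)) * (1/2) \<le> prob {\<omega>\<in>space M. P0 (gridv X s d n \<omega>)} * prob (G j) * prob {\<omega>\<in>space M. P0 (gridv X (s + real (n + j) * d) d n \<omega>)}"
      by (intro mult_mono P0prob s sn) auto
    thus ?thesis unfolding e by simp
  qed
  have Gchar: "\<omega> \<in> G j \<longleftrightarrow> \<omega> \<in> space M \<and> (\<forall>i<j. \<bar>X (B i) \<omega> - X (s + 1) \<omega>\<bar> < A) \<and> A \<le> \<bar>X (B j) \<omega> - X (s + 1) \<omega>\<bar>" for \<omega> j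
    unfolding G_def P1_def nd by (auto simp: gridv_def B_def d_def)
  have disjG: "disjoint_family_on G {1..N}"
    unfolding disjoint_family_on_def
  proof (intro ballI impI equals0I)
    fix i j \<omega> assume "i \<in> {1..N}" "j \<in> {1..N}" and ij: "i \<noteq> j" and "\<omega> \<in> G i \<inter> G j"
    hence a: "\<forall>k<i. \<bar>X (B k) \<omega> - X (s + 1) \<omega>\<bar> < A" "A \<le> \<bar>X (B i) \<omega> - X (s + 1) \<omega>\<bar>"
      "\<forall>k<j. \<bar>X (B k) \<omega> - X (s + 1) \<omega>\<bar> < A" "A \<le> \<bar>X (B j) \<omega> - X (s + 1) \<omega>\<bar>"
      unfolding Int_iff Gchar by blast+
    consider "i < j" | "j < i" using ij by linarith
    thus False using a by cases (fastforce simp: not_le[symmetric])+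
  qed
  have EsubG: "E' j \<subseteq> G j" for j unfolding E'_def G_def split by auto
  have disjE: "disjoint_family_on E' {1..N}"
    using disjG EsubG unfolding disjoint_family_on_def by blast
  have EE: "(\<Union>j\<in>{1..N}. E' j) \<subseteq> E"
  proof
    fix \<omega> assume "\<omega> \<in> (\<Union>j\<in>{1..N}. E' j)"
    then obtain j where j: "j \<in> {1..N}" "\<omega> \<in> E' j" by blast
    have Gj: "\<omega> \<in> G j" using EsubG j by blast
    have w: "\<omega> \<in> space M" and 0: "P0 (gridv X s d n \<omega>)" and 3: "P0 (gridv X (s + real (n + j) * d) d n \<omega>)"
      using j(2) unfolding E'_def split by auto
    have p0: "\<bar>X (r + real i / 2 ^ m) \<omega> - X r \<omega>\<bar> \<le> S0" if "P0 (gridv X r d n \<omega>)" "i \<le> 2 ^ m" for r i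
      using that unfolding P0_def by (auto simp: gridv_def d_def n_def not_less)
    have "j \<in> {1..2 ^ (m - p)}" using j(1) by (simp add: N_def)
    thus "\<omega> \<in> E" unfolding E_def using w p0[OF 0] p0[OF 3] Gj unfolding Gchar njd B_def by blast
  qed
  have Esets: "E \<in> sets M"
  proof -
    have [measurable]: "random_variable borel (X (s + real j / 2 ^ m))" "random_variable borel (X s)" "random_variable borel (X (s + 1))"
      "random_variable borel (X (s + 1 + real j / 2 ^ m))" "random_variable borel (X (s + 1 + real j / 2 ^ m + real i / 2 ^ m))" for i j
      using X s by (auto intro!: levy_rv)
    show ?thesis unfolding E_def by measurable
  qed
  have pA: "prob {\<omega>\<in>space M. A \<le> \<bar>X (1 / 2 ^ p) \<omega>\<bar>} \<le> prob (\<Union>j\<in>{1..N}. G j)"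
  proof -
    define h :: real where "h = 1 / 2 ^ p"
    define S where "S = {y::real. A \<le> \<bar>y\<bar>}"
    have S[measurable]: "S \<in> sets borel" unfolding S_def by measurable
    have h0: "0 \<le> h" by (simp add: h_def)
    have s1: "0 \<le> s + 1" using s by simp
    have "{\<omega>\<in>space M. A \<le> \<bar>X h \<omega>\<bar>} = X h -` S \<inter> space M" by (auto simp: S_def)
    hence "prob {\<omega>\<in>space M. A \<le> \<bar>X h \<omega>\<bar>} = measure (distr M borel (X h)) S"
      using levy_measurable[OF X h0] by (simp add: measure_distr)
    also have "\<dots> = measure (distr M borel (linc X (s + 1) h 0)) S" by (simp add: linc_law[OF X s1 h0])
    also have "\<dots> = prob (linc X (s + 1) h 0 -` S \<inter> space M)"
      using linc_measurable[OF X s1 h0] by (simp add: measure_distr)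
    also have "\<dots> \<le> prob (\<Union>j\<in>{1..N}. G j)"
    proof (rule finite_measure_mono)
      show "linc X (s + 1) h 0 -` S \<inter> space M \<subseteq> (\<Union>j\<in>{1..N}. G j)"
      proof
        fix \<omega> assume w: "\<omega> \<in> linc X (s + 1) h 0 -` S \<inter> space M"
        \<comment> \<open>Index \<open>N\<close> is the time 1 / 2^p after s + 1, so a large
          displacement there forces a first passage at some index up to \<open>N\<close>.\<close>
        have "real N = (2::real) ^ (m - p)" by (simp add: N_def)
        hence BN: "B N = s + 1 + h" using p by (simp add: B_def h_def power_diff)
        have AN: "A \<le> \<bar>X (B N) \<omega> - X (s + 1) \<omega>\<bar>" using w by (simp add: linc_def S_def BN)
        define k where "k = (LEAST i. A \<le> \<bar>X (B i) \<omega> - X (s + 1) \<omega>\<bar>)"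
        have k: "A \<le> \<bar>X (B k) \<omega> - X (s + 1) \<omega>\<bar>" unfolding k_def by (rule LeastI[where P="\<lambda>i. A \<le> \<bar>X (B i) \<omega> - X (s + 1) \<omega>\<bar>", OF AN])
        have kN: "k \<le> N" unfolding k_def by (rule Least_le[where P="\<lambda>i. A \<le> \<bar>X (B i) \<omega> - X (s + 1) \<omega>\<bar>", OF AN])
        have kl: "\<bar>X (B i) \<omega> - X (s + 1) \<omega>\<bar> < A" if "i < k" for i
          using not_less_Least[of i "\<lambda>i. A \<le> \<bar>X (B i) \<omega> - X (s + 1) \<omega>\<bar>"] that unfolding k_def by simp
        have "k \<noteq> 0" using k A by (auto simp: B_def intro: ccontr)
        hence "k \<in> {1..N}" using kN by simp
        moreover have "\<omega> \<in> G k" unfolding Gchar using w k kl by auto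
        ultimately show "\<omega> \<in> (\<Union>j\<in>{1..N}. G j)" by blast
      qed
    qed (use Gs in auto)
    finally show ?thesis by (simp add: h_def)
  qed
  have "prob {\<omega>\<in>space M. A \<le> \<bar>X (1 / 2 ^ p) \<omega>\<bar>} / 4 \<le> prob (\<Union>j\<in>{1..N}. G j) / 4" using pA by simp
  also have "\<dots> = (\<Sum>j\<in>{1..N}. prob (G j) / 4)"
    using finite_measure_finite_Union[OF _ _ disjG] Gs by (simp add: sum_divide_distrib image_subset_iff)
  also have "\<dots> \<le> (\<Sum>j\<in>{1..N}. prob (E' j))" by (intro sum_mono EG)
  also have "\<dots> = prob (\<Union>j\<in>{1..N}. E' j)"
    using finite_measure_finite_Union[OF _ _ disjE] Es by (simp add: image_subset_iff)
  also have "\<dots> \<le> prob E" by (rule finite_measure_mono[OF EE Esets])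
  finally show ?thesis .
qed

lemma osc_mono: "k \<le> k' \<Longrightarrow> osc X s m k \<subseteq> osc X s m k'"
proof
  fix \<omega> assume kk: "k \<le> k'" and "\<omega> \<in> osc X s m k"
  then obtain i j where w: "\<omega> \<in> space M" and ij: "i < 3 * 2 ^ m" "j \<le> 2 ^ k"
    "R + 1 < \<bar>X (s + real i / 2 ^ m + real j / 2 ^ (m + k)) \<omega> - X (s + real i / 2 ^ m) \<omega>\<bar>" by (auto simp: osc_def)
  obtain l where l: "k' = k + l" using kk le_Suc_ex by blast
  have f1: "j * 2 ^ l \<in> {..2 ^ k'}" using ij(2) unfolding l by (simp add: power_add)
  have f2: "real (j * 2 ^ l) / 2 ^ (m + k') = real j / 2 ^ (m + k)" unfolding l by (simp add: power_add)
  have "R + 1 < \<bar>X (s + real i / 2 ^ m + real (j * 2 ^ l) / 2 ^ (m + k')) \<omega> - X (s + real i / 2 ^ m) \<omega>\<bar>"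
    unfolding f2 by (rule ij(3))
  moreover have "i \<in> {..<3 * 2 ^ m}" using ij(1) by simp
  ultimately show "\<omega> \<in> osc X s m k'" unfolding osc_def using w f1 by blast
qed

text \<open>The grid \<open>m\<close> is taken so fine that oscillation inside its cells, on all
  finer grids together, costs at most pA / 8 of the pA / 4 gained from
  \<open>growth_prob_grid\<close>. By equality of laws the same numbers serve every process and
  starting time.\<close>

lemma growth_prob:
  assumes L: "levy_measure \<mu>" "emeasure \<mu> UNIV > 0" and S0: "\<And>X s m. levy X \<Longrightarrow> 0 \<le> s \<Longrightarrow> prob (maxgt X s m S0) \<le> 1/2" and A: "0 < A"
  shows "\<exists>m\<ge>p. \<exists>e>0. \<forall>X s. levy X \<longrightarrow> 0 \<le> s \<longrightarrow> e \<le> prob {\<omega>\<in>space M. growth R S0 A m p s (\<lambda>t. X t \<omega>)}"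
proof -
  define pA where "pA = prob {\<omega>\<in>space M. A \<le> \<bar>X0 (1 / 2 ^ p) \<omega>\<bar>}"
  have pA: "0 < pA" unfolding pA_def by (rule levy_unbounded[OF base L]) simp
  have pAeq: "prob {\<omega>\<in>space M. A \<le> \<bar>X (1 / 2 ^ p) \<omega>\<bar>} = pA" if X: "levy X" for X
  proof -
    have S[measurable]: "{y::real. A \<le> \<bar>y\<bar>} \<in> sets borel" by measurable
    have "prob {\<omega>\<in>space M. A \<le> \<bar>X (1 / 2 ^ p) \<omega>\<bar>} = measure (distr M borel (X (1 / 2 ^ p))) {y. A \<le> \<bar>y\<bar>}" if X: "levy X" for X
      using levy_measurable[OF X, of "1 / 2 ^ p"] by (simp add: measure_distr vimage_def Collect_conj_eq Int_commute)
    thus ?thesis using levy_law_eq[OF X base, of "1 / 2 ^ p"] X base by (simp add: pA_def)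
  qed
  have "0 < pA / 8" using pA by simp
  from osc_small[OF this] obtain m0 where "\<forall>X s m m'. levy X \<longrightarrow> 0 \<le> s \<longrightarrow> m0 \<le> m \<longrightarrow> prob (osc X s m m') \<le> pA / 8" by blast
  note m0 = this[rule_format]
  define m where "m = max m0 p"
  show ?thesis
  proof (intro exI[of _ m] conjI exI[of _ "pA / 8"] allI impI)
    fix X and s :: real assume X: "levy X" and s: "0 \<le> s"
    define E where "E = {\<omega>\<in>space M. (\<forall>j\<in>{..2 ^ m}. \<bar>X (s + real j / 2 ^ m) \<omega> - X s \<omega>\<bar> \<le> S0) \<and>
     (\<exists>j\<in>{1..2 ^ (m - p)}.
        (\<forall>i\<in>{..<j}. \<bar>X (s + 1 + real i / 2 ^ m) \<omega> - X (s + 1) \<omega>\<bar> < A) \<and>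
        A \<le> \<bar>X (s + 1 + real j / 2 ^ m) \<omega> - X (s + 1) \<omega>\<bar> \<and>
        (\<forall>i\<in>{..2 ^ m}. \<bar>X (s + 1 + real j / 2 ^ m + real i / 2 ^ m) \<omega> - X (s + 1 + real j / 2 ^ m) \<omega>\<bar> \<le> S0))}"
    define G where "G = {\<omega>\<in>space M. growth R S0 A m p s (\<lambda>t. X t \<omega>)}"
    have [measurable]: "random_variable borel (X (s + real j / 2 ^ m))" "random_variable borel (X s)" "random_variable borel (X (s + 1))"
      "random_variable borel (X (s + 1 + real j / 2 ^ m))" "random_variable borel (X (s + 1 + real j / 2 ^ m + real i / 2 ^ m))"
      "random_variable borel (X (s + real i / 2 ^ m + real j / 2 ^ (m + m')))" for i j m'
      using X s by (auto intro!: levy_rv)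
    have Gs: "G \<in> sets M" unfolding G_def growth_def by measurable
    have pE: "pA / 4 \<le> prob E"
      using growth_prob_grid[OF X s S0[OF X] _ A, where m=m and p=p] pAeq[OF X] unfolding E_def by (simp add: m_def)
    have os: "osc X s m k \<in> sets M" for k by (rule osc_sets[OF X s])
    \<comment> \<open>The events increase with the fineness \<open>k\<close>, so the bound that is
      uniform in \<open>k\<close> passes to their union.\<close>
    have "(\<lambda>k. prob (osc X s m k)) \<longlonglongrightarrow> prob (\<Union>k. osc X s m k)"
      by (rule finite_Lim_measure_incseq) (use os in \<open>auto intro!: monoI osc_mono\<close>)
    hence pO: "prob (\<Union>k. osc X s m k) \<le> pA / 8"
      by (rule LIMSEQ_le_const2) (use m0[OF X s] in \<open>auto simp: m_def\<close>)
    have "E \<subseteq> G \<union> (\<Union>k. osc X s m k)"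
    proof
      fix \<omega> assume E: "\<omega> \<in> E"
      show "\<omega> \<in> G \<union> (\<Union>k. osc X s m k)"
      proof (rule ccontr)
        assume n: "\<omega> \<notin> G \<union> (\<Union>k. osc X s m k)"
        have w: "\<omega> \<in> space M" using E by (simp add: E_def)
        have "\<forall>i\<in>{..<3 * 2 ^ m}. \<forall>m'. \<forall>j\<in>{..2 ^ m'}. \<bar>X (s + real i / 2 ^ m + real j / 2 ^ (m + m')) \<omega> - X (s + real i / 2 ^ m) \<omega>\<bar> \<le> R + 1"
        proof (intro ballI allI)
          fix i m' j :: nat assume "i \<in> {..<3 * 2 ^ m}" "j \<in> {..(2::nat) ^ m'}"
          moreover have "\<omega> \<notin> osc X s m m'" using n by blast
          ultimately show "\<bar>X (s + real i / 2 ^ m + real j / 2 ^ (m + m')) \<omega> - X (s + real i / 2 ^ m) \<omega>\<bar> \<le> R + 1"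
            using w unfolding osc_def not_less[symmetric] by blast
        qed
        hence "\<omega> \<in> G" using E unfolding G_def growth_def E_def by blast
        thus False using n by simp
      qed
    qed
    hence "prob E \<le> prob (G \<union> (\<Union>k. osc X s m k))" by (rule finite_measure_mono) (use Gs os in auto)
    also have "\<dots> \<le> prob G + prob (\<Union>k. osc X s m k)" by (rule measure_Un_le) (use Gs os in auto)
    finally have "pA / 8 \<le> prob G" using pE pO by linarith
    thus "pA / 8 \<le> prob {\<omega>\<in>space M. growth R S0 A m p s (\<lambda>t. X t \<omega>)}" by (simp add: G_def)
  qed (use pA in \<open>auto simp: m_def\<close>)
qed

end

section \<open>Weighted noise and solutions\<close>

text \<open>Convexity of the fourth power, obtained from two weighted Cauchy-Schwarz
  inequalities.\<close>

lemma sum_power4_le: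
  fixes w S :: "'i \<Rightarrow> real"
  assumes w: "\<And>k. k \<in> F \<Longrightarrow> 0 \<le> w k"
  shows "(\<Sum>k\<in>F. w k * S k) ^ 4 \<le> (\<Sum>k\<in>F. w k) ^ 3 * (\<Sum>k\<in>F. w k * S k ^ 4)"
proof -
  have cs: "(\<Sum>k\<in>F. w k * T k)\<^sup>2 \<le> (\<Sum>k\<in>F. w k) * (\<Sum>k\<in>F. w k * (T k)\<^sup>2)" for T :: "'i \<Rightarrow> real"
  proof -
    have "(\<Sum>k\<in>F. w k * T k)\<^sup>2 = (\<Sum>k\<in>F. sqrt (w k) * (sqrt (w k) * T k))\<^sup>2"
      using w by (intro arg_cong[where f="\<lambda>x. x\<^sup>2"] sum.cong) (auto simp: mult.assoc[symmetric])
    also have "\<dots> \<le> (\<Sum>k\<in>F. (sqrt (w k))\<^sup>2) * (\<Sum>k\<in>F. (sqrt (w k) * T k)\<^sup>2)" by (rule Cauchy_Schwarz_ineq_sum)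
    also have "\<dots> = (\<Sum>k\<in>F. w k) * (\<Sum>k\<in>F. w k * (T k)\<^sup>2)" using w by (simp add: power_mult_distrib)
    finally show ?thesis .
  qed
  have W: "0 \<le> (\<Sum>k\<in>F. w k)" using w by (intro sum_nonneg) auto
  have Q: "0 \<le> (\<Sum>k\<in>F. w k * S k ^ 2)" using w by (intro sum_nonneg) auto
  have "(\<Sum>k\<in>F. w k * S k) ^ 4 = ((\<Sum>k\<in>F. w k * S k)\<^sup>2)\<^sup>2" by (simp add: power_mult[symmetric])
  also have "\<dots> \<le> ((\<Sum>k\<in>F. w k) * (\<Sum>k\<in>F. w k * (S k)\<^sup>2))\<^sup>2" by (intro power_mono cs) auto
  also have "\<dots> = (\<Sum>k\<in>F. w k)\<^sup>2 * (\<Sum>k\<in>F. w k * (S k)\<^sup>2)\<^sup>2" by (simp add: power_mult_distrib)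
  also have "\<dots> \<le> (\<Sum>k\<in>F. w k)\<^sup>2 * ((\<Sum>k\<in>F. w k) * (\<Sum>k\<in>F. w k * ((S k)\<^sup>2)\<^sup>2))"
    by (intro mult_left_mono cs) auto
  also have "\<dots> = (\<Sum>k\<in>F. w k) ^ 3 * (\<Sum>k\<in>F. w k * S k ^ 4)"
    by (simp add: power2_eq_square power3_eq_cube power4_eq_xxxx mult.assoc)
  finally show ?thesis .
qed

text \<open>As \<open>lam k\<close> is at least k^2, a weight is at most a constant times |k| to the
  power 1 - 2 \<gamma>, which is summable because \<gamma> > 1.\<close>

lemma weight_sum_bounded:
  assumes g: "\<gamma> > 1" and C: "0 \<le> C" and b: "\<And>k. k \<noteq> 0 \<Longrightarrow> 0 \<le> \<beta> k \<and> \<beta> k \<le> C * lam k powr (- \<gamma>)"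
  shows "\<exists>W. \<forall>N. (\<Sum>k\<in>FN N. 2 * sqrt 2 * pi * \<bar>real_of_int k\<bar> * \<beta> k) \<le> W"
proof -
  define K where "K = 2 * sqrt 2 * pi * C"
  have K0: "0 \<le> K" using C by (simp add: K_def)
  have sm: "summable (\<lambda>n. real n powr (1 - 2 * \<gamma>))" using g by (subst summable_real_powr_iff) simp
  define V where "V = (\<Sum>n. real n powr (1 - 2 * \<gamma>))"
  have tm: "2 * sqrt 2 * pi * \<bar>real_of_int k\<bar> * \<beta> k \<le> K * (real (nat \<bar>k\<bar>) powr (1 - 2 * \<gamma>))" if k: "k \<noteq> 0" for k
  proof -
    define x where "x = \<bar>real_of_int k\<bar>"
    have x: "x \<ge> 1" using k unfolding x_def by linarith
    hence x0: "0 \<le> x" by simp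
    have "1 \<le> 4 * pi\<^sup>2"
    proof -
      have "3\<^sup>2 \<le> pi\<^sup>2" using pi_gt3 by (intro power_mono) auto
      thus ?thesis by simp
    qed
    hence "1 * x\<^sup>2 \<le> 4 * pi\<^sup>2 * x\<^sup>2" by (intro mult_right_mono) auto
    hence "x\<^sup>2 \<le> lam k" by (simp add: lam_def x_def)
    hence "lam k powr (- \<gamma>) \<le> (x\<^sup>2) powr (- \<gamma>)" using x g by (intro powr_mono2') auto
    also have "(x\<^sup>2) powr (- \<gamma>) = x powr (- 2 * \<gamma>)"
    proof -
      have "x\<^sup>2 = x powr 2" using x by simp
      thus ?thesis by (simp only: powr_powr) simp
    qed
    finally have "\<beta> k \<le> C * x powr (- 2 * \<gamma>)" using b[OF k] mult_left_mono[OF _ C] by (meson order_trans)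
    hence "2 * sqrt 2 * pi * x * \<beta> k \<le> 2 * sqrt 2 * pi * x * (C * x powr (- 2 * \<gamma>))" using x by (intro mult_left_mono) auto
    also have "\<dots> = K * (x powr 1 * x powr (- 2 * \<gamma>))" unfolding K_def powr_one[OF x0] by (simp only: mult_ac)
    also have "x powr 1 * x powr (- 2 * \<gamma>) = x powr (1 - 2 * \<gamma>)" by (subst powr_add[symmetric]) simp
    also have "x = real (nat \<bar>k\<bar>)" by (simp add: x_def)
    finally show ?thesis by simp
  qed
  have pos: "(\<Sum>n\<in>{1..N}. real n powr (1 - 2 * \<gamma>)) \<le> V" for N
    unfolding V_def by (rule sum_le_suminf[OF sm]) auto
  have "(\<Sum>k\<in>FN N. 2 * sqrt 2 * pi * \<bar>real_of_int k\<bar> * \<beta> k) \<le> K * (2 * V)" for N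
  proof -
    have "FN N - {0} = int ` {1..N} \<union> (\<lambda>k. - int k) ` {1..N}" (is "_ = ?A \<union> ?B")
    proof (intro equalityI subsetI)
      fix k assume k: "k \<in> FN N - {0}"
      show "k \<in> ?A \<union> ?B"
      proof (cases "k > 0")
        case True
        hence "k = int (nat k)" "nat k \<in> {1..N}" using k by auto
        thus ?thesis by blast
      next
        case False
        hence "k = - int (nat (- k))" "nat (- k) \<in> {1..N}" using k by auto
        thus ?thesis by blast
      qed
    qed auto
    note AB = this
    have "(\<Sum>k\<in>FN N. 2 * sqrt 2 * pi * \<bar>real_of_int k\<bar> * \<beta> k) = (\<Sum>k\<in>FN N - {0}. 2 * sqrt 2 * pi * \<bar>real_of_int k\<bar> * \<beta> k)"
      by (rule sum.mono_neutral_right) auto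
    also have "\<dots> \<le> (\<Sum>k\<in>FN N - {0}. K * (real (nat \<bar>k\<bar>) powr (1 - 2 * \<gamma>)))" by (intro sum_mono tm) auto
    also have "\<dots> = (\<Sum>k\<in>?A. K * (real (nat \<bar>k\<bar>) powr (1 - 2 * \<gamma>))) + (\<Sum>k\<in>?B. K * (real (nat \<bar>k\<bar>) powr (1 - 2 * \<gamma>)))"
      unfolding AB by (rule sum.union_disjoint) auto
    also have "\<dots> = K * (\<Sum>n\<in>{1..N}. real n powr (1 - 2 * \<gamma>)) + K * (\<Sum>n\<in>{1..N}. real n powr (1 - 2 * \<gamma>))"
      by (simp add: sum.reindex inj_on_def sum_distrib_left)
    also have "\<dots> \<le> K * V + K * V" using K0 pos[of N] by (intro add_mono mult_left_mono) auto
    finally show ?thesis by simp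
  qed
  thus ?thesis by blast
qed

lemma l2_distL2: "distL2 f g = l2 (\<lambda>x. f x - g x)"
  by (simp add: distL2_def l2_def set_lint_UI)

lemma L2_cadlag_bounded:
  fixes v :: "real \<Rightarrow> real \<Rightarrow> real" and T :: real
  assumes H: "\<And>t. 0 \<le> t \<Longrightarrow> in_H (v t)"
    and c: "\<And>t. 0 \<le> t \<Longrightarrow> ((\<lambda>s. distL2 (v s) (v t)) \<longlongrightarrow> 0) (at_right t) \<and>
                (t > 0 \<longrightarrow> (\<exists>w. in_H w \<and> ((\<lambda>s. distL2 (v s) w) \<longlongrightarrow> 0) (at_left t)))"
    and T: "0 \<le> T"
  shows "\<exists>B. \<forall>t\<in>{0..T}. l2 (v t) \<le> B"
proof (rule locally_bounded_imp_bounded[OF T])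
  fix t assume t: "0 \<le> t" "t \<le> T"
  have tri: "l2 (v s) \<le> l2 w + distL2 (v s) w" if "0 \<le> s" "sqint w" for s w
    using l2_triangle[OF that(2) sqint_diff[OF in_H_sqint[OF H[OF that(1)]] that(2)]] by (simp add: l2_distL2)
  have "eventually (\<lambda>s. distL2 (v s) (v t) < 1) (at_right t)"
    by (rule order_tendstoD(2)) (use c[OF t(1)] in auto)
  then obtain r where r: "r > t" "\<And>s. t < s \<Longrightarrow> s < r \<Longrightarrow> distL2 (v s) (v t) < 1"
    unfolding eventually_at_right_field by auto
  obtain q w where q: "q < t" "sqint w" "\<And>s. 0 \<le> s \<Longrightarrow> q < s \<Longrightarrow> s < t \<Longrightarrow> distL2 (v s) w < 1"
  proof (cases "t > 0")
    case True
    then obtain w where w: "in_H w" "((\<lambda>s. distL2 (v s) w) \<longlongrightarrow> 0) (at_left t)" using c[OF t(1)] by blast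
    have "eventually (\<lambda>s. distL2 (v s) w < 1) (at_left t)" by (rule order_tendstoD(2)[OF w(2)]) simp
    thus ?thesis using that in_H_sqint[OF w(1)] unfolding eventually_at_left_field by blast
  next
    case False thus ?thesis using that[of "t - 1" "\<lambda>x. 0"] by auto
  qed
  show "\<exists>d>0. \<exists>B. \<forall>y. 0 \<le> y \<and> y \<le> T \<and> \<bar>y - t\<bar> < d \<longrightarrow> l2 (v y) \<le> B"
  proof (rule exI[of _ "min (r - t) (t - q)"], rule conjI, goal_cases)
    case 2
    show ?case
    proof (rule exI[of _ "l2 (v t) + l2 w + 1"], intro allI impI)
      fix y assume y: "0 \<le> y \<and> y \<le> T \<and> \<bar>y - t\<bar> < min (r - t) (t - q)"
      consider "y < t" | "y = t" | "y > t" by linarith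
      thus "l2 (v y) \<le> l2 (v t) + l2 w + 1"
      proof cases
        case 1
        hence "distL2 (v y) w < 1" using y by (intro q(3)) auto
        thus ?thesis using tri[OF _ q(2), of y] y l2_nonneg[of "v t"] by linarith
      next
        case 2 thus ?thesis using l2_nonneg[of w] by simp
      next
        case 3
        hence "distL2 (v y) (v t) < 1" using y by (intro r(2)) auto
        thus ?thesis using tri[of y "v t"] in_H_sqint[OF H[OF t(1)]] y l2_nonneg[of w] by linarith
      qed
    qed
  qed (use r q in auto)
qed

text \<open>Mode 1 serves as the reference process; it will also produce the displacement in the
  lower bound.\<close>

locale burgers_setting = levy_noise M \<mu> R "L 1" for M :: "'a measure" and \<mu> :: "real measure" and R :: real
    and L :: "int \<Rightarrow> real \<Rightarrow> 'a \<Rightarrow> real" +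
  fixes \<beta> :: "int \<Rightarrow> real" and Wt :: real
  assumes levyk: "\<And>k. k \<noteq> 0 \<Longrightarrow> levy (L k)"
    and L_indep: "indep_vars (\<lambda>_. Pi\<^sub>M UNIV (\<lambda>_. borel)) (\<lambda>k \<omega>. \<lambda>t. L k t \<omega>) (UNIV - {0})"
    and beta_pos: "\<And>k. k \<noteq> 0 \<Longrightarrow> 0 < \<beta> k"
    and Wt: "\<And>N. (\<Sum>k\<in>FN N. 2 * sqrt 2 * pi * \<bar>real_of_int k\<bar> * \<beta> k) \<le> Wt"
    and mu: "levy_measure \<mu>" "emeasure \<mu> UNIV > 0"
begin

definition wt :: "int \<Rightarrow> real" where "wt k = 2 * sqrt 2 * pi * \<bar>real_of_int k\<bar> * \<beta> k"

lemma wt_nonneg: "0 \<le> wt k"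
  using beta_pos[of k] by (cases "k = 0") (auto simp: wt_def)

lemma Wt_nonneg: "0 \<le> Wt" using Wt[of 0] by simp

lemma wt_sum: "A \<subseteq> FN N \<Longrightarrow> (\<Sum>k\<in>A. wt k) \<le> Wt"
  using sum_mono2[of "FN N" A wt] wt_nonneg Wt[of N] by (simp add: wt_def)

definition pth :: "'a \<Rightarrow> int \<Rightarrow> real \<Rightarrow> real" where "pth \<omega> k t = (if k = 0 then 0 else \<beta> k * L k t \<omega>)"

text \<open>A supremum of partial sums, convenient for measurability and monotone convergence. The
  removed modes \<open>D\<close> are {0} for the upper bound and {0, 1} for the lower one, where
  mode 1 is handled separately.\<close>

definition Zsum :: "int set \<Rightarrow> real \<Rightarrow> (int \<Rightarrow> real \<Rightarrow> real) \<Rightarrow> ennreal" where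
  "Zsum D r x = (SUP N. \<Sum>k\<in>FN N - D. ennreal (wt k) * Zp r (x k))"

abbreviation Lp :: "'a \<Rightarrow> int \<Rightarrow> real \<Rightarrow> real" where "Lp \<omega> k \<equiv> (\<lambda>t. L k t \<omega>)"

lemma Zp_L_measurable: "k \<noteq> 0 \<Longrightarrow> 0 \<le> r \<Longrightarrow> (\<lambda>\<omega>. Zp r (Lp \<omega> k)) \<in> borel_measurable M"
  by (rule Zp_measurable[OF levyk])

lemma Zsum_measurable:
  assumes "0 \<le> r" "0 \<in> D" shows "(\<lambda>\<omega>. Zsum D r (Lp \<omega>)) \<in> borel_measurable M"
  unfolding Zsum_def using assms
  by (intro borel_measurable_SUP borel_measurable_sum borel_measurable_times_ennreal borel_measurable_const Zp_L_measurable) auto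

lemma Zsum_expect:
  assumes r: "0 \<le> r" and D: "0 \<in> D" and C: "\<And>X s. levy X \<Longrightarrow> 0 \<le> s \<Longrightarrow> (\<integral>\<^sup>+ \<omega>. Zp s (\<lambda>t. X t \<omega>) \<partial>M) \<le> ennreal C" "0 \<le> C"
  shows "(\<integral>\<^sup>+ \<omega>. Zsum D r (Lp \<omega>) \<partial>M) \<le> ennreal (Wt * C)"
proof -
  define f where "f N \<omega> = (\<Sum>k\<in>FN N - D. ennreal (wt k) * Zp r (Lp \<omega> k))" for N \<omega>
  have fm: "f N \<in> borel_measurable M" for N unfolding f_def[abs_def] using r D
    by (intro borel_measurable_sum borel_measurable_times_ennreal borel_measurable_const Zp_L_measurable) auto
  have inc: "incseq f" unfolding f_def by (intro monoI le_funI sum_mono2) auto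
  have "(\<integral>\<^sup>+ \<omega>. f N \<omega> \<partial>M) \<le> ennreal (Wt * C)" for N
  proof -
    have "(\<integral>\<^sup>+ \<omega>. f N \<omega> \<partial>M) = (\<Sum>k\<in>FN N - D. \<integral>\<^sup>+ \<omega>. ennreal (wt k) * Zp r (Lp \<omega> k) \<partial>M)"
      unfolding f_def using r D
      by (intro nn_integral_sum borel_measurable_times_ennreal borel_measurable_const Zp_L_measurable) auto
    also have "\<dots> = (\<Sum>k\<in>FN N - D. ennreal (wt k) * (\<integral>\<^sup>+ \<omega>. Zp r (Lp \<omega> k) \<partial>M))"
      by (intro sum.cong refl nn_integral_cmult Zp_L_measurable r) (use D in auto)
    also have "\<dots> \<le> (\<Sum>k\<in>FN N - D. ennreal (wt k) * ennreal C)"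
    proof (intro sum_mono mult_left_mono)
      fix k assume "k \<in> FN N - D"
      hence "k \<noteq> 0" using D by auto
      thus "(\<integral>\<^sup>+ \<omega>. Zp r (Lp \<omega> k) \<partial>M) \<le> ennreal C" by (intro C(1)[OF levyk r])
    qed auto
    also have "\<dots> = ennreal (\<Sum>k\<in>FN N - D. wt k * C)"
      using wt_nonneg C(2) by (simp add: ennreal_mult'' sum_ennreal[symmetric])
    also have "\<dots> \<le> ennreal (Wt * C)"
      unfolding sum_distrib_right[symmetric] using C(2) by (intro ennreal_leI mult_right_mono wt_sum[of _ N]) auto
    finally show ?thesis .
  qed
  moreover have "(\<integral>\<^sup>+ \<omega>. Zsum D r (Lp \<omega>) \<partial>M) = (SUP N. \<integral>\<^sup>+ \<omega>. f N \<omega> \<partial>M)"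
    unfolding Zsum_def f_def[symmetric] by (rule nn_integral_monotone_convergence_SUP[OF inc fm])
  ultimately show ?thesis by (simp add: SUP_least)
qed

text \<open>\<open>sum_power4_le\<close> with total weight at most \<open>Wt\<close> converts
  weighted fourth powers into a bound on the weighted sum, uniform in \<open>N\<close> and in
  \<open>t\<close>.\<close>

lemma Zsum_bound:
  assumes c: "\<And>k. k \<noteq> 0 \<Longrightarrow> cadlag_path (Lp \<omega> k)" and r: "0 \<le> r" "r \<le> t" "t \<le> r + 1" and D: "0 \<in> D"
    and z: "Zsum D r (Lp \<omega>) \<le> ennreal z" "0 \<le> z"
  shows "(\<Sum>k\<in>FN N - D. wt k * \<bar>L k t \<omega> - L k r \<omega>\<bar>) \<le> root 4 (Wt ^ 3 * z)"
proof -
  define S where "S = (\<Sum>k\<in>FN N - D. wt k * \<bar>L k t \<omega> - L k r \<omega>\<bar>)"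
  have S0: "0 \<le> S" unfolding S_def using wt_nonneg by (intro sum_nonneg) auto
  have "ennreal (\<Sum>k\<in>FN N - D. wt k * \<bar>L k t \<omega> - L k r \<omega>\<bar> ^ 4) = (\<Sum>k\<in>FN N - D. ennreal (wt k) * ennreal (\<bar>L k t \<omega> - L k r \<omega>\<bar> ^ 4))"
    using wt_nonneg by (simp add: ennreal_mult'' sum_ennreal[symmetric])
  also have "\<dots> \<le> (\<Sum>k\<in>FN N - D. ennreal (wt k) * Zp r (Lp \<omega> k))"
    using D by (intro sum_mono mult_left_mono Zp_dominates c r) auto
  also have "\<dots> \<le> Zsum D r (Lp \<omega>)" unfolding Zsum_def by (rule SUP_upper) simp
  also have "\<dots> \<le> ennreal z" by (rule z(1))
  finally have q: "(\<Sum>k\<in>FN N - D. wt k * \<bar>L k t \<omega> - L k r \<omega>\<bar> ^ 4) \<le> z" using z(2) by simp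
  have "S ^ 4 \<le> (\<Sum>k\<in>FN N - D. wt k) ^ 3 * (\<Sum>k\<in>FN N - D. wt k * \<bar>L k t \<omega> - L k r \<omega>\<bar> ^ 4)"
    unfolding S_def by (rule sum_power4_le) (rule wt_nonneg)
  also have "\<dots> \<le> Wt ^ 3 * z"
    using q wt_nonneg Wt_nonneg by (intro mult_mono power_mono wt_sum[of _ N] sum_nonneg) (auto intro: zero_le_power)
  finally have "root 4 (S ^ 4) \<le> root 4 (Wt ^ 3 * z)" by (intro real_root_le_mono) auto
  moreover have "root 4 (S ^ 4) = S" by (rule real_root_power_cancel) (use S0 in auto)
  ultimately show ?thesis unfolding S_def[symmetric] by linarith
qed

lemma pth_sum:
  "(\<Sum>k\<in>FN N. 2 * sqrt 2 * pi * \<bar>real_of_int k\<bar> * \<bar>pth \<omega> k t - pth \<omega> k r\<bar>) = (\<Sum>k\<in>FN N - {0}. wt k * \<bar>L k t \<omega> - L k r \<omega>\<bar>)"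
proof -
  have "(\<Sum>k\<in>FN N. 2 * sqrt 2 * pi * \<bar>real_of_int k\<bar> * \<bar>pth \<omega> k t - pth \<omega> k r\<bar>) = (\<Sum>k\<in>FN N - {0}. 2 * sqrt 2 * pi * \<bar>real_of_int k\<bar> * \<bar>pth \<omega> k t - pth \<omega> k r\<bar>)"
    by (rule sum.mono_neutral_right) auto
  also have "\<dots> = (\<Sum>k\<in>FN N - {0}. wt k * \<bar>L k t \<omega> - L k r \<omega>\<bar>)"
  proof (rule sum.cong[OF refl])
    fix k assume "k \<in> FN N - {0}"
    hence k: "k \<noteq> 0" by auto
    have "pth \<omega> k t - pth \<omega> k r = \<beta> k * (L k t \<omega> - L k r \<omega>)" using k by (simp add: pth_def right_diff_distrib)
    thus "2 * sqrt 2 * pi * \<bar>real_of_int k\<bar> * \<bar>pth \<omega> k t - pth \<omega> k r\<bar> = wt k * \<bar>L k t \<omega> - L k r \<omega>\<bar>"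
      using beta_pos[OF k] by (simp add: abs_mult wt_def mult_ac)
  qed
  finally show ?thesis .
qed

text \<open>Countably many almost sure properties are intersected, after which all dynamical
  arguments concern a single path.\<close>

lemma solution_path:
  assumes sol: "burgers_solution M \<beta> L \<nu> u0 u" and nu: "0 < \<nu>" "\<nu> \<le> 1"
  shows "AE \<omega> in M. burgers_path \<nu> (\<lambda>t. u t \<omega>) (pth \<omega>) (\<lambda>k. ipL2 u0 (ebasis k)) \<and> (\<forall>k. k \<noteq> 0 \<longrightarrow> cadlag_path (Lp \<omega> k))"
proof -
  have m: "(\<lambda>(t, \<omega>). H1_sq (u t \<omega>)) \<in> borel_measurable (lborel \<Otimes>\<^sub>M M)" using sol by (simp add: burgers_solution_def)
  have "AE \<omega> in M. cadlag_path (Lp \<omega> k)" if "k \<noteq> 0" for k by (rule levy_cadlag[OF levyk[OF that]])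
  hence cad: "AE \<omega> in M. \<forall>k. k \<noteq> 0 \<longrightarrow> cadlag_path (Lp \<omega> k)" by (subst AE_all_countable) auto
  have ae: "AE \<omega> in M.
        (\<forall>t\<ge>0. in_H (u t \<omega>)) \<and>
        (\<forall>t\<ge>0. ((\<lambda>s. distL2 (u s \<omega>) (u t \<omega>)) \<longlongrightarrow> 0) (at_right t) \<and>
                (t > 0 \<longrightarrow> (\<exists>v. in_H v \<and> ((\<lambda>s. distL2 (u s \<omega>) v) \<longlongrightarrow> 0) (at_left t)))) \<and>
        (\<forall>T\<ge>0. (\<integral>\<^sup>+ t\<in>{0..T}. H1_sq (u t \<omega>) \<partial>lborel) < \<infinity>) \<and>
        (\<forall>t\<ge>0. \<forall>k. k \<noteq> 0 \<longrightarrow>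
           set_integrable lborel {0..t} (\<lambda>s. burgers_rhs \<nu> (u s \<omega>) k) \<and>
           ipL2 (u t \<omega>) (ebasis k) =
             ipL2 u0 (ebasis k) + (LINT s:{0..t}|lborel. burgers_rhs \<nu> (u s \<omega>) k) + \<beta> k * L k t \<omega>)"
    using sol unfolding burgers_solution_def by (rule conjunct2)
  show ?thesis
    using cad ae AE_space
  proof eventually_elim
    case (elim \<omega>)
    note a = elim(2)[THEN conjunct1] and b = elim(2)[THEN conjunct2, THEN conjunct1]
      and c = elim(2)[THEN conjunct2, THEN conjunct2, THEN conjunct1] and d = elim(2)[THEN conjunct2, THEN conjunct2, THEN conjunct2]
    have "burgers_path \<nu> (\<lambda>t. u t \<omega>) (pth \<omega>) (\<lambda>k. ipL2 u0 (ebasis k))"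
    proof
      show "0 < \<nu>" "\<nu> \<le> 1" by (rule nu)+
      show "in_H (u t \<omega>)" if "0 \<le> t" for t using a that by blast
      show "\<exists>B. \<forall>t\<in>{0..T}. l2 (u t \<omega>) \<le> B" if "0 \<le> T" for T
        by (rule L2_cadlag_bounded[OF _ _ that]) (use a b in blast)+
      have "(\<lambda>t. (t, \<omega>)) \<in> measurable lborel (lborel \<Otimes>\<^sub>M M)" by (rule measurable_Pair2'[OF elim(3)])
      from measurable_compose[OF this m] show "(\<lambda>t. H1_sq (u t \<omega>)) \<in> borel_measurable borel" by simp
      show "(\<integral>\<^sup>+ t\<in>{0..T}. H1_sq (u t \<omega>) \<partial>lborel) < \<infinity>" if "0 \<le> T" for T using c that by blast
      show "pth \<omega> 0 t = 0" for t by (simp add: pth_def)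
      show "(\<lambda>t. pth \<omega> k (max 0 t)) \<in> borel_measurable borel" for k
      proof (cases "k = 0")
        case True thus ?thesis by (simp add: pth_def)
      next
        case False
        have "(\<lambda>t. Lp \<omega> k (max 0 t)) \<in> borel_measurable borel"
          by (rule right_continuous_measurable) (use elim(1) False in \<open>auto simp: cadlag_path_def\<close>)
        thus ?thesis using False unfolding pth_def by simp
      qed
      show "set_integrable lborel {0..t} (\<lambda>s. burgers_rhs \<nu> (u s \<omega>) k)" if "0 \<le> t" "k \<noteq> 0" for t k using d that by blast
      show "ipL2 (u t \<omega>) (ebasis k) = ipL2 u0 (ebasis k) + (LINT s:{0..t}|lborel. burgers_rhs \<nu> (u s \<omega>) k) + pth \<omega> k t" if "0 \<le> t" "k \<noteq> 0" for t k
        using d that unfolding pth_def by auto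
    qed
    thus ?case using elim(1) by blast
  qed
qed

end

section \<open>Averaged bounds\<close>

text \<open>The witness is so large that \<open>B\<close> and the square root are each at most half
  of \<open>b * A\<close>.\<close>

lemma linear_beats_sqrt:
  fixes B D F b :: real
  assumes "0 < b" "0 \<le> D" "0 \<le> F" shows "\<exists>A>0. B + sqrt (D + F * A) \<le> b * A"
proof -
  define A where "A = max 1 (max (2 * B / b) (4 * (D + F) / b\<^sup>2))"
  have A1: "1 \<le> A" and A2: "2 * B / b \<le> A" and A3: "4 * (D + F) / b\<^sup>2 \<le> A" by (auto simp: A_def)
  have "2 * B \<le> b * A" using A2 assms(1) by (simp add: field_simps)
  have "4 * (D + F) \<le> b\<^sup>2 * A" using A3 assms(1) by (simp add: field_simps)
  hence "4 * (D + F) * A \<le> b\<^sup>2 * A * A" using A1 by (intro mult_right_mono) auto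
  hence "4 * (D * A + F * A) \<le> (b * A)\<^sup>2" by (simp add: power2_eq_square algebra_simps)
  moreover have "D * 1 \<le> D * A" using A1 assms by (intro mult_left_mono) auto
  ultimately have "D + F * A \<le> (b * A / 2)\<^sup>2" by (simp add: power_divide)
  hence "sqrt (D + F * A) \<le> b * A / 2" using A1 assms by (intro real_le_lsqrt) auto
  thus ?thesis using \<open>2 * B \<le> b * A\<close> A1 by (intro exI[of _ A]) auto
qed

lemma ennreal_affine:
  "0 \<le> a \<Longrightarrow> 0 \<le> b \<Longrightarrow> 0 \<le> c \<Longrightarrow> 0 \<le> d \<Longrightarrow> ennreal a + ennreal b * (ennreal c + ennreal d) = ennreal (a + b * (c + d))"
  by (simp add: ennreal_mult)

text \<open>The interval is covered by \<lceil>\<sigma>\<rceil> \<le> 2 \<sigma> windows of unit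
  length.\<close>

lemma average_le:
  fixes f :: "real \<Rightarrow> ennreal" and T c \<sigma> :: real
  assumes f[measurable]: "f \<in> borel_measurable borel" and w: "\<And>a. T \<le> a \<Longrightarrow> (\<integral>\<^sup>+t\<in>{a..a+1}. f t \<partial>lborel) \<le> ennreal c"
    and c: "0 \<le> c" and \<sigma>: "1 \<le> \<sigma>"
  shows "ennreal (1 / \<sigma>) * (\<integral>\<^sup>+t\<in>{T..T+\<sigma>}. f t \<partial>lborel) \<le> ennreal (2 * c)"
proof -
  have n: "(\<integral>\<^sup>+t\<in>{T..T+real n}. f t \<partial>lborel) \<le> ennreal (real n * c)" for n
  proof (induction n)
    case 0
    have "(\<integral>\<^sup>+t\<in>{T..T+real 0}. f t \<partial>lborel) = (\<integral>\<^sup>+t\<in>{T}. f t \<partial>lborel)" by simp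
    also have "\<dots> = 0" by (rule nn_integral_null_set) (simp add: null_sets_def)
    finally show ?case by simp
  next
    case (Suc n)
    have "(\<integral>\<^sup>+t\<in>{T..T+real (Suc n)}. f t \<partial>lborel)
      \<le> (\<integral>\<^sup>+t. f t * indicator {T..T+real n} t + f t * indicator {T+real n..T+real n+1} t \<partial>lborel)"
      by (intro nn_integral_mono) (auto simp: indicator_def)
    also have "\<dots> = (\<integral>\<^sup>+t\<in>{T..T+real n}. f t \<partial>lborel) + (\<integral>\<^sup>+t\<in>{T+real n..T+real n+1}. f t \<partial>lborel)"
      by (rule nn_integral_add) auto
    also have "\<dots> \<le> ennreal (real n * c) + ennreal c" by (intro add_mono Suc w) auto
    also have "\<dots> = ennreal (real (Suc n) * c)" using c by (simp add: ennreal_plus[symmetric] algebra_simps del: ennreal_plus)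
    finally show ?case .
  qed
  define n where "n = nat \<lceil>\<sigma>\<rceil>"
  have nr: "\<sigma> \<le> real n" "real n \<le> 2 * \<sigma>" using \<sigma> unfolding n_def by linarith+
  have "(\<integral>\<^sup>+t\<in>{T..T+\<sigma>}. f t \<partial>lborel) \<le> (\<integral>\<^sup>+t\<in>{T..T+real n}. f t \<partial>lborel)"
    using nr by (intro nn_integral_mono) (auto simp: indicator_def)
  also have "\<dots> \<le> ennreal (2 * \<sigma> * c)" using n[of n] nr c by (elim order_trans) (intro ennreal_leI mult_right_mono)
  finally have "ennreal (1 / \<sigma>) * (\<integral>\<^sup>+t\<in>{T..T+\<sigma>}. f t \<partial>lborel) \<le> ennreal (1 / \<sigma>) * ennreal (2 * \<sigma> * c)"
    by (intro mult_left_mono) auto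
  also have "\<dots> = ennreal (2 * c)" using \<sigma> c by (subst ennreal_mult''[symmetric]) auto
  finally show ?thesis .
qed

text \<open>Each block of length 4 contributes its last 3 units, so that consecutive windows do not
  meet; at least \<sigma> / 8 blocks fit once \<sigma> \<ge> 4.\<close>

lemma average_ge:
  fixes f :: "real \<Rightarrow> ennreal" and T d \<sigma> :: real
  assumes f[measurable]: "f \<in> borel_measurable borel" and w: "\<And>a. T \<le> a \<Longrightarrow> ennreal d \<le> (\<integral>\<^sup>+t\<in>{a..a+3}. f t \<partial>lborel)"
    and d: "0 \<le> d" and \<sigma>: "4 \<le> \<sigma>"
  shows "ennreal (d / 8) \<le> ennreal (1 / \<sigma>) * (\<integral>\<^sup>+t\<in>{T..T+\<sigma>}. f t \<partial>lborel)"
proof -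
  have n: "ennreal (real n * d) \<le> (\<integral>\<^sup>+t\<in>{T..T+4*real n}. f t \<partial>lborel)" for n
  proof (induction n)
    case (Suc n)
    have "ennreal (real (Suc n) * d) = ennreal (real n * d) + ennreal d"
      using d by (simp add: ennreal_plus[symmetric] algebra_simps del: ennreal_plus)
    also have "\<dots> \<le> (\<integral>\<^sup>+t\<in>{T..T+4*real n}. f t \<partial>lborel) + (\<integral>\<^sup>+t\<in>{T+4*real n+1..T+4*real n+1+3}. f t \<partial>lborel)"
      by (intro add_mono Suc w) auto
    also have "\<dots> = (\<integral>\<^sup>+t. f t * indicator {T..T+4*real n} t + f t * indicator {T+4*real n+1..T+4*real n+1+3} t \<partial>lborel)"
      by (rule nn_integral_add[symmetric]) auto
    also have "\<dots> \<le> (\<integral>\<^sup>+t\<in>{T..T+4*real (Suc n)}. f t \<partial>lborel)"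
      by (intro nn_integral_mono) (auto simp: indicator_def)
    finally show ?case .
  qed simp
  define n where "n = nat \<lfloor>\<sigma> / 4\<rfloor>"
  have nr: "4 * real n \<le> \<sigma>" "\<sigma> / 8 \<le> real n" 
  proof -
    have "1 \<le> \<lfloor>\<sigma> / 4\<rfloor>" using \<sigma> by simp
    hence "real n = of_int \<lfloor>\<sigma> / 4\<rfloor>" "1 \<le> real n" unfolding n_def by simp_all
    thus "4 * real n \<le> \<sigma>" "\<sigma> / 8 \<le> real n" using floor_correct[of "\<sigma> / 4"] by linarith+
  qed
  have "ennreal (\<sigma> / 8 * d) \<le> ennreal (real n * d)" using nr d by (intro ennreal_leI mult_right_mono)
  also have "\<dots> \<le> (\<integral>\<^sup>+t\<in>{T..T+4*real n}. f t \<partial>lborel)" by (rule n)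
  also have "\<dots> \<le> (\<integral>\<^sup>+t\<in>{T..T+\<sigma>}. f t \<partial>lborel)"
    using nr by (intro nn_integral_mono) (auto simp: indicator_def)
  finally have "ennreal (1 / \<sigma>) * ennreal (\<sigma> / 8 * d) \<le> ennreal (1 / \<sigma>) * (\<integral>\<^sup>+t\<in>{T..T+\<sigma>}. f t \<partial>lborel)"
    by (intro mult_left_mono) auto
  moreover have "ennreal (1 / \<sigma>) * ennreal (\<sigma> / 8 * d) = ennreal (d / 8)" using \<sigma> d by (subst ennreal_mult''[symmetric]) auto
  ultimately show ?thesis by simp
qed

section \<open>Expected dissipation over short windows\<close>

context burgers_setting
begin

lemma expectation_measurable:
  assumes "burgers_solution M \<beta> L \<nu> u0 u"
  shows "(\<lambda>t. \<integral>\<^sup>+ \<omega>. H1_sq (u t \<omega>) \<partial>M) \<in> borel_measurable borel"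
proof -
  have "(\<lambda>(t, \<omega>). H1_sq (u t \<omega>)) \<in> borel_measurable (lborel \<Otimes>\<^sub>M M)" using assms by (simp add: burgers_solution_def)
  from borel_measurable_nn_integral[OF this] show ?thesis by simp
qed

lemma expectation_swap:
  assumes "burgers_solution M \<beta> L \<nu> u0 u"
  shows "(\<integral>\<^sup>+ t\<in>{a..b}. (\<integral>\<^sup>+ \<omega>. H1_sq (u t \<omega>) \<partial>M) \<partial>lborel) = (\<integral>\<^sup>+ \<omega>. (\<integral>\<^sup>+ t\<in>{a..b}. H1_sq (u t \<omega>) \<partial>lborel) \<partial>M)"
proof -
  have m: "(\<lambda>(t, \<omega>). H1_sq (u t \<omega>)) \<in> borel_measurable (lborel \<Otimes>\<^sub>M M)" using assms by (simp add: burgers_solution_def)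
  interpret P: pair_sigma_finite lborel M ..
  have mt: "(\<lambda>\<omega>. H1_sq (u t \<omega>)) \<in> borel_measurable M" for t
    using measurable_compose[OF measurable_Pair1'[of t lborel M] m] by simp
  have mi: "(\<lambda>(t, \<omega>). H1_sq (u t \<omega>) * indicator {a..b} t) \<in> borel_measurable (lborel \<Otimes>\<^sub>M M)"
    using borel_measurable_times_ennreal[OF m, of "\<lambda>x. indicator {a..b} (fst x)"] by (simp add: split_beta')
  have "(\<integral>\<^sup>+ t\<in>{a..b}. (\<integral>\<^sup>+ \<omega>. H1_sq (u t \<omega>) \<partial>M) \<partial>lborel) = (\<integral>\<^sup>+ t. \<integral>\<^sup>+ \<omega>. H1_sq (u t \<omega>) * indicator {a..b} t \<partial>M \<partial>lborel)"
    by (intro nn_integral_cong nn_integral_multc[symmetric] mt)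
  also have "\<dots> = (\<integral>\<^sup>+ \<omega>. \<integral>\<^sup>+ t. H1_sq (u t \<omega>) * indicator {a..b} t \<partial>lborel \<partial>M)" by (rule P.Fubini'[OF mi, symmetric])
  finally show ?thesis .
qed

text \<open>The noise bound is a fourth root, so the fourth powers in
  \<open>dissipation_upper\<close> become linear in \<open>Zsum\<close>, whose expectation is
  finite.\<close>

lemma window_upper:
  assumes P: "burgers_path \<nu> (\<lambda>t. u t \<omega>) (pth \<omega>) c0" and cad: "\<And>k. k \<noteq> 0 \<Longrightarrow> cadlag_path (Lp \<omega> k)" and a: "0 \<le> a"
    and fin: "Zsum {0} a (Lp \<omega>) \<noteq> \<infinity>" "Zsum {0} (a + 1) (Lp \<omega>) \<noteq> \<infinity>"
  shows "(\<integral>\<^sup>+ t\<in>{a+1..a+2}. H1_sq (u t \<omega>) \<partial>lborel)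
    \<le> ennreal (2600 / \<nu>) + ennreal (1300 * Wt ^ 3 / \<nu>) * (Zsum {0} a (Lp \<omega>) + Zsum {0} (a + 1) (Lp \<omega>))"
proof -
  interpret P: burgers_path \<nu> "\<lambda>t. u t \<omega>" "pth \<omega>" c0 by (rule P)
  obtain z0 where z0: "Zsum {0} a (Lp \<omega>) = ennreal z0" "0 \<le> z0" using fin(1) by (cases "Zsum {0} a (Lp \<omega>)") auto
  obtain z1 where z1: "Zsum {0} (a + 1) (Lp \<omega>) = ennreal z1" "0 \<le> z1" using fin(2) by (cases "Zsum {0} (a + 1) (Lp \<omega>)") auto
  have n: "P.noise_le r (r + 1) (root 4 (Wt ^ 3 * z))" if "0 \<le> r" "Zsum {0} r (Lp \<omega>) = ennreal z" "0 \<le> z" for r z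
    unfolding P.noise_le_def pth_sum
    by (intro allI impI Zsum_bound cad) (use that in auto)
  have r4: "root 4 (Wt ^ 3 * z) ^ 4 = Wt ^ 3 * z" if "0 \<le> z" for z
    using that Wt_nonneg by (intro real_root_pow_pos2) auto
  have "\<nu> * P.Dh (a + 1) (a + 2) \<le> 1300 * (1 + root 4 (Wt ^ 3 * z0) ^ 4) + 1300 * (1 + root 4 (Wt ^ 3 * z1) ^ 4)"
    using n[OF a z0] n[of "a + 1", OF _ z1] a by (intro P.dissipation_upper) (auto simp: add.assoc)
  also have "\<dots> = 2600 + 1300 * Wt ^ 3 * (z0 + z1)" unfolding r4[OF z0(2)] r4[OF z1(2)] by (simp add: algebra_simps)
  finally have D: "P.Dh (a + 1) (a + 2) \<le> 2600 / \<nu> + 1300 * Wt ^ 3 / \<nu> * (z0 + z1)"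
    using P.nu by (simp add: field_simps)
  have "(\<integral>\<^sup>+ t\<in>{a+1..a+2}. H1_sq (u t \<omega>) \<partial>lborel) = ennreal (P.Dh (a + 1) (a + 2))"
    unfolding P.Dh_def using P.hh_sq_integrable(2)[of "a + 1" "a + 2"] a by (simp add: nn_integral_TI)
  also have "\<dots> \<le> ennreal (2600 / \<nu> + 1300 * Wt ^ 3 / \<nu> * (z0 + z1))" by (rule ennreal_leI[OF D])
  also have "\<dots> = ennreal (2600 / \<nu>) + ennreal (1300 * Wt ^ 3 / \<nu>) * (ennreal z0 + ennreal z1)"
    using P.nu Wt_nonneg z0(2) z1(2) by (intro ennreal_affine[symmetric]) auto
  finally show ?thesis by (simp only: z0 z1)
qed

lemma expected_window_upper:
  assumes sol: "burgers_solution M \<beta> L \<nu> u0 u" and nu: "0 < \<nu>" "\<nu> \<le> 1" and a: "0 \<le> a"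
    and C: "\<And>X s. levy X \<Longrightarrow> 0 \<le> s \<Longrightarrow> (\<integral>\<^sup>+ \<omega>. Zp s (\<lambda>t. X t \<omega>) \<partial>M) \<le> ennreal C" "0 \<le> C"
  shows "(\<integral>\<^sup>+ t\<in>{a+1..a+2}. (\<integral>\<^sup>+ \<omega>. H1_sq (u t \<omega>) \<partial>M) \<partial>lborel) \<le> ennreal ((2600 + 2600 * Wt ^ 4 * C) / \<nu>)"
proof -
  define Z0 Z1 where "Z0 = (\<lambda>\<omega>. Zsum {0} a (Lp \<omega>))" and "Z1 = (\<lambda>\<omega>. Zsum {0} (a + 1) (Lp \<omega>))"
  have Zm[measurable]: "Z0 \<in> borel_measurable M" "Z1 \<in> borel_measurable M"
    unfolding Z0_def Z1_def using a by (auto intro!: Zsum_measurable)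
  have Ze: "(\<integral>\<^sup>+ \<omega>. Z0 \<omega> \<partial>M) \<le> ennreal (Wt * C)" "(\<integral>\<^sup>+ \<omega>. Z1 \<omega> \<partial>M) \<le> ennreal (Wt * C)"
    unfolding Z0_def Z1_def using a by (auto intro!: Zsum_expect C)
  have fin: "AE \<omega> in M. Z0 \<omega> \<noteq> \<infinity>" "AE \<omega> in M. Z1 \<omega> \<noteq> \<infinity>"
    using Ze by (intro nn_integral_noteq_infinite Zm; auto simp: top_unique)+
  have "AE \<omega> in M. (\<integral>\<^sup>+ t\<in>{a+1..a+2}. H1_sq (u t \<omega>) \<partial>lborel) \<le> ennreal (2600 / \<nu>) + ennreal (1300 * Wt ^ 3 / \<nu>) * (Z0 \<omega> + Z1 \<omega>)"
    using solution_path[OF sol nu] fin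
  proof eventually_elim
    case (elim \<omega>)
    show ?case unfolding Z0_def Z1_def
      by (rule window_upper[where u=u and \<omega>=\<omega>, OF elim(1)[THEN conjunct1] _ a]) (use elim in \<open>auto simp: Z0_def Z1_def\<close>)
  qed
  hence "(\<integral>\<^sup>+ \<omega>. (\<integral>\<^sup>+ t\<in>{a+1..a+2}. H1_sq (u t \<omega>) \<partial>lborel) \<partial>M) \<le> (\<integral>\<^sup>+ \<omega>. ennreal (2600 / \<nu>) + ennreal (1300 * Wt ^ 3 / \<nu>) * (Z0 \<omega> + Z1 \<omega>) \<partial>M)"
    by (rule nn_integral_mono_AE)
  also have "\<dots> = ennreal (2600 / \<nu>) + ennreal (1300 * Wt ^ 3 / \<nu>) * ((\<integral>\<^sup>+ \<omega>. Z0 \<omega> \<partial>M) + (\<integral>\<^sup>+ \<omega>. Z1 \<omega> \<partial>M))"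
    by (simp add: nn_integral_add nn_integral_cmult emeasure_space_1)
  also have "\<dots> \<le> ennreal (2600 / \<nu>) + ennreal (1300 * Wt ^ 3 / \<nu>) * (ennreal (Wt * C) + ennreal (Wt * C))"
    by (intro add_mono mult_left_mono Ze) auto
  also have "\<dots> = ennreal (2600 / \<nu> + 1300 * Wt ^ 3 / \<nu> * (Wt * C + Wt * C))"
    using nu Wt_nonneg C(2) by (intro ennreal_affine) auto
  also have "2600 / \<nu> + 1300 * Wt ^ 3 / \<nu> * (Wt * C + Wt * C) = (2600 + 2600 * Wt ^ 4 * C) / \<nu>"
    using nu by (simp add: field_simps power3_eq_cube power4_eq_xxxx)
  finally show ?thesis unfolding expectation_swap[OF sol] .
qed

text \<open>The event \<open>growth\<close> for mode 1 is combined with a moderate bound for the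
  other modes. The passage takes at most time 1 / 2^p, and Xg^3 \<le> 2^p makes that short enough
  for \<open>dissipation_lower\<close>.\<close>

lemma window_lower:
  assumes P: "burgers_path \<nu> (\<lambda>t. u t \<omega>) (pth \<omega>) c0" and cad: "\<And>k. k \<noteq> 0 \<Longrightarrow> cadlag_path (Lp \<omega> k)" and s: "0 \<le> s"
    and g: "growth R S0 A m p s (Lp \<omega> 1)" and pm: "p \<le> m" and S0: "0 \<le> S0" and A: "0 \<le> A"
    and z: "\<And>i. i \<le> 2 \<Longrightarrow> Zsum {0, 1} (s + real i) (Lp \<omega>) \<le> ennreal z" "0 \<le> z"
    and X0: "X0 = wt 1 * (S0 + (R + 1)) + 6 * root 4 (Wt ^ 3 * z)"
    and Xg: "Xg = wt 1 * (A + (R + 1)) + 6 * root 4 (Wt ^ 3 * z) + 1" "Xg ^ 3 \<le> 2 ^ p"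
    and E0: "E0 = 600 * (1 + X0 ^ 4)" and B: "B = 7 + 6 * X0 + 7 * X0\<^sup>2 + X0 ^ 3"
    and AB: "B + sqrt (E0 + 4 + 2 * Xg * sqrt E0) \<le> \<beta> 1 * A"
  shows "ennreal (1 / (3 * \<nu>)) \<le> (\<integral>\<^sup>+ t\<in>{s..s+3}. H1_sq (u t \<omega>) \<partial>lborel)"
proof -
  interpret P: burgers_path \<nu> "\<lambda>t. u t \<omega>" "pth \<omega>" c0 by (rule P)
  define Y where "Y = root 4 (Wt ^ 3 * z)"
  have Y0: "0 \<le> Y" unfolding Y_def using Wt_nonneg z by simp
  define V where "V N t r = (\<Sum>k\<in>FN N - {0, 1}. wt k * \<bar>L k t \<omega> - L k r \<omega>\<bar>)" for N t r
  have Vtri: "V N t r \<le> V N t q + V N q r" for N t q r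
    unfolding V_def sum.distrib[symmetric] distrib_left[symmetric] using wt_nonneg by (intro sum_mono mult_left_mono) auto
  have Vsym: "V N t r = V N r t" for N t r unfolding V_def by (simp add: abs_minus_commute)
  have Vi: "V N t (s + real i) \<le> Y" if "i \<le> 2" "s + real i \<le> t" "t \<le> s + real i + 1" for N t i
    unfolding V_def Y_def by (rule Zsum_bound[OF cad _ _ _ _ z(1)[OF that(1)] z(2)]) (use that s in auto)
  \<comment> \<open>Up to three unit windows are chained, each contributing at most
    \<open>Y\<close>. Comparing two arbitrary times through \<open>s\<close> doubles this, whence
    the factor 6.\<close>
  have Vs: "V N t s \<le> 3 * Y" if t: "s \<le> t" "t \<le> s + 3" for N t
  proof -
    have a: "V N (s + 1) s \<le> Y" using Vi[of 0 "s + 1" N] by simp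
    have b: "V N (s + 2) (s + 1) \<le> Y" using Vi[of 1 "s + 2" N] by simp
    consider "t \<le> s + 1" | "s + 1 \<le> t" "t \<le> s + 2" | "s + 2 \<le> t" by linarith
    thus ?thesis
    proof cases
      case 1 thus ?thesis using Vi[of 0 t N] t Y0 by simp
    next
      case 2 thus ?thesis using Vi[of 1 t N] Vtri[of N t s "s + 1"] a Y0 by simp
    next
      case 3 thus ?thesis using Vi[of 2 t N] Vtri[of N t s "s + 1"] Vtri[of N t "s + 1" "s + 2"] a b t by simp
    qed
  qed
  have Vr: "V N t r \<le> 6 * Y" if "s \<le> t" "t \<le> s + 3" "s \<le> r" "r \<le> s + 3" for N t r
    using Vtri[of N t r s] Vs[of t N] Vs[of r N] Vsym[of N s r] that by simp
  obtain b where b: "s + 1 < b" "b \<le> s + 1 + 1 / 2 ^ p" "A \<le> \<bar>L 1 b \<omega> - L 1 (s + 1) \<omega>\<bar>"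
    "\<forall>t. s \<le> t \<longrightarrow> t \<le> s + 1 \<longrightarrow> \<bar>L 1 t \<omega> - L 1 s \<omega>\<bar> \<le> S0 + (R + 1)"
    "\<forall>t. s + 1 \<le> t \<longrightarrow> t \<le> b \<longrightarrow> \<bar>L 1 t \<omega> - L 1 (s + 1) \<omega>\<bar> \<le> A + (R + 1)"
    "\<forall>t. b \<le> t \<longrightarrow> t \<le> b + 1 \<longrightarrow> \<bar>L 1 t \<omega> - L 1 b \<omega>\<bar> \<le> S0 + (R + 1)"
    using growth_path[OF cad s g pm R0 S0] by auto
  have p1: "1 / (2::real) ^ p \<le> 1" by simp
  have b2: "b \<le> s + 2" using b(2) p1 by linarith
  have full: "(\<Sum>k\<in>FN N - {0}. wt k * \<bar>L k t \<omega> - L k r \<omega>\<bar>) \<le> wt 1 * D + 6 * Y"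
    if "\<bar>L 1 t \<omega> - L 1 r \<omega>\<bar> \<le> D" "s \<le> t" "t \<le> s + 3" "s \<le> r" "r \<le> s + 3" for N t r D
  proof -
    have "(\<Sum>k\<in>FN N - {0}. wt k * \<bar>L k t \<omega> - L k r \<omega>\<bar>) \<le> (\<Sum>k\<in>insert 1 (FN N - {0, 1}). wt k * \<bar>L k t \<omega> - L k r \<omega>\<bar>)"
      using wt_nonneg by (intro sum_mono2) auto
    also have "\<dots> = wt 1 * \<bar>L 1 t \<omega> - L 1 r \<omega>\<bar> + V N t r" unfolding V_def by (subst sum.insert) auto
    also have "\<dots> \<le> wt 1 * D + 6 * Y" using that wt_nonneg by (intro add_mono mult_left_mono Vr) auto
    finally show ?thesis .
  qed
  have n0: "P.noise_le s (s + 1) X0" unfolding P.noise_le_def pth_sum X0 Y_def[symmetric]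
    by (intro allI impI full) (use b in auto)
  have n1: "P.noise_le b (b + 1) X0" unfolding P.noise_le_def pth_sum X0 Y_def[symmetric]
    by (intro allI impI full) (use b b2 in auto)
  have "P.noise_le (s + 1) b (Xg - 1)" unfolding P.noise_le_def pth_sum Xg(1) Y_def[symmetric] add_diff_cancel
    by (intro allI impI full) (use b b2 in auto)
  hence ng: "P.noise_le (s + 1) b Xg" unfolding P.noise_le_def by (smt (verit))
  \<comment> \<open>The summand 1 in \<open>Xg\<close> serves this purpose; the noise bound itself
    holds without it.\<close>
  have Xg1: "1 \<le> Xg" unfolding Xg(1) Y_def[symmetric] using wt_nonneg[of 1] R0 A Y0 by simp
  have "Xg ^ 3 * (b - (s + 1)) \<le> 2 ^ p * (1 / 2 ^ p)" using b Xg(2) by (intro mult_mono) auto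
  hence h: "Xg ^ 3 * (b - (s + 1)) \<le> 1" by simp
  have "pth \<omega> 1 b - pth \<omega> 1 (s + 1) = \<beta> 1 * (L 1 b \<omega> - L 1 (s + 1) \<omega>)" by (simp add: pth_def right_diff_distrib)
  hence "\<bar>pth \<omega> 1 b - pth \<omega> 1 (s + 1)\<bar> = \<beta> 1 * \<bar>L 1 b \<omega> - L 1 (s + 1) \<omega>\<bar>" using beta_pos[of 1] by (simp add: abs_mult)
  moreover have "\<beta> 1 * A \<le> \<beta> 1 * \<bar>L 1 b \<omega> - L 1 (s + 1) \<omega>\<bar>" using b(3) beta_pos[of 1] by (intro mult_left_mono) auto
  ultimately have "B + sqrt (E0 + 4 + 2 * Xg * sqrt E0) \<le> \<bar>pth \<omega> 1 b - pth \<omega> 1 (s + 1)\<bar>" using AB by linarith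
  from P.dissipation_lower[OF n0 ng n1 s _ h Xg1 E0 this] have "1/3 \<le> \<nu> * P.Dh s (b + 1)" using b B by simp
  also have "\<dots> \<le> \<nu> * P.Dh s (s + 3)"
    using P.Dh_split[of s "b + 1" "s + 3"] P.Dh_nonneg[of "b + 1" "s + 3"] s b b2 P.nu by (intro mult_left_mono) auto
  finally have "1 / (3 * \<nu>) \<le> P.Dh s (s + 3)" using P.nu by (simp add: field_simps)
  hence "ennreal (1 / (3 * \<nu>)) \<le> ennreal (P.Dh s (s + 3))" by (rule ennreal_leI)
  also have "\<dots> = (\<integral>\<^sup>+ t\<in>{s..s+3}. H1_sq (u t \<omega>) \<partial>lborel)"
    unfolding P.Dh_def using P.hh_sq_integrable(2)[OF s, of "s + 3"] by (simp add: nn_integral_TI)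
  finally show ?thesis .
qed

text \<open>Measurability as a functional of the paths of the remaining modes, needed to separate it
  from mode 1 by independence.\<close>

lemma Zsum_path_measurable:
  "Zsum {0, 1} r \<in> borel_measurable (PiM (UNIV - {0, 1}) (\<lambda>_. PiM UNIV (\<lambda>_. borel)))"
proof -
  have c: "(\<lambda>x. x t) \<in> borel_measurable (PiM UNIV (\<lambda>_. borel :: real measure))" for t :: real
    by (rule measurable_component_singleton) simp
  note c[measurable]
  have "Zp r \<in> borel_measurable (PiM UNIV (\<lambda>_. borel))" unfolding Zp_def by measurable
  hence "(\<lambda>x. Zp r (x k)) \<in> borel_measurable (PiM (UNIV - {0, 1}) (\<lambda>_. PiM UNIV (\<lambda>_. borel)))" if "k \<in> UNIV - {0, 1}" for k
    by (rule measurable_compose[OF measurable_component_singleton[OF that]])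
  thus ?thesis unfolding Zsum_def
    by (intro borel_measurable_SUP borel_measurable_sum borel_measurable_times_ennreal borel_measurable_const) auto
qed

text \<open>Markov's inequality: the three sums have total expectation at most half of K = 6 Wt C +
  1, so they stay below K with probability at least 1/2, and this event is independent of mode
  1.\<close>

lemma growth_event_prob:
  assumes s: "0 \<le> s" and C: "\<And>X s. levy X \<Longrightarrow> 0 \<le> s \<Longrightarrow> (\<integral>\<^sup>+ \<omega>. Zp s (\<lambda>t. X t \<omega>) \<partial>M) \<le> ennreal C" "0 \<le> C"
    and e: "e \<le> prob {\<omega>\<in>space M. growth R S0 A m p s (Lp \<omega> 1)}"
  shows "\<exists>E\<in>events. e / 2 \<le> prob E \<and>
    (\<forall>\<omega>\<in>E. growth R S0 A m p s (Lp \<omega> 1) \<and> (\<forall>i\<le>2. Zsum {0, 1} (s + real i) (Lp \<omega>) \<le> ennreal (6 * Wt * C + 1)))"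
proof -
  define D :: "int set" where "D = UNIV - {0, 1}"
  define N where "N = PiM D (\<lambda>_. PiM UNIV (\<lambda>_. borel) :: (real \<Rightarrow> real) measure)"
  define N1 where "N1 = PiM {1::int} (\<lambda>_. PiM UNIV (\<lambda>_. borel) :: (real \<Rightarrow> real) measure)"
  define K where "K = 6 * Wt * C + 1"
  have K: "0 < K" "3 * (Wt * C) \<le> K / 2" unfolding K_def using Wt_nonneg C(2) by (auto intro: add_nonneg_pos)
  define Z where "Z x = Zsum {0, 1} s x + Zsum {0, 1} (s + 1) x + Zsum {0, 1} (s + 2) x" for x
  have Zm: "Z \<in> borel_measurable N" unfolding Z_def N_def D_def
    by (intro borel_measurable_add Zsum_path_measurable)
  \<comment> \<open>\<open>Z\<close> reads the modes in \<open>D\<close> only; this identifies the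
    event on restricted families of paths with the event on all modes.\<close>
  have Zr: "Z (restrict x D) = Z x" for x
    unfolding Z_def Zsum_def D_def by (auto intro!: SUP_cong sum.cong arg_cong2[where f="(+)"])
  define G where "G = {x\<in>space N. Z x \<le> ennreal K}"
  define F where "F = {x\<in>space N1. growth R S0 A m p s (x 1)}"
  have G: "G \<in> sets N" unfolding G_def using Zm by measurable
  have "Measurable.pred N1 (\<lambda>x. growth R S0 A m p s (x 1))" unfolding N1_def
    using measurable_compose[OF measurable_component_singleton[of 1 "{1}" "\<lambda>_. PiM UNIV (\<lambda>_. borel)"] growth_measurable[of R S0 A m p s]] by simp
  hence F: "F \<in> sets N1" unfolding F_def by measurable
  define X where "X k \<omega> = Lp \<omega> k" for k \<omega>
  have ind: "indep_var N1 (\<lambda>\<omega>. restrict (\<lambda>k. X k \<omega>) {1}) N (\<lambda>\<omega>. restrict (\<lambda>k. X k \<omega>) D)"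
    unfolding N_def N1_def by (rule indep_var_restrict[OF L_indep[folded X_def]]) (auto simp: D_def)
  have m1: "(\<lambda>\<omega>. restrict (\<lambda>k. X k \<omega>) {1}) \<in> measurable M N1" and m2: "(\<lambda>\<omega>. restrict (\<lambda>k. X k \<omega>) D) \<in> measurable M N"
    using indep_var_rv1[OF ind] indep_var_rv2[OF ind] by auto
  define EF where "EF = {\<omega>\<in>space M. growth R S0 A m p s (Lp \<omega> 1)}"
  define EG where "EG = {\<omega>\<in>space M. Z (Lp \<omega>) \<le> ennreal K}"
  have EF: "(\<lambda>\<omega>. restrict (\<lambda>k. X k \<omega>) {1}) -` F \<inter> space M = EF"
    using measurable_space[OF m1] by (auto simp: F_def EF_def X_def)
  have EG: "(\<lambda>\<omega>. restrict (\<lambda>k. X k \<omega>) D) -` G \<inter> space M = EG"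
    using measurable_space[OF m2] Zr by (auto simp: G_def EG_def X_def)
  have EFm: "EF \<in> events" using measurable_sets[OF m1 F] EF by simp
  have EGm: "EG \<in> events" using measurable_sets[OF m2 G] EG by simp
  have "(\<lambda>x. (restrict (\<lambda>k. X k x) {1}, restrict (\<lambda>k. X k x) D)) -` (F \<times> G) \<inter> space M = EF \<inter> EG"
    using EF EG by auto
  hence pr: "prob (EF \<inter> EG) = prob EF * prob EG" using indep_varD[OF ind F G] EF EG by simp
  have ZLm: "(\<lambda>\<omega>. Z (Lp \<omega>)) \<in> borel_measurable M"
    unfolding Z_def using s by (intro borel_measurable_add Zsum_measurable) auto
  have "(\<integral>\<^sup>+ \<omega>. Z (Lp \<omega>) \<partial>M) = (\<integral>\<^sup>+ \<omega>. Zsum {0, 1} s (Lp \<omega>) \<partial>M) + (\<integral>\<^sup>+ \<omega>. Zsum {0, 1} (s + 1) (Lp \<omega>) \<partial>M) + (\<integral>\<^sup>+ \<omega>. Zsum {0, 1} (s + 2) (Lp \<omega>) \<partial>M)"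
  proof -
    have add: "(\<integral>\<^sup>+ \<omega>. f \<omega> + g \<omega> + h \<omega> \<partial>M) = (\<integral>\<^sup>+ \<omega>. f \<omega> \<partial>M) + (\<integral>\<^sup>+ \<omega>. g \<omega> \<partial>M) + (\<integral>\<^sup>+ \<omega>. h \<omega> \<partial>M)"
      if [measurable]: "f \<in> borel_measurable M" "g \<in> borel_measurable M" "h \<in> borel_measurable M" for f g h :: "'a \<Rightarrow> ennreal"
      by (simp add: nn_integral_add)
    show ?thesis unfolding Z_def by (intro add Zsum_measurable) (use s in auto)
  qed
  also have "\<dots> \<le> ennreal (Wt * C) + ennreal (Wt * C) + ennreal (Wt * C)"
    using s by (intro add_mono Zsum_expect C) auto
  also have "\<dots> = ennreal (3 * (Wt * C))" using Wt_nonneg C(2) by (simp add: ennreal_plus[symmetric] del: ennreal_plus)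
  finally have Ze: "(\<integral>\<^sup>+ \<omega>. Z (Lp \<omega>) \<partial>M) \<le> ennreal (3 * (Wt * C))" .
  have "ennreal (K * prob (space M - EG)) = ennreal K * emeasure M (space M - EG)"
    using K by (simp add: emeasure_eq_measure ennreal_mult)
  also have "\<dots> = (\<integral>\<^sup>+ \<omega>. ennreal K * indicator (space M - EG) \<omega> \<partial>M)" using EGm by (simp add: nn_integral_cmult_indicator)
  also have "\<dots> \<le> (\<integral>\<^sup>+ \<omega>. Z (Lp \<omega>) \<partial>M)" by (intro nn_integral_mono) (auto simp: EG_def indicator_def)
  also have "\<dots> \<le> ennreal (K / 2)" using Ze K(2) by (meson ennreal_leI order_trans)
  finally have "K * prob (space M - EG) \<le> K / 2" using K by simp
  hence "prob (space M - EG) \<le> 1/2" using K by (simp add: field_simps)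
  hence "1/2 \<le> prob EG" using prob_compl[OF EGm] by simp
  hence "prob EF * (1/2) \<le> prob EF * prob EG" by (intro mult_left_mono) auto
  hence "e / 2 \<le> prob (EF \<inter> EG)" using e pr unfolding EF_def[symmetric] by simp
  moreover have "growth R S0 A m p s (Lp \<omega> 1) \<and> (\<forall>i\<le>2. Zsum {0, 1} (s + real i) (Lp \<omega>) \<le> ennreal (6 * Wt * C + 1))" if "\<omega> \<in> EF \<inter> EG" for \<omega>
  proof (intro conjI allI impI)
    show "growth R S0 A m p s (Lp \<omega> 1)" using that by (simp add: EF_def)
    fix i :: nat assume "i \<le> 2"
    hence "i = 0 \<or> i = 1 \<or> i = 2" by linarith
    hence "Zsum {0, 1} (s + real i) (Lp \<omega>) \<le> Z (Lp \<omega>)" unfolding Z_def by (auto intro: add_increasing add_increasing2)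
    also have "\<dots> \<le> ennreal (6 * Wt * C + 1)" using that by (simp add: EG_def K_def)
    finally show "Zsum {0, 1} (s + real i) (Lp \<omega>) \<le> ennreal (6 * Wt * C + 1)" .
  qed
  ultimately show ?thesis using EFm EGm by (intro bexI[of _ "EF \<inter> EG"]) auto
qed

text \<open>The order of choice matters: \<open>C\<close> and \<open>S0\<close> fix the moderate
  noise \<open>X0\<close>, hence \<open>E0\<close> and \<open>B\<close>; then come \<open>A\<close>,
  \<open>Xg\<close>, the duration exponent \<open>p\<close>, and last the grid \<open>m\<close> with
  the probability \<open>e\<close>. All are chosen before \<nu>, the solution and
  \<open>s\<close>.\<close>

lemma expected_window_lower:
  "\<exists>e>0. \<forall>\<nu> u0 u s. burgers_solution M \<beta> L \<nu> u0 u \<longrightarrow> 0 < \<nu> \<longrightarrow> \<nu> \<le> 1 \<longrightarrow> 0 \<le> s \<longrightarrow>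
     ennreal (e / \<nu>) \<le> (\<integral>\<^sup>+ t\<in>{s..s+3}. (\<integral>\<^sup>+ \<omega>. H1_sq (u t \<omega>) \<partial>M) \<partial>lborel)"
proof -
  obtain C where C: "0 \<le> C" "\<And>X s. levy X \<Longrightarrow> 0 \<le> s \<Longrightarrow> (\<integral>\<^sup>+ \<omega>. Zp s (\<lambda>t. X t \<omega>) \<partial>M) \<le> ennreal C"
    using moment by blast
  obtain S0 where S0: "0 < S0" "\<And>X s m. levy X \<Longrightarrow> 0 \<le> s \<Longrightarrow> prob (maxgt X s m S0) \<le> 1/2"
    using tight[of "1/2"] by auto
  define z where "z = 6 * Wt * C + 1"
  have z: "0 \<le> z" unfolding z_def using Wt_nonneg C by simp
  define Y where "Y = root 4 (Wt ^ 3 * z)"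
  have Y: "0 \<le> Y" unfolding Y_def using Wt_nonneg z by simp
  define X0 where "X0 = wt 1 * (S0 + (R + 1)) + 6 * Y"
  define E0 where "E0 = 600 * (1 + X0 ^ 4)"
  define B where "B = 7 + 6 * X0 + 7 * X0\<^sup>2 + X0 ^ 3"
  define l where "l = wt 1 * (R + 1) + 6 * Y + 1"
  have l: "0 \<le> l" unfolding l_def using wt_nonneg[of 1] R0 Y by simp
  have E0: "0 \<le> E0" unfolding E0_def by simp
  \<comment> \<open>\<open>Xg\<close> is affine in \<open>A\<close> with intercept \<open>l\<close>
    and slope \<open>wt 1\<close>; the requirement compares a square root of \<open>A\<close> with a
    multiple of \<open>A\<close>.\<close>
  obtain A where A: "0 < A" "B + sqrt (E0 + 4 + 2 * l * sqrt E0 + 2 * wt 1 * sqrt E0 * A) \<le> \<beta> 1 * A"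
    using linear_beats_sqrt[of "\<beta> 1" "E0 + 4 + 2 * l * sqrt E0" "2 * wt 1 * sqrt E0" B] beta_pos[of 1] E0 l wt_nonneg[of 1] by auto
  define Xg where "Xg = wt 1 * (A + (R + 1)) + 6 * Y + 1"
  have "E0 + 4 + 2 * l * sqrt E0 + 2 * wt 1 * sqrt E0 * A = E0 + 4 + 2 * Xg * sqrt E0"
    unfolding Xg_def l_def by (simp add: algebra_simps)
  note AB = A(2)[unfolded this]
  obtain p :: nat where p: "Xg ^ 3 \<le> 2 ^ p" using real_arch_pow[of 2 "Xg ^ 3"] by (auto intro: less_imp_le)
  obtain m e where me: "p \<le> m" "0 < e" "\<And>X s. levy X \<Longrightarrow> 0 \<le> s \<Longrightarrow> e \<le> prob {\<omega>\<in>space M. growth R S0 A m p s (\<lambda>t. X t \<omega>)}"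
    using growth_prob[OF mu S0(2) A(1), of p] by blast
  have "ennreal (e / 6 / \<nu>) \<le> (\<integral>\<^sup>+ t\<in>{s..s+3}. (\<integral>\<^sup>+ \<omega>. H1_sq (u t \<omega>) \<partial>M) \<partial>lborel)"
    if sol: "burgers_solution M \<beta> L \<nu> u0 u" and nu: "0 < \<nu>" "\<nu> \<le> 1" and s: "0 \<le> s" for \<nu> u0 u s
  proof -
    obtain E where E: "E \<in> events" "e / 2 \<le> prob E" "\<And>\<omega>. \<omega> \<in> E \<Longrightarrow> growth R S0 A m p s (Lp \<omega> 1)"
      "\<And>\<omega> i. \<omega> \<in> E \<Longrightarrow> i \<le> 2 \<Longrightarrow> Zsum {0, 1} (s + real i) (Lp \<omega>) \<le> ennreal z"
      using growth_event_prob[OF s C(2,1) me(3)[OF levyk s]] unfolding z_def by fastforce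
    have "AE \<omega> in M. ennreal (1 / (3 * \<nu>)) * indicator E \<omega> \<le> (\<integral>\<^sup>+ t\<in>{s..s+3}. H1_sq (u t \<omega>) \<partial>lborel)"
      using solution_path[OF sol nu]
    proof eventually_elim
      case (elim \<omega>)
      show ?case
      proof (cases "\<omega> \<in> E")
        case True
        have "ennreal (1 / (3 * \<nu>)) \<le> (\<integral>\<^sup>+ t\<in>{s..s+3}. H1_sq (u t \<omega>) \<partial>lborel)"
          by (rule window_lower[where u=u and \<omega>=\<omega>, OF elim[THEN conjunct1] _ s E(3)[OF True] me(1) less_imp_le[OF S0(1)] less_imp_le[OF A(1)] E(4)[OF True] z
                X0_def[unfolded Y_def] Xg_def[unfolded Y_def] p E0_def B_def AB])
             (use elim in auto)
        thus ?thesis by (auto simp: indicator_def)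
      qed simp
    qed
    hence "(\<integral>\<^sup>+ \<omega>. ennreal (1 / (3 * \<nu>)) * indicator E \<omega> \<partial>M) \<le> (\<integral>\<^sup>+ \<omega>. (\<integral>\<^sup>+ t\<in>{s..s+3}. H1_sq (u t \<omega>) \<partial>lborel) \<partial>M)"
      by (rule nn_integral_mono_AE)
    \<comment> \<open>The factor 1/6 combines the half in the probability of the event with the
      third in the dissipation on it.\<close>
    moreover have "ennreal (e / 6 / \<nu>) \<le> ennreal (1 / (3 * \<nu>) * prob E)"
      using mult_left_mono[OF E(2), of "1 / (3 * \<nu>)"] nu by (intro ennreal_leI) (simp add: field_simps)
    moreover have "ennreal (1 / (3 * \<nu>) * prob E) = (\<integral>\<^sup>+ \<omega>. ennreal (1 / (3 * \<nu>)) * indicator E \<omega> \<partial>M)"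
      unfolding nn_integral_cmult_indicator[OF E(1)] emeasure_eq_measure using nu by (intro ennreal_mult) auto
    ultimately show ?thesis unfolding expectation_swap[OF sol] by simp
  qed
  thus ?thesis using me(2) by (intro exI[of _ "e / 6"]) auto
qed

end

theorem theorem5p2:
  fixes M :: "'a measure" and \<mu> :: "real measure"
    and L :: "int \<Rightarrow> real \<Rightarrow> 'a \<Rightarrow> real" and \<beta> :: "int \<Rightarrow> real"
    and \<gamma>0 C1' C2' :: real and u0 :: "real \<Rightarrow> real"
  assumes "prob_space M"
    and "levy_measure \<mu>"
    and "emeasure \<mu> UNIV > 0"
    and "\<forall>k. k \<noteq> 0 \<longrightarrow> levy_process_triplet0 M \<mu> (L k)"
    and "prob_space.indep_vars M (\<lambda>_. Pi\<^sub>M UNIV (\<lambda>_. borel)) (\<lambda>k \<omega>. \<lambda>t. L k t \<omega>) (UNIV - {0})"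
    and "\<exists>R>0. \<forall>k. k \<noteq> 0 \<longrightarrow> (AE \<omega> in M. \<forall>t>0. \<forall>l.
            ((\<lambda>s. L k s \<omega>) \<longlongrightarrow> l) (at_left t) \<longrightarrow> \<bar>L k t \<omega> - l\<bar> \<le> R)"
    and "\<gamma>0 > 1" and "C1' > 0" and "C2' > 0"
    and "\<forall>k. k \<noteq> 0 \<longrightarrow> C1' * lam k powr (- \<gamma>0) \<le> \<beta> k \<and> \<beta> k \<le> C2' * lam k powr (- \<gamma>0)"
    and "in_H1 u0"
  shows "\<exists>C1>0. \<exists>C2>0. \<exists>\<sigma>0>0. \<forall>\<nu>\<in>{0<..1}. \<forall>u. burgers_solution M \<beta> L \<nu> u0 u \<longrightarrow>
           (\<forall>\<sigma>\<ge>\<sigma>0. \<forall>T\<ge>1.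
              ennreal (C1 / \<nu>) \<le> ennreal (1 / \<sigma>) * (\<integral>\<^sup>+ t\<in>{T..T+\<sigma>}. (\<integral>\<^sup>+ \<omega>. H1_sq (u t \<omega>) \<partial>M) \<partial>lborel) \<and>
              ennreal (1 / \<sigma>) * (\<integral>\<^sup>+ t\<in>{T..T+\<sigma>}. (\<integral>\<^sup>+ \<omega>. H1_sq (u t \<omega>) \<partial>M) \<partial>lborel) \<le> ennreal (C2 / \<nu>))"
proof -
  interpret prob_space M by (rule assms(1))
  obtain R where R: "0 < R" "\<And>k. k \<noteq> 0 \<Longrightarrow> AE \<omega> in M. \<forall>t>0. \<forall>l. ((\<lambda>s. L k s \<omega>) \<longlongrightarrow> l) (at_left t) \<longrightarrow> \<bar>L k t \<omega> - l\<bar> \<le> R"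
    using assms(6) by blast
  have bp: "0 < \<beta> k" if "k \<noteq> 0" for k
  proof -
    have "0 < C1' * lam k powr (- \<gamma>0)" using that assms(8) by (simp add: lam_def)
    thus ?thesis using assms(10) that by (meson less_le_trans)
  qed
  obtain W where W: "\<And>N. (\<Sum>k\<in>FN N. 2 * sqrt 2 * pi * \<bar>real_of_int k\<bar> * \<beta> k) \<le> W"
    using weight_sum_bounded[OF assms(7), of C2' \<beta>] assms(9,10) bp by (meson less_imp_le)
  interpret burgers_setting M \<mu> R L \<beta> W
    by unfold_locales (use R assms(2-5) bp W in auto)
  obtain C where C: "0 \<le> C" "\<And>X s. levy X \<Longrightarrow> 0 \<le> s \<Longrightarrow> (\<integral>\<^sup>+ \<omega>. Zp s (\<lambda>t. X t \<omega>) \<partial>M) \<le> ennreal C"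
    using moment by blast
  obtain e where e: "0 < e" "\<And>\<nu> u0 u s. burgers_solution M \<beta> L \<nu> u0 u \<Longrightarrow> 0 < \<nu> \<Longrightarrow> \<nu> \<le> 1 \<Longrightarrow> 0 \<le> s \<Longrightarrow>
     ennreal (e / \<nu>) \<le> (\<integral>\<^sup>+ t\<in>{s..s+3}. (\<integral>\<^sup>+ \<omega>. H1_sq (u t \<omega>) \<partial>M) \<partial>lborel)"
    using expected_window_lower by blast
  define U where "U = 2600 + 2600 * W ^ 4 * C"
  have U: "0 < U" unfolding U_def using C(1) by (intro add_pos_nonneg) auto
  show ?thesis
  proof (rule exI[of _ "e / 8"], rule conjI, goal_cases)
    case 2
    show ?case
    proof (rule exI[of _ "2 * U"], rule conjI, goal_cases)
      case 2
      show ?case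
      proof (rule exI[of _ 4], intro conjI ballI allI impI)
        fix \<nu> u \<sigma> T :: real and v
        assume nu: "\<nu> \<in> {0<..1}" and sol: "burgers_solution M \<beta> L \<nu> u0 v" and \<sigma>: "4 \<le> \<sigma>" and T: "1 \<le> T"
        define f where "f t = (\<integral>\<^sup>+ \<omega>. H1_sq (v t \<omega>) \<partial>M)" for t
        have fm: "f \<in> borel_measurable borel" unfolding f_def[abs_def] by (rule expectation_measurable[OF sol])
        have "ennreal (e / \<nu> / 8) \<le> ennreal (1 / \<sigma>) * (\<integral>\<^sup>+ t\<in>{T..T+\<sigma>}. f t \<partial>lborel)"
          by (rule average_ge[OF fm _ _ \<sigma>]) (use nu T e sol in \<open>auto simp: f_def\<close>)
        thus "ennreal (e / 8 / \<nu>) \<le> ennreal (1 / \<sigma>) * (\<integral>\<^sup>+ t\<in>{T..T+\<sigma>}. (\<integral>\<^sup>+ \<omega>. H1_sq (v t \<omega>) \<partial>M) \<partial>lborel)"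
          by (simp add: f_def mult.commute)
        \<comment> \<open>The estimate starts one unit before \<open>a\<close>, to let the initial
          value be forgotten; T \<ge> 1 keeps that starting time nonnegative.\<close>
        have "(\<integral>\<^sup>+ t\<in>{a..a+1}. f t \<partial>lborel) \<le> ennreal (U / \<nu>)" if "T \<le> a" for a
          using expected_window_upper[OF sol _ _ _ C(2,1), of "a - 1"] nu T that by (simp add: f_def U_def add.commute)
        hence "ennreal (1 / \<sigma>) * (\<integral>\<^sup>+ t\<in>{T..T+\<sigma>}. f t \<partial>lborel) \<le> ennreal (2 * (U / \<nu>))"
          by (rule average_le[OF fm]) (use nu U \<sigma> in auto)
        thus "ennreal (1 / \<sigma>) * (\<integral>\<^sup>+ t\<in>{T..T+\<sigma>}. (\<integral>\<^sup>+ \<omega>. H1_sq (v t \<omega>) \<partial>M) \<partial>lborel) \<le> ennreal (2 * U / \<nu>)"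
          by (simp add: f_def)
      qed simp
    qed (use U in simp)
  qed (use e in simp)
qed

end
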